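(* Let $m\geq1$ be an integer and consider $L_+=|\nabla|-\frac{2m}{1+x^2}$ and $L_-=L_++R$ as self-adjoint operators acting on $L^2(\mathbb{R})$ with domain $H^1(\mathbb{R})$. Then the following hold. (i) The point spectrum of $L_+$ consists of exactly $2m$ eigenvalues, $\sigma_{\mathrm p}(L_+)=\{E_0,E_1,\dots,E_{2m-1}\}$. Moreover, each eigenvalue $E_k$ is simple and $$E_0<E_1<\dots<E_{2m-2}<E_{2m-1}=0.$$ (ii) The point spectrum of $L_-$ only contains zero, $\sigma_{\mathrm p}(L_-)=\{0\}$. Moreover, the eigenvalue $E=0$ of $L_-$ is exactly $2m$-fold degenerate. In particular, $L_+$ and $L_-$ have no embedded eigenvalue $E>0$ inside $\sigma_{\mathrm{ess}}(L_+)=\sigma_{\mathrm{ess}}(L_-)=[0,\infty)$.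
   Context: $|\nabla|=\sqrt{-\Delta}$ on $\mathbb{R}$ (Fourier multiplier $|\xi|$). For $m\ge1$ let $f_m(x)=\mathrm{Re}\left(i\cdot\frac{x-i}{x+i}\right)^m$, $g_m(x)=\mathrm{Im}\left(i\cdot\frac{x-i}{x+i}\right)^m$, $\mathbf{Q}_m=(f_m,g_m,0):\mathbb{R}\to\mathbb{S}^2$, and $$(Rf)(x)=\frac1{2\pi}\int_{\mathbb{R}}\frac{|\mathbf{Q}_m(x)-\mathbf{Q}_m(y)|^2}{|x-y|^2}f(y)\,dy .$$ The point spectrum $\sigma_{\mathrm p}(L_\pm)$ is the set of $E\in\mathbb{R}$ such that $L_\pm\varphi=E\varphi$ for some $\varphi\in H^1(\mathbb{R})$, $\varphi\not\equiv0$. *)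

theory Defs
  imports "HOL-Analysis.Analysis"
begin

text \<open>
  Elements of \<open>L\<^sup>2(\<real>)\<close> (complex scalars) are represented by Borel functions; equality in
  \<open>L\<^sup>2(\<real>)\<close> is equality almost everywhere and is always written out. A linear operator on
  \<open>L\<^sup>2(\<real>)\<close> is given by a domain \<open>D\<close> and a map \<open>T\<close> on representatives, of which only the
  values on \<open>D\<close> modulo null sets matter.
\<close>

definition L2 :: "(real \<Rightarrow> complex) set" where
  "L2 = {f \<in> borel_measurable lborel. integrable lborel (\<lambda>x. (norm (f x))\<^sup>2)}"

definition L2_inner :: "(real \<Rightarrow> complex) \<Rightarrow> (real \<Rightarrow> complex) \<Rightarrow> complex" where
  "L2_inner f g = (LINT x|lborel. f x * cnj (g x))"

definition L2_norm :: "(real \<Rightarrow> complex) \<Rightarrow> real" where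
  "L2_norm f = sqrt (LINT x|lborel. (norm (f x))\<^sup>2)"

text \<open>
  \<open>has_fourier f g\<close>: \<open>g\<close> is the Fourier--Plancherel transform of \<open>f\<close>, i.e. the \<open>L\<^sup>2\<close>-limit of
  the truncated transforms \<open>\<xi> \<mapsto> \<integral> f(x) e\<^sup>-\<^sup>i\<^sup>x\<^sup>\<xi> dx\<close> over \<open>[-N, N]\<close>. The \<open>L\<^sup>2\<close> distance is an
  \<open>ennreal\<close>-valued integral, so that it is not spuriously zero for non-integrable functions.
\<close>

definition has_fourier :: "(real \<Rightarrow> complex) \<Rightarrow> (real \<Rightarrow> complex) \<Rightarrow> bool" where
  "has_fourier f g \<longleftrightarrow> f \<in> L2 \<and> g \<in> L2 \<and>
     (\<lambda>N::nat. \<integral>\<^sup>+ \<xi>. ennreal ((norm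
        ((LINT x:{- real N..real N}|lborel. cis (- (x * \<xi>)) * f x) - g \<xi>))\<^sup>2) \<partial>lborel)
     \<longlonglongrightarrow> 0"

definition H1 :: "(real \<Rightarrow> complex) set" where
  "H1 = {f. \<exists>g. has_fourier f g \<and> integrable lborel (\<lambda>\<xi>. (1 + \<xi>\<^sup>2) * (norm (g \<xi>))\<^sup>2)}"

text \<open>
  The Fourier multiplier \<open>\<bar>\<xi>\<bar>\<close>. For \<open>f \<in> H1\<close> a function \<open>h\<close> as below exists and is unique up
  to a null set, by Plancherel's theorem.
\<close>

definition abs_nabla :: "(real \<Rightarrow> complex) \<Rightarrow> real \<Rightarrow> complex" where
  "abs_nabla f = (SOME h. \<exists>g. has_fourier f g \<and> has_fourier h (\<lambda>\<xi>. complex_of_real \<bar>\<xi>\<bar> * g \<xi>))"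

definition f_fun :: "nat \<Rightarrow> real \<Rightarrow> real" where
  "f_fun m x = Re ((\<i> * ((complex_of_real x - \<i>) / (complex_of_real x + \<i>))) ^ m)"

definition g_fun :: "nat \<Rightarrow> real \<Rightarrow> real" where
  "g_fun m x = Im ((\<i> * ((complex_of_real x - \<i>) / (complex_of_real x + \<i>))) ^ m)"

definition Q_map :: "nat \<Rightarrow> real \<Rightarrow> real ^ 3" where
  "Q_map m x = vector [f_fun m x, g_fun m x, 0]"

text \<open>The value of the integrand on the diagonal \<open>y = x\<close>, where Isabelle gives \<open>0 / 0 = 0\<close>, is irrelevant.\<close>

definition R_op :: "nat \<Rightarrow> (real \<Rightarrow> complex) \<Rightarrow> real \<Rightarrow> complex" where
  "R_op m f x = complex_of_real (1 / (2 * pi)) *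
     (LINT y|lborel. complex_of_real ((norm (Q_map m x - Q_map m y))\<^sup>2 / \<bar>x - y\<bar>\<^sup>2) * f y)"

definition L_plus :: "nat \<Rightarrow> (real \<Rightarrow> complex) \<Rightarrow> real \<Rightarrow> complex" where
  "L_plus m f x = abs_nabla f x - complex_of_real (2 * real m / (1 + x\<^sup>2)) * f x"

definition L_minus :: "nat \<Rightarrow> (real \<Rightarrow> complex) \<Rightarrow> real \<Rightarrow> complex" where
  "L_minus m f x = L_plus m f x + R_op m f x"

text \<open>
  Self-adjointness: \<open>T\<close> is densely defined in \<open>L\<^sup>2\<close> and equals its adjoint. The left-hand side
  of the equivalence says that \<open>(u, v)\<close> lies in the graph of the adjoint, the right-hand side
  that it lies in the graph of \<open>T\<close>.
\<close>

definition self_adjoint ::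
  "(real \<Rightarrow> complex) set \<Rightarrow> ((real \<Rightarrow> complex) \<Rightarrow> real \<Rightarrow> complex) \<Rightarrow> bool" where
  "self_adjoint D T \<longleftrightarrow>
     D \<subseteq> L2 \<and> T ` D \<subseteq> L2 \<and>
     (\<forall>f\<in>L2. \<forall>\<epsilon>>0. \<exists>g\<in>D. L2_norm (\<lambda>x. f x - g x) < \<epsilon>) \<and>
     (\<forall>u\<in>L2. \<forall>v\<in>L2. (\<forall>f\<in>D. L2_inner (T f) u = L2_inner f v) \<longleftrightarrow>
        (u \<in> D \<and> (AE x in lborel. T u x = v x)))"

definition eigenspace ::
  "(real \<Rightarrow> complex) set \<Rightarrow> ((real \<Rightarrow> complex) \<Rightarrow> real \<Rightarrow> complex) \<Rightarrow> complex \<Rightarrow> (real \<Rightarrow> complex) set" where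
  "eigenspace D T z = {\<phi> \<in> D. AE x in lborel. T \<phi> x = z * \<phi> x}"

text \<open>\<open>has_dim_AE V k\<close>: modulo null functions, \<open>V\<close> has a basis of \<open>k\<close> elements over \<open>\<complex>\<close>.\<close>

definition has_dim_AE :: "(real \<Rightarrow> complex) set \<Rightarrow> nat \<Rightarrow> bool" where
  "has_dim_AE V k \<longleftrightarrow> (\<exists>b :: nat \<Rightarrow> real \<Rightarrow> complex.
     (\<forall>j<k. b j \<in> V) \<and>
     (\<forall>c :: nat \<Rightarrow> complex. (AE x in lborel. (\<Sum>j<k. c j * b j x) = 0) \<longrightarrow> (\<forall>j<k. c j = 0)) \<and>
     (\<forall>f\<in>V. \<exists>c :: nat \<Rightarrow> complex. AE x in lborel. f x = (\<Sum>j<k. c j * b j x)))"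

definition point_spectrum ::
  "(real \<Rightarrow> complex) set \<Rightarrow> ((real \<Rightarrow> complex) \<Rightarrow> real \<Rightarrow> complex) \<Rightarrow> real set" where
  "point_spectrum D T =
     {E. \<exists>\<phi>\<in>eigenspace D T (complex_of_real E). \<not> (AE x in lborel. \<phi> x = 0)}"

text \<open>
  \<open>T - z\<close> is a bijection of \<open>D\<close> onto \<open>L\<^sup>2\<close> with bounded inverse; injectivity (modulo null
  functions) is contained in the norm estimate.
\<close>

definition resolvent_set ::
  "(real \<Rightarrow> complex) set \<Rightarrow> ((real \<Rightarrow> complex) \<Rightarrow> real \<Rightarrow> complex) \<Rightarrow> complex set" where
  "resolvent_set D T = {z.
     (\<forall>g\<in>L2. \<exists>f\<in>D. AE x in lborel. T f x - z * f x = g x) \<and>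
     (\<exists>C. \<forall>f\<in>D. L2_norm f \<le> C * L2_norm (\<lambda>x. T f x - z * f x))}"

definition spectrum ::
  "(real \<Rightarrow> complex) set \<Rightarrow> ((real \<Rightarrow> complex) \<Rightarrow> real \<Rightarrow> complex) \<Rightarrow> complex set" where
  "spectrum D T = - resolvent_set D T"

definition discrete_spectrum ::
  "(real \<Rightarrow> complex) set \<Rightarrow> ((real \<Rightarrow> complex) \<Rightarrow> real \<Rightarrow> complex) \<Rightarrow> complex set" where
  "discrete_spectrum D T =
     {z. z isolated_in spectrum D T \<and> (\<exists>k\<ge>1. has_dim_AE (eigenspace D T z) k)}"

text \<open>The usual essential spectrum of a self-adjoint operator: what remains of the spectrum
  after removing the isolated eigenvalues of finite multiplicity.\<close>

definition essential_spectrum ::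
  "(real \<Rightarrow> complex) set \<Rightarrow> ((real \<Rightarrow> complex) \<Rightarrow> real \<Rightarrow> complex) \<Rightarrow> complex set" where
  "essential_spectrum D T = spectrum D T - discrete_spectrum D T"

end

theory Submission
  imports Defs "HOL-Real_Asymp.Real_Asymp" "HOL-Computational_Algebra.Polynomial"
    "Jordan_Normal_Form.Determinant"
begin

text \<open>
  Let \<open>\<beta>(x) = (x - \<i>) / (x + \<i>)\<close>. The Fejer identity, applied to the chord lengths of \<open>Q_map m\<close>, shows that \<open>R\<close>
  has finite rank, with kernel a combination of \<open>e\<^sub>d(x) - e\<^sub>d\<^sub>-\<^sub>1(x)\<close> for \<open>\<bar>d\<bar> < m\<close>, where
  \<open>e\<^sub>n = \<beta>\<^sup>n / (1 - \<i> x)\<close>, \<open>n \<in> \<int>\<close>, is the orthogonal system adapted to the Hardy space \<open>H\<^sup>+\<close>.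
  On \<open>H\<^sup>+\<close> the operator \<open>|\<nabla>|\<close> is \<open>- \<i> d/dx\<close>, so that \<open>|\<nabla>| - 2 m / (1 + x\<^sup>2)\<close> agrees with
  \<open>\<beta>\<^sup>m |\<nabla>| \<beta>\<^sup>-\<^sup>m\<close> on \<open>\<beta>\<^sup>m H\<^sup>+\<close>. Hence \<open>L_minus m\<close> vanishes on the span of \<open>e\<^sub>n\<close>, \<open>-m \<le> n < m\<close>, and on the two
  halves \<open>\<beta>\<^sup>m H\<^sup>+\<close> and \<open>\<beta>\<^sup>-\<^sup>m H\<^sup>-\<close> of the complement it is unitarily equivalent to \<open>|\<nabla>|\<close> on \<open>H\<^sup>\<plusminus>\<close>. This
  gives its spectrum, and off \<open>[0, \<infinity>)\<close> the resolvent of the finite rank perturbation \<open>L_plus m\<close> exists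
  as soon as \<open>L_plus m - z\<close> is injective.

  For the eigenvalues of \<open>L_plus m\<close> let \<open>G\<close> be the Fourier transform of an eigenfunction and \<open>u\<close> the
  convolution of \<open>G\<close> with \<open>exp (- \<bar>s\<bar>)\<close>. Then \<open>(\<bar>\<xi>\<bar> - E) G = m u\<close> and \<open>u'' - u = - 2 G\<close>, so that
  \<open>u'' = (1 - 2 m / (\<bar>\<xi>\<bar> - E)) u\<close>, a Coulomb equation. Its decaying solution at \<open>\<xi> > max 0 E\<close> is
  \<open>W (\<xi> - E)\<close>, where \<open>W r = P r exp (- r)\<close> and \<open>P\<close> is a Laguerre polynomial with \<open>m\<close> roots in
  \<open>[0, \<infinity>)\<close>, one of them \<open>0\<close>. Even and odd continuation to \<open>\<xi> < 0\<close> give the conditions \<open>W' (- E) = 0\<close> and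
  \<open>W (- E) = 0\<close>, together \<open>2 m\<close> values \<open>E \<le> 0\<close>. For \<open>E > 0\<close> square integrability of \<open>G\<close> forces
  \<open>u (\<plusminus> E) = 0\<close>; the equation has a nonnegative potential on \<open>[- E, E]\<close>, so \<open>u = 0\<close> there, and then
  \<open>u = 0\<close> beyond because \<open>W' 0 \<noteq> 0\<close>.
\<close>

section \<open>Square integrable functions\<close>

text \<open>The exponent \<open>m\<close> enters through - \<i> \<beta>' / \<beta> = 2 / (1 + x^2):
  moving one factor \<beta> past - \<i> d/dx creates one copy of the potential, so \<open>m\<close>
  factors absorb it on one Hardy half. In Fourier variables the same potential is a convolution with
  exp (- \<bar>s\<bar>), and exp (- \<bar>s\<bar>) / 2 is the Green function of 1 - d^2/d\<xi>^2;
  this trades the integral equation for a second order one. For E \<le> 0 the only quantization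
  condition sits at \<xi> = 0, where \<bar>\<xi>\<bar> has its kink: u and u' are continuous there
  because they are convolutions, whatever G does. The transform is an \<open>L2\<close> limit of
  truncated integrals, so inversion and Plancherel are obtained by Abel summation, that is, by
  inserting exp (- e \<bar>\<xi>\<bar>) and letting the Poisson kernel concentrate. The essential
  spectrum is reached without compactness. A function with transform the indicator of
  [E, E + \<delta>] has \<open>L2\<close> norm of order sqrt \<delta> but sup norm of order
  \<delta>, so a perturbation controlled by the sup norm does not see it.\<close>

lemma cnj_borel_measurable [measurable]: "cnj \<in> borel_measurable borel"
  by (intro borel_measurable_continuous_onI continuous_intros)

lemma L2_measurable [measurable_dest]: "f \<in> L2 \<Longrightarrow> f \<in> borel_measurable borel"
  by (simp add: L2_def)

lemma L2_integrable: "f \<in> L2 \<Longrightarrow> integrable lborel (\<lambda>x. (norm (f x))\<^sup>2)"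
  by (simp add: L2_def)

lemma L2I:
  "f \<in> borel_measurable borel \<Longrightarrow> integrable lborel (\<lambda>x. (norm (f x))\<^sup>2) \<Longrightarrow> f \<in> L2"
  by (simp add: L2_def)

lemma L2_norm_nonneg [simp]: "0 \<le> L2_norm f"
  by (simp add: L2_norm_def)

lemma L2_norm_power2: "(L2_norm f)\<^sup>2 = (LINT x|lborel. (norm (f x))\<^sup>2)"
  by (simp add: L2_norm_def)

lemma L2_iff_nn:
  assumes "f \<in> borel_measurable borel"
  shows "f \<in> L2 \<longleftrightarrow> (\<integral>\<^sup>+x. ennreal ((norm (f x))\<^sup>2) \<partial>lborel) < \<infinity>"
  using assms by (auto simp: L2_def integrable_iff_bounded)

lemma nn_integral_L2:
  assumes "f \<in> L2"
  shows "(\<integral>\<^sup>+x. ennreal ((norm (f x))\<^sup>2) \<partial>lborel) = ennreal ((L2_norm f)\<^sup>2)"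
  unfolding L2_norm_power2 by (rule nn_integral_eq_integral) (auto intro: L2_integrable assms)

lemma L2_dominated:
  assumes "f \<in> borel_measurable borel" "g \<in> L2" "AE x in lborel. norm (f x) \<le> C * norm (g x)"
  shows "f \<in> L2"
proof (rule L2I)
  show "integrable lborel (\<lambda>x. (norm (f x))\<^sup>2)"
  proof (rule Bochner_Integration.integrable_bound)
    show "integrable lborel (\<lambda>x. C\<^sup>2 * (norm (g x))\<^sup>2)"
      using L2_integrable[OF assms(2)] by simp
    show "AE x in lborel. norm ((norm (f x))\<^sup>2) \<le> norm (C\<^sup>2 * (norm (g x))\<^sup>2)"
      using assms(3)
    proof eventually_elim
      case (elim x)
      then have "(norm (f x))\<^sup>2 \<le> (C * norm (g x))\<^sup>2" by (intro power_mono) auto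
      then show ?case by (simp add: power_mult_distrib)
    qed
  qed (use assms(1) in measurable)
qed (use assms in auto)

lemma L2_cong_AE:
  assumes "f \<in> L2" "g \<in> borel_measurable borel" "AE x in lborel. f x = g x"
  shows "g \<in> L2"
  by (rule L2_dominated[of g f 1]) (use assms in auto)

lemma L2_mult_bounded:
  assumes "f \<in> L2" "b \<in> borel_measurable borel" "\<And>x. norm (b x) \<le> C"
  shows "(\<lambda>x. b x * f x) \<in> L2"
  by (rule L2_dominated[of _ f C])
    (use assms in \<open>auto simp: norm_mult intro!: mult_right_mono dest: L2_measurable\<close>)

lemma L2_zero [simp]: "(\<lambda>x. 0) \<in> L2"
  by (simp add: L2_def)

lemma L2_scale: "f \<in> L2 \<Longrightarrow> (\<lambda>x. c * f x) \<in> L2"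
  by (rule L2_mult_bounded[where C="norm c"]) auto

lemma L2_cnj: "f \<in> L2 \<Longrightarrow> (\<lambda>x. cnj (f x)) \<in> L2"
  by (rule L2_dominated[of _ f 1]) (auto dest: L2_measurable)

lemma L2_add:
  assumes "f \<in> L2" "g \<in> L2"
  shows "(\<lambda>x. f x + g x) \<in> L2"
proof (rule L2I)
  show "integrable lborel (\<lambda>x. (norm (f x + g x))\<^sup>2)"
  proof (rule Bochner_Integration.integrable_bound)
    show "integrable lborel (\<lambda>x. 2 * (norm (f x))\<^sup>2 + 2 * (norm (g x))\<^sup>2)"
      using L2_integrable assms by auto
    have "(norm (f x + g x))\<^sup>2 \<le> 2 * (norm (f x))\<^sup>2 + 2 * (norm (g x))\<^sup>2" for x
    proof -
      have "(norm (f x + g x))\<^sup>2 \<le> (norm (f x) + norm (g x))\<^sup>2"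
        by (intro power_mono norm_triangle_ineq) auto
      also have "\<dots> \<le> 2 * (norm (f x))\<^sup>2 + 2 * (norm (g x))\<^sup>2"
        using sum_squares_bound[of "norm (f x)" "norm (g x)"] by (simp add: power2_sum)
      finally show ?thesis .
    qed
    then show "AE x in lborel. norm ((norm (f x + g x))\<^sup>2)
        \<le> norm (2 * (norm (f x))\<^sup>2 + 2 * (norm (g x))\<^sup>2)"
      by auto
  qed (use assms in measurable)
qed (use assms in measurable)

lemma L2_minus: "f \<in> L2 \<Longrightarrow> (\<lambda>x. - f x) \<in> L2"
  using L2_scale[of f "-1"] by simp

lemma L2_diff: "f \<in> L2 \<Longrightarrow> g \<in> L2 \<Longrightarrow> (\<lambda>x. f x - g x) \<in> L2"
  using L2_add[of f "\<lambda>x. - g x"] L2_minus[of g] by simp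

lemma L2_sum: "(\<And>i. i \<in> I \<Longrightarrow> f i \<in> L2) \<Longrightarrow> (\<lambda>x. \<Sum>i\<in>I. f i x) \<in> L2"
  by (induction I rule: infinite_finite_induct) (auto intro: L2_add)

lemma L2_indicator:
  assumes "f \<in> L2" "A \<in> sets borel"
  shows "(\<lambda>x. indicator A x * f x) \<in> L2"
  by (rule L2_mult_bounded[where C=1]) (use assms in \<open>auto simp: indicator_def\<close>)

lemma L2_mult_integrable:
  assumes "f \<in> L2" "g \<in> L2"
  shows "integrable lborel (\<lambda>x. f x * g x)"
proof (rule Bochner_Integration.integrable_bound)
  show "integrable lborel (\<lambda>x. (norm (f x))\<^sup>2 + (norm (g x))\<^sup>2)"
    using L2_integrable assms by auto
  have "norm (f x) * norm (g x) \<le> (norm (f x))\<^sup>2 + (norm (g x))\<^sup>2" for x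
    using sum_squares_bound[of "norm (f x)" "norm (g x)"]
      mult_nonneg_nonneg[OF norm_ge_zero norm_ge_zero, of "f x" "g x"] by linarith
  then show "AE x in lborel. norm (f x * g x) \<le> norm ((norm (f x))\<^sup>2 + (norm (g x))\<^sup>2)"
    by (simp add: norm_mult)
qed (use assms in measurable)

lemma L2_inner_integrable:
  "f \<in> L2 \<Longrightarrow> g \<in> L2 \<Longrightarrow> integrable lborel (\<lambda>x. f x * cnj (g x))"
  by (intro L2_mult_integrable L2_cnj)

lemma L2_mult_integrable_norm:
  "f \<in> L2 \<Longrightarrow> g \<in> L2 \<Longrightarrow> integrable lborel (\<lambda>x. norm (f x) * norm (g x))"
  using integrable_norm[OF L2_mult_integrable[of f g]] by (simp add: norm_mult)

lemma L2_norm_cong_AE: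
  assumes "f \<in> borel_measurable borel" "g \<in> borel_measurable borel" "AE x in lborel. f x = g x"
  shows "L2_norm f = L2_norm g"
  unfolding L2_norm_def by (intro arg_cong[where f=sqrt] integral_cong_AE) (use assms in auto)

lemma L2_inner_cong_AE:
  assumes "f \<in> L2" "g \<in> L2" "f' \<in> L2" "g' \<in> L2"
    "AE x in lborel. f x = f' x" "AE x in lborel. g x = g' x"
  shows "L2_inner f g = L2_inner f' g'"
  unfolding L2_inner_def
  by (intro integral_cong_AE) (use assms L2_inner_integrable in \<open>auto intro: borel_measurable_integrable\<close>)

lemma L2_Cauchy_Schwarz_norm:
  assumes "f \<in> L2" "g \<in> L2"
  shows "(LINT x|lborel. norm (f x) * norm (g x)) \<le> L2_norm f * L2_norm g"
proof -
  have "(\<integral>\<^sup>+x. ennreal (norm (f x)) * ennreal (norm (g x)) \<partial>lborel)\<^sup>2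
     \<le> (\<integral>\<^sup>+x. (ennreal (norm (f x)))\<^sup>2 \<partial>lborel) * (\<integral>\<^sup>+x. (ennreal (norm (g x)))\<^sup>2 \<partial>lborel)"
    by (rule Cauchy_Schwarz_nn_integral) (use assms in measurable)
  also have "\<dots> = ennreal ((L2_norm f)\<^sup>2 * (L2_norm g)\<^sup>2)"
    using nn_integral_L2[OF assms(1)] nn_integral_L2[OF assms(2)]
    by (simp add: ennreal_power ennreal_mult)
  also have "(\<integral>\<^sup>+x. ennreal (norm (f x)) * ennreal (norm (g x)) \<partial>lborel)
      = ennreal (LINT x|lborel. norm (f x) * norm (g x))"
    using nn_integral_eq_integral[OF L2_mult_integrable_norm[OF assms]]
    by (simp add: ennreal_mult)
  finally have "(LINT x|lborel. norm (f x) * norm (g x))\<^sup>2 \<le> (L2_norm f)\<^sup>2 * (L2_norm g)\<^sup>2"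
    by (simp add: ennreal_power)
  then have "(LINT x|lborel. norm (f x) * norm (g x))\<^sup>2 \<le> (L2_norm f * L2_norm g)\<^sup>2"
    by (simp add: power_mult_distrib)
  then show ?thesis by (rule power2_le_imp_le) auto
qed

lemma L2_Cauchy_Schwarz:
  assumes "f \<in> L2" "g \<in> L2"
  shows "norm (L2_inner f g) \<le> L2_norm f * L2_norm g"
proof -
  have "norm (L2_inner f g) \<le> (LINT x|lborel. norm (f x * cnj (g x)))"
    unfolding L2_inner_def by (rule integral_norm_bound)
  then show ?thesis using L2_Cauchy_Schwarz_norm[OF assms] by (simp add: norm_mult)
qed

lemma L2_inner_self:
  assumes "f \<in> L2" shows "L2_inner f f = complex_of_real ((L2_norm f)\<^sup>2)"
proof -
  have "L2_inner f f = (LINT x|lborel. complex_of_real ((norm (f x))\<^sup>2))"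
    unfolding L2_inner_def by (simp only: complex_norm_square)
  then show ?thesis by (simp only: integral_complex_of_real L2_norm_power2)
qed

lemma L2_inner_commute: "L2_inner g f = cnj (L2_inner f g)"
  unfolding L2_inner_def by (simp add: mult.commute flip: Bochner_Integration.integral_cnj)

lemma L2_inner_add_left:
  "f \<in> L2 \<Longrightarrow> g \<in> L2 \<Longrightarrow> h \<in> L2 \<Longrightarrow> L2_inner (\<lambda>x. f x + g x) h = L2_inner f h + L2_inner g h"
  unfolding L2_inner_def
  by (simp add: distrib_right L2_inner_integrable)

lemma L2_inner_diff_left:
  "f \<in> L2 \<Longrightarrow> g \<in> L2 \<Longrightarrow> h \<in> L2 \<Longrightarrow> L2_inner (\<lambda>x. f x - g x) h = L2_inner f h - L2_inner g h"
  unfolding L2_inner_def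
  by (simp add: left_diff_distrib L2_inner_integrable)

lemma L2_inner_scale_left: "L2_inner (\<lambda>x. c * f x) h = c * L2_inner f h"
  unfolding L2_inner_def by (simp add: mult.assoc)

lemma L2_inner_sum_left:
  "finite I \<Longrightarrow> (\<And>i. i \<in> I \<Longrightarrow> f i \<in> L2) \<Longrightarrow> h \<in> L2 \<Longrightarrow>
   L2_inner (\<lambda>x. \<Sum>i\<in>I. f i x) h = (\<Sum>i\<in>I. L2_inner (f i) h)"
proof (induction I rule: finite_induct)
  case empty then show ?case by (simp add: L2_inner_def)
next
  case (insert i I)
  then show ?case by (simp add: L2_inner_add_left L2_sum)
qed

lemma L2_inner_add_right:
  "f \<in> L2 \<Longrightarrow> g \<in> L2 \<Longrightarrow> h \<in> L2 \<Longrightarrow> L2_inner h (\<lambda>x. f x + g x) = L2_inner h f + L2_inner h g"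
  by (subst (1 2 3) L2_inner_commute) (simp add: L2_inner_add_left)

lemma L2_inner_diff_right:
  "f \<in> L2 \<Longrightarrow> g \<in> L2 \<Longrightarrow> h \<in> L2 \<Longrightarrow> L2_inner h (\<lambda>x. f x - g x) = L2_inner h f - L2_inner h g"
  by (subst (1 2 3) L2_inner_commute) (simp add: L2_inner_diff_left)

lemma L2_inner_scale_right: "L2_inner h (\<lambda>x. c * f x) = cnj c * L2_inner h f"
  by (subst (1 2) L2_inner_commute) (simp add: L2_inner_scale_left)

lemma L2_norm_scale: "L2_norm (\<lambda>x. c * f x) = norm c * L2_norm f"
  by (simp add: L2_norm_def norm_mult power_mult_distrib real_sqrt_mult)

lemma L2_norm_minus_commute: "L2_norm (\<lambda>x. f x - g x) = L2_norm (\<lambda>x. g x - f x)"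
  by (simp add: L2_norm_def norm_minus_commute)

lemma L2_norm_triangle:
  assumes "f \<in> L2" "g \<in> L2"
  shows "L2_norm (\<lambda>x. f x + g x) \<le> L2_norm f + L2_norm g"
proof (rule power2_le_imp_le)
  have "complex_of_real ((L2_norm (\<lambda>x. f x + g x))\<^sup>2)
      = L2_inner f f + L2_inner f g + cnj (L2_inner f g) + L2_inner g g"
    using assms by (simp add: L2_inner_self[symmetric] L2_add L2_inner_add_left L2_inner_add_right
        L2_inner_commute[of g f] del: of_real_power)
  also have "\<dots> = complex_of_real ((L2_norm f)\<^sup>2 + 2 * Re (L2_inner f g) + (L2_norm g)\<^sup>2)"
    using assms complex_add_cnj[of "L2_inner f g"] by (simp add: L2_inner_self)
  finally have "(L2_norm (\<lambda>x. f x + g x))\<^sup>2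
      = (L2_norm f)\<^sup>2 + 2 * Re (L2_inner f g) + (L2_norm g)\<^sup>2"
    by (simp only: of_real_eq_iff)
  also have "\<dots> \<le> (L2_norm f + L2_norm g)\<^sup>2"
    using L2_Cauchy_Schwarz[OF assms] complex_Re_le_cmod[of "L2_inner f g"]
    by (simp add: power2_sum)
  finally show "(L2_norm (\<lambda>x. f x + g x))\<^sup>2 \<le> (L2_norm f + L2_norm g)\<^sup>2" .
qed simp

lemma L2_norm_triangle_diff:
  assumes "f \<in> L2" "g \<in> L2"
  shows "L2_norm (\<lambda>x. f x - g x) \<le> L2_norm f + L2_norm g"
  using L2_norm_triangle[OF assms(1) L2_minus[OF assms(2)]] L2_norm_scale[of "-1" g] by simp

lemma L2_norm_triangle3:
  assumes "f \<in> L2" "g \<in> L2" "h \<in> L2"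
  shows "L2_norm (\<lambda>x. f x - h x) \<le> L2_norm (\<lambda>x. f x - g x) + L2_norm (\<lambda>x. g x - h x)"
  using L2_norm_triangle[OF L2_diff[OF assms(1,2)] L2_diff[OF assms(2,3)]] by simp

lemma L2_norm_eq_0:
  assumes "f \<in> L2" shows "L2_norm f = 0 \<longleftrightarrow> (AE x in lborel. f x = 0)"
  using integral_nonneg_eq_0_iff_AE[OF L2_integrable[OF assms]]
  by (simp add: L2_norm_def)

lemma L2_norm_dominated:
  assumes "f \<in> borel_measurable borel" "g \<in> L2" "AE x in lborel. norm (f x) \<le> C * norm (g x)" "0 \<le> C"
  shows "L2_norm f \<le> C * L2_norm g"
proof -
  have f: "f \<in> L2" using L2_dominated assms(1-3) .
  have "(L2_norm f)\<^sup>2 \<le> (LINT x|lborel. C\<^sup>2 * (norm (g x))\<^sup>2)"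
    unfolding L2_norm_power2
  proof (rule integral_mono_AE)
    show "AE x in lborel. (norm (f x))\<^sup>2 \<le> C\<^sup>2 * (norm (g x))\<^sup>2"
      using assms(3) by eventually_elim (metis norm_ge_zero power_mono power_mult_distrib)
  qed (use L2_integrable f assms(2) in auto)
  also have "\<dots> = (C * L2_norm g)\<^sup>2"
    by (simp add: L2_norm_power2 power_mult_distrib)
  finally show ?thesis by (rule power2_le_imp_le) (use assms in auto)
qed

lemma L2_norm_sum:
  "finite I \<Longrightarrow> (\<And>i. i \<in> I \<Longrightarrow> f i \<in> L2) \<Longrightarrow>
   L2_norm (\<lambda>x. \<Sum>i\<in>I. f i x) \<le> (\<Sum>i\<in>I. L2_norm (f i))"
proof (induction I rule: finite_induct)
  case empty then show ?case by (simp add: L2_norm_def)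
next
  case (insert i I)
  have "L2_norm (\<lambda>x. f i x + (\<Sum>i\<in>I. f i x)) \<le> L2_norm (f i) + L2_norm (\<lambda>x. \<Sum>i\<in>I. f i x)"
    by (rule L2_norm_triangle) (use insert in \<open>auto intro: L2_sum\<close>)
  with insert show ?case by simp
qed

text \<open>A subsequence with steps below 2^-k converges almost everywhere because the sum of 2^k
  |d_k|^2 has finite integral. Fatou's lemma then turns the pointwise limit into the limit in
  \<open>L2\<close>.\<close>

lemma L2_complete:
  assumes X: "\<And>n. X n \<in> L2"
    and cauchy: "\<And>e. e > 0 \<Longrightarrow> \<exists>N. \<forall>m\<ge>N. \<forall>n\<ge>N. L2_norm (\<lambda>x. X m x - X n x) < e"
  obtains g where "g \<in> L2" "(\<lambda>n. L2_norm (\<lambda>x. X n x - g x)) \<longlonglongrightarrow> 0"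
proof -
  obtain N where N: "\<And>e m n. e > 0 \<Longrightarrow> m \<ge> N e \<Longrightarrow> n \<ge> N e \<Longrightarrow> L2_norm (\<lambda>x. X m x - X n x) < e"
    using cauchy by metis
  \<comment> \<open>Summing the Cauchy indices up to k makes \<open>r\<close> increasing while
    \<open>r k\<close> still dominates the index belonging to (1/2)^k.\<close>
  define r where "r k = k + (\<Sum>j\<le>k. N ((1/2)^j))" for k
  have r_ge: "N ((1/2)^k) \<le> r k" "k \<le> r k" for k
    unfolding r_def using member_le_sum[of k "{..k}" "\<lambda>j. N ((1/2)^j)"] by auto
  have r_mono: "r k \<le> r (Suc k)" for k by (simp add: r_def)
  define d where "d k x = X (r (Suc k)) x - X (r k) x" for k x
  have dL2: "d k \<in> L2" for k unfolding d_def by (intro L2_diff X)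
  have [measurable]: "X n \<in> borel_measurable borel" "d n \<in> borel_measurable borel" for n
    using X dL2 by auto
  have d_norm: "L2_norm (d k) \<le> (1/2)^k" for k
    unfolding d_def using order.trans[OF r_ge(1)[of k] r_mono[of k]]
    by (intro less_imp_le[OF N] r_ge(1)) auto
  have "(\<integral>\<^sup>+x. (\<Sum>k. ennreal (2^k * (norm (d k x))\<^sup>2)) \<partial>lborel)
      = (\<Sum>k. \<integral>\<^sup>+x. ennreal (2^k * (norm (d k x))\<^sup>2) \<partial>lborel)"
    by (rule nn_integral_suminf) measurable
  also have "\<dots> = (\<Sum>k. ennreal (2^k * (L2_norm (d k))\<^sup>2))"
    by (simp add: ennreal_mult nn_integral_cmult nn_integral_L2[OF dL2])
  also have "\<dots> \<le> (\<Sum>k. ennreal ((1/2)^k))"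
  proof (rule suminf_le)
    fix k
    have "2^k * (L2_norm (d k))\<^sup>2 \<le> 2^k * ((1/2)^k)\<^sup>2"
      by (intro mult_left_mono power_mono d_norm) auto
    also have "\<dots> = (1/2)^k" by (simp add: power2_eq_square flip: power_mult_distrib)
    finally show "ennreal (2^k * (L2_norm (d k))\<^sup>2) \<le> ennreal ((1/2)^k)" by (rule ennreal_leI)
  qed auto
  also have "\<dots> = ennreal (\<Sum>k. (1/2)^k)"
    by (rule suminf_ennreal2) (auto intro: summable_geometric)
  finally have "(\<integral>\<^sup>+x. (\<Sum>k. ennreal (2^k * (norm (d k x))\<^sup>2)) \<partial>lborel) \<noteq> \<infinity>"
    by (metis ennreal_neq_top infinity_ennreal_def neq_top_trans)
  then have "AE x in lborel. (\<Sum>k. ennreal (2^k * (norm (d k x))\<^sup>2)) \<noteq> \<infinity>"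
    by (intro nn_integral_PInf_AE) auto
  then have "AE x in lborel. convergent (\<lambda>k. X (r k) x)"
  proof eventually_elim
    case (elim x)
    then have "summable (\<lambda>k. 2^k * (norm (d k x))\<^sup>2)"
      by (intro summable_suminf_not_top) auto
    moreover have "summable (\<lambda>k. (1/2::real)^k)" by (intro summable_geometric) auto
    ultimately have "summable (\<lambda>k. (1/2::real)^k + 2^k * (norm (d k x))\<^sup>2)"
      by (rule summable_add[rotated])
    then have "summable (\<lambda>k. d k x)"
    proof (rule summable_comparison_test'[of _ 0])
      fix k :: nat
      define a where "a = (2::real)^k"
      have a: "a > 0" by (simp add: a_def)
      \<comment> \<open>Expanding this square gives 2 |d| \<le> 1/a + a |d|^2, which converts
        weighted square summability into absolute convergence of the telescoping series.\<close>
      have "0 \<le> (a * norm (d k x) - 1)\<^sup>2" by simp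
      then have "2 * a * norm (d k x) \<le> 1 + a * (a * (norm (d k x))\<^sup>2)"
        by (simp add: power2_eq_square algebra_simps)
      also have "\<dots> = a * (1 / a + a * (norm (d k x))\<^sup>2)" using a by (simp add: field_simps)
      finally have "2 * norm (d k x) \<le> 1 / a + a * (norm (d k x))\<^sup>2"
        using a by (simp add: mult.assoc mult.left_commute[of 2 a])
      then show "norm (d k x) \<le> (1/2)^k + 2^k * (norm (d k x))\<^sup>2"
        unfolding a_def by (simp add: power_one_over) (use norm_ge_zero[of "d k x"] in linarith)
    qed
    then have "(\<lambda>n. \<Sum>k<n. d k x) \<longlonglongrightarrow> (\<Sum>k. d k x)" by (rule summable_LIMSEQ)
    then have "(\<lambda>n. (\<Sum>k<n. d k x) + X (r 0) x) \<longlonglongrightarrow> (\<Sum>k. d k x) + X (r 0) x"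
      by (intro tendsto_intros)
    moreover have "(\<Sum>k<n. d k x) + X (r 0) x = X (r n) x" for n
      unfolding d_def by (simp add: sum_lessThan_telescope[of "\<lambda>k. X (r k) x"])
    ultimately show ?case by (auto simp: convergent_def)
  qed
  then have lim: "AE x in lborel. (\<lambda>k. X (r k) x) \<longlonglongrightarrow> lim (\<lambda>k. X (r k) x)"
    by (simp add: convergent_LIMSEQ_iff)
  define g where "g x = lim (\<lambda>k. X (r k) x)" for x
  have [measurable]: "g \<in> borel_measurable borel" unfolding g_def by measurable
  have bound: "(\<integral>\<^sup>+x. ennreal ((norm (X n x - g x))\<^sup>2) \<partial>lborel) \<le> ennreal (e\<^sup>2)"
    if e: "e > 0" "n \<ge> N e" for n e
  proof -
    have "(\<integral>\<^sup>+x. ennreal ((norm (X n x - g x))\<^sup>2) \<partial>lborel)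
        = (\<integral>\<^sup>+x. liminf (\<lambda>k. ennreal ((norm (X n x - X (r k) x))\<^sup>2)) \<partial>lborel)"
    proof (rule nn_integral_cong_AE, use lim in eventually_elim)
      case (elim x)
      then have "(\<lambda>k. ennreal ((norm (X n x - X (r k) x))\<^sup>2)) \<longlonglongrightarrow> ennreal ((norm (X n x - g x))\<^sup>2)"
        unfolding g_def by (intro tendsto_ennrealI tendsto_intros)
      then show ?case by (intro lim_imp_Liminf[symmetric]) auto
    qed
    also have "\<dots> \<le> liminf (\<lambda>k. \<integral>\<^sup>+x. ennreal ((norm (X n x - X (r k) x))\<^sup>2) \<partial>lborel)"
      by (rule nn_integral_liminf) measurable
    also have "\<dots> \<le> liminf (\<lambda>k. ennreal (e\<^sup>2))"
    proof (rule Liminf_mono, rule eventually_sequentiallyI)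
      fix k assume "k \<ge> N e"
      then have "L2_norm (\<lambda>x. X n x - X (r k) x) < e" using e r_ge(2)[of k] by (intro N) auto
      then show "(\<integral>\<^sup>+x. ennreal ((norm (X n x - X (r k) x))\<^sup>2) \<partial>lborel) \<le> ennreal (e\<^sup>2)"
        by (subst nn_integral_L2[OF L2_diff[OF X X]]) (intro ennreal_leI power_mono; simp)
    qed
    also have "\<dots> = ennreal (e\<^sup>2)" by (simp add: Liminf_const)
    finally show ?thesis .
  qed
  have diff: "(\<lambda>x. X n x - g x) \<in> L2" if "e > 0" "n \<ge> N e" for n e
    using bound[OF that] by (subst L2_iff_nn) (auto simp: le_less_trans)
  have "g \<in> L2"
    using L2_diff[OF X[of "N 1"] diff[of 1 "N 1"]] by simp
  moreover have "(\<lambda>n. L2_norm (\<lambda>x. X n x - g x)) \<longlonglongrightarrow> 0"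
  proof (rule LIMSEQ_I)
    fix e :: real assume e: "e > 0"
    have "norm (L2_norm (\<lambda>x. X n x - g x) - 0) < e" if "n \<ge> N (e/2)" for n
    proof -
      have "ennreal ((L2_norm (\<lambda>x. X n x - g x))\<^sup>2) \<le> ennreal ((e/2)\<^sup>2)"
        using bound[of "e/2" n] nn_integral_L2[OF diff[of "e/2" n]] that e by simp
      then have "(L2_norm (\<lambda>x. X n x - g x))\<^sup>2 \<le> (e/2)\<^sup>2" by (simp add: ennreal_le_iff)
      then have "L2_norm (\<lambda>x. X n x - g x) \<le> e/2" by (rule power2_le_imp_le) (use e in auto)
      then show ?thesis using e by simp
    qed
    then show "\<exists>no. \<forall>n\<ge>no. norm (L2_norm (\<lambda>x. X n x - g x) - 0) < e" by blast
  qed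
  ultimately show ?thesis by (rule that)
qed

section \<open>The Fourier transform on \<open>L\<^sup>1\<close> and the Poisson kernel\<close>

lemma cis_borel_measurable [measurable]: "cis \<in> borel_measurable borel"
  by (intro borel_measurable_continuous_onI continuous_intros)

lemma complex_of_real_borel_measurable [measurable]: "complex_of_real \<in> borel_measurable borel"
  by (intro borel_measurable_continuous_onI continuous_intros)

lemma lborel_swap_integrals:
  fixes F :: "real \<Rightarrow> real \<Rightarrow> complex"
  assumes [measurable]: "case_prod F \<in> borel_measurable (lborel \<Otimes>\<^sub>M lborel)"
    and fin: "(\<integral>\<^sup>+x. \<integral>\<^sup>+y. ennreal (norm (F x y)) \<partial>lborel \<partial>lborel) < \<infinity>"
  shows "(LINT y|lborel. LINT x|lborel. F x y) = (LINT x|lborel. LINT y|lborel. F x y)"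
    and "integrable lborel (\<lambda>x. LINT y|lborel. F x y)"
    and "integrable lborel (\<lambda>y. LINT x|lborel. F x y)"
proof -
  have int: "integrable (lborel \<Otimes>\<^sub>M lborel) (case_prod F)"
  proof (rule integrableI_bounded)
    have "(\<integral>\<^sup>+z. ennreal (norm (case_prod F z)) \<partial>(lborel \<Otimes>\<^sub>M lborel))
        = (\<integral>\<^sup>+x. \<integral>\<^sup>+y. ennreal (norm (F x y)) \<partial>lborel \<partial>lborel)"
      by (subst lborel.nn_integral_fst[symmetric]) auto
    with fin show "(\<integral>\<^sup>+z. ennreal (norm (case_prod F z)) \<partial>(lborel \<Otimes>\<^sub>M lborel)) < \<infinity>" by simp
  qed simp
  show "(LINT y|lborel. LINT x|lborel. F x y) = (LINT x|lborel. LINT y|lborel. F x y)"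
    by (rule lborel_pair.Fubini_integral[OF int])
  show "integrable lborel (\<lambda>x. LINT y|lborel. F x y)"
    by (rule lborel_pair.integrable_fst[OF int])
  show "integrable lborel (\<lambda>y. LINT x|lborel. F x y)"
    by (rule lborel_pair.integrable_snd[OF int])
qed

lemma lborel_swap_bounded_kernel:
  fixes f g :: "real \<Rightarrow> complex"
  assumes [measurable]: "case_prod K \<in> borel_measurable (lborel \<Otimes>\<^sub>M lborel)"
    and K: "\<And>x y. norm (K x y) \<le> C"
    and f: "integrable lborel f" and g: "integrable lborel g"
  shows "(LINT y|lborel. (LINT x|lborel. K x y * f x) * g y)
       = (LINT x|lborel. f x * (LINT y|lborel. K x y * g y))"
proof -
  have [measurable]: "f \<in> borel_measurable borel" "g \<in> borel_measurable borel"
    using f g by (auto dest: borel_measurable_integrable)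
  have C: "0 \<le> C" using K[of 0 0] norm_ge_zero order_trans by blast
  define F where "F x y = K x y * f x * g y" for x y
  have "(\<integral>\<^sup>+x. \<integral>\<^sup>+y. ennreal (norm (F x y)) \<partial>lborel \<partial>lborel)
      \<le> (\<integral>\<^sup>+x. \<integral>\<^sup>+y. ennreal C * (ennreal (norm (f x)) * ennreal (norm (g y))) \<partial>lborel \<partial>lborel)"
    unfolding F_def by (intro nn_integral_mono)
      (auto simp: norm_mult mult.assoc C intro!: ennreal_leI mult_right_mono K simp flip: ennreal_mult')
  also have "\<dots> = ennreal C * ((\<integral>\<^sup>+x. ennreal (norm (f x)) \<partial>lborel) * (\<integral>\<^sup>+y. ennreal (norm (g y)) \<partial>lborel))"
    by (simp add: nn_integral_cmult nn_integral_multc)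
  also have "\<dots> < \<infinity>"
    using f g by (auto simp: integrable_iff_bounded ennreal_mult_less_top)
  finally have fin: "(\<integral>\<^sup>+x. \<integral>\<^sup>+y. ennreal (norm (F x y)) \<partial>lborel \<partial>lborel) < \<infinity>" .
  have [measurable]: "case_prod F \<in> borel_measurable (lborel \<Otimes>\<^sub>M lborel)"
    unfolding F_def by measurable
  have "(LINT y|lborel. (LINT x|lborel. K x y * f x) * g y) = (LINT y|lborel. LINT x|lborel. F x y)"
    unfolding F_def by simp
  also have "\<dots> = (LINT x|lborel. LINT y|lborel. F x y)"
    by (rule lborel_swap_integrals(1)[OF _ fin]) measurable
  also have "\<dots> = (LINT x|lborel. f x * (LINT y|lborel. K x y * g y))"
    unfolding F_def by (simp add: mult.assoc mult.left_commute[of _ "f _"])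
  finally show ?thesis .
qed

lemma lborel_integral_reflect:
  fixes f :: "real \<Rightarrow> complex" shows "(LINT x|lborel. f (- x)) = (LINT x|lborel. f x)"
  using lborel_integral_real_affine[of "-1" f 0] by simp

lemma lborel_integrable_reflect:
  fixes f :: "real \<Rightarrow> 'a :: {banach, second_countable_topology}"
  shows "integrable lborel f \<Longrightarrow> integrable lborel (\<lambda>x. f (- x))"
  using lborel_integrable_real_affine[of f "-1" 0] by simp

lemma AE_lborel_reflect:
  assumes "AE x in lborel. P x" shows "AE x in lborel. P (- x :: real)"
proof -
  obtain N where N: "N \<in> null_sets lborel" "{x. \<not> P x} \<subseteq> N"
    using assms by (auto simp: eventually_ae_filter)
  have [measurable]: "N \<in> sets borel" using N by auto
  have "emeasure lborel (uminus -` N) = (\<integral>\<^sup>+x. indicator N (0 + (-1) * x) \<partial>lborel)"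
    by (subst nn_integral_indicator[symmetric])
      (auto simp: indicator_def intro!: nn_integral_cong measurable_sets_borel[of uminus borel])
  also have "\<dots> = 0"
    using nn_integral_real_affine[of "indicator N" "-1" 0] null_setsD1[OF N(1)] by simp
  finally have "emeasure lborel (uminus -` N) = 0" .
  then have "uminus -` N \<in> null_sets lborel"
    using measurable_sets_borel[of uminus borel N] by (simp add: null_sets_def)
  moreover have "{x. \<not> P (- x)} \<subseteq> uminus -` N" using N(2) by auto
  ultimately show ?thesis unfolding eventually_ae_filter by auto
qed

section \<open>Half-line exponentials and the Poisson kernel\<close>

lemma exp_half_line:
  fixes z :: complex assumes z: "Re z > 0"
  shows "integrable lborel (\<lambda>s. indicator {0..} s * exp (- (z * of_real s)))" (is "integrable _ ?f")
    and "(LINT s|lborel. indicator {0..} s * exp (- (z * of_real s))) = 1 / z"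
proof -
  have real_int: "integrable lborel (\<lambda>s. indicator {0..} s * exp (- (Re z * s)) :: real)"
  proof (rule integrableI_bounded)
    have "(\<integral>\<^sup>+s. ennreal (norm (indicator {0..} s * exp (- (Re z * s)) :: real)) \<partial>lborel)
        = (\<integral>\<^sup>+s. ennreal (exp (- (Re z * s))) * indicator {0..} s \<partial>lborel)"
      by (intro nn_integral_cong) (auto simp: indicator_def)
    also have "\<dots> = ennreal (0 - (- exp (- (Re z * 0)) / Re z))"
    proof (rule nn_integral_FTC_atLeast)
      show "((\<lambda>s. - exp (- (Re z * s)) / Re z) \<longlongrightarrow> 0) at_top"
        using z by real_asymp
    qed (use z in \<open>auto intro!: derivative_eq_intros\<close>)
    finally show "(\<integral>\<^sup>+s. ennreal (norm (indicator {0..} s * exp (- (Re z * s)) :: real)) \<partial>lborel) < \<infinity>"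
      by simp
  qed simp
  show int: "integrable lborel ?f"
    by (rule Bochner_Integration.integrable_bound[OF real_int]) (auto simp: norm_mult indicator_def)
  have "(\<lambda>n. LINT s|lborel. indicator {0..real n} s *\<^sub>R exp (- (z * of_real s)))
      \<longlonglongrightarrow> (LINT s|lborel. ?f s)"
  proof (rule integral_dominated_convergence[OF _ _ real_int])
    show "AE s in lborel. (\<lambda>n. indicator {0..real n} s *\<^sub>R exp (- (z * of_real s))) \<longlonglongrightarrow> ?f s"
    proof (rule AE_I2)
      fix s :: real
      obtain N :: nat where N: "s \<le> real N" using real_arch_simple by blast
      have "indicator {0..real n} s *\<^sub>R exp (- (z * of_real s)) = ?f s" if "n \<ge> N" for n
        using N that by (auto simp: indicator_def)
      then show "(\<lambda>n. indicator {0..real n} s *\<^sub>R exp (- (z * of_real s))) \<longlonglongrightarrow> ?f s"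
        by (intro tendsto_eventually eventually_sequentiallyI)
    qed
  qed (auto simp: indicator_def)
  moreover have "(LINT s|lborel. indicator {0..real n} s *\<^sub>R exp (- (z * of_real s)))
      = - exp (- (z * of_real (real n))) / z - (- exp (- (z * of_real 0)) / z)" for n
  proof (rule integral_FTC_Icc)
    fix s :: real
    show "((\<lambda>s. - exp (- (z * of_real s)) / z) has_vector_derivative exp (- (z * of_real s)))
      (at s within {0..real n})"
      using z by (auto intro!: derivative_eq_intros has_vector_derivative_real_field)
  qed (auto intro!: continuous_intros)
  moreover have "(\<lambda>n. - exp (- (z * of_real (real n))) / z - (- exp (- (z * of_real 0)) / z)) \<longlonglongrightarrow> 0 / z - (- 1 / z)"
  proof -
    have "(\<lambda>n. norm (exp (- (z * of_real (real n))))) \<longlonglongrightarrow> 0"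
      using z by (simp add: norm_exp) real_asymp
    then have "(\<lambda>n. exp (- (z * of_real (real n)))) \<longlonglongrightarrow> 0" by (rule tendsto_norm_zero_cancel)
    from tendsto_minus[OF this] have "(\<lambda>n. - exp (- (z * of_real (real n)))) \<longlonglongrightarrow> 0" by simp
    then show ?thesis using z by (intro tendsto_intros) auto
  qed
  ultimately have "(LINT s|lborel. ?f s) = 0 / z - (- 1 / z)"
    using LIMSEQ_unique by auto
  then show "(LINT s|lborel. ?f s) = 1 / z" by simp
qed

text \<open>The Poisson kernel of the half plane, scaled to total mass 2 pi, so that it is exactly
  the transform of exp (- e \<bar>\<xi>\<bar>) in the unnormalized convention.\<close>

definition poisson_kernel :: "real \<Rightarrow> real \<Rightarrow> real" where
  "poisson_kernel e t = 2 * e / (e\<^sup>2 + t\<^sup>2)"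

lemma poisson_kernel_measurable [measurable]: "poisson_kernel e \<in> borel_measurable borel"
  unfolding poisson_kernel_def by measurable

lemma poisson_kernel_nonneg: "e > 0 \<Longrightarrow> 0 \<le> poisson_kernel e t"
  by (simp add: poisson_kernel_def)

text \<open>The two half lines overlap at \<xi> = 0, where the right-hand side counts the value
  twice; hence the equality holds almost everywhere only.\<close>

lemma exp_abs_split:
  "AE \<xi> in lborel. cis (t * \<xi>) * of_real (exp (- e * \<bar>\<xi>\<bar>))
    = indicator {0..} \<xi> * exp (- (Complex e (- t) * of_real \<xi>))
    + indicator {0..} (- \<xi>) * exp (- (Complex e t * of_real (- \<xi>)))"
proof -
  have "AE \<xi> in lborel. \<xi> \<noteq> (0::real)" by (rule AE_lborel_singleton)
  then show ?thesis
    by eventually_elim (auto simp: indicator_def complex_eq_iff Re_exp Im_exp mult.commute)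
qed

lemma exp_abs_integrable:
  fixes e :: real assumes "e > 0" shows "integrable lborel (\<lambda>\<xi>. exp (- e * \<bar>\<xi>\<bar>))"
proof -
  have "integrable lborel (\<lambda>\<xi>. cis (0 * \<xi>) * of_real (exp (- e * \<bar>\<xi>\<bar>)))"
    using Bochner_Integration.integrable_add[OF exp_half_line(1)[of "Complex e (-0)"]
        lborel_integrable_reflect[OF exp_half_line(1)[of "Complex e 0"]]] assms
    by (subst integrable_cong_AE[OF _ _ exp_abs_split]) auto
  then show ?thesis by (simp add: complex_of_real_integrable_eq)
qed

lemma poisson_kernel_fourier:
  assumes "e > 0"
  shows "(LINT \<xi>|lborel. cis (t * \<xi>) * of_real (exp (- e * \<bar>\<xi>\<bar>))) = of_real (poisson_kernel e t)"
proof -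
  let ?a = "Complex e (- t)" and ?b = "Complex e t"
  have "(LINT \<xi>|lborel. cis (t * \<xi>) * of_real (exp (- e * \<bar>\<xi>\<bar>)))
      = (LINT \<xi>|lborel. indicator {0..} \<xi> * exp (- (?a * of_real \<xi>))
        + indicator {0..} (- \<xi>) * exp (- (?b * of_real (- \<xi>))))"
    by (intro integral_cong_AE exp_abs_split) measurable
  also have "\<dots> = (LINT \<xi>|lborel. indicator {0..} \<xi> * exp (- (?a * of_real \<xi>)))
      + (LINT \<xi>|lborel. indicator {0..} (- \<xi>) * exp (- (?b * of_real (- \<xi>))))"
    using assms by (intro Bochner_Integration.integral_add exp_half_line(1)
        lborel_integrable_reflect[OF exp_half_line(1)[of ?b]]) auto
  also have "\<dots> = 1 / ?a + 1 / ?b"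
    using assms lborel_integral_reflect[of "\<lambda>\<xi>. indicator {0..} \<xi> * exp (- (?b * of_real \<xi>))"]
    by (simp add: exp_half_line(2))
  also have "\<dots> = of_real (poisson_kernel e t)"
    using assms by (simp add: complex_eq_iff poisson_kernel_def Re_divide Im_divide power2_eq_square
        add_nonneg_eq_0_iff)
  finally show ?thesis .
qed

lemma poisson_kernel_total:
  assumes e: "e > 0"
  shows "(\<integral>\<^sup>+y. ennreal (poisson_kernel e (x - y)) \<partial>lborel) = ennreal (2 * pi)"
proof -
  have half: "(\<integral>\<^sup>+t. ennreal (poisson_kernel e t) * indicator {0..} t \<partial>lborel) = ennreal pi"
  proof -
    have "(\<integral>\<^sup>+t. ennreal (poisson_kernel e t) * indicator {0..} t \<partial>lborel)
        = ennreal (pi - 2 * arctan (0 / e))"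
    proof (rule nn_integral_FTC_atLeast)
      show "((\<lambda>t. 2 * arctan (t / e)) \<longlongrightarrow> pi) at_top" using e by real_asymp
      show "((\<lambda>t. 2 * arctan (t / e)) has_real_derivative poisson_kernel e t) (at t)" for t
        using e by (auto intro!: derivative_eq_intros
            simp: poisson_kernel_def field_simps power2_eq_square)
    qed (auto intro: poisson_kernel_nonneg e)
    then show ?thesis by simp
  qed
  have "(\<integral>\<^sup>+t. ennreal (poisson_kernel e t) \<partial>lborel)
      = (\<integral>\<^sup>+t. ennreal (poisson_kernel e t) * indicator {0..} t
         + ennreal (poisson_kernel e (-t)) * indicator {0..} (-t) \<partial>lborel)"
    using AE_lborel_singleton[of "0::real"]
    by (intro nn_integral_cong_AE) (auto elim!: eventually_mono simp: indicator_def poisson_kernel_def)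
  also have "\<dots> = ennreal pi + (\<integral>\<^sup>+t. ennreal (poisson_kernel e (-t)) * indicator {0..} (-t) \<partial>lborel)"
    by (subst nn_integral_add) (auto simp: half)
  also have "(\<integral>\<^sup>+t. ennreal (poisson_kernel e (-t)) * indicator {0..} (-t) \<partial>lborel) = ennreal pi"
    using nn_integral_real_affine[of "\<lambda>t. ennreal (poisson_kernel e t) * indicator {0..} t" "-1" 0]
    by (simp add: half)
  finally have total: "(\<integral>\<^sup>+t. ennreal (poisson_kernel e t) \<partial>lborel) = ennreal (2 * pi)"
    by (simp flip: ennreal_plus)
  show ?thesis
    using nn_integral_real_affine[of "\<lambda>t. ennreal (poisson_kernel e t)" "-1" x] total by simp
qed

text \<open>As e tends to 0 the difference of arctangents tends to 2 pi times the indicator of the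
  interval, off the endpoints. This is how an indicator is recovered in the inversion
  theorem.\<close>

lemma poisson_kernel_interval:
  assumes e: "e > 0" and ab: "a \<le> b"
  shows "(LINT y|lborel. of_real (poisson_kernel e (x - y)) * indicator {a..b} y)
     = complex_of_real (2 * arctan ((b - x) / e) - 2 * arctan ((a - x) / e))"
proof -
  have "(LINT y|lborel. poisson_kernel e (x - y) * indicator {a..b} y)
      = 2 * arctan ((b - x) / e) - 2 * arctan ((a - x) / e)"
  proof (rule integral_FTC_Icc_real[OF ab])
    fix y
    show "((\<lambda>y. 2 * arctan ((y - x) / e)) has_real_derivative poisson_kernel e (x - y)) (at y)"
      using e by (auto intro!: derivative_eq_intros
            simp: poisson_kernel_def field_simps power2_eq_square)
    show "isCont (\<lambda>y. poisson_kernel e (x - y)) y"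
      unfolding poisson_kernel_def using e
      by (intro continuous_intros) (auto simp: add_nonneg_eq_0_iff)
  qed
  moreover have "(LINT y|lborel. of_real (poisson_kernel e (x - y)) * indicator {a..b} y)
     = complex_of_real (LINT y|lborel. poisson_kernel e (x - y) * indicator {a..b} y)"
    by (subst integral_complex_of_real[symmetric])
      (auto intro!: Bochner_Integration.integral_cong simp: indicator_def)
  ultimately show ?thesis by simp
qed

text \<open>Compact intervals are stable under intersection and generate the Borel sets, so the
  vanishing integrals extend to every Borel set. Restricting to [-N, N] makes f integrable, which
  \<open>L2\<close> alone does not.\<close>

lemma AE_zero_if_interval_integrals_zero:
  fixes f :: "real \<Rightarrow> complex"
  assumes f: "f \<in> L2" and zero: "\<And>a b. a \<le> b \<Longrightarrow> (LINT x|lborel. indicator {a..b} x * f x) = 0"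
  shows "AE x in lborel. f x = 0"
proof -
  have ind_L2: "(indicator A :: real \<Rightarrow> complex) \<in> L2"
    if [measurable]: "A \<in> sets borel" and "A \<subseteq> {a..b}" for A a b
  proof (rule L2_dominated[of _ "indicator {a..b}" 1])
    have "integrable lborel (\<lambda>x. indicator {a..b} x :: real)"
      by (intro integrable_real_indicator) (auto simp: emeasure_lborel_Icc_eq)
    then show "(indicator {a..b} :: real \<Rightarrow> complex) \<in> L2"
      by (intro L2I) (auto simp: indicator_def elim!: Bochner_Integration.integrable_cong[THEN iffD1, rotated 2])
  qed (use that in \<open>auto simp: indicator_def intro!: AE_I2\<close>)
  have "AE x in lborel. indicator {-real N..real N} x * f x = 0" for N :: nat
  proof (rule sigma_finite_measure.density_zero[OF lborel.sigma_finite_measure_axioms])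
    let ?I = "{-real N..real N}"
    let ?g = "\<lambda>x. indicator ?I x * f x"
    show int: "integrable lborel ?g" by (intro L2_mult_integrable ind_L2 f) auto
    fix A :: "real set" assume "A \<in> sets lborel"
    have "Int_stable (range (\<lambda>(a,b). {a..b::real}))" by (auto simp: Int_stable_def)
    moreover have "range (\<lambda>(a,b). {a..b::real}) \<subseteq> Pow UNIV" by simp
    moreover have "A \<in> sigma_sets UNIV (range (\<lambda>(a,b). {a..b::real}))"
      using \<open>A \<in> sets lborel\<close> by (simp add: borel_eq_atLeastAtMost)
    ultimately show "set_lebesgue_integral lborel A ?g = 0"
    proof (induction rule: sigma_sets_induct_disjoint)
      case (basic A)
      then obtain a b where A: "A = {a..b}" by auto
      have "set_lebesgue_integral lborel A ?g
          = (LINT x|lborel. indicator {max a (-real N)..min b (real N)} x * f x)"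
        unfolding set_lebesgue_integral_def A
        by (intro Bochner_Integration.integral_cong) (auto simp: indicator_def)
      also have "\<dots> = 0"
        by (cases "max a (-real N) \<le> min b (real N)") (use zero in auto)
      finally show ?case .
    next
      case empty then show ?case by (simp add: set_lebesgue_integral_def)
    next
      case (compl A)
      then have [measurable]: "A \<in> sets lborel" by (simp add: borel_eq_atLeastAtMost)
      have "set_lebesgue_integral lborel (UNIV - A) ?g + set_lebesgue_integral lborel A ?g
          = (LINT x|lborel. ?g x)"
        unfolding set_lebesgue_integral_def
      proof (subst Bochner_Integration.integral_add[symmetric])
        show "integrable lborel (\<lambda>x. indicator (UNIV - A) x *\<^sub>R ?g x)"
          "integrable lborel (\<lambda>x. indicator A x *\<^sub>R ?g x)"
          by (intro integrable_mult_indicator int; measurable)+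
      qed (auto intro!: Bochner_Integration.integral_cong simp: indicator_def)
      moreover have "(LINT x|lborel. ?g x) = 0" by (rule zero) simp
      ultimately show ?case using compl by simp
    next
      case (union A)
      then have Am [measurable]: "A i \<in> sets lborel" for i
        by (auto simp: borel_eq_atLeastAtMost)
      have "set_lebesgue_integral lborel (\<Union>i. A i) ?g = (\<Sum>i. set_lebesgue_integral lborel (A i) ?g)"
      proof (rule lebesgue_integral_countable_add)
        show "set_integrable lborel (\<Union>i. A i) ?g"
          unfolding set_integrable_def by (intro integrable_mult_indicator int) measurable
      qed (use union Am in \<open>auto simp: disjoint_family_on_def\<close>)
      then show ?case using union by simp
    qed
  qed
  then have "AE x in lborel. \<forall>N::nat. indicator {-real N..real N} x * f x = 0"
    unfolding AE_all_countable by (rule allI)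
  then show ?thesis
  proof eventually_elim
    case (elim x)
    obtain N :: nat where "\<bar>x\<bar> \<le> real N" using real_arch_simple by blast
    then have "x \<in> {-real N..real N}" by auto
    with elim[rule_format, of N] show ?case by simp
  qed
qed

lemma norm_lborel_integral_le:
  fixes f :: "real \<Rightarrow> complex"
  shows "ennreal (norm (LINT x|lborel. f x)) \<le> (\<integral>\<^sup>+x. ennreal (norm (f x)) \<partial>lborel)"
  by (cases "integrable lborel f") (auto simp: integral_norm_bound_ennreal not_integrable_integral_eq)

section \<open>The Fourier integral of integrable functions\<close>

definition FT :: "(real \<Rightarrow> complex) \<Rightarrow> real \<Rightarrow> complex" where
  "FT f \<xi> = (LINT x|lborel. cis (- (x * \<xi>)) * f x)"

lemma FT_measurable [measurable]:
  assumes [measurable]: "f \<in> borel_measurable borel"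
  shows "FT f \<in> borel_measurable borel"
  unfolding FT_def by measurable

lemma cis_mult_integrable:
  fixes f :: "real \<Rightarrow> complex"
  assumes "integrable lborel f" and [measurable]: "b \<in> borel_measurable borel"
  shows "integrable lborel (\<lambda>x. cis (b x) * f x)"
  by (rule Bochner_Integration.integrable_bound[OF assms(1)])
    (use borel_measurable_integrable[OF assms(1)] in \<open>auto simp: norm_mult\<close>)

lemma FT_bound: "norm (FT f \<xi>) \<le> (LINT x|lborel. norm (f x))"
  unfolding FT_def by (rule order_trans[OF integral_norm_bound]) (simp add: norm_mult)

lemma FT_diff:
  assumes "integrable lborel f" "integrable lborel g"
  shows "FT (\<lambda>x. f x - g x) \<xi> = FT f \<xi> - FT g \<xi>"
  unfolding FT_def using assms by (simp add: right_diff_distrib cis_mult_integrable)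

lemma FT_mult_formula:
  assumes "integrable lborel f" "integrable lborel g"
  shows "(LINT \<xi>|lborel. FT f \<xi> * g \<xi>) = (LINT x|lborel. f x * FT g x)"
proof -
  have "(LINT \<xi>|lborel. (LINT x|lborel. cis (- (x * \<xi>)) * f x) * g \<xi>)
      = (LINT x|lborel. f x * (LINT \<xi>|lborel. cis (- (x * \<xi>)) * g \<xi>))"
    by (rule lborel_swap_bounded_kernel[where C=1]) (use assms in auto)
  then show ?thesis by (simp add: FT_def mult.commute[of _ "_::real"])
qed

lemma FT_cnj: "cnj (FT f \<xi>) = FT (\<lambda>x. cnj (f x)) (- \<xi>)"
  unfolding FT_def by (simp add: cis_cnj flip: Bochner_Integration.integral_cnj)

text \<open>The multiplication formula moves the transform from f onto cis (x \<xi>) exp (- e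
  \<bar>\<xi>\<bar>), whose transform at y is the Poisson kernel at x - y. This is Abel-regularized
  inversion.\<close>

lemma FT_poisson:
  assumes e: "e > 0" and f: "integrable lborel f"
  shows "(LINT \<xi>|lborel. cis (x * \<xi>) * (of_real (exp (- e * \<bar>\<xi>\<bar>)) * FT f \<xi>))
    = (LINT y|lborel. of_real (poisson_kernel e (x - y)) * f y)"
proof -
  let ?g = "\<lambda>\<xi>. cis (x * \<xi>) * complex_of_real (exp (- e * \<bar>\<xi>\<bar>))"
  have g: "integrable lborel ?g"
    using exp_abs_integrable[OF e] by (intro cis_mult_integrable) auto
  have "FT ?g y = of_real (poisson_kernel e (x - y))" for y
    using poisson_kernel_fourier[OF e, of "x - y"]
    by (simp add: FT_def cis_mult left_diff_distrib algebra_simps flip: mult.assoc)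
  then show ?thesis
    using FT_mult_formula[OF f g] by (simp add: mult.commute mult.left_commute)
qed

lemma exp_weighted_FT_integrable:
  assumes e: "e > 0" and f: "integrable lborel f"
  shows "integrable lborel (\<lambda>\<xi>. of_real (exp (- e * \<bar>\<xi>\<bar>)) * FT f \<xi>)"
proof (rule Bochner_Integration.integrable_bound)
  show "integrable lborel (\<lambda>\<xi>. exp (- e * \<bar>\<xi>\<bar>) * (LINT x|lborel. norm (f x)))"
    using exp_abs_integrable[OF e] by simp
  show "AE \<xi> in lborel. norm (of_real (exp (- e * \<bar>\<xi>\<bar>)) * FT f \<xi>)
      \<le> norm (exp (- e * \<bar>\<xi>\<bar>) * (LINT x|lborel. norm (f x)))"
    by (auto simp: norm_mult intro!: mult_left_mono order_trans[OF FT_bound])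
qed (use borel_measurable_integrable[OF f] in measurable)

text \<open>Schur's test: |f x| |f y| is at most the mean of the two squares, and in each half the
  free variable of the symmetric kernel integrates to 2 pi.\<close>

lemma poisson_quadratic_bound:
  assumes e: "e > 0" and f: "f \<in> L2"
  shows "(\<integral>\<^sup>+x. ennreal (norm (f x)) * (\<integral>\<^sup>+y. ennreal (poisson_kernel e (x - y)) * ennreal (norm (f y)) \<partial>lborel) \<partial>lborel)
    \<le> ennreal (2 * pi * (L2_norm f)\<^sup>2)"
proof -
  have [measurable]: "f \<in> borel_measurable borel" using f by auto
  have sym: "poisson_kernel e (x - y) = poisson_kernel e (y - x)" for x y
    by (simp add: poisson_kernel_def power2_commute)
  have amgm: "ennreal (norm a) * ennreal (norm b) \<le> ennreal ((norm a)\<^sup>2 / 2) + ennreal ((norm b)\<^sup>2 / 2)"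
    for a b :: complex
    using sum_squares_bound[of "norm a" "norm b"]
    by (simp flip: ennreal_mult' ennreal_plus)
  let ?P = "\<lambda>x y. ennreal (poisson_kernel e (x - y))"
  let ?N = "\<lambda>x. ennreal ((norm (f x))\<^sup>2 / 2)"
  have half: "(\<integral>\<^sup>+x. ?N x \<partial>lborel) = ennreal ((L2_norm f)\<^sup>2 / 2)"
  proof -
    have "(\<integral>\<^sup>+x. ?N x \<partial>lborel) = (\<integral>\<^sup>+x. ennreal (1/2) * ennreal ((norm (f x))\<^sup>2) \<partial>lborel)"
      by (subst ennreal_mult'[symmetric]) auto
    also have "\<dots> = ennreal (1/2) * ennreal ((L2_norm f)\<^sup>2)"
      by (subst nn_integral_cmult) (auto simp only: nn_integral_L2[OF f] intro!: measurable_compose[OF _ measurable_ennreal], measurable)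
    also have "\<dots> = ennreal ((L2_norm f)\<^sup>2 / 2)"
      by (subst ennreal_mult'[symmetric]) auto
    finally show ?thesis .
  qed
  have "(\<integral>\<^sup>+x. ennreal (norm (f x)) * (\<integral>\<^sup>+y. ?P x y * ennreal (norm (f y)) \<partial>lborel) \<partial>lborel)
      = (\<integral>\<^sup>+x. \<integral>\<^sup>+y. ?P x y * (ennreal (norm (f x)) * ennreal (norm (f y))) \<partial>lborel \<partial>lborel)"
    by (simp add: mult.left_commute flip: nn_integral_cmult)
  also have "\<dots> \<le> (\<integral>\<^sup>+x. \<integral>\<^sup>+y. ?P x y * (?N x + ?N y) \<partial>lborel \<partial>lborel)"
    by (intro nn_integral_mono mult_left_mono amgm) auto
  also have "\<dots> = (\<integral>\<^sup>+x. (\<integral>\<^sup>+y. ?N x * ?P x y \<partial>lborel) + (\<integral>\<^sup>+y. ?N y * ?P x y \<partial>lborel) \<partial>lborel)"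
    by (intro nn_integral_cong) (subst nn_integral_add[symmetric]; simp add: distrib_left mult.commute)
  also have "\<dots> = (\<integral>\<^sup>+x. \<integral>\<^sup>+y. ?N x * ?P x y \<partial>lborel \<partial>lborel) + (\<integral>\<^sup>+x. \<integral>\<^sup>+y. ?N y * ?P x y \<partial>lborel \<partial>lborel)"
    by (rule nn_integral_add) measurable
  also have "(\<integral>\<^sup>+x. \<integral>\<^sup>+y. ?N y * ?P x y \<partial>lborel \<partial>lborel) = (\<integral>\<^sup>+y. \<integral>\<^sup>+x. ?N y * ?P x y \<partial>lborel \<partial>lborel)"
    by (rule lborel_pair.Fubini'[symmetric]) measurable
  also have "(\<integral>\<^sup>+y. \<integral>\<^sup>+x. ?N y * ?P x y \<partial>lborel \<partial>lborel) = (\<integral>\<^sup>+x. \<integral>\<^sup>+y. ?N x * ?P x y \<partial>lborel \<partial>lborel)"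
    by (subst sym) simp
  also have "(\<integral>\<^sup>+x. \<integral>\<^sup>+y. ?N x * ?P x y \<partial>lborel \<partial>lborel) = ennreal ((L2_norm f)\<^sup>2 / 2) * ennreal (2 * pi)"
    by (simp add: nn_integral_cmult poisson_kernel_total[OF e] nn_integral_multc half)
  also have "\<dots> + \<dots> = ennreal (2 * pi * (L2_norm f)\<^sup>2)"
    by (simp add: field_simps flip: ennreal_mult' ennreal_plus)
  finally show ?thesis .
qed

text \<open>With the weight exp (- e \<bar>\<xi>\<bar>) inserted, the squared norm of the transform
  becomes the quadratic form of the Poisson kernel in f, bounded uniformly in e; Fatou's lemma
  removes the weight. Equality comes only later, from inversion.\<close>

lemma FT_L2_bound:
  assumes f: "f \<in> L2" and int: "integrable lborel f"
  shows "FT f \<in> L2" "L2_norm (FT f) \<le> sqrt (2 * pi) * L2_norm f"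
proof -
  have [measurable]: "f \<in> borel_measurable borel" using f by auto
  have bound: "(\<integral>\<^sup>+\<xi>. ennreal (exp (- e * \<bar>\<xi>\<bar>) * (norm (FT f \<xi>))\<^sup>2) \<partial>lborel)
      \<le> ennreal (2 * pi * (L2_norm f)\<^sup>2)" if e: "e > 0" for e :: real
  proof -
    let ?g = "\<lambda>\<xi>. of_real (exp (- e * \<bar>\<xi>\<bar>)) * cnj (FT f \<xi>)"
    have "integrable lborel (\<lambda>\<xi>. cnj (of_real (exp (- e * \<bar>\<xi>\<bar>)) * FT f \<xi>))"
      using exp_weighted_FT_integrable[OF e int] by (subst complex_integrable_cnj)
    then have g: "integrable lborel ?g" by simp
    have FTg: "FT ?g x = cnj (LINT y|lborel. of_real (poisson_kernel e (x - y)) * f y)" for x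
      unfolding FT_poisson[OF e int, of x, symmetric] FT_def[of ?g]
      by (simp add: cis_cnj mult.commute[of x] flip: Bochner_Integration.integral_cnj)
    have int2: "integrable lborel (\<lambda>\<xi>. FT f \<xi> * ?g \<xi>)"
      by (rule Bochner_Integration.integrable_bound[OF
            integrable_mult_right[OF g, of "of_real (LINT x|lborel. norm (f x))"]])
        (use borel_measurable_integrable[OF g] in
          \<open>auto simp: norm_mult intro!: mult_right_mono order_trans[OF FT_bound]\<close>)
    have eq: "FT f \<xi> * ?g \<xi> = of_real (exp (- e * \<bar>\<xi>\<bar>) * (norm (FT f \<xi>))\<^sup>2)" for \<xi>
      by (simp only: of_real_mult complex_norm_square mult_ac)
    have "integrable lborel (\<lambda>\<xi>. exp (- e * \<bar>\<xi>\<bar>) * (norm (FT f \<xi>))\<^sup>2)"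
      using int2 unfolding eq complex_of_real_integrable_eq .
    then have "(\<integral>\<^sup>+\<xi>. ennreal (exp (- e * \<bar>\<xi>\<bar>) * (norm (FT f \<xi>))\<^sup>2) \<partial>lborel)
        = ennreal (LINT \<xi>|lborel. exp (- e * \<bar>\<xi>\<bar>) * (norm (FT f \<xi>))\<^sup>2)"
      by (rule nn_integral_eq_integral) auto
    also have "\<dots> = ennreal (Re (LINT \<xi>|lborel. FT f \<xi> * ?g \<xi>))"
      unfolding eq integral_complex_of_real by simp
    also have "\<dots> \<le> ennreal (norm (LINT \<xi>|lborel. FT f \<xi> * ?g \<xi>))"
      by (intro ennreal_leI complex_Re_le_cmod)
    also have "(LINT \<xi>|lborel. FT f \<xi> * ?g \<xi>)
        = (LINT x|lborel. f x * cnj (LINT y|lborel. of_real (poisson_kernel e (x - y)) * f y))"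
      by (simp only: FT_mult_formula[OF int g] FTg)
    also have "ennreal (norm \<dots>)
        \<le> (\<integral>\<^sup>+x. ennreal (norm (f x)) * ennreal (norm (LINT y|lborel. of_real (poisson_kernel e (x - y)) * f y)) \<partial>lborel)"
      by (rule order_trans[OF norm_lborel_integral_le]) (simp add: norm_mult ennreal_mult')
    also have "\<dots> \<le> (\<integral>\<^sup>+x. ennreal (norm (f x)) * (\<integral>\<^sup>+y. ennreal (poisson_kernel e (x - y)) * ennreal (norm (f y)) \<partial>lborel) \<partial>lborel)"
      by (intro nn_integral_mono mult_left_mono order_trans[OF norm_lborel_integral_le])
        (auto simp: norm_mult ennreal_mult' poisson_kernel_nonneg[OF e] intro!: nn_integral_mono)
    also have "\<dots> \<le> ennreal (2 * pi * (L2_norm f)\<^sup>2)" by (rule poisson_quadratic_bound[OF e f])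
    finally show ?thesis .
  qed
  have "(\<integral>\<^sup>+\<xi>. ennreal ((norm (FT f \<xi>))\<^sup>2) \<partial>lborel)
      = (\<integral>\<^sup>+\<xi>. liminf (\<lambda>n. ennreal (exp (- (1 / real (Suc n)) * \<bar>\<xi>\<bar>) * (norm (FT f \<xi>))\<^sup>2)) \<partial>lborel)"
  proof (rule nn_integral_cong, rule lim_imp_Liminf[symmetric])
    fix \<xi> :: real
    have "(\<lambda>n. exp (- (1 / real (Suc n)) * \<bar>\<xi>\<bar>)) \<longlonglongrightarrow> 1" by real_asymp
    then have "(\<lambda>n. exp (- (1 / real (Suc n)) * \<bar>\<xi>\<bar>) * (norm (FT f \<xi>))\<^sup>2) \<longlonglongrightarrow> 1 * (norm (FT f \<xi>))\<^sup>2"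
      by (intro tendsto_mult tendsto_const)
    then show "(\<lambda>n. ennreal (exp (- (1 / real (Suc n)) * \<bar>\<xi>\<bar>) * (norm (FT f \<xi>))\<^sup>2))
        \<longlonglongrightarrow> ennreal ((norm (FT f \<xi>))\<^sup>2)" by (intro tendsto_ennrealI) simp
  qed simp
  also have "\<dots> \<le> liminf (\<lambda>n. \<integral>\<^sup>+\<xi>. ennreal (exp (- (1 / real (Suc n)) * \<bar>\<xi>\<bar>) * (norm (FT f \<xi>))\<^sup>2) \<partial>lborel)"
    by (rule nn_integral_liminf) measurable
  also have "\<dots> \<le> liminf (\<lambda>n::nat. ennreal (2 * pi * (L2_norm f)\<^sup>2))"
    by (intro Liminf_mono always_eventually allI bound) auto
  also have "\<dots> = ennreal (2 * pi * (L2_norm f)\<^sup>2)" by (simp add: Liminf_const)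
  finally have le: "(\<integral>\<^sup>+\<xi>. ennreal ((norm (FT f \<xi>))\<^sup>2) \<partial>lborel) \<le> ennreal (2 * pi * (L2_norm f)\<^sup>2)" .
  then show L2: "FT f \<in> L2" by (subst L2_iff_nn) (auto intro: le_less_trans)
  have "(L2_norm (FT f))\<^sup>2 \<le> 2 * pi * (L2_norm f)\<^sup>2"
    using le unfolding nn_integral_L2[OF L2] by (subst (asm) ennreal_le_iff) auto
  then have "(L2_norm (FT f))\<^sup>2 \<le> (sqrt (2 * pi) * L2_norm f)\<^sup>2"
    by (simp add: power_mult_distrib)
  then show "L2_norm (FT f) \<le> sqrt (2 * pi) * L2_norm f"
    by (rule power2_le_imp_le) simp
qed

section \<open>The Fourier--Plancherel transform\<close>

definition trunc :: "nat \<Rightarrow> (real \<Rightarrow> complex) \<Rightarrow> real \<Rightarrow> complex" where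
  "trunc N f x = indicator {- real N..real N} x * f x"

lemma trunc_L2: "f \<in> L2 \<Longrightarrow> trunc N f \<in> L2"
  unfolding trunc_def by (rule L2_indicator) auto

lemma interval_indicator_L2: "(indicator {a..b} :: real \<Rightarrow> complex) \<in> L2"
proof (rule L2I)
  have "integrable lborel (\<lambda>x. indicator {a..b} x :: real)"
    by (intro integrable_real_indicator) (auto simp: emeasure_lborel_Icc_eq)
  also have "(\<lambda>x. indicator {a..b} x :: real) = (\<lambda>x. (norm (indicator {a..b} x :: complex))\<^sup>2)"
    by (auto simp: indicator_def)
  finally show "integrable lborel (\<lambda>x. (norm (indicator {a..b} x :: complex))\<^sup>2)" .
qed simp

lemma trunc_integrable: "f \<in> L2 \<Longrightarrow> integrable lborel (trunc N f)"
  unfolding trunc_def by (intro L2_mult_integrable interval_indicator_L2)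

lemma trunc_tendsto:
  assumes f: "f \<in> L2" shows "(\<lambda>N. L2_norm (\<lambda>x. trunc N f x - f x)) \<longlonglongrightarrow> 0"
proof -
  have [measurable]: "f \<in> borel_measurable borel" using f by auto
  have "(\<lambda>N. LINT x|lborel. (norm (trunc N f x - f x))\<^sup>2) \<longlonglongrightarrow> (LINT x::real|lborel. 0)"
  proof (rule integral_dominated_convergence[OF _ _ L2_integrable[OF f]])
    show "AE x in lborel. (\<lambda>N. (norm (trunc N f x - f x))\<^sup>2) \<longlonglongrightarrow> 0"
    proof (rule AE_I2)
      fix x
      obtain N :: nat where "\<bar>x\<bar> \<le> real N" using real_arch_simple by blast
      then have "(norm (trunc n f x - f x))\<^sup>2 = 0" if "n \<ge> N" for n
        using that by (auto simp: trunc_def indicator_def)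
      then show "(\<lambda>N. (norm (trunc N f x - f x))\<^sup>2) \<longlonglongrightarrow> 0"
        by (intro tendsto_eventually eventually_sequentiallyI)
    qed
  qed (auto simp: trunc_def indicator_def)
  then show ?thesis unfolding L2_norm_def using tendsto_real_sqrt by fastforce
qed

definition L2_lim :: "(nat \<Rightarrow> real \<Rightarrow> complex) \<Rightarrow> (real \<Rightarrow> complex) \<Rightarrow> bool" where
  "L2_lim X f \<longleftrightarrow> (\<lambda>n. L2_norm (\<lambda>x. X n x - f x)) \<longlonglongrightarrow> 0"

lemma FT_add:
  assumes "integrable lborel f" "integrable lborel g"
  shows "FT (\<lambda>x. f x + g x) \<xi> = FT f \<xi> + FT g \<xi>"
  unfolding FT_def using assms by (simp add: distrib_left cis_mult_integrable)

lemma L2_norm_squeeze: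
  assumes "\<And>n. L2_norm (Y n) \<le> B n" "B \<longlonglongrightarrow> 0"
  shows "(\<lambda>n. L2_norm (Y n)) \<longlonglongrightarrow> 0"
  by (rule tendsto_sandwich[of "\<lambda>_. 0" _ _ B]) (use assms in auto)

lemma L2_lim_dominated:
  assumes "L2_lim X f" "\<And>n. L2_norm (\<lambda>x. Y n x - g x) \<le> C * L2_norm (\<lambda>x. X n x - f x)"
  shows "L2_lim Y g"
proof -
  have "(\<lambda>n. C * L2_norm (\<lambda>x. X n x - f x)) \<longlonglongrightarrow> C * 0"
    using assms(1) unfolding L2_lim_def by (intro tendsto_intros)
  then have "(\<lambda>n. C * L2_norm (\<lambda>x. X n x - f x)) \<longlonglongrightarrow> 0" by simp
  then show ?thesis unfolding L2_lim_def
    by (rule Lim_null_comparison[rotated]) (use assms(2) in auto)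
qed

lemma L2_lim_unique:
  assumes X: "\<And>n. X n \<in> L2" and f: "f \<in> L2" and g: "g \<in> L2" and lim: "L2_lim X f" "L2_lim X g"
  shows "AE x in lborel. f x = g x"
proof -
  have "L2_norm (\<lambda>x. f x - g x) \<le> L2_norm (\<lambda>x. X n x - f x) + L2_norm (\<lambda>x. X n x - g x)" for n
    using L2_norm_triangle3[OF f X[of n] g] L2_norm_minus_commute[of f "X n"] by simp
  moreover have "(\<lambda>n. L2_norm (\<lambda>x. X n x - f x) + L2_norm (\<lambda>x. X n x - g x)) \<longlonglongrightarrow> 0 + 0"
    using lim unfolding L2_lim_def by (intro tendsto_add)
  ultimately have "L2_norm (\<lambda>x. f x - g x) \<le> 0 + 0"
    by (intro LIMSEQ_le_const) auto
  then have "L2_norm (\<lambda>x. f x - g x) = 0" using L2_norm_nonneg[of "\<lambda>x. f x - g x"] by linarith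
  then show ?thesis using L2_norm_eq_0[OF L2_diff[OF f g]] by simp
qed

lemma L2_lim_norm:
  assumes X: "\<And>n. X n \<in> L2" and f: "f \<in> L2" and lim: "L2_lim X f"
  shows "(\<lambda>n. L2_norm (X n)) \<longlonglongrightarrow> L2_norm f"
proof -
  have "\<bar>L2_norm (X n) - L2_norm f\<bar> \<le> L2_norm (\<lambda>x. X n x - f x)" for n
    using L2_norm_triangle[OF L2_diff[OF X[of n] f] f] L2_norm_triangle[OF L2_diff[OF f X[of n]] X[of n]]
      L2_norm_minus_commute[of f "X n"] by (simp add: abs_le_iff)
  then have "(\<lambda>n. \<bar>L2_norm (X n) - L2_norm f\<bar>) \<longlonglongrightarrow> 0"
    by (intro tendsto_sandwich[OF _ _ tendsto_const lim[unfolded L2_lim_def]]) auto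
  then have "(\<lambda>n. L2_norm (X n) - L2_norm f) \<longlonglongrightarrow> 0"
    by (rule tendsto_rabs_zero_cancel)
  then show ?thesis by (simp add: LIM_zero_iff)
qed

lemma L2_lim_mult:
  assumes X: "\<And>n. X n \<in> L2" and Y: "\<And>n. Y n \<in> L2" and f: "f \<in> L2" and g: "g \<in> L2"
    and lim: "L2_lim X f" "L2_lim Y g"
  shows "(\<lambda>n. LINT x|lborel. X n x * Y n x) \<longlonglongrightarrow> (LINT x|lborel. f x * g x)"
proof -
  have norm_cnj: "L2_norm (\<lambda>x. cnj (h x)) = L2_norm h" for h by (simp add: L2_norm_def)
  have mult: "norm (LINT x|lborel. a x * b x) \<le> L2_norm a * L2_norm b" if "a \<in> L2" "b \<in> L2" for a b
    using L2_Cauchy_Schwarz[OF that(1) L2_cnj[OF that(2)]] by (simp add: L2_inner_def norm_cnj)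
  have bound: "norm ((LINT x|lborel. X n x * Y n x) - (LINT x|lborel. f x * g x))
      \<le> L2_norm (\<lambda>x. X n x - f x) * L2_norm (Y n) + L2_norm f * L2_norm (\<lambda>x. Y n x - g x)" for n
  proof -
    have "(LINT x|lborel. X n x * Y n x) - (LINT x|lborel. f x * g x)
        = (LINT x|lborel. (X n x - f x) * Y n x) + (LINT x|lborel. f x * (Y n x - g x))"
      using X Y f g by (simp add: left_diff_distrib right_diff_distrib L2_mult_integrable)
    also have "norm \<dots> \<le> norm (LINT x|lborel. (X n x - f x) * Y n x) + norm (LINT x|lborel. f x * (Y n x - g x))"
      by (rule norm_triangle_ineq)
    also have "\<dots> \<le> L2_norm (\<lambda>x. X n x - f x) * L2_norm (Y n) + L2_norm f * L2_norm (\<lambda>x. Y n x - g x)"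
      by (intro add_mono mult L2_diff X Y f g)
    finally show ?thesis .
  qed
  have "(\<lambda>n. L2_norm (\<lambda>x. X n x - f x) * L2_norm (Y n) + L2_norm f * L2_norm (\<lambda>x. Y n x - g x))
      \<longlonglongrightarrow> 0 * L2_norm g + L2_norm f * 0"
    using lim L2_lim_norm[OF Y g lim(2)] unfolding L2_lim_def by (intro tendsto_intros)
  then have "(\<lambda>n. L2_norm (\<lambda>x. X n x - f x) * L2_norm (Y n) + L2_norm f * L2_norm (\<lambda>x. Y n x - g x))
      \<longlonglongrightarrow> 0" by simp
  then have "(\<lambda>n. (LINT x|lborel. X n x * Y n x) - (LINT x|lborel. f x * g x)) \<longlonglongrightarrow> 0"
    by (rule Lim_null_comparison[rotated]) (use bound in auto)
  then show ?thesis by (simp add: LIM_zero_iff)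
qed

lemma L2_lim_trunc: "f \<in> L2 \<Longrightarrow> L2_lim (\<lambda>N. trunc N f) f"
  unfolding L2_lim_def by (rule trunc_tendsto)

lemma FT_trunc_L2: "f \<in> L2 \<Longrightarrow> FT (trunc N f) \<in> L2"
  by (intro FT_L2_bound trunc_L2 trunc_integrable)

text \<open>By \<open>FT_L2_bound\<close> every truncated transform lies in \<open>L2\<close>, so
  the extended integral in the definition is finite and equals a squared \<open>L2_norm\<close>.
  From here on the extended reals disappear.\<close>

lemma has_fourier_iff:
  "has_fourier f g \<longleftrightarrow> f \<in> L2 \<and> g \<in> L2 \<and> L2_lim (\<lambda>N. FT (trunc N f)) g"
proof (cases "f \<in> L2 \<and> g \<in> L2")
  case True
  have eq: "(LINT x:{- real N..real N}|lborel. cis (- (x * \<xi>)) * f x) = FT (trunc N f) \<xi>" for N \<xi>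
    unfolding set_lebesgue_integral_def FT_def trunc_def
    by (intro Bochner_Integration.integral_cong) (auto simp: indicator_def)
  have nn: "(\<integral>\<^sup>+\<xi>. ennreal ((norm (FT (trunc N f) \<xi> - g \<xi>))\<^sup>2) \<partial>lborel)
      = ennreal ((L2_norm (\<lambda>\<xi>. FT (trunc N f) \<xi> - g \<xi>))\<^sup>2)" for N
    using True by (intro nn_integral_L2 L2_diff FT_trunc_L2) auto
  have "(\<lambda>N. ennreal ((L2_norm (\<lambda>\<xi>. FT (trunc N f) \<xi> - g \<xi>))\<^sup>2)) \<longlonglongrightarrow> 0 \<longleftrightarrow>
      (\<lambda>N. (L2_norm (\<lambda>\<xi>. FT (trunc N f) \<xi> - g \<xi>))\<^sup>2) \<longlonglongrightarrow> 0"
    using tendsto_ennreal_iff[of "\<lambda>N. (L2_norm (\<lambda>\<xi>. FT (trunc N f) \<xi> - g \<xi>))\<^sup>2" sequentially 0] by simp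
  also have "\<dots> \<longleftrightarrow> L2_lim (\<lambda>N. FT (trunc N f)) g"
    unfolding L2_lim_def
    using tendsto_real_sqrt[of "\<lambda>N. (L2_norm (\<lambda>\<xi>. FT (trunc N f) \<xi> - g \<xi>))\<^sup>2" 0 sequentially]
      tendsto_power[of "\<lambda>N. L2_norm (\<lambda>\<xi>. FT (trunc N f) \<xi> - g \<xi>)" 0 sequentially 2] by auto
  finally show ?thesis using True by (simp add: has_fourier_def eq nn)
qed (auto simp: has_fourier_def)

lemma has_fourier_L2: "has_fourier f g \<Longrightarrow> f \<in> L2" "has_fourier f g \<Longrightarrow> g \<in> L2"
  by (auto simp: has_fourier_def)

text \<open>Truncations of f are Cauchy in \<open>L2\<close> and the transform is Lipschitz on them
  by \<open>FT_L2_bound\<close>, so completeness supplies the limit.\<close>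

lemma has_fourier_exists:
  assumes f: "f \<in> L2" obtains g where "has_fourier f g"
proof -
  let ?c = "sqrt (2 * pi)"
  have le: "L2_norm (\<lambda>\<xi>. FT (trunc m f) \<xi> - FT (trunc n f) \<xi>)
      \<le> ?c * (L2_norm (\<lambda>x. trunc m f x - f x) + L2_norm (\<lambda>x. trunc n f x - f x))" for m n
  proof -
    have "L2_norm (\<lambda>\<xi>. FT (trunc m f) \<xi> - FT (trunc n f) \<xi>) = L2_norm (FT (\<lambda>x. trunc m f x - trunc n f x))"
      by (intro arg_cong[where f=L2_norm] ext) (simp add: FT_diff trunc_integrable f)
    also have "\<dots> \<le> ?c * L2_norm (\<lambda>x. trunc m f x - trunc n f x)"
      by (intro FT_L2_bound L2_diff trunc_L2 f Bochner_Integration.integrable_diff trunc_integrable)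
    also have "L2_norm (\<lambda>x. trunc m f x - trunc n f x)
        \<le> L2_norm (\<lambda>x. trunc m f x - f x) + L2_norm (\<lambda>x. trunc n f x - f x)"
      using L2_norm_triangle3[OF trunc_L2[OF f] f trunc_L2[OF f]] L2_norm_minus_commute[of f] by simp
    finally show ?thesis by (simp add: mult_left_mono)
  qed
  obtain g where "g \<in> L2" "(\<lambda>N. L2_norm (\<lambda>\<xi>. FT (trunc N f) \<xi> - g \<xi>)) \<longlonglongrightarrow> 0"
  proof (rule L2_complete[of "\<lambda>N. FT (trunc N f)"])
    fix e :: real assume "e > 0"
    then have "e / (2 * ?c) > 0" by simp
    then obtain N where N: "\<And>n. n \<ge> N \<Longrightarrow> L2_norm (\<lambda>x. trunc n f x - f x) < e / (2 * ?c)"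
      using trunc_tendsto[OF f] unfolding LIMSEQ_iff by fastforce
    have "L2_norm (\<lambda>\<xi>. FT (trunc m f) \<xi> - FT (trunc n f) \<xi>) < e" if "m \<ge> N" "n \<ge> N" for m n
    proof -
      have "?c * (L2_norm (\<lambda>x. trunc m f x - f x) + L2_norm (\<lambda>x. trunc n f x - f x))
          < ?c * (e / (2 * ?c) + e / (2 * ?c))"
        using N that by (intro mult_strict_left_mono add_strict_mono) auto
      also have "\<dots> = e" by (simp add: field_simps)
      finally show ?thesis using le[of m n] by linarith
    qed
    then show "\<exists>N. \<forall>m\<ge>N. \<forall>n\<ge>N. L2_norm (\<lambda>\<xi>. FT (trunc m f) \<xi> - FT (trunc n f) \<xi>) < e" by blast
  qed (use FT_trunc_L2 f in auto)
  then have "has_fourier f g" using f by (simp add: has_fourier_iff L2_lim_def)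
  then show ?thesis by (rule that)
qed

lemma has_fourier_norm_le:
  assumes "has_fourier f g" shows "L2_norm g \<le> sqrt (2 * pi) * L2_norm f"
proof (rule LIMSEQ_le)
  show "(\<lambda>N. L2_norm (FT (trunc N f))) \<longlonglongrightarrow> L2_norm g"
    using assms by (intro L2_lim_norm) (auto simp: has_fourier_iff FT_trunc_L2)
  show "(\<lambda>N. sqrt (2 * pi) * L2_norm (trunc N f)) \<longlonglongrightarrow> sqrt (2 * pi) * L2_norm f"
    using assms by (intro tendsto_intros L2_lim_norm L2_lim_trunc) (auto simp: has_fourier_iff trunc_L2)
  show "\<exists>N. \<forall>n\<ge>N. L2_norm (FT (trunc n f)) \<le> sqrt (2 * pi) * L2_norm (trunc n f)"
    using assms by (auto intro!: FT_L2_bound trunc_L2 trunc_integrable simp: has_fourier_iff)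
qed

lemma has_fourier_cong_AE:
  assumes fg: "has_fourier f g" and "f' \<in> borel_measurable borel" "g' \<in> borel_measurable borel"
    and f: "AE x in lborel. f x = f' x" and g: "AE x in lborel. g x = g' x"
  shows "has_fourier f' g'"
proof -
  have [measurable]: "f \<in> borel_measurable borel" "g \<in> borel_measurable borel"
    "f' \<in> borel_measurable borel" "g' \<in> borel_measurable borel"
    using has_fourier_L2[OF fg] assms by auto
  have "FT (trunc N f') = FT (trunc N f)" for N
    unfolding FT_def trunc_def
    by (intro ext integral_cong_AE) (use f in \<open>measurable, auto\<close>)
  moreover have "L2_norm (\<lambda>\<xi>. FT (trunc N f) \<xi> - g' \<xi>) = L2_norm (\<lambda>\<xi>. FT (trunc N f) \<xi> - g \<xi>)" for N
  proof (rule L2_norm_cong_AE)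
    have [measurable]: "trunc N f \<in> borel_measurable borel" unfolding trunc_def by measurable
    show "(\<lambda>\<xi>. FT (trunc N f) \<xi> - g' \<xi>) \<in> borel_measurable borel"
      "(\<lambda>\<xi>. FT (trunc N f) \<xi> - g \<xi>) \<in> borel_measurable borel" by measurable
  qed (use g in auto)
  moreover have "f' \<in> L2" "g' \<in> L2"
    using L2_cong_AE[of f f'] L2_cong_AE[of g g'] has_fourier_L2[OF fg] assms by auto
  ultimately show ?thesis
    using fg by (simp add: has_fourier_iff L2_lim_def)
qed

lemma has_fourier_add:
  assumes "has_fourier f F" "has_fourier g G"
  shows "has_fourier (\<lambda>x. f x + g x) (\<lambda>\<xi>. F \<xi> + G \<xi>)"
proof -
  have L2: "f \<in> L2" "F \<in> L2" "g \<in> L2" "G \<in> L2" using assms by (auto simp: has_fourier_def)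
  have "trunc N (\<lambda>x. f x + g x) = (\<lambda>x. trunc N f x + trunc N g x)" for N
    by (rule ext) (simp add: trunc_def distrib_left)
  then have FT_eq: "FT (trunc N (\<lambda>x. f x + g x)) \<xi> = FT (trunc N f) \<xi> + FT (trunc N g) \<xi>" for N \<xi>
    by (simp only: FT_add[OF trunc_integrable[OF L2(1)] trunc_integrable[OF L2(3)]])
  have "L2_norm (\<lambda>\<xi>. FT (trunc N (\<lambda>x. f x + g x)) \<xi> - (F \<xi> + G \<xi>))
      \<le> L2_norm (\<lambda>\<xi>. FT (trunc N f) \<xi> - F \<xi>) + L2_norm (\<lambda>\<xi>. FT (trunc N g) \<xi> - G \<xi>)" for N
  proof -
    have "(\<lambda>\<xi>. FT (trunc N (\<lambda>x. f x + g x)) \<xi> - (F \<xi> + G \<xi>))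
        = (\<lambda>\<xi>. (FT (trunc N f) \<xi> - F \<xi>) + (FT (trunc N g) \<xi> - G \<xi>))"
      by (rule ext) (simp only: FT_eq add_diff_add)
    then show ?thesis
      by (simp only:) (intro L2_norm_triangle L2_diff FT_trunc_L2 L2)
  qed
  moreover have "(\<lambda>N. L2_norm (\<lambda>\<xi>. FT (trunc N f) \<xi> - F \<xi>) + L2_norm (\<lambda>\<xi>. FT (trunc N g) \<xi> - G \<xi>)) \<longlonglongrightarrow> 0 + 0"
    using assms unfolding has_fourier_iff L2_lim_def by (intro tendsto_add) auto
  ultimately have "L2_lim (\<lambda>N. FT (trunc N (\<lambda>x. f x + g x))) (\<lambda>\<xi>. F \<xi> + G \<xi>)"
    unfolding L2_lim_def add_0_right
    by (rule L2_norm_squeeze)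
  then show ?thesis using L2 by (simp add: has_fourier_iff L2_add)
qed

lemma has_fourier_scale:
  assumes "has_fourier f F" shows "has_fourier (\<lambda>x. c * f x) (\<lambda>\<xi>. c * F \<xi>)"
proof -
  have "FT (trunc N (\<lambda>x. c * f x)) \<xi> = c * FT (trunc N f) \<xi>" for N \<xi>
    unfolding FT_def trunc_def by (simp add: mult.left_commute[of _ c] flip: integral_mult_right_zero)
  then have "L2_norm (\<lambda>\<xi>. FT (trunc N (\<lambda>x. c * f x)) \<xi> - c * F \<xi>)
      \<le> norm c * L2_norm (\<lambda>\<xi>. FT (trunc N f) \<xi> - F \<xi>)" for N
    by (simp add: L2_norm_scale flip: right_diff_distrib)
  then have "L2_lim (\<lambda>N. FT (trunc N (\<lambda>x. c * f x))) (\<lambda>\<xi>. c * F \<xi>)"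
    by (rule L2_lim_dominated[rotated]) (use assms in \<open>simp add: has_fourier_iff\<close>)
  then show ?thesis
    using assms by (simp add: has_fourier_iff L2_scale)
qed

lemma has_fourier_diff:
  "has_fourier f F \<Longrightarrow> has_fourier g G \<Longrightarrow> has_fourier (\<lambda>x. f x - g x) (\<lambda>\<xi>. F \<xi> - G \<xi>)"
  using has_fourier_add[of f F "\<lambda>x. -1 * g x" "\<lambda>\<xi>. -1 * G \<xi>"] has_fourier_scale[of g G "-1"] by simp

lemma has_fourier_zero: "has_fourier (\<lambda>x. 0) (\<lambda>\<xi>. 0)"
proof -
  obtain g where "has_fourier (\<lambda>x. 0) g" using has_fourier_exists[OF L2_zero] .
  from has_fourier_scale[OF this, of 0] show ?thesis by simp
qed

lemma has_fourier_AE_zero: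
  assumes "has_fourier f F" "AE x in lborel. f x = 0" shows "AE \<xi> in lborel. F \<xi> = 0"
proof -
  have "L2_norm f = 0" using assms has_fourier_L2 L2_norm_eq_0 by blast
  then have "L2_norm F = 0" using has_fourier_norm_le[OF assms(1)] L2_norm_nonneg[of F] by simp
  then show ?thesis using assms has_fourier_L2 L2_norm_eq_0 by blast
qed

lemma has_fourier_unique_AE:
  assumes "has_fourier f F" "has_fourier g G" "AE x in lborel. f x = g x"
  shows "AE \<xi> in lborel. F \<xi> = G \<xi>"
  using has_fourier_AE_zero[OF has_fourier_diff[OF assms(1,2)]] assms(3) by simp

lemma has_fourier_FT:
  assumes f: "f \<in> L2" and int: "integrable lborel f"
  shows "has_fourier f (FT f)"
proof -
  have "L2_norm (\<lambda>\<xi>. FT (trunc N f) \<xi> - FT f \<xi>) \<le> sqrt (2 * pi) * L2_norm (\<lambda>x. trunc N f x - f x)" for N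
  proof -
    have "(\<lambda>\<xi>. FT (trunc N f) \<xi> - FT f \<xi>) = FT (\<lambda>x. trunc N f x - f x)"
      by (rule ext) (simp add: FT_diff trunc_integrable f int)
    then show ?thesis
      using FT_L2_bound(2)[OF L2_diff[OF trunc_L2[OF f] f]
        Bochner_Integration.integrable_diff[OF trunc_integrable[OF f] int], of N] by simp
  qed
  then have "L2_lim (\<lambda>N. FT (trunc N f)) (FT f)"
    by (rule L2_lim_dominated[OF L2_lim_trunc[OF f]])
  then show ?thesis using f int by (simp add: has_fourier_iff FT_L2_bound)
qed

text \<open>The graph of the transform is closed. It serves to pass from truncated functions, where
  all integrals converge absolutely, to general ones.\<close>

lemma has_fourier_limit:
  assumes hf: "\<And>n. has_fourier (X n) (Y n)" and f: "f \<in> L2" and g: "g \<in> L2"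
    and lim: "L2_lim X f" "L2_lim Y g"
  shows "has_fourier f g"
proof -
  obtain g' where g': "has_fourier f g'" using has_fourier_exists[OF f] .
  have "L2_lim Y g'"
    by (rule L2_lim_dominated[OF lim(1)]) (rule has_fourier_norm_le[OF has_fourier_diff[OF hf g']])
  then have "AE x in lborel. g' x = g x"
    using hf g' g lim by (intro L2_lim_unique[of Y]) (auto simp: has_fourier_def)
  then show ?thesis using g' f g by (intro has_fourier_cong_AE[OF g']) auto
qed

lemma L2_norm_reflect: "L2_norm (\<lambda>x. f (- x)) = L2_norm f"
  using lborel_integral_real_affine[of "-1" "\<lambda>x. (norm (f x))\<^sup>2" 0] by (simp add: L2_norm_def)

lemma L2_reflect: "f \<in> L2 \<Longrightarrow> (\<lambda>x. f (- x)) \<in> L2"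
  using lborel_integrable_reflect[of "\<lambda>x. (norm (f x))\<^sup>2"]
    measurable_compose[of uminus borel borel f borel] by (auto simp: L2_def)

lemma has_fourier_reflect:
  assumes "has_fourier f F" shows "has_fourier (\<lambda>x. f (- x)) (\<lambda>\<xi>. F (- \<xi>))"
proof -
  have eq: "FT (trunc N (\<lambda>x. f (- x))) \<xi> = FT (trunc N f) (- \<xi>)" for N \<xi>
  proof -
    have "FT (trunc N (\<lambda>x. f (- x))) \<xi> = (LINT x|lborel. cis (- (- x * - \<xi>)) * trunc N f (- x))"
      unfolding FT_def trunc_def
      by (intro Bochner_Integration.integral_cong) (auto simp: indicator_def)
    also have "\<dots> = FT (trunc N f) (- \<xi>)"
      unfolding FT_def by (rule lborel_integral_reflect[of "\<lambda>x. cis (- (x * - \<xi>)) * trunc N f x"])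
    finally show ?thesis .
  qed
  have "L2_norm (\<lambda>\<xi>. FT (trunc N f) (- \<xi>) - F (- \<xi>)) = L2_norm (\<lambda>\<xi>. FT (trunc N f) \<xi> - F \<xi>)" for N
    by (rule L2_norm_reflect)
  then show ?thesis using assms by (simp add: has_fourier_iff L2_lim_def eq L2_reflect)
qed

lemma has_fourier_cnj:
  assumes "has_fourier f F" shows "has_fourier (\<lambda>x. cnj (f x)) (\<lambda>\<xi>. cnj (F (- \<xi>)))"
proof -
  have "trunc N (\<lambda>x. cnj (f x)) = (\<lambda>x. cnj (trunc N f x))" for N
    by (auto simp: trunc_def indicator_def)
  then have eq: "FT (trunc N (\<lambda>x. cnj (f x))) \<xi> = cnj (FT (trunc N f) (- \<xi>))" for N \<xi>
    by (simp add: FT_cnj)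
  have "L2_norm (\<lambda>\<xi>. cnj (FT (trunc N f) (- \<xi>)) - cnj (F (- \<xi>)))
      = L2_norm (\<lambda>\<xi>. FT (trunc N f) (- \<xi>) - F (- \<xi>))" for N
    by (simp add: L2_norm_def flip: complex_cnj_diff)
  moreover have "L2_norm (\<lambda>\<xi>. FT (trunc N f) (- \<xi>) - F (- \<xi>)) = L2_norm (\<lambda>\<xi>. FT (trunc N f) \<xi> - F \<xi>)" for N
    by (rule L2_norm_reflect)
  ultimately show ?thesis using assms by (simp add: has_fourier_iff L2_lim_def eq L2_reflect L2_cnj)
qed

lemma has_fourier_mult_formula:
  assumes "has_fourier f F" "has_fourier g G"
  shows "(LINT \<xi>|lborel. F \<xi> * g \<xi>) = (LINT x|lborel. f x * G x)"
proof -
  have L2: "f \<in> L2" "F \<in> L2" "g \<in> L2" "G \<in> L2" using assms by (auto simp: has_fourier_def)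
  have "(\<lambda>N. LINT \<xi>|lborel. FT (trunc N f) \<xi> * trunc N g \<xi>) \<longlonglongrightarrow> (LINT \<xi>|lborel. F \<xi> * g \<xi>)"
    using assms by (intro L2_lim_mult FT_trunc_L2 trunc_L2 L2_lim_trunc L2) (auto simp: has_fourier_iff)
  moreover have "(\<lambda>N. LINT x|lborel. trunc N f x * FT (trunc N g) x) \<longlonglongrightarrow> (LINT x|lborel. f x * G x)"
    using assms by (intro L2_lim_mult FT_trunc_L2 trunc_L2 L2_lim_trunc L2) (auto simp: has_fourier_iff)
  moreover have "(LINT \<xi>|lborel. FT (trunc N f) \<xi> * trunc N g \<xi>) = (LINT x|lborel. trunc N f x * FT (trunc N g) x)" for N
    by (intro FT_mult_formula trunc_integrable L2)
  ultimately show ?thesis using LIMSEQ_unique by auto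
qed

section \<open>Inversion and Plancherel\<close>

lemma arctan_scaled_tendsto:
  "(\<lambda>n. arctan (x / (1 / real (Suc n)))) \<longlonglongrightarrow> (pi / 2) * sgn x"
proof -
  consider "x > 0" | "x = 0" | "x < 0" by linarith
  then show ?thesis by cases (simp_all, real_asymp+)
qed

text \<open>The transform K of \<open>FT f\<close> is compared with the expected function by
  integrating over intervals. After the weight exp (- e \<bar>\<xi>\<bar>) is inserted, the pairing
  is computed with \<open>poisson_kernel_interval\<close>, and both sides converge by domination as
  e tends to 0.\<close>

lemma has_fourier_inversion_integrable:
  fixes f :: "real \<Rightarrow> complex"
  assumes f: "f \<in> L2" and int: "integrable lborel f"
  shows "has_fourier (FT f) (\<lambda>x. 2 * pi * f (- x))"
proof -
  have [measurable]: "f \<in> borel_measurable borel" using f by auto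
  have FTf: "FT f \<in> L2" by (rule FT_L2_bound[OF f int])
  obtain K where K: "has_fourier (FT f) K" using has_fourier_exists[OF FTf] .
  have KL2: "K \<in> L2" using K by (rule has_fourier_L2)
  have fr: "(\<lambda>x. 2 * pi * f (- x)) \<in> L2" by (intro L2_scale L2_reflect f)
  have "AE x in lborel. K x - 2 * pi * f (- x) = 0"
  proof (rule AE_zero_if_interval_integrals_zero)
    show "(\<lambda>x. K x - 2 * pi * f (- x)) \<in> L2" by (intro L2_diff KL2 fr)
    fix a b :: real assume ab: "a \<le> b"
    let ?i = "indicator {a..b} :: real \<Rightarrow> complex"
    have i: "?i \<in> L2" "integrable lborel ?i"
      using interval_indicator_L2[of a b] L2_mult_integrable[OF interval_indicator_L2[of a b] interval_indicator_L2[of a b]]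
      by (simp_all flip: indicator_inter_arith)
    have FTi: "FT ?i \<in> L2" by (rule FT_L2_bound[OF i])
    let ?e = "\<lambda>n. 1 / real (Suc n)"
    have "(\<lambda>n. LINT \<xi>|lborel. FT f \<xi> * (of_real (exp (- ?e n * \<bar>\<xi>\<bar>)) * FT ?i \<xi>))
        \<longlonglongrightarrow> (LINT \<xi>|lborel. FT f \<xi> * FT ?i \<xi>)"
    proof (rule integral_dominated_convergence)
      show "integrable lborel (\<lambda>\<xi>. norm (FT f \<xi>) * norm (FT ?i \<xi>))"
        by (rule L2_mult_integrable_norm[OF FTf FTi])
      show "AE \<xi> in lborel. (\<lambda>n. FT f \<xi> * (of_real (exp (- ?e n * \<bar>\<xi>\<bar>)) * FT ?i \<xi>))
          \<longlonglongrightarrow> FT f \<xi> * FT ?i \<xi>"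
      proof (rule AE_I2)
        fix \<xi> :: real
        have "(\<lambda>n. exp (- ?e n * \<bar>\<xi>\<bar>)) \<longlonglongrightarrow> 1" by real_asymp
        then have "(\<lambda>n. FT f \<xi> * (of_real (exp (- ?e n * \<bar>\<xi>\<bar>)) * FT ?i \<xi>))
          \<longlonglongrightarrow> FT f \<xi> * (of_real 1 * FT ?i \<xi>)"
          by (intro tendsto_mult tendsto_const tendsto_of_real)
        then show "(\<lambda>n. FT f \<xi> * (of_real (exp (- ?e n * \<bar>\<xi>\<bar>)) * FT ?i \<xi>))
          \<longlonglongrightarrow> FT f \<xi> * FT ?i \<xi>" by simp
      qed
      show "AE \<xi> in lborel. norm (FT f \<xi> * (of_real (exp (- ?e n * \<bar>\<xi>\<bar>)) * FT ?i \<xi>))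
          \<le> norm (FT f \<xi>) * norm (FT ?i \<xi>)" for n
        by (auto simp: norm_mult intro!: mult_left_mono mult_left_le_one_le)
    qed measurable
    moreover have "(LINT \<xi>|lborel. FT f \<xi> * (of_real (exp (- ?e n * \<bar>\<xi>\<bar>)) * FT ?i \<xi>))
        = (LINT x|lborel. f x * of_real (2 * arctan ((b + x) / ?e n) - 2 * arctan ((a + x) / ?e n)))" for n
    proof -
      have e: "?e n > 0" by simp
      have "FT (\<lambda>\<xi>. of_real (exp (- ?e n * \<bar>\<xi>\<bar>)) * FT ?i \<xi>) x
          = of_real (2 * arctan ((b + x) / ?e n) - 2 * arctan ((a + x) / ?e n))" for x
        using FT_poisson[OF e i(2), of "- x"] poisson_kernel_interval[OF e ab, of "- x"]
        by (subst FT_def) (simp add: mult.commute[of x])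
      then show ?thesis
        using FT_mult_formula[OF int exp_weighted_FT_integrable[OF e i(2)]] by simp
    qed
    moreover have "(\<lambda>n. LINT x|lborel. f x * of_real (2 * arctan ((b + x) / ?e n) - 2 * arctan ((a + x) / ?e n)))
        \<longlonglongrightarrow> (LINT x|lborel. f x * (2 * pi * ?i (- x)))"
    proof (rule integral_dominated_convergence)
      show "integrable lborel (\<lambda>x. (2 * pi) * norm (f x))" using int by simp
      \<comment> \<open>At x = - a and x = - b the arctangents tend to half the jump, so these two
        points are left out.\<close>
      show "AE x in lborel. (\<lambda>n. f x * of_real (2 * arctan ((b + x) / ?e n) - 2 * arctan ((a + x) / ?e n)))
          \<longlonglongrightarrow> f x * (2 * pi * ?i (- x))"
        using AE_lborel_singleton[of "-a"] AE_lborel_singleton[of "-b"]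
      proof eventually_elim
        case (elim x)
        have "2 * ((pi / 2) * sgn (b + x)) - 2 * ((pi / 2) * sgn (a + x)) = 2 * pi * indicator {a..b} (- x)"
          using elim ab by (auto simp: sgn_if indicator_def)
        moreover have "(\<lambda>n. f x * of_real (2 * arctan ((b + x) / ?e n) - 2 * arctan ((a + x) / ?e n)))
          \<longlonglongrightarrow> f x * of_real (2 * ((pi / 2) * sgn (b + x)) - 2 * ((pi / 2) * sgn (a + x)))"
          by (intro tendsto_intros arctan_scaled_tendsto)
        ultimately have "(\<lambda>n. f x * of_real (2 * arctan ((b + x) / ?e n) - 2 * arctan ((a + x) / ?e n)))
          \<longlonglongrightarrow> f x * of_real (2 * pi * indicator {a..b} (- x))" by metis
        then show ?case by (auto simp: indicator_def)
      qed
      show "AE x in lborel. norm (f x * of_real (2 * arctan ((b + x) / ?e n) - 2 * arctan ((a + x) / ?e n)))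
          \<le> 2 * pi * norm (f x)" for n
      proof (rule AE_I2)
        fix x
        have "\<bar>2 * arctan ((b + x) / ?e n) - 2 * arctan ((a + x) / ?e n)\<bar> \<le> 2 * pi"
          using arctan_bounded[of "(b + x) / ?e n"] arctan_bounded[of "(a + x) / ?e n"]
          unfolding abs_le_iff by linarith
        then show "norm (f x * of_real (2 * arctan ((b + x) / ?e n) - 2 * arctan ((a + x) / ?e n)))
          \<le> 2 * pi * norm (f x)"
          unfolding norm_mult norm_of_real by (subst mult.commute) (rule mult_right_mono, auto)
      qed
    qed measurable
    ultimately have "(LINT \<xi>|lborel. FT f \<xi> * FT ?i \<xi>) = (LINT x|lborel. f x * (2 * pi * ?i (- x)))"
      using LIMSEQ_unique by auto
    also have "(LINT \<xi>|lborel. FT f \<xi> * FT ?i \<xi>) = (LINT x|lborel. K x * ?i x)"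
      using has_fourier_mult_formula[OF K has_fourier_FT[OF i]] by simp
    also have "(LINT x|lborel. f x * (2 * pi * ?i (- x))) = (LINT x|lborel. 2 * pi * f (- x) * ?i x)"
      using lborel_integral_reflect[of "\<lambda>x. f x * (2 * pi * ?i (- x))"] by (simp add: mult_ac)
    finally have eq: "(LINT x|lborel. K x * ?i x) = (LINT x|lborel. 2 * pi * f (- x) * ?i x)" .
    have "(LINT x|lborel. ?i x * (K x - 2 * pi * f (- x)))
        = (LINT x|lborel. K x * ?i x - 2 * pi * f (- x) * ?i x)"
      by (simp add: algebra_simps)
    also have "\<dots> = 0"
      using L2_mult_integrable[OF KL2 i(1)] L2_mult_integrable[OF fr i(1)] eq by simp
    finally show "(LINT x|lborel. ?i x * (K x - 2 * pi * f (- x))) = 0" .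
  qed
  then show ?thesis
    using FTf fr by (intro has_fourier_cong_AE[OF K]) auto
qed

lemma has_fourier_inversion:
  fixes f :: "real \<Rightarrow> complex"
  assumes hf: "has_fourier f F" shows "has_fourier F (\<lambda>x. 2 * pi * f (- x))"
proof (rule has_fourier_limit)
  have f: "f \<in> L2" "F \<in> L2" using hf by (auto simp: has_fourier_def)
  show "F \<in> L2" "(\<lambda>x. 2 * pi * f (- x)) \<in> L2" using f by (auto intro: L2_scale L2_reflect)
  show "has_fourier (FT (trunc n f)) (\<lambda>x. 2 * pi * trunc n f (- x))" for n
    by (intro has_fourier_inversion_integrable trunc_L2 trunc_integrable f)
  show "L2_lim (\<lambda>n. FT (trunc n f)) F" using hf by (simp add: has_fourier_iff)
  show "L2_lim (\<lambda>n x. 2 * pi * trunc n f (- x)) (\<lambda>x. 2 * pi * f (- x))"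
  proof (rule L2_lim_dominated[OF L2_lim_trunc[OF f(1)], where C="2 * pi"])
    fix n
    show "L2_norm (\<lambda>x. 2 * pi * trunc n f (- x) - 2 * pi * f (- x))
        \<le> 2 * pi * L2_norm (\<lambda>x. trunc n f x - f x)"
      using L2_norm_scale[of "2 * pi" "\<lambda>x. trunc n f (- x) - f (- x)"]
        L2_norm_reflect[of "\<lambda>x. trunc n f x - f x"]
      by (simp add: right_diff_distrib norm_mult)
  qed
qed

text \<open>Inversion reflects the argument and conjugation reflects it back, so cnj G has the
  transform 2 pi cnj g; the multiplication formula then gives Parseval's identity.\<close>

lemma has_fourier_inner:
  assumes f: "has_fourier f F" and g: "has_fourier g G"
  shows "L2_inner F G = 2 * pi * L2_inner f g"
proof -
  have "has_fourier (\<lambda>x. cnj (G x)) (\<lambda>x. cnj (2 * pi * g x))"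
    using has_fourier_cnj[OF has_fourier_inversion[OF g]] by simp
  from has_fourier_mult_formula[OF f this]
  have "L2_inner F G = (LINT x|lborel. f x * cnj (2 * pi * g x))" by (simp add: L2_inner_def)
  also have "\<dots> = (LINT x|lborel. 2 * pi * (f x * cnj (g x)))"
    by (intro Bochner_Integration.integral_cong) (simp_all add: mult.left_commute)
  finally show ?thesis by (simp add: L2_inner_def)
qed

lemma has_fourier_norm:
  assumes "has_fourier f F" shows "L2_norm F = sqrt (2 * pi) * L2_norm f"
proof -
  have "complex_of_real ((L2_norm F)\<^sup>2) = complex_of_real (2 * pi * (L2_norm f)\<^sup>2)"
    using has_fourier_inner[OF assms assms] L2_inner_self has_fourier_L2[OF assms] by simp
  then have "(L2_norm F)\<^sup>2 = 2 * pi * (L2_norm f)\<^sup>2" by (simp only: of_real_eq_iff)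
  then have "(L2_norm F)\<^sup>2 = (sqrt (2 * pi) * L2_norm f)\<^sup>2" by (simp add: power_mult_distrib)
  then show ?thesis by (rule power2_eq_imp_eq) auto
qed

lemma has_fourier_AE_zero_iff:
  assumes "has_fourier f F"
  shows "(AE x in lborel. f x = 0) \<longleftrightarrow> (AE \<xi> in lborel. F \<xi> = 0)"
  using has_fourier_norm[OF assms] L2_norm_eq_0 has_fourier_L2[OF assms]
  by (metis mult_eq_0_iff pi_neq_zero real_sqrt_eq_0_iff zero_neq_numeral)

text \<open>Inversion makes the reflected transform of G, divided by 2 pi, a preimage. It lets test
  functions be prescribed by their transforms.\<close>

lemma has_fourier_surj:
  assumes G: "G \<in> L2" obtains f where "has_fourier f G"
proof -
  obtain K where K: "has_fourier G K" using has_fourier_exists[OF G] .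
  from has_fourier_scale[OF has_fourier_reflect[OF has_fourier_inversion[OF K]], of "1 / (2 * pi)"]
  have "has_fourier (\<lambda>x. 1 / (2 * pi) * K (- x)) G" by simp
  then show ?thesis by (rule that)
qed

lemma has_fourier_inverse_FT:
  assumes "G \<in> L2" "integrable lborel G"
  shows "has_fourier (\<lambda>x. 1 / (2 * pi) * FT G (- x)) G"
  using has_fourier_scale[OF has_fourier_reflect[OF has_fourier_inversion_integrable[OF assms]], of "1 / (2 * pi)"]
  by simp

section \<open>Convolution with an integrable kernel\<close>

definition conv :: "(real \<Rightarrow> real) \<Rightarrow> (real \<Rightarrow> complex) \<Rightarrow> real \<Rightarrow> complex" where
  "conv k G \<xi> = (LINT s|lborel. of_real (k s) * G (\<xi> - s))"

text \<open>Square integrability of the kernel makes \<open>conv k G\<close> converge at every point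
  for G in \<open>L2\<close>, so it is a definite function and can later be differentiated
  pointwise. Integrability gives the bound on \<open>L2\<close>.\<close>

locale conv_kernel =
  fixes k :: "real \<Rightarrow> real"
  assumes k_meas [measurable]: "k \<in> borel_measurable borel"
    and k_nonneg: "\<And>s. 0 \<le> k s"
    and k_int: "integrable lborel k"
    and k_L2: "(\<lambda>s. complex_of_real (k s)) \<in> L2"
begin

text \<open>The sign makes this the integral of k(s) exp (\<i> x s): convolving a transform with k
  multiplies the original function by \<open>k_hat\<close>.\<close>

abbreviation "k_hat x \<equiv> FT (\<lambda>s. complex_of_real (k s)) (- x)"

lemma k_hat_bound: "norm (k_hat x) \<le> (LINT s|lborel. k s)"
  using FT_bound[of "\<lambda>s. complex_of_real (k s)" "- x"] by (simp add: k_nonneg)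

lemma k_hat_measurable [measurable]: "(\<lambda>x. k_hat x) \<in> borel_measurable borel"
  by measurable

lemma conv_measurable [measurable]:
  assumes [measurable]: "G \<in> borel_measurable borel"
  shows "conv k G \<in> borel_measurable borel"
  unfolding conv_def by measurable

lemma shift_L2: "G \<in> L2 \<Longrightarrow> (\<lambda>s. G (\<xi> - s)) \<in> L2"
  using lborel_integrable_real_affine[of "\<lambda>s. (norm (G s))\<^sup>2" "-1" \<xi>]
    measurable_compose[of "\<lambda>s. \<xi> - s" borel borel G borel] by (auto simp: L2_def)

lemma conv_integrable: "G \<in> L2 \<Longrightarrow> integrable lborel (\<lambda>s. of_real (k s) * G (\<xi> - s))"
  by (intro L2_mult_integrable k_L2 shift_L2)

lemma conv_diff:
  "G \<in> L2 \<Longrightarrow> H \<in> L2 \<Longrightarrow> conv k (\<lambda>s. G s - H s) \<xi> = conv k G \<xi> - conv k H \<xi>"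
  unfolding conv_def by (simp add: right_diff_distrib conv_integrable)

text \<open>Young's inequality: splitting k into sqrt k times sqrt k and applying Cauchy-Schwarz
  bounds the square of the convolution by the mass of k times the convolution of k with
  |G|^2.\<close>

lemma conv_L2_bound:
  assumes G: "G \<in> L2"
  shows "conv k G \<in> L2" "L2_norm (conv k G) \<le> (LINT s|lborel. k s) * L2_norm G"
proof -
  have [measurable]: "G \<in> borel_measurable borel" using G by auto
  define c where "c = (LINT s|lborel. k s)"
  have c: "c \<ge> 0" unfolding c_def by (intro Bochner_Integration.integral_nonneg k_nonneg)
  have kc: "(\<integral>\<^sup>+s. ennreal (k s) \<partial>lborel) = ennreal c"
    unfolding c_def by (intro nn_integral_eq_integral k_int) (simp add: k_nonneg)
  have point: "ennreal ((norm (conv k G \<xi>))\<^sup>2)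
      \<le> ennreal c * (\<integral>\<^sup>+s. ennreal (k s) * ennreal ((norm (G (\<xi> - s)))\<^sup>2) \<partial>lborel)" for \<xi>
  proof -
    have "ennreal (norm (conv k G \<xi>)) \<le> (\<integral>\<^sup>+s. ennreal (norm (of_real (k s) * G (\<xi> - s))) \<partial>lborel)"
      unfolding conv_def by (rule norm_lborel_integral_le)
    also have "\<dots> = (\<integral>\<^sup>+s. ennreal (sqrt (k s)) * (ennreal (sqrt (k s) * norm (G (\<xi> - s)))) \<partial>lborel)"
      by (intro nn_integral_cong) (simp add: norm_mult k_nonneg flip: ennreal_mult' mult.assoc)
    finally have "(ennreal (norm (conv k G \<xi>)))\<^sup>2
        \<le> (\<integral>\<^sup>+s. ennreal (sqrt (k s)) * (ennreal (sqrt (k s) * norm (G (\<xi> - s)))) \<partial>lborel)\<^sup>2"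
      by (intro power_mono) auto
    also have "\<dots> \<le> (\<integral>\<^sup>+s. (ennreal (sqrt (k s)))\<^sup>2 \<partial>lborel)
        * (\<integral>\<^sup>+s. (ennreal (sqrt (k s) * norm (G (\<xi> - s))))\<^sup>2 \<partial>lborel)"
      by (rule Cauchy_Schwarz_nn_integral) measurable
    also have "(\<lambda>s. (ennreal (sqrt (k s)))\<^sup>2) = (\<lambda>s. ennreal (k s))"
      by (simp add: ennreal_power k_nonneg)
    also have "(\<lambda>s. (ennreal (sqrt (k s) * norm (G (\<xi> - s))))\<^sup>2)
        = (\<lambda>s. ennreal (k s) * ennreal ((norm (G (\<xi> - s)))\<^sup>2))"
      by (simp add: ennreal_power k_nonneg power_mult_distrib ennreal_mult')
    finally show ?thesis by (simp add: ennreal_power kc)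
  qed
  have inner: "(\<integral>\<^sup>+\<xi>. ennreal ((norm (G (\<xi> - s)))\<^sup>2) \<partial>lborel) = ennreal ((L2_norm G)\<^sup>2)" for s
    using nn_integral_real_affine[of "\<lambda>x. ennreal ((norm (G x))\<^sup>2)" 1 "- s"] nn_integral_L2[OF G] by simp
  have "(\<integral>\<^sup>+\<xi>. ennreal ((norm (conv k G \<xi>))\<^sup>2) \<partial>lborel)
      \<le> (\<integral>\<^sup>+\<xi>. ennreal c * (\<integral>\<^sup>+s. ennreal (k s) * ennreal ((norm (G (\<xi> - s)))\<^sup>2) \<partial>lborel) \<partial>lborel)"
    by (intro nn_integral_mono point)
  also have "\<dots> = ennreal c * (\<integral>\<^sup>+\<xi>. \<integral>\<^sup>+s. ennreal (k s) * ennreal ((norm (G (\<xi> - s)))\<^sup>2) \<partial>lborel \<partial>lborel)"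
    by (rule nn_integral_cmult) measurable
  also have "(\<integral>\<^sup>+\<xi>. \<integral>\<^sup>+s. ennreal (k s) * ennreal ((norm (G (\<xi> - s)))\<^sup>2) \<partial>lborel \<partial>lborel)
      = (\<integral>\<^sup>+s. \<integral>\<^sup>+\<xi>. ennreal (k s) * ennreal ((norm (G (\<xi> - s)))\<^sup>2) \<partial>lborel \<partial>lborel)"
    by (rule lborel_pair.Fubini'[symmetric]) measurable
  also have "\<dots> = ennreal c * ennreal ((L2_norm G)\<^sup>2)"
    by (simp add: nn_integral_cmult inner nn_integral_multc kc)
  also have "ennreal c * (ennreal c * ennreal ((L2_norm G)\<^sup>2)) = ennreal ((c * L2_norm G)\<^sup>2)"
    using c by (simp add: power2_eq_square mult_ac flip: ennreal_mult')
  finally have le: "(\<integral>\<^sup>+\<xi>. ennreal ((norm (conv k G \<xi>))\<^sup>2) \<partial>lborel) \<le> ennreal ((c * L2_norm G)\<^sup>2)" .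
  then show L2: "conv k G \<in> L2" by (subst L2_iff_nn) (auto intro: le_less_trans)
  have "(L2_norm (conv k G))\<^sup>2 \<le> (c * L2_norm G)\<^sup>2"
    using le unfolding nn_integral_L2[OF L2] by (subst (asm) ennreal_le_iff) auto
  then show "L2_norm (conv k G) \<le> (LINT s|lborel. k s) * L2_norm G"
    unfolding c_def[symmetric] by (rule power2_le_imp_le) (use c in auto)
qed

lemma conv_FT:
  assumes G: "integrable lborel G"
  shows "integrable lborel (conv k G)"
    and "FT (conv k G) (- x) = k_hat x * FT G (- x)"
proof -
  have [measurable]: "G \<in> borel_measurable borel" using G by auto
  have shift: "(\<integral>\<^sup>+\<xi>. ennreal (norm (G (\<xi> - s))) \<partial>lborel) = (\<integral>\<^sup>+\<xi>. ennreal (norm (G \<xi>)) \<partial>lborel)" for s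
    using nn_integral_real_affine[of "\<lambda>x. ennreal (norm (G x))" 1 "- s"] by simp
  have fin: "(\<integral>\<^sup>+s. \<integral>\<^sup>+\<xi>. ennreal (norm (cis (x * \<xi>) * (of_real (k s) * G (\<xi> - s)))) \<partial>lborel \<partial>lborel) < \<infinity>" for x
  proof -
    have "(\<integral>\<^sup>+s. \<integral>\<^sup>+\<xi>. ennreal (norm (cis (x * \<xi>) * (of_real (k s) * G (\<xi> - s)))) \<partial>lborel \<partial>lborel)
        = (\<integral>\<^sup>+s. ennreal (k s) \<partial>lborel) * (\<integral>\<^sup>+\<xi>. ennreal (norm (G \<xi>)) \<partial>lborel)"
      by (simp add: norm_mult ennreal_mult' k_nonneg nn_integral_cmult shift nn_integral_multc)
    also have "\<dots> < \<infinity>"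
      using G k_int by (simp add: integrable_iff_bounded ennreal_mult_less_top k_nonneg)
    finally show ?thesis .
  qed
  have m: "(\<lambda>(s, \<xi>). cis (x * \<xi>) * (of_real (k s) * G (\<xi> - s))) \<in> borel_measurable (lborel \<Otimes>\<^sub>M lborel)" for x
    by measurable
  note swap = lborel_swap_integrals[OF m fin]
  show "integrable lborel (conv k G)" using swap(3)[of 0] by (simp add: conv_def[abs_def])
  have "FT (conv k G) (- x) = (LINT \<xi>|lborel. LINT s|lborel. cis (x * \<xi>) * (of_real (k s) * G (\<xi> - s)))"
    unfolding FT_def conv_def by (simp add: mult.commute[of x])
  also have "\<dots> = (LINT s|lborel. LINT \<xi>|lborel. cis (x * \<xi>) * (of_real (k s) * G (\<xi> - s)))"
    by (rule swap(1))
  also have "\<dots> = (LINT s|lborel. cis (x * s) * of_real (k s) * FT G (- x))"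
  proof (rule Bochner_Integration.integral_cong[OF refl])
    fix s
    have "(LINT \<xi>|lborel. cis (x * \<xi>) * (of_real (k s) * G (\<xi> - s)))
        = (LINT \<xi>|lborel. cis (x * (s + \<xi>)) * (of_real (k s) * G \<xi>))"
      using lborel_integral_real_affine[of 1 "\<lambda>\<xi>. cis (x * \<xi>) * (of_real (k s) * G (\<xi> - s))" s] by simp
    also have "\<dots> = (LINT \<xi>|lborel. cis (x * s) * of_real (k s) * (cis (x * \<xi>) * G \<xi>))"
      by (simp add: distrib_left mult_ac flip: cis_mult)
    finally show "(LINT \<xi>|lborel. cis (x * \<xi>) * (of_real (k s) * G (\<xi> - s)))
        = cis (x * s) * of_real (k s) * FT G (- x)"
      by (simp add: FT_def mult.commute[of x])
  qed
  also have "\<dots> = k_hat x * FT G (- x)"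
    by (simp add: FT_def mult.commute[of x])
  finally show "FT (conv k G) (- x) = k_hat x * FT G (- x)" .
qed

text \<open>For a truncated G everything is integrable and \<open>conv_FT\<close> applies to its
  inverse transform. Both sides depend continuously on G in \<open>L2\<close>, so the closed graph
  gives the general case.\<close>

lemma has_fourier_conv:
  assumes hf: "has_fourier f G"
  shows "has_fourier (\<lambda>x. k_hat x * f x) (conv k G)"
proof -
  have L2: "f \<in> L2" "G \<in> L2" using hf by (auto simp: has_fourier_def)
  define c where "c = (LINT s|lborel. k s)"
  define f' where "f' N x = 1 / (2 * pi) * FT (trunc N G) (- x)" for N x
  have f': "has_fourier (f' N) (trunc N G)" for N
    unfolding f'_def by (intro has_fourier_inverse_FT trunc_L2 trunc_integrable L2)
  have lim_f': "L2_lim f' f"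
  proof (rule L2_lim_dominated[OF L2_lim_trunc[OF L2(2)]])
    fix N
    show "L2_norm (\<lambda>x. f' N x - f x) \<le> 1 / sqrt (2 * pi) * L2_norm (\<lambda>x. trunc N G x - G x)"
      using has_fourier_norm[OF has_fourier_diff[OF f'[of N] hf]] by simp
  qed
  have [measurable]: "f' N \<in> borel_measurable borel" "f \<in> borel_measurable borel" for N
    using has_fourier_L2[OF f'[of N]] L2 by auto
  show ?thesis
  proof (rule has_fourier_limit)
    show "has_fourier (\<lambda>x. k_hat x * f' N x) (conv k (trunc N G))" for N
    proof -
      have "has_fourier (\<lambda>x. 1 / (2 * pi) * FT (conv k (trunc N G)) (- x)) (conv k (trunc N G))"
        by (intro has_fourier_inverse_FT conv_L2_bound conv_FT trunc_L2 trunc_integrable L2)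
      then show ?thesis
        unfolding conv_FT(2)[OF trunc_integrable[OF L2(2)]] f'_def by (simp add: mult_ac)
    qed
    show "(\<lambda>x. k_hat x * f x) \<in> L2"
      using k_hat_bound by (intro L2_mult_bounded L2) auto
    show "conv k G \<in> L2" by (intro conv_L2_bound L2)
    show "L2_lim (\<lambda>N x. k_hat x * f' N x) (\<lambda>x. k_hat x * f x)"
    proof (rule L2_lim_dominated[OF lim_f'])
      fix N
      show "L2_norm (\<lambda>x. k_hat x * f' N x - k_hat x * f x) \<le> c * L2_norm (\<lambda>x. f' N x - f x)"
      proof (rule L2_norm_dominated)
        show "AE x in lborel. norm (k_hat x * f' N x - k_hat x * f x) \<le> c * norm (f' N x - f x)"
          unfolding c_def right_diff_distrib[symmetric] norm_mult
          by (intro AE_I2 mult_right_mono k_hat_bound) auto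
        show "(\<lambda>x. f' N x - f x) \<in> L2" using has_fourier_L2[OF f'[of N]] L2 by (intro L2_diff)
        show "0 \<le> c" unfolding c_def by (intro Bochner_Integration.integral_nonneg k_nonneg)
      qed measurable
    qed
    show "L2_lim (\<lambda>N. conv k (trunc N G)) (conv k G)"
    proof (rule L2_lim_dominated[OF L2_lim_trunc[OF L2(2)]])
      fix N
      have "(\<lambda>x. conv k (trunc N G) x - conv k G x) = conv k (\<lambda>x. trunc N G x - G x)"
        by (rule ext) (simp add: conv_diff trunc_L2 L2)
      then show "L2_norm (\<lambda>x. conv k (trunc N G) x - conv k G x) \<le> c * L2_norm (\<lambda>x. trunc N G x - G x)"
        unfolding c_def using conv_L2_bound(2)[OF L2_diff[OF trunc_L2[OF L2(2)] L2(2)]] by simp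
    qed
  qed
qed

end

section \<open>The operator \<open>|\<nabla>|\<close> and its perturbations\<close>

lemma H1I:
  assumes f: "has_fourier f G" and w: "(\<lambda>\<xi>. complex_of_real \<bar>\<xi>\<bar> * G \<xi>) \<in> L2"
  shows "f \<in> H1"
proof -
  have "integrable lborel (\<lambda>\<xi>. (norm (G \<xi>))\<^sup>2 + (norm (complex_of_real \<bar>\<xi>\<bar> * G \<xi>))\<^sup>2)"
    using w has_fourier_L2[OF f] by (intro Bochner_Integration.integrable_add L2_integrable)
  then show ?thesis unfolding H1_def using f
    by (auto simp: norm_mult power_mult_distrib algebra_simps)
qed

lemma H1E:
  assumes "f \<in> H1"
  obtains G where "has_fourier f G" "(\<lambda>\<xi>. complex_of_real \<bar>\<xi>\<bar> * G \<xi>) \<in> L2"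
proof -
  obtain G where G: "has_fourier f G" "integrable lborel (\<lambda>\<xi>. (1 + \<xi>\<^sup>2) * (norm (G \<xi>))\<^sup>2)"
    using assms by (auto simp: H1_def)
  have [measurable]: "G \<in> borel_measurable borel" using has_fourier_L2[OF G(1)] by auto
  have "(\<lambda>\<xi>. complex_of_real \<bar>\<xi>\<bar> * G \<xi>) \<in> L2"
  proof (rule L2I)
    show "integrable lborel (\<lambda>\<xi>. (norm (complex_of_real \<bar>\<xi>\<bar> * G \<xi>))\<^sup>2)"
      by (rule Bochner_Integration.integrable_bound[OF G(2)])
        (auto simp: norm_mult power_mult_distrib intro!: mult_right_mono)
  qed simp
  with G(1) show ?thesis by (rule that)
qed

lemma H1_L2: "f \<in> H1 \<Longrightarrow> f \<in> L2"
  by (auto simp: H1_def has_fourier_def)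

lemma H1_weight:
  assumes "f \<in> H1" "has_fourier f G"
  shows "(\<lambda>\<xi>. complex_of_real \<bar>\<xi>\<bar> * G \<xi>) \<in> L2"
proof -
  obtain G' where G': "has_fourier f G'" "(\<lambda>\<xi>. complex_of_real \<bar>\<xi>\<bar> * G' \<xi>) \<in> L2"
    using H1E[OF assms(1)] .
  have [measurable]: "G \<in> borel_measurable borel" using has_fourier_L2[OF assms(2)] by auto
  show ?thesis
    using has_fourier_unique_AE[OF G'(1) assms(2)] by (intro L2_cong_AE[OF G'(2)]) auto
qed

lemma abs_nabla_fourier:
  assumes "f \<in> H1" "has_fourier f G"
  shows "has_fourier (abs_nabla f) (\<lambda>\<xi>. complex_of_real \<bar>\<xi>\<bar> * G \<xi>)"
proof -
  obtain h where "has_fourier h (\<lambda>\<xi>. complex_of_real \<bar>\<xi>\<bar> * G \<xi>)"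
    using has_fourier_surj[OF H1_weight[OF assms]] .
  then have "\<exists>h g. has_fourier f g \<and> has_fourier h (\<lambda>\<xi>. complex_of_real \<bar>\<xi>\<bar> * g \<xi>)"
    using assms by blast
  from someI_ex[OF this] obtain g where g: "has_fourier f g"
    "has_fourier (abs_nabla f) (\<lambda>\<xi>. complex_of_real \<bar>\<xi>\<bar> * g \<xi>)"
    unfolding abs_nabla_def by auto
  have [measurable]: "G \<in> borel_measurable borel" using has_fourier_L2[OF assms(2)] by auto
  show ?thesis
    using has_fourier_unique_AE[OF g(1) assms(2)] has_fourier_L2[OF g(2)]
    by (intro has_fourier_cong_AE[OF g(2)]) auto
qed

text \<open>\<open>abs_nabla\<close> is a choice among functions that agree almost everywhere; this
  lemma identifies it on the Fourier side without unfolding the choice.\<close>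

lemma abs_nabla_eqI:
  assumes "has_fourier f G" "has_fourier h (\<lambda>\<xi>. complex_of_real \<bar>\<xi>\<bar> * G \<xi>)"
  shows "f \<in> H1" "AE x in lborel. abs_nabla f x = h x"
proof -
  show f: "f \<in> H1" using H1I[OF assms(1)] has_fourier_L2[OF assms(2)] by simp
  have "has_fourier (\<lambda>x. abs_nabla f x - h x) (\<lambda>\<xi>. 0)"
    using has_fourier_diff[OF abs_nabla_fourier[OF f assms(1)] assms(2)] by simp
  then show "AE x in lborel. abs_nabla f x = h x"
    using has_fourier_AE_zero_iff by fastforce
qed

lemma abs_nabla_L2: "f \<in> H1 \<Longrightarrow> abs_nabla f \<in> L2"
  by (metis H1E abs_nabla_fourier has_fourier_L2(1))

lemma H1_add: assumes "f \<in> H1" "g \<in> H1"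
  shows "(\<lambda>x. f x + g x) \<in> H1" "AE x in lborel. abs_nabla (\<lambda>x. f x + g x) x = abs_nabla f x + abs_nabla g x"
proof -
  obtain F G where F: "has_fourier f F" and G: "has_fourier g G" using assms by (metis H1E)
  have "has_fourier (\<lambda>x. abs_nabla f x + abs_nabla g x) (\<lambda>\<xi>. complex_of_real \<bar>\<xi>\<bar> * (F \<xi> + G \<xi>))"
    using has_fourier_add[OF abs_nabla_fourier[OF assms(1) F] abs_nabla_fourier[OF assms(2) G]]
    by (simp add: distrib_left)
  from abs_nabla_eqI[OF has_fourier_add[OF F G] this]
  show "(\<lambda>x. f x + g x) \<in> H1" "AE x in lborel. abs_nabla (\<lambda>x. f x + g x) x = abs_nabla f x + abs_nabla g x" .
qed

lemma H1_scale: assumes "f \<in> H1"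
  shows "(\<lambda>x. c * f x) \<in> H1" "AE x in lborel. abs_nabla (\<lambda>x. c * f x) x = c * abs_nabla f x"
proof -
  obtain F where F: "has_fourier f F" using assms by (metis H1E)
  have "has_fourier (\<lambda>x. c * abs_nabla f x) (\<lambda>\<xi>. complex_of_real \<bar>\<xi>\<bar> * (c * F \<xi>))"
    using has_fourier_scale[OF abs_nabla_fourier[OF assms F], of c] by (simp add: mult.left_commute)
  from abs_nabla_eqI[OF has_fourier_scale[OF F] this]
  show "(\<lambda>x. c * f x) \<in> H1" "AE x in lborel. abs_nabla (\<lambda>x. c * f x) x = c * abs_nabla f x" .
qed

lemma H1_reflect: assumes "f \<in> H1"
  shows "(\<lambda>x. f (- x)) \<in> H1" "AE x in lborel. abs_nabla (\<lambda>x. f (- x)) x = abs_nabla f (- x)"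
proof -
  obtain F where F: "has_fourier f F" using assms by (metis H1E)
  have "has_fourier (\<lambda>x. abs_nabla f (- x)) (\<lambda>\<xi>. complex_of_real \<bar>\<xi>\<bar> * F (- \<xi>))"
    using has_fourier_reflect[OF abs_nabla_fourier[OF assms F]] by simp
  from abs_nabla_eqI[OF has_fourier_reflect[OF F] this]
  show "(\<lambda>x. f (- x)) \<in> H1" "AE x in lborel. abs_nabla (\<lambda>x. f (- x)) x = abs_nabla f (- x)" .
qed

lemma H1_zero: "(\<lambda>x. 0) \<in> H1"
  using H1I[OF has_fourier_zero] by simp

lemma H1_cong_AE:
  assumes "f \<in> H1" "g \<in> borel_measurable borel" "AE x in lborel. f x = g x"
  shows "g \<in> H1" "AE x in lborel. abs_nabla g x = abs_nabla f x"
proof -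
  obtain F where F: "has_fourier f F" using assms by (metis H1E)
  have F': "has_fourier g F"
    using has_fourier_L2[OF F] by (intro has_fourier_cong_AE[OF F] assms) auto
  show "g \<in> H1" "AE x in lborel. abs_nabla g x = abs_nabla f x"
    using abs_nabla_eqI[OF F' abs_nabla_fourier[OF assms(1) F]] .
qed

section \<open>Band-limited functions and self-adjointness\<close>

lemma band_limited_H1:
  assumes "has_fourier f G" "\<And>\<xi>. \<bar>\<xi>\<bar> > c \<Longrightarrow> G \<xi> = 0"
  shows "f \<in> H1"
proof (rule H1I[OF assms(1)])
  have G: "G \<in> L2" using has_fourier_L2[OF assms(1)] by simp
  then have [measurable]: "G \<in> borel_measurable borel" by auto
  show "(\<lambda>\<xi>. complex_of_real \<bar>\<xi>\<bar> * G \<xi>) \<in> L2"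
  proof (rule L2_dominated[OF _ G, of _ c])
    show "AE \<xi> in lborel. norm (complex_of_real \<bar>\<xi>\<bar> * G \<xi>) \<le> c * norm (G \<xi>)"
    proof (rule AE_I2)
      fix \<xi> show "norm (complex_of_real \<bar>\<xi>\<bar> * G \<xi>) \<le> c * norm (G \<xi>)"
        using assms(2)[of \<xi>] by (cases "\<bar>\<xi>\<bar> > c") (auto simp: norm_mult intro!: mult_right_mono)
    qed
  qed measurable
qed

lemma trunc_band: "\<bar>\<xi>\<bar> > real n \<Longrightarrow> trunc n G \<xi> = 0"
  by (auto simp: trunc_def indicator_def)

lemma H1_dense:
  assumes f: "f \<in> L2" and e: "e > 0"
  shows "\<exists>g\<in>H1. L2_norm (\<lambda>x. f x - g x) < e"
proof -
  obtain F where F: "has_fourier f F" using has_fourier_exists[OF f] .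
  have FL2: "F \<in> L2" using F by (rule has_fourier_L2)
  have "\<forall>\<^sub>F n in sequentially. L2_norm (\<lambda>x. trunc n F x - F x) < sqrt (2 * pi) * e"
    using trunc_tendsto[OF FL2] e by (intro order_tendstoD) auto
  then obtain n where n: "L2_norm (\<lambda>x. trunc n F x - F x) < sqrt (2 * pi) * e"
    by (meson eventually_happens' sequentially_bot)
  obtain g where g: "has_fourier g (trunc n F)" using has_fourier_surj[OF trunc_L2[OF FL2]] .
  have "g \<in> H1" using trunc_band by (rule band_limited_H1[OF g])
  moreover have "L2_norm (\<lambda>x. g x - f x) < e"
    using n has_fourier_norm[OF has_fourier_diff[OF g F]] by simp
  ultimately show ?thesis by (intro bexI[of _ g]) (simp_all add: L2_norm_minus_commute[of f g])
qed

lemma abs_nabla_symmetric: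
  assumes "f \<in> H1" "g \<in> H1"
  shows "L2_inner (abs_nabla f) g = L2_inner f (abs_nabla g)"
proof -
  obtain F G where F: "has_fourier f F" and G: "has_fourier g G" using assms by (metis H1E)
  have "complex_of_real (2 * pi) * L2_inner (abs_nabla f) g = complex_of_real (2 * pi) * L2_inner f (abs_nabla g)"
    unfolding has_fourier_inner[OF abs_nabla_fourier[OF assms(1) F] G, symmetric]
      has_fourier_inner[OF F abs_nabla_fourier[OF assms(2) G], symmetric]
    unfolding L2_inner_def by (simp add: mult_ac)
  then show ?thesis by simp
qed

text \<open>Let D be the defect \<bar>\<xi>\<bar> U - V. Testing the adjoint relation with the
  band-limited function whose transform is the truncation of D yields the squared norm of that
  truncation, which is therefore 0.\<close>

lemma abs_nabla_adjoint:
  assumes u: "u \<in> L2" and v: "v \<in> L2"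
    and adj: "\<And>f. f \<in> H1 \<Longrightarrow> L2_inner (abs_nabla f) u = L2_inner f v"
  shows "u \<in> H1" "AE x in lborel. abs_nabla u x = v x"
proof -
  obtain U V where U: "has_fourier u U" and V: "has_fourier v V"
    using u v has_fourier_exists by metis
  have UV: "U \<in> L2" "V \<in> L2" using U V by (auto simp: has_fourier_def)
  then have [measurable]: "U \<in> borel_measurable borel" "V \<in> borel_measurable borel" by auto
  define D where "D \<xi> = complex_of_real \<bar>\<xi>\<bar> * U \<xi> - V \<xi>" for \<xi>
  have [measurable]: "D \<in> borel_measurable borel" unfolding D_def by measurable
  have "AE \<xi> in lborel. indicator {-real n..real n} \<xi> * D \<xi> = 0" for n
  proof -
    have tU: "(\<lambda>\<xi>. complex_of_real \<bar>\<xi>\<bar> * trunc n U \<xi>) \<in> L2"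
    proof (rule L2_dominated[OF _ UV(1), of _ "real n"])
      show "AE \<xi> in lborel. norm (complex_of_real \<bar>\<xi>\<bar> * trunc n U \<xi>) \<le> real n * norm (U \<xi>)"
        by (auto simp: trunc_def indicator_def norm_mult intro!: mult_right_mono AE_I2)
    qed (simp add: trunc_def)
    have D_eq: "trunc n D = (\<lambda>\<xi>. complex_of_real \<bar>\<xi>\<bar> * trunc n U \<xi> - trunc n V \<xi>)"
      by (rule ext) (simp add: trunc_def D_def algebra_simps)
    have DL2: "trunc n D \<in> L2" unfolding D_eq by (intro L2_diff tU trunc_L2 UV)
    obtain f where f: "has_fourier f (trunc n D)" using has_fourier_surj[OF DL2] .
    have fH1: "f \<in> H1" using trunc_band by (rule band_limited_H1[OF f])
    have wL2: "(\<lambda>\<xi>. complex_of_real \<bar>\<xi>\<bar> * trunc n D \<xi>) \<in> L2" by (rule H1_weight[OF fH1 f])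
    have "L2_inner (\<lambda>\<xi>. complex_of_real \<bar>\<xi>\<bar> * trunc n D \<xi>) U = L2_inner (trunc n D) V"
      using adj[OF fH1] has_fourier_inner[OF abs_nabla_fourier[OF fH1 f] U] has_fourier_inner[OF f V] by simp
    moreover have "L2_inner (trunc n D) (trunc n D)
        = L2_inner (\<lambda>\<xi>. complex_of_real \<bar>\<xi>\<bar> * trunc n D \<xi>) U - L2_inner (trunc n D) V"
    proof -
      have "L2_inner (trunc n D) (trunc n D)
          = (LINT \<xi>|lborel. complex_of_real \<bar>\<xi>\<bar> * trunc n D \<xi> * cnj (U \<xi>) - trunc n D \<xi> * cnj (V \<xi>))"
        unfolding L2_inner_def
        by (intro Bochner_Integration.integral_cong)
          (auto simp: trunc_def indicator_def D_def algebra_simps)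
      then show ?thesis unfolding L2_inner_def
        by (simp add: L2_inner_integrable wL2 DL2 UV)
    qed
    ultimately have "L2_norm (trunc n D) = 0" using L2_inner_self[OF DL2] by simp
    then show ?thesis using L2_norm_eq_0[OF DL2] by (simp add: trunc_def)
  qed
  then have "AE \<xi> in lborel. \<forall>n. indicator {-real n..real n} \<xi> * D \<xi> = 0"
    unfolding AE_all_countable by (rule allI)
  then have D0: "AE \<xi> in lborel. V \<xi> = complex_of_real \<bar>\<xi>\<bar> * U \<xi>"
  proof eventually_elim
    case (elim \<xi>)
    obtain n :: nat where "\<bar>\<xi>\<bar> \<le> real n" using real_arch_simple by blast
    then have "\<xi> \<in> {-real n..real n}" by auto
    with elim[rule_format, of n] show ?case by (simp add: D_def)
  qed
  have "has_fourier v (\<lambda>\<xi>. complex_of_real \<bar>\<xi>\<bar> * U \<xi>)"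
    by (rule has_fourier_cong_AE[OF V]) (use v D0 in auto)
  from abs_nabla_eqI[OF U this] show "u \<in> H1" "AE x in lborel. abs_nabla u x = v x" .
qed

text \<open>The factor 1 / (2 pi) is estimated by 1, since only the order of magnitude of the sup
  norm matters for the Weyl functions below.\<close>

lemma inverse_fourier_sup_bound:
  assumes "has_fourier f G" "integrable lborel G"
  shows "AE x in lborel. norm (f x) \<le> (LINT \<xi>|lborel. norm (G \<xi>))"
proof -
  have G: "G \<in> L2" using has_fourier_L2[OF assms(1)] by simp
  have "AE x in lborel. f x - 1 / (2 * pi) * FT G (- x) = 0"
    using has_fourier_AE_zero_iff[OF has_fourier_diff[OF assms(1) has_fourier_inverse_FT[OF G assms(2)]]] by simp
  then show ?thesis
  proof eventually_elim
    case (elim x)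
    have "norm (f x) = norm (FT G (- x)) / (2 * pi)" using elim by (simp add: norm_mult norm_divide)
    also have "\<dots> \<le> norm (FT G (- x)) / 1"
      using pi_ge_two by (intro divide_left_mono) auto
    also have "\<dots> \<le> (LINT \<xi>|lborel. norm (G \<xi>))" using FT_bound by simp
    finally show ?case .
  qed
qed

text \<open>\<open>C\<close> stands for the perturbation that is subtracted from \<open>|\<nabla>|\<close>. The last assumption, a bound
  from \<open>L\<^sup>\<infinity>\<close> to \<open>L\<^sup>2\<close>, replaces relative compactness.\<close>

locale perturbation =
  fixes C :: "(real \<Rightarrow> complex) \<Rightarrow> real \<Rightarrow> complex" and K :: real
  assumes C_L2: "f \<in> L2 \<Longrightarrow> C f \<in> L2"
    and C_symmetric: "f \<in> L2 \<Longrightarrow> g \<in> L2 \<Longrightarrow> L2_inner (C f) g = L2_inner f (C g)"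
    and C_bound: "f \<in> L2 \<Longrightarrow> AE x in lborel. norm (f x) \<le> s \<Longrightarrow> L2_norm (C f) \<le> K * s"
begin

definition T :: "(real \<Rightarrow> complex) \<Rightarrow> real \<Rightarrow> complex" where
  "T f x = abs_nabla f x - C f x"

lemma T_L2: "f \<in> H1 \<Longrightarrow> T f \<in> L2"
  unfolding T_def[abs_def] by (intro L2_diff abs_nabla_L2 C_L2 H1_L2)

lemma T_symmetric: "f \<in> H1 \<Longrightarrow> g \<in> H1 \<Longrightarrow> L2_inner (T f) g = L2_inner f (T g)"
  unfolding T_def[abs_def]
  by (simp add: L2_inner_diff_left L2_inner_diff_right abs_nabla_L2 C_L2 H1_L2
      abs_nabla_symmetric C_symmetric)

text \<open>C is symmetric and defined on all of \<open>L2\<close>, so (u, v) is in the adjoint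
  graph of T exactly when (u, v + C u) is in that of |\<nabla>|.\<close>

lemma self_adjoint_T: "self_adjoint H1 T"
  unfolding self_adjoint_def
proof (intro conjI ballI allI impI)
  show "H1 \<subseteq> L2" using H1_L2 by auto
  show "T ` H1 \<subseteq> L2" using T_L2 by auto
  show "\<exists>g\<in>H1. L2_norm (\<lambda>x. f x - g x) < e" if "f \<in> L2" "e > 0" for f e
    using H1_dense that .
  fix u v assume u: "u \<in> L2" and v: "v \<in> L2"
  show "(\<forall>f\<in>H1. L2_inner (T f) u = L2_inner f v) \<longleftrightarrow> u \<in> H1 \<and> (AE x in lborel. T u x = v x)"
  proof
    assume adj: "\<forall>f\<in>H1. L2_inner (T f) u = L2_inner f v"
    have v': "(\<lambda>x. v x + C u x) \<in> L2" by (intro L2_add v C_L2 u)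
    have "L2_inner (abs_nabla f) u = L2_inner f (\<lambda>x. v x + C u x)" if f: "f \<in> H1" for f
    proof -
      have "L2_inner (T f) u = L2_inner (abs_nabla f) u - L2_inner (C f) u"
        unfolding T_def[abs_def] by (intro L2_inner_diff_left abs_nabla_L2 C_L2 H1_L2 f u)
      then show ?thesis using adj f u v
        by (simp add: L2_inner_add_right C_L2 H1_L2 C_symmetric algebra_simps)
    qed
    from abs_nabla_adjoint[OF u v' this]
    show "u \<in> H1 \<and> (AE x in lborel. T u x = v x)" by (auto simp: T_def)
  next
    assume "u \<in> H1 \<and> (AE x in lborel. T u x = v x)"
    then have uH: "u \<in> H1" and ae: "AE x in lborel. T u x = v x" by auto
    show "\<forall>f\<in>H1. L2_inner (T f) u = L2_inner f v"
      using T_symmetric[OF _ uH] ae by (auto intro!: L2_inner_cong_AE H1_L2 T_L2 uH v)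
  qed
qed

lemma eigenvalue_real:
  assumes f: "f \<in> H1" and ev: "AE x in lborel. T f x = z * f x" and nz: "\<not> (AE x in lborel. f x = 0)"
  shows "z \<in> \<real>"
proof -
  have fL: "f \<in> L2" using f by (rule H1_L2)
  have "L2_inner (T f) f = L2_inner (\<lambda>x. z * f x) f"
    using ev by (intro L2_inner_cong_AE T_L2 f fL L2_scale) auto
  then have 1: "L2_inner (T f) f = z * L2_inner f f" by (simp add: L2_inner_scale_left)
  moreover have "L2_inner (T f) f = cnj (L2_inner (T f) f)"
    using T_symmetric[OF f f] L2_inner_commute[of f "T f"] by simp
  ultimately have "z * L2_inner f f = cnj z * L2_inner f f"
    by (simp add: L2_inner_self[OF fL])
  moreover have "L2_inner f f \<noteq> 0" using L2_inner_self[OF fL] L2_norm_eq_0[OF fL] nz by simp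
  ultimately have "z = cnj z" by simp
  then show ?thesis by (metis Reals_cnj_iff)
qed

text \<open>For the function f with transform the indicator of [E, E + \<delta>], the norm of f is
  of order sqrt \<delta>, the norm of (|\<nabla>| - E) f is at most \<delta> sqrt \<delta>, and the
  sup bound of order \<delta> gives norm at most K \<delta> for C f. A bounded inverse would force
  sqrt \<delta> to be bounded below.\<close>

lemma nonneg_in_spectrum:
  assumes E: "E \<ge> 0" shows "complex_of_real E \<in> spectrum H1 T"
  unfolding spectrum_def
proof (rule ComplI)
  assume "complex_of_real E \<in> resolvent_set H1 T"
  then obtain c where c: "\<And>f. f \<in> H1 \<Longrightarrow> L2_norm f \<le> c * L2_norm (\<lambda>x. T f x - of_real E * f x)"
    by (auto simp: resolvent_set_def)
  have bound: "1 / sqrt (2 * pi) \<le> \<bar>c\<bar> * (sqrt (1 / real (Suc n)) * (1 + \<bar>K\<bar>))" for n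
  proof -
    define \<delta> where "\<delta> = 1 / real (Suc n)"
    have d: "\<delta> > 0" "\<delta> \<le> 1" by (auto simp: \<delta>_def)
    define I where "I = (indicator {E..E+\<delta>} :: real \<Rightarrow> complex)"
    have I: "I \<in> L2" "integrable lborel I"
      using interval_indicator_L2[of E "E+\<delta>"]
        L2_mult_integrable[OF interval_indicator_L2[of E "E+\<delta>"] interval_indicator_L2[of E "E+\<delta>"]]
      by (simp_all add: I_def flip: indicator_inter_arith)
    have norm_I: "(\<lambda>\<xi>. norm (I \<xi>)) = indicator {E..E+\<delta>}" by (auto simp: I_def indicator_def)
    have intI: "(LINT \<xi>|lborel. norm (I \<xi>)) = \<delta>" unfolding norm_I using d by simp
    have nI: "L2_norm I = sqrt \<delta>"
    proof -
      have "(\<lambda>\<xi>. (norm (I \<xi>))\<^sup>2) = (\<lambda>\<xi>. norm (I \<xi>))" by (auto simp: I_def indicator_def)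
      then show ?thesis using intI by (simp add: L2_norm_def)
    qed
    obtain f where f: "has_fourier f I" using has_fourier_surj[OF I(1)] .
    have fH1: "f \<in> H1"
      by (rule band_limited_H1[OF f, of "E + 1"]) (use d E in \<open>auto simp: I_def indicator_def\<close>)
    have fn: "L2_norm f = sqrt \<delta> / sqrt (2 * pi)" using has_fourier_norm[OF f] nI by simp
    have Cf: "L2_norm (C f) \<le> K * \<delta>"
      using inverse_fourier_sup_bound[OF f I(2)] intI by (intro C_bound H1_L2 fH1) auto
    have "L2_norm (\<lambda>x. abs_nabla f x - of_real E * f x)
        = L2_norm (\<lambda>\<xi>. complex_of_real \<bar>\<xi>\<bar> * I \<xi> - of_real E * I \<xi>) / sqrt (2 * pi)"
      using has_fourier_norm[OF has_fourier_diff[OF abs_nabla_fourier[OF fH1 f] has_fourier_scale[OF f, of "of_real E"]]]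
      by simp
    also have "\<dots> \<le> (\<delta> * L2_norm I) / sqrt (2 * pi)"
    proof (intro divide_right_mono L2_norm_dominated I)
      show "AE \<xi> in lborel. norm (complex_of_real \<bar>\<xi>\<bar> * I \<xi> - of_real E * I \<xi>) \<le> \<delta> * norm (I \<xi>)"
        using E d by (intro AE_I2) (auto simp: I_def indicator_def simp flip: of_real_diff)
    qed (use d I in auto)
    finally have "L2_norm (\<lambda>x. abs_nabla f x - of_real E * f x) \<le> \<delta> * L2_norm I / sqrt (2 * pi)" .
    also have "\<dots> \<le> \<delta> * L2_norm I / 1"
      using d pi_ge_two by (intro divide_left_mono) (auto simp: real_le_rsqrt)
    finally have nab: "L2_norm (\<lambda>x. abs_nabla f x - of_real E * f x) \<le> \<delta> * sqrt \<delta>" by (simp add: nI)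
    have "L2_norm (\<lambda>x. T f x - of_real E * f x)
        = L2_norm (\<lambda>x. (abs_nabla f x - of_real E * f x) - C f x)"
      by (simp add: T_def algebra_simps)
    also have "\<dots> \<le> \<delta> * sqrt \<delta> + K * \<delta>"
      using L2_norm_triangle_diff[OF L2_diff[OF abs_nabla_L2[OF fH1] L2_scale[OF H1_L2[OF fH1], of "of_real E"]]
          C_L2[OF H1_L2[OF fH1]]] nab Cf by linarith
    also have "\<dots> \<le> \<delta> * (1 + \<bar>K\<bar>)"
    proof -
      have "\<delta> * sqrt \<delta> \<le> \<delta> * 1" using d by (intro mult_left_mono) auto
      moreover have "K * \<delta> \<le> \<bar>K\<bar> * \<delta>" using d by (intro mult_right_mono) auto
      ultimately show ?thesis by (simp add: algebra_simps)
    qed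
    finally have "\<bar>c\<bar> * L2_norm (\<lambda>x. T f x - of_real E * f x) \<le> \<bar>c\<bar> * (\<delta> * (1 + \<bar>K\<bar>))"
      by (rule mult_left_mono) simp
    moreover have "c * L2_norm (\<lambda>x. T f x - of_real E * f x) \<le> \<bar>c\<bar> * L2_norm (\<lambda>x. T f x - of_real E * f x)"
      by (intro mult_right_mono) auto
    ultimately have "sqrt \<delta> / sqrt (2 * pi) \<le> \<bar>c\<bar> * (\<delta> * (1 + \<bar>K\<bar>))" using c[OF fH1] fn by simp
    also have "\<dots> = sqrt \<delta> * (\<bar>c\<bar> * (sqrt \<delta> * (1 + \<bar>K\<bar>)))" using d by simp
    finally have "sqrt \<delta> * (1 / sqrt (2 * pi)) \<le> sqrt \<delta> * (\<bar>c\<bar> * (sqrt \<delta> * (1 + \<bar>K\<bar>)))" by simp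
    then show ?thesis unfolding \<delta>_def[symmetric] using d by (simp only: mult_le_cancel_left_pos real_sqrt_gt_zero)
  qed
  have "(\<lambda>n. \<bar>c\<bar> * (sqrt (1 / real (Suc n)) * (1 + \<bar>K\<bar>))) \<longlonglongrightarrow> \<bar>c\<bar> * (0 * (1 + \<bar>K\<bar>))"
    by (intro tendsto_mult tendsto_const) real_asymp
  then have "1 / sqrt (2 * pi) \<le> \<bar>c\<bar> * (0 * (1 + \<bar>K\<bar>))"
    by (rule LIMSEQ_le_const) (use bound in blast)
  then show False using pi_gt_zero by (simp add: not_le)
qed

text \<open>No E \<ge> 0 is isolated, because E + d/2 is again in the spectrum for every d > 0. The
  finitely many points of N are isolated eigenvalues of finite multiplicity and are thereby
  removed.\<close>

lemma essential_spectrum_T: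
  assumes N: "finite N" "\<And>E. E \<in> N \<Longrightarrow> E < 0"
    and res: "\<And>z. z \<notin> complex_of_real ` {0..} \<Longrightarrow> z \<notin> complex_of_real ` N \<Longrightarrow> z \<in> resolvent_set H1 T"
    and dim: "\<And>E. E \<in> N \<Longrightarrow> \<exists>k\<ge>1. has_dim_AE (eigenspace H1 T (complex_of_real E)) k"
  shows "essential_spectrum H1 T = complex_of_real ` {0..}"
proof
  have sub: "spectrum H1 T \<subseteq> complex_of_real ` {0..} \<union> complex_of_real ` N"
    using res by (auto simp: spectrum_def)
  show "complex_of_real ` {0..} \<subseteq> essential_spectrum H1 T"
  proof
    fix z assume "z \<in> complex_of_real ` {0..}"
    then obtain E where E: "z = of_real E" "E \<ge> 0" by auto
    have "\<not> z isolated_in spectrum H1 T"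
    proof
      assume "z isolated_in spectrum H1 T"
      then obtain U where U: "open U" "U \<inter> spectrum H1 T = {z}" by (auto simp: isolated_in_def)
      then obtain d where d: "d > 0" "ball z d \<subseteq> U" by (metis Int_iff insertI1 openE)
      have "complex_of_real (E + d / 2) \<in> ball z d" using d by (simp add: E dist_norm norm_minus_commute flip: of_real_diff)
      moreover have "complex_of_real (E + d / 2) \<in> spectrum H1 T"
        using d E by (intro nonneg_in_spectrum) auto
      ultimately have "complex_of_real (E + d / 2) = z" using U d by blast
      then have "E + d / 2 = E" unfolding E by (simp only: of_real_eq_iff)
      then show False using d by simp
    qed
    then show "z \<in> essential_spectrum H1 T"
      using nonneg_in_spectrum[OF E(2)] E by (simp add: essential_spectrum_def discrete_spectrum_def)
  qed
  show "essential_spectrum H1 T \<subseteq> complex_of_real ` {0..}"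
  proof
    fix z assume z: "z \<in> essential_spectrum H1 T"
    show "z \<in> complex_of_real ` {0..}"
    proof (rule ccontr)
      assume nz: "z \<notin> complex_of_real ` {0..}"
      have zs: "z \<in> spectrum H1 T" using z by (simp add: essential_spectrum_def)
      then obtain E where E: "z = of_real E" "E \<in> N" using sub nz by auto
      let ?S = "complex_of_real ` {0..} \<union> complex_of_real ` (N - {E})"
      have "closed ((\<lambda>x. complex_of_real x) ` {0..})"
      proof -
        have "complex_of_real ` {0..} = \<real>\<^sub>\<ge>\<^sub>0" by (auto simp: nonneg_Reals_def)
        then show ?thesis by simp
      qed
      then have "closed ?S" using N(1) by (intro closed_Un) (auto intro: finite_imp_closed)
      moreover have "z \<notin> ?S" using nz E by auto
      ultimately have "- ?S \<inter> spectrum H1 T = {z}"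
        using sub zs E by auto
      moreover have "open (- ?S)" using \<open>closed ?S\<close> by (rule open_Compl)
      ultimately have "z isolated_in spectrum H1 T" using zs by (auto simp: isolated_in_def)
      then have "z \<in> discrete_spectrum H1 T" using dim[OF E(2)] E by (auto simp: discrete_spectrum_def)
      then show False using z by (simp add: essential_spectrum_def)
    qed
  qed
qed

end

section \<open>The Hardy space\<close>

text \<open>The Cayley transform, written \<beta> in the overview.\<close>

definition cay :: "real \<Rightarrow> complex" where
  "cay x = (complex_of_real x - \<i>) / (complex_of_real x + \<i>)"

text \<open>The inverse transform of 2 pi times the one-sided exponential; it is also e_0, the first
  function of the orthogonal system.\<close>

definition res :: "real \<Rightarrow> complex" where
  "res x = 1 / (1 - \<i> * complex_of_real x)"

lemma nonzero_shifts:
  "complex_of_real x + \<i> \<noteq> 0" "1 - \<i> * complex_of_real x \<noteq> 0" "1 + \<i> * complex_of_real x \<noteq> 0"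
  by (auto simp: complex_eq_iff)

lemma one_plus_square: "(1 - \<i> * complex_of_real x) * (1 + \<i> * complex_of_real x) = 1 + (complex_of_real x)\<^sup>2"
  by (simp add: algebra_simps power2_eq_square)

lemma cnj_res: "cnj (res x) = 1 / (1 + \<i> * complex_of_real x)"
  by (simp add: res_def)

lemma res_reflect: "res (- x) = cnj (res x)"
  by (simp add: cnj_res res_def)

text \<open>Through this form multiplication by \<open>cay\<close> becomes, on the Fourier side, the
  identity minus twice a one-sided convolution.\<close>

lemma cay_eq: "cay x = 1 - 2 * res x"
proof -
  have "complex_of_real x - \<i> = - \<i> * (1 + \<i> * complex_of_real x)"
    "complex_of_real x + \<i> = \<i> * (1 - \<i> * complex_of_real x)" by (simp_all add: algebra_simps)
  then have "cay x = - ((1 + \<i> * complex_of_real x) / (1 - \<i> * complex_of_real x))"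
    by (simp add: cay_def)
  also have "\<dots> = 1 - 2 * res x"
    unfolding res_def using nonzero_shifts[of x] by (simp add: divide_simps)
  finally show ?thesis .
qed

lemma cay_alt: "cay x * (1 - \<i> * complex_of_real x) = - (1 + \<i> * complex_of_real x)"
  unfolding cay_eq res_def using nonzero_shifts[of x] by (simp add: field_simps)

lemma res_mult_cnj: "res x * cnj (res x) = complex_of_real (1 / (1 + x\<^sup>2))"
  unfolding cnj_res unfolding res_def using one_plus_square[of x] by simp

lemma res_plus_cnj: "res x + cnj (res x) = complex_of_real (2 / (1 + x\<^sup>2))"
proof -
  have "res x + cnj (res x) = 2 * (res x * cnj (res x))"
    unfolding cnj_res unfolding res_def using nonzero_shifts[of x] by (simp add: field_simps)
  also have "\<dots> = complex_of_real (2 / (1 + x\<^sup>2))" unfolding res_mult_cnj by simp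
  finally show ?thesis .
qed

text \<open>The relation behind the index shift n to -n - 1 under reflection and behind the
  cancellation in \<open>abs_nabla_cay_mult\<close>.\<close>

lemma cay_cnj_res: "cay x * cnj (res x) = - res x"
  using cay_alt[of x] nonzero_shifts[of x] unfolding cnj_res res_def by (simp add: field_simps)

lemma cay_inverse: "cay x * (1 - 2 * cnj (res x)) = 1"
proof -
  have "cay x * (1 - 2 * cnj (res x)) = cay x - 2 * (cay x * cnj (res x))" by (simp add: algebra_simps)
  also have "\<dots> = cay x + 2 * res x" unfolding cay_cnj_res by simp
  also have "\<dots> = 1" by (simp add: cay_eq)
  finally show ?thesis .
qed

lemma cay_nz [simp]: "cay x \<noteq> 0"
  using cay_inverse[of x] by auto

lemma inverse_cay: "inverse (cay x) = 1 - 2 * cnj (res x)"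
  using cay_inverse[of x] by (rule inverse_unique)

lemma cnj_cay: "cnj (cay x) = inverse (cay x)"
  unfolding inverse_cay by (simp add: cay_eq)

lemma norm_cay [simp]: "norm (cay x) = 1"
proof -
  have "complex_of_real ((norm (cay x))\<^sup>2) = 1"
    unfolding complex_norm_square cnj_cay by simp
  then have "(norm (cay x))\<^sup>2 = 1" by (simp only: of_real_eq_1_iff)
  then show ?thesis by (simp add: power2_eq_1_iff) (metis norm_ge_zero not_one_le_zero neg_0_le_iff_le order_trans zero_le_one neg_le_0_iff_le)
qed

lemma norm_cay_powi [simp]: "norm (cay x powi n) = 1"
  by (simp add: norm_power_int)

lemma cay_reflect: "cay (- x) = inverse (cay x)"
  unfolding inverse_cay by (simp add: cay_eq res_reflect)

lemma cay_powi_reflect: "cay (- x) powi n = cay x powi (- n)"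
  by (simp add: cay_reflect power_int_inverse power_int_minus)

lemma norm_res_sq: "(norm (res x))\<^sup>2 = 1 / (1 + x\<^sup>2)"
proof -
  have "complex_of_real ((norm (res x))\<^sup>2) = complex_of_real (1 / (1 + x\<^sup>2))"
    unfolding complex_norm_square res_mult_cnj ..
  then show ?thesis by (simp only: of_real_eq_iff)
qed

lemma norm_res_le: "norm (res x) \<le> 1"
proof -
  have "(norm (res x))\<^sup>2 \<le> 1\<^sup>2" unfolding norm_res_sq by (simp add: divide_simps add_pos_nonneg)
  then show ?thesis by (rule power2_le_imp_le) simp
qed

lemma res_measurable [measurable]: "res \<in> borel_measurable borel"
  unfolding res_def by measurable

lemma cay_measurable [measurable]: "cay \<in> borel_measurable borel"
  unfolding cay_def by measurable

lemma cay_powi_measurable [measurable]: "(\<lambda>x. cay x powi n) \<in> borel_measurable borel"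
  unfolding power_int_def by measurable

lemma L2_cay_powi: "f \<in> L2 \<Longrightarrow> (\<lambda>x. cay x powi n * f x) \<in> L2"
  by (rule L2_mult_bounded[where C=1]) auto

lemma L2_norm_cay_powi: "L2_norm (\<lambda>x. cay x powi n * f x) = L2_norm f"
  by (simp add: L2_norm_def norm_mult)

lemma L2_inner_cay_powi: "L2_inner (\<lambda>x. cay x powi n * f x) g = L2_inner f (\<lambda>x. cay x powi (- n) * g x)"
  unfolding L2_inner_def by (simp add: cnj_cay power_int_inverse power_int_minus mult_ac)

section \<open>Exponential kernels on the half line\<close>

definition ek :: "real \<Rightarrow> real" where "ek s = indicator {0..} s * exp (- s)"

text \<open>The convolution of \<open>ek\<close> with itself, hence the kernel that belongs to
  multiplication by the square of \<open>res\<close>.\<close>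

definition sek :: "real \<Rightarrow> real" where "sek s = s * ek s"

lemma ek_measurable [measurable]: "ek \<in> borel_measurable borel"
  unfolding ek_def by measurable

lemma sek_measurable [measurable]: "sek \<in> borel_measurable borel"
  unfolding sek_def by measurable

lemma ek_nonneg: "0 \<le> ek s" by (simp add: ek_def)

lemma ek_integrable: "integrable lborel ek"
proof -
  have "(\<lambda>s. complex_of_real (ek s)) = (\<lambda>s. indicator {0..} s * exp (- (1 * of_real s)))"
    by (auto simp: ek_def indicator_def exp_of_real[symmetric])
  then have "integrable lborel (\<lambda>s. complex_of_real (ek s))" using exp_half_line(1)[of 1] by simp
  then show ?thesis by (simp add: complex_of_real_integrable_eq)
qed

lemma ek_L2: "(\<lambda>s. complex_of_real (ek s)) \<in> L2"
proof (rule L2I)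
  show "integrable lborel (\<lambda>s. (norm (complex_of_real (ek s)))\<^sup>2)"
    by (rule Bochner_Integration.integrable_bound[OF ek_integrable])
      (auto simp: ek_def indicator_def power2_eq_square mult_le_one intro!: mult_left_le AE_I2)
qed measurable

interpretation ek: conv_kernel ek
  by unfold_locales (auto intro: ek_nonneg ek_integrable ek_L2)

lemma ek_hat: "FT (\<lambda>s. complex_of_real (ek s)) (- x) = res x"
proof -
  have "FT (\<lambda>s. complex_of_real (ek s)) (- x)
      = (LINT s|lborel. indicator {0..} s * exp (- ((1 - \<i> * of_real x) * of_real s)))"
    unfolding FT_def
    by (intro Bochner_Integration.integral_cong)
      (auto simp: ek_def indicator_def complex_eq_iff Re_exp Im_exp mult.commute)
  also have "\<dots> = res x" by (subst exp_half_line(2)) (auto simp: res_def)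
  finally show ?thesis .
qed

lemma conv_ek_ek: "conv ek (\<lambda>s. complex_of_real (ek s)) = (\<lambda>s. complex_of_real (sek s))"
proof
  fix \<xi> :: real
  have "conv ek (\<lambda>s. complex_of_real (ek s)) \<xi> = (LINT s|lborel. indicator {0..\<xi>} s *\<^sub>R complex_of_real (exp (- \<xi>)))"
    unfolding conv_def
    by (intro Bochner_Integration.integral_cong)
      (auto simp: ek_def indicator_def exp_add[symmetric] simp flip: of_real_mult)
  also have "\<dots> = complex_of_real (sek \<xi>)"
    by (cases "0 \<le> \<xi>") (auto simp: sek_def ek_def scaleR_conv_of_real)
  finally show "conv ek (\<lambda>s. complex_of_real (ek s)) \<xi> = complex_of_real (sek \<xi>)" .
qed

interpretation sek: conv_kernel sek
proof
  have "integrable lborel (\<lambda>s. complex_of_real (sek s))"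
    using ek.conv_FT(1)[of "\<lambda>s. complex_of_real (ek s)"] ek_integrable by (simp add: conv_ek_ek)
  then show "integrable lborel sek" by (simp add: complex_of_real_integrable_eq)
  show "(\<lambda>s. complex_of_real (sek s)) \<in> L2"
    using ek.conv_L2_bound(1)[OF ek_L2] by (simp add: conv_ek_ek)
qed (auto simp: sek_def ek_def indicator_def)

lemma sek_hat: "FT (\<lambda>s. complex_of_real (sek s)) (- x) = (res x)\<^sup>2"
  using ek.conv_FT(2)[of "\<lambda>s. complex_of_real (ek s)" x] ek_integrable
  by (simp add: conv_ek_ek ek_hat power2_eq_square)

lemma has_fourier_res_mult:
  "has_fourier f G \<Longrightarrow> has_fourier (\<lambda>x. res x * f x) (conv ek G)"
  using ek.has_fourier_conv[of f G] by (simp add: ek_hat)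

lemma has_fourier_res2_mult:
  "has_fourier f G \<Longrightarrow> has_fourier (\<lambda>x. (res x)\<^sup>2 * f x) (conv sek G)"
  using sek.has_fourier_conv[of f G] by (simp add: sek_hat)

lemma has_fourier_cnj_res_mult:
  "has_fourier f G \<Longrightarrow> has_fourier (\<lambda>x. cnj (res x) * f x) (\<lambda>\<xi>. conv ek (\<lambda>\<eta>. G (- \<eta>)) (- \<xi>))"
  using has_fourier_reflect[OF has_fourier_res_mult[OF has_fourier_reflect[of f G]]]
  by (simp add: res_reflect)

lemma has_fourier_res: "has_fourier res (\<lambda>s. 2 * pi * complex_of_real (ek s))"
  using has_fourier_scale[OF has_fourier_inverse_FT[of "\<lambda>s. complex_of_real (ek s)"], of "2 * pi"]
  by (simp add: ek_L2 ek_integrable ek_hat)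

lemma res_L2: "res \<in> L2"
  using has_fourier_res by (rule has_fourier_L2)

lemma integral_inverse_square:
  "integrable lborel (\<lambda>x::real. 1 / (1 + x\<^sup>2))" "(LINT x|lborel. 1 / (1 + x\<^sup>2)) = (pi :: real)"
proof -
  have i: "(\<integral>\<^sup>+y. ennreal (2 / (1 + y\<^sup>2)) \<partial>lborel) = ennreal (2 * pi)"
    using poisson_kernel_total[of 1 0] by (simp add: poisson_kernel_def)
  have "integrable lborel (\<lambda>x::real. 2 / (1 + x\<^sup>2))"
    by (rule integrableI_nonneg) (auto simp: i)
  moreover have "(LINT x::real|lborel. 2 / (1 + x\<^sup>2)) = 2 * pi"
    using i by (subst integral_eq_nn_integral) auto
  ultimately show "integrable lborel (\<lambda>x::real. 1 / (1 + x\<^sup>2))" "(LINT x|lborel. 1 / (1 + x\<^sup>2)) = (pi :: real)"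
    using integrable_mult_right[of "1/2" lborel "\<lambda>x::real. 2 / (1 + x\<^sup>2)"]
      integral_mult_right_zero[of lborel "1/2" "\<lambda>x::real. 2 / (1 + x\<^sup>2)"] by auto
qed

text \<open>\<open>H\<^sup>+\<close>, with respect to the convention \<open>e\<^sup>-\<^sup>i\<^sup>x\<^sup>\<xi>\<close> of \<open>has_fourier\<close>. The other half
  \<open>H\<^sup>-\<close> is always reached by the reflection \<open>x \<mapsto> - x\<close>.\<close>

definition Hp :: "(real \<Rightarrow> complex) \<Rightarrow> bool" where
  "Hp f \<longleftrightarrow> (\<exists>G. has_fourier f G \<and> (\<forall>\<xi><0. G \<xi> = 0))"

lemma Hp_L2: "Hp f \<Longrightarrow> f \<in> L2"
  by (auto simp: Hp_def has_fourier_def)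

text \<open>\<open>Hp\<close> asks for a representative that vanishes at every negative frequency;
  multiplying the given one by the indicator of the half line provides it.\<close>

lemma HpI_AE:
  assumes "has_fourier f G" "AE \<xi> in lborel. \<xi> < 0 \<longrightarrow> G \<xi> = 0" shows "Hp f"
proof -
  have [measurable]: "G \<in> borel_measurable borel" using has_fourier_L2[OF assms(1)] by auto
  have "has_fourier f (\<lambda>\<xi>. indicator {0..} \<xi> * G \<xi>)"
    using has_fourier_L2[OF assms(1)] assms(2)
    by (intro has_fourier_cong_AE[OF assms(1)]) (auto elim!: eventually_mono simp: indicator_def)
  then show ?thesis unfolding Hp_def by (intro exI[of _ "\<lambda>\<xi>. indicator {0..} \<xi> * G \<xi>"]) simp
qed

lemma Hp_diff:
  assumes "Hp f" "Hp g" shows "Hp (\<lambda>x. f x - g x)"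
proof -
  obtain F G where "has_fourier f F" "has_fourier g G" "\<forall>\<xi><0. F \<xi> = 0" "\<forall>\<xi><0. G \<xi> = 0"
    using assms by (auto simp: Hp_def)
  then show ?thesis
    unfolding Hp_def by (intro exI[of _ "\<lambda>\<xi>. F \<xi> - G \<xi>"] conjI has_fourier_diff) auto
qed

lemma Hp_scale:
  assumes "Hp f" shows "Hp (\<lambda>x. c * f x)"
proof -
  obtain F where "has_fourier f F" "\<forall>\<xi><0. F \<xi> = 0" using assms by (auto simp: Hp_def)
  then show ?thesis
    unfolding Hp_def by (intro exI[of _ "\<lambda>\<xi>. c * F \<xi>"] conjI has_fourier_scale) auto
qed

lemma Hp_res: "Hp res"
  unfolding Hp_def using has_fourier_res by (intro exI conjI) (auto simp: ek_def)

text \<open>The kernel lives on s \<ge> 0, so the convolution at \<xi> only sees values of G at or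
  to the left of \<xi>. This makes multiplication by \<open>res\<close>, and then by
  \<open>cay\<close>, preserve the Hardy space.\<close>

lemma conv_ek_neg:
  assumes "\<And>\<xi>. \<xi> < 0 \<Longrightarrow> G \<xi> = 0" "\<xi> < 0" shows "conv ek G \<xi> = 0"
proof -
  have "conv ek G \<xi> = (LINT s::real|lborel. 0)"
    unfolding conv_def using assms by (intro Bochner_Integration.integral_cong) (auto simp: ek_def indicator_def)
  then show ?thesis by simp
qed

lemma Hp_res_mult: assumes "Hp f" shows "Hp (\<lambda>x. res x * f x)"
proof -
  obtain F where F: "has_fourier f F" "\<And>\<xi>. \<xi> < 0 \<Longrightarrow> F \<xi> = 0" using assms by (auto simp: Hp_def)
  show ?thesis unfolding Hp_def
    using has_fourier_res_mult[OF F(1)] conv_ek_neg[of F] F(2) by blast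
qed

lemma Hp_cay: assumes "Hp f" shows "Hp (\<lambda>x. cay x * f x)"
  using Hp_diff[OF assms Hp_scale[OF Hp_res_mult[OF assms], of 2]] by (simp add: cay_eq algebra_simps)

lemma Hp_cay_power: "Hp f \<Longrightarrow> Hp (\<lambda>x. cay x ^ k * f x)"
  by (induction k) (auto dest: Hp_cay simp: mult.assoc)

text \<open>The two transforms have supports that meet at most in \<xi> = 0, a null set, so Parseval
  gives 0.\<close>

lemma Hp_inner_orthogonal:
  assumes "Hp f" "Hp (\<lambda>x. g (- x))" shows "L2_inner f g = 0"
proof -
  obtain F G where F: "has_fourier f F" "\<And>\<xi>. \<xi> < 0 \<Longrightarrow> F \<xi> = 0"
    and G: "has_fourier (\<lambda>x. g (- x)) G" "\<And>\<xi>. \<xi> < 0 \<Longrightarrow> G \<xi> = 0"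
    using assms by (auto simp: Hp_def)
  have G': "has_fourier g (\<lambda>\<xi>. G (- \<xi>))" using has_fourier_reflect[OF G(1)] by simp
  have "L2_inner F (\<lambda>\<xi>. G (- \<xi>)) = (LINT \<xi>::real|lborel. 0)"
    unfolding L2_inner_def
  proof (rule integral_cong_AE)
    show "AE \<xi> in lborel. F \<xi> * cnj (G (- \<xi>)) = 0"
      using AE_lborel_singleton[of "0::real"]
      by eventually_elim (metis F(2) G(2) complex_cnj_zero mult_zero_left mult_zero_right neg_less_0_iff_less linorder_neqE_linordered_idom)
  qed (use L2_inner_integrable[OF has_fourier_L2(2)[OF F(1)] has_fourier_L2(2)[OF G']] in auto)
  then show ?thesis using has_fourier_inner[OF F(1) G'] by simp
qed

text \<open>Dividing by \<open>cay\<close> convolves with the reflected kernel, which looks to the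
  right. At \<xi> < 0 the result is exp \<xi> times one fixed integral, namely a multiple of the
  inner product with \<open>res\<close>; orthogonality to \<open>res\<close> is thus exactly the
  right condition.\<close>

lemma Hp_inverse_cay:
  assumes f: "Hp f" and orth: "L2_inner f res = 0" shows "Hp (\<lambda>x. inverse (cay x) * f x)"
proof -
  obtain F where F: "has_fourier f F" "\<And>\<xi>. \<xi> < 0 \<Longrightarrow> F \<xi> = 0" using f by (auto simp: Hp_def)
  have "L2_inner F (\<lambda>s. 2 * pi * complex_of_real (ek s)) = 0"
    using has_fourier_inner[OF F(1) has_fourier_res] orth by simp
  then have zero: "(LINT t|lborel. of_real (ek t) * F t) = 0"
    using integral_mult_right_zero[of lborel "2 * complex_of_real pi" "\<lambda>t. of_real (ek t) * F t"]
    by (simp add: L2_inner_def mult_ac)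
  have "conv ek (\<lambda>\<eta>. F (- \<eta>)) (- \<xi>) = 0" if "\<xi> < 0" for \<xi>
  proof -
    have "conv ek (\<lambda>\<eta>. F (- \<eta>)) (- \<xi>) = (LINT s|lborel. of_real (ek s) * F (\<xi> + s))"
      by (simp add: conv_def algebra_simps)
    also have "\<dots> = (LINT t|lborel. of_real (ek (t - \<xi>)) * F t)"
      using lborel_integral_real_affine[of 1 "\<lambda>t. of_real (ek (t - \<xi>)) * F t" \<xi>] by simp
    also have "\<dots> = (LINT t|lborel. of_real (exp \<xi>) * (of_real (ek t) * F t))"
      using that F(2)
      by (intro Bochner_Integration.integral_cong)
        (auto simp: ek_def indicator_def exp_diff exp_minus field_simps)
    also have "\<dots> = 0" using zero by simp
    finally show ?thesis .
  qed
  then have "Hp (\<lambda>x. cnj (res x) * f x)"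
    unfolding Hp_def using has_fourier_cnj_res_mult[OF F(1)] by blast
  from Hp_diff[OF f Hp_scale[OF this, of 2]] show ?thesis by (simp add: inverse_cay algebra_simps)
qed

text \<open>The Leibniz rule for - \<i> d/dx, since - \<i> times the derivative of
  \<open>res\<close> is its square. On the Fourier side it is the splitting \<xi> = (\<xi> - s) + s
  inside the convolution: the part with s turns \<open>ek\<close> into \<open>sek\<close>, and
  positivity of the frequencies lets \<bar>\<xi> - s\<bar> be read as \<xi> - s.\<close>

lemma abs_nabla_res_mult:
  assumes f: "f \<in> H1" "Hp f"
  shows "(\<lambda>x. res x * f x) \<in> H1"
    and "AE x in lborel. abs_nabla (\<lambda>x. res x * f x) x = res x * abs_nabla f x + (res x)\<^sup>2 * f x"
proof -
  obtain F where F: "has_fourier f F" "\<And>\<xi>. \<xi> < 0 \<Longrightarrow> F \<xi> = 0" using f by (auto simp: Hp_def)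
  let ?W = "\<lambda>\<xi>. complex_of_real \<bar>\<xi>\<bar> * F \<xi>"
  have W: "?W \<in> L2" using H1_weight[OF f(1) F(1)] .
  have FL: "F \<in> L2" using F(1) by (rule has_fourier_L2)
  have "conv ek ?W \<xi> + conv sek F \<xi> = complex_of_real \<bar>\<xi>\<bar> * conv ek F \<xi>" for \<xi>
  proof (cases "\<xi> < 0")
    case True
    then have "conv sek F \<xi> = (LINT s::real|lborel. 0)"
      unfolding conv_def using F(2)
      by (intro Bochner_Integration.integral_cong) (auto simp: sek_def ek_def indicator_def)
    then show ?thesis using True F(2) by (simp add: conv_ek_neg)
  next
    case False
    have "conv ek ?W \<xi> + conv sek F \<xi> = (LINT s|lborel. of_real (ek s) * ?W (\<xi> - s) + of_real (sek s) * F (\<xi> - s))"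
      unfolding conv_def
      using ek.conv_integrable[OF W, of \<xi>] sek.conv_integrable[OF FL, of \<xi>] by simp
    also have "\<dots> = (LINT s|lborel. of_real \<xi> * (of_real (ek s) * F (\<xi> - s)))"
    proof (rule Bochner_Integration.integral_cong[OF refl])
      fix s
      show "of_real (ek s) * ?W (\<xi> - s) + of_real (sek s) * F (\<xi> - s) = of_real \<xi> * (of_real (ek s) * F (\<xi> - s))"
        using F(2)[of "\<xi> - s"] by (cases "\<xi> - s < 0") (auto simp: sek_def algebra_simps)
    qed
    finally show ?thesis using False by (simp add: conv_def)
  qed
  moreover have "has_fourier (\<lambda>x. res x * abs_nabla f x + (res x)\<^sup>2 * f x) (\<lambda>\<xi>. conv ek ?W \<xi> + conv sek F \<xi>)"
    by (intro has_fourier_add has_fourier_res_mult has_fourier_res2_mult abs_nabla_fourier f F)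
  ultimately have "has_fourier (\<lambda>x. res x * abs_nabla f x + (res x)\<^sup>2 * f x) (\<lambda>\<xi>. complex_of_real \<bar>\<xi>\<bar> * conv ek F \<xi>)"
    by simp
  from abs_nabla_eqI[OF has_fourier_res_mult[OF F(1)] this]
  show "(\<lambda>x. res x * f x) \<in> H1"
    "AE x in lborel. abs_nabla (\<lambda>x. res x * f x) x = res x * abs_nabla f x + (res x)\<^sup>2 * f x" .
qed

text \<open>Here the potential appears: - \<i> times the derivative of \<open>cay\<close> is -2
  \<open>res\<close>^2, which equals 2 / (1 + x^2) times \<open>cay\<close>.\<close>

lemma abs_nabla_cay_mult:
  assumes f: "f \<in> H1" "Hp f"
  shows "(\<lambda>x. cay x * f x) \<in> H1"
    and "AE x in lborel. abs_nabla (\<lambda>x. cay x * f x) x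
       = cay x * abs_nabla f x + complex_of_real (2 / (1 + x\<^sup>2)) * (cay x * f x)"
proof -
  note r = abs_nabla_res_mult[OF f]
  have eq: "(\<lambda>x. cay x * f x) = (\<lambda>x. f x + (-2) * (res x * f x))" by (auto simp: cay_eq algebra_simps)
  have s: "(\<lambda>x. (-2) * (res x * f x)) \<in> H1" by (rule H1_scale[OF r(1)])
  show "(\<lambda>x. cay x * f x) \<in> H1" unfolding eq by (rule H1_add[OF f(1) s])
  have c: "cay x * abs_nabla f x + complex_of_real (2 / (1 + x\<^sup>2)) * (cay x * f x)
      = abs_nabla f x + (-2) * (res x * abs_nabla f x + (res x)\<^sup>2 * f x)" for x
  proof -
    have "complex_of_real (2 / (1 + x\<^sup>2)) = 2 * (res x * cnj (res x))"
      unfolding res_mult_cnj by simp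
    then have "complex_of_real (2 / (1 + x\<^sup>2)) * cay x = 2 * res x * (cay x * cnj (res x))"
      by simp
    also have "\<dots> = - 2 * (res x)\<^sup>2" by (simp add: cay_cnj_res power2_eq_square)
    finally have c1: "complex_of_real (2 / (1 + x\<^sup>2)) * cay x = - 2 * (res x)\<^sup>2" .
    have "cay x * abs_nabla f x + complex_of_real (2 / (1 + x\<^sup>2)) * (cay x * f x)
        = (1 - 2 * res x) * abs_nabla f x + (complex_of_real (2 / (1 + x\<^sup>2)) * cay x) * f x"
      by (simp only: mult.assoc) (simp only: cay_eq)
    then show ?thesis unfolding c1 by (simp add: algebra_simps)
  qed
  show "AE x in lborel. abs_nabla (\<lambda>x. cay x * f x) x
       = cay x * abs_nabla f x + complex_of_real (2 / (1 + x\<^sup>2)) * (cay x * f x)"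
    unfolding c unfolding eq
    using H1_add(2)[OF f(1) s] H1_scale(2)[OF r(1), of "-2"] r(2) by eventually_elim simp
qed

lemma abs_nabla_cay_power:
  assumes f: "f \<in> H1" "Hp f"
  shows "(\<lambda>x. cay x ^ k * f x) \<in> H1 \<and> (AE x in lborel. abs_nabla (\<lambda>x. cay x ^ k * f x) x
       = cay x ^ k * abs_nabla f x + complex_of_real (2 * real k / (1 + x\<^sup>2)) * (cay x ^ k * f x))"
proof (induction k)
  case 0 then show ?case using f by simp
next
  case (Suc k)
  have eq: "(\<lambda>x. cay x ^ Suc k * f x) = (\<lambda>x. cay x * (cay x ^ k * f x))" by (simp add: mult.assoc)
  note s = abs_nabla_cay_mult[OF conjunct1[OF Suc.IH] Hp_cay_power[OF f(2)]]
  have "AE x in lborel. abs_nabla (\<lambda>x. cay x * (cay x ^ k * f x)) x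
       = cay x ^ Suc k * abs_nabla f x + complex_of_real (2 * real (Suc k) / (1 + x\<^sup>2)) * (cay x ^ Suc k * f x)"
    using s(2) conjunct2[OF Suc.IH]
    by eventually_elim (simp add: algebra_simps add_divide_distrib)
  then show ?case unfolding eq using s(1) by (simp add: mult.assoc)
qed

lemma abs_nabla_res: "res \<in> H1" "AE x in lborel. abs_nabla res x = (res x)\<^sup>2"
proof -
  have "has_fourier (\<lambda>x. res x * res x) (conv ek (\<lambda>s. 2 * pi * complex_of_real (ek s)))"
    by (rule has_fourier_res_mult[OF has_fourier_res])
  also have "conv ek (\<lambda>s. 2 * pi * complex_of_real (ek s)) = (\<lambda>\<xi>. 2 * pi * conv ek (\<lambda>s. complex_of_real (ek s)) \<xi>)"
    unfolding conv_def by (simp add: mult.left_commute flip: integral_mult_right_zero)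
  also have "\<dots> = (\<lambda>\<xi>. complex_of_real \<bar>\<xi>\<bar> * (2 * pi * complex_of_real (ek \<xi>)))"
    unfolding conv_ek_ek by (auto simp: sek_def ek_def indicator_def)
  finally have "has_fourier (\<lambda>x. (res x)\<^sup>2) (\<lambda>\<xi>. complex_of_real \<bar>\<xi>\<bar> * (2 * pi * complex_of_real (ek \<xi>)))"
    by (simp add: power2_eq_square)
  from abs_nabla_eqI[OF has_fourier_res this]
  show "res \<in> H1" "AE x in lborel. abs_nabla res x = (res x)\<^sup>2" .
qed

section \<open>The operator \<open>R\<close>\<close>

text \<open>Raising m by 1 adds a full Dirichlet sum to the weighted sum, and the factor 2 - z -
  1/z, minus a second difference, collapses that sum to its four boundary powers.\<close>

lemma fejer_identity:
  fixes z :: complex assumes z: "z \<noteq> 0"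
  shows "(2 - z - inverse z) * (\<Sum>d\<in>{- int m<..<int m}. of_int (int m - \<bar>d\<bar>) * z powi d)
    = 2 - z powi (int m) - z powi (- int m)"
proof (induction m)
  case 0 then show ?case by simp
next
  case (Suc m)
  have dirichlet: "(2 - z - inverse z) * (\<Sum>d\<in>{- int n..int n}. z powi d)
      = z powi (int n) + z powi (- int n) - z powi (int n + 1) - z powi (- int n - 1)" for n
  proof (induction n)
    case 0 then show ?case using z by (simp add: power_int_minus)
  next
    case (Suc n)
    have of_nat_Suc_int: "int (Suc n) = int n + 1" and minus_Suc_int: "- (int n + 1) = - int n - 1"
      and plus_2_int: "int n + 1 + 1 = int n + 2" and minus_2_int: "- int n - 1 - 1 = - int n - 2" by simp_all
    have set: "{- int (Suc n)..int (Suc n)} = insert (int n + 1) (insert (- int n - 1) {- int n..int n})" by auto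
    have a: "z powi (int n + 1) = z * z powi (int n)" "z powi (int n + 2) = z * (z * z powi (int n))"
      "z powi (- int n - 1) = inverse z * z powi (- int n)"
      "z powi (- int n - 2) = inverse z * (inverse z * z powi (- int n))"
      using z power_int_add[of z "int n" 1] power_int_add[of z "int n" 2]
        power_int_diff[of z "- int n" 1] power_int_diff[of z "- int n" 2]
      by (simp_all add: divide_inverse power2_eq_square)
    have "(2 - z - inverse z) * (\<Sum>d\<in>{- int (Suc n)..int (Suc n)}. z powi d)
        = (2 - z - inverse z) * (z powi (int n + 1) + z powi (- int n - 1))
          + (2 - z - inverse z) * (\<Sum>d\<in>{- int n..int n}. z powi d)"
      unfolding set by (simp add: algebra_simps)
    also have "\<dots> = z powi (int n + 1) + z powi (- int n - 1) - z powi (int n + 2) - z powi (- int n - 2)"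
      unfolding Suc.IH a using z by (simp add: field_simps)
    finally show ?case by (simp only: of_nat_Suc_int minus_Suc_int plus_2_int minus_2_int)
  qed
  have set: "{- int (Suc m)<..<int (Suc m)} = {- int m..int m}" by auto
  \<comment> \<open>The weights at d = m and d = - m are 0, so the open range for m may be closed to
    match the Dirichlet sum.\<close>
  have "(\<Sum>d\<in>{- int m..int m}. of_int (int m - \<bar>d\<bar>) * z powi d)
      = (\<Sum>d\<in>{- int m<..<int m}. of_int (int m - \<bar>d\<bar>) * z powi d)"
    by (rule sum.mono_neutral_right) auto
  note trim = this
  have "(\<Sum>d\<in>{- int (Suc m)<..<int (Suc m)}. of_int (int (Suc m) - \<bar>d\<bar>) * z powi d)
      = (\<Sum>d\<in>{- int m<..<int m}. of_int (int m - \<bar>d\<bar>) * z powi d) + (\<Sum>d\<in>{- int m..int m}. z powi d)"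
  proof -
    have "of_int (int (Suc m) - \<bar>d\<bar>) * z powi d = of_int (int m - \<bar>d\<bar>) * z powi d + z powi d" for d
      by (simp add: algebra_simps)
    then show ?thesis unfolding set by (simp only: sum.distrib trim)
  qed
  then have "(2 - z - inverse z) * (\<Sum>d\<in>{- int (Suc m)<..<int (Suc m)}. of_int (int (Suc m) - \<bar>d\<bar>) * z powi d)
      = 2 - z powi (int m + 1) - z powi (- int m - 1)"
    using Suc.IH dirichlet[of m] by (simp add: distrib_left)
  moreover have "int (Suc m) = int m + 1" "- (int m + 1) = - int m - 1" by simp_all
  ultimately show ?case by (simp only:)
qed

lemma unit_chord:
  fixes a b :: complex assumes "norm a = 1" "norm b = 1"
  shows "complex_of_real ((norm (a - b))\<^sup>2) = 2 - a / b - inverse (a / b)"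
proof -
  have ab: "a * cnj a = 1" "b * cnj b = 1" using assms by (simp_all flip: complex_norm_square)
  then have inv: "inverse a = cnj a" "inverse b = cnj b" by (auto intro: inverse_unique)
  have "inverse (a / b) = b / a" by simp
  then have q: "a / b = a * cnj b" "inverse (a / b) = b * cnj a"
    unfolding divide_inverse inv by simp_all
  show ?thesis unfolding complex_norm_square unfolding q(2) unfolding q(1)
    using ab by (simp add: algebra_simps)
qed

lemma Q_map_distance:
  "(norm (Q_map m x - Q_map m y))\<^sup>2 = (norm (cay x ^ m - cay y ^ m))\<^sup>2"
proof -
  have "(norm (Q_map m x - Q_map m y))\<^sup>2 = (f_fun m x - f_fun m y)\<^sup>2 + (g_fun m x - g_fun m y)\<^sup>2"
    unfolding power2_norm_eq_inner inner_vec_def sum_3 Q_map_def by (simp add: power2_eq_square)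
  also have "\<dots> = (norm ((\<i> * cay x) ^ m - (\<i> * cay y) ^ m))\<^sup>2"
    by (simp add: f_fun_def g_fun_def cay_def cmod_power2)
  also have "(\<i> * cay x) ^ m - (\<i> * cay y) ^ m = \<i> ^ m * (cay x ^ m - cay y ^ m)"
    by (simp add: power_mult_distrib right_diff_distrib)
  finally show ?thesis by (simp add: norm_mult norm_power)
qed

text \<open>The factor (x - y)^2 is what cancels the denominator in the kernel of R.\<close>

lemma cay_chord: "(norm (cay x - cay y))\<^sup>2 = 4 * (x - y)\<^sup>2 * (1 / (1 + x\<^sup>2)) * (1 / (1 + y\<^sup>2))"
proof -
  have "res x - res y = \<i> * complex_of_real (x - y) * (res x * res y)"
    unfolding res_def using nonzero_shifts[of x] nonzero_shifts[of y] by (simp add: field_simps)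
  moreover have "cay x - cay y = - 2 * (res x - res y)" by (simp add: cay_eq)
  ultimately have "cay x - cay y = - 2 * \<i> * complex_of_real (x - y) * (res x * res y)"
    by simp
  then have "norm (cay x - cay y) = 2 * \<bar>x - y\<bar> * (norm (res x) * norm (res y))"
    by (simp add: norm_mult del: of_real_diff)
  then have "(norm (cay x - cay y))\<^sup>2 = 4 * (x - y)\<^sup>2 * (norm (res x))\<^sup>2 * (norm (res y))\<^sup>2"
    by (simp add: power_mult_distrib)
  then show ?thesis by (simp only: norm_res_sq)
qed

section \<open>R as an operator of finite rank\<close>

definition pfun :: "int \<Rightarrow> real \<Rightarrow> complex" where
  "pfun d x = cay x powi d * complex_of_real (1 / (1 + x\<^sup>2))"

text \<open>The function e_n of the overview.\<close>

definition efun :: "int \<Rightarrow> real \<Rightarrow> complex" where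
  "efun n x = cay x powi n * res x"

text \<open>The Fejer identity at z = \<open>cay x\<close> / \<open>cay y\<close> contains the
  squared chord 2 - z - 1/z, hence (x - y)^2 by \<open>cay_chord\<close>. What remains after
  cancelling is a sum of products, one for each d with \<bar>d\<bar> < m.\<close>

lemma R_kernel:
  assumes "x \<noteq> y"
  shows "complex_of_real ((norm (Q_map m x - Q_map m y))\<^sup>2 / \<bar>x - y\<bar>\<^sup>2)
    = 4 * (\<Sum>d\<in>{- int m<..<int m}. of_int (int m - \<bar>d\<bar>) * (pfun d x * cnj (pfun d y)))"
proof -
  define z where "z = cay x / cay y"
  have z: "z \<noteq> 0" by (simp add: z_def)
  have p: "pfun d x * cnj (pfun d y) = complex_of_real (1 / (1 + x\<^sup>2)) * complex_of_real (1 / (1 + y\<^sup>2)) * z powi d" for d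
    by (simp add: pfun_def z_def power_int_mult_distrib cnj_cay power_int_inverse divide_inverse mult_ac)
  have c: "complex_of_real (4 * (x - y)\<^sup>2) * (complex_of_real (1 / (1 + x\<^sup>2)) * complex_of_real (1 / (1 + y\<^sup>2)))
      = 2 - z - inverse z"
    using unit_chord[of "cay x" "cay y"] unfolding cay_chord z_def by simp
  have "complex_of_real ((norm (Q_map m x - Q_map m y))\<^sup>2) = 2 - z powi (int m) - z powi (- int m)"
    unfolding Q_map_distance z_def
    by (subst unit_chord) (simp_all add: norm_power power_divide power_int_minus)
  also have "\<dots> = complex_of_real (4 * (x - y)\<^sup>2) * (complex_of_real (1 / (1 + x\<^sup>2)) * complex_of_real (1 / (1 + y\<^sup>2)))
      * (\<Sum>d\<in>{- int m<..<int m}. of_int (int m - \<bar>d\<bar>) * z powi d)"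
    unfolding c by (rule fejer_identity[OF z, symmetric])
  also have "\<dots> = complex_of_real ((x - y)\<^sup>2) * (4 * (\<Sum>d\<in>{- int m<..<int m}. of_int (int m - \<bar>d\<bar>) * (pfun d x * cnj (pfun d y))))"
    unfolding p sum_distrib_left by (intro sum.cong refl) (simp add: mult_ac)
  finally show ?thesis using assms by (simp add: field_simps)
qed

lemma pfun_norm: "norm (pfun d x) = 1 / (1 + x\<^sup>2)"
  by (simp add: pfun_def norm_mult norm_divide del: of_real_divide of_real_add)

lemma pfun_measurable [measurable]: "pfun d \<in> borel_measurable borel"
  unfolding pfun_def[abs_def] by measurable

lemma efun_measurable [measurable]: "efun n \<in> borel_measurable borel"
  unfolding efun_def[abs_def] by measurable

lemma pfun_norm_le: "norm (pfun d x) \<le> norm (res x)"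
proof -
  have "(norm (res x))\<^sup>2 \<le> norm (res x)"
    unfolding power2_eq_square by (intro mult_left_le_one_le norm_res_le) auto
  then show ?thesis unfolding pfun_norm norm_res_sq .
qed

lemma pfun_L2: "pfun d \<in> L2"
  by (rule L2_dominated[OF _ res_L2, of _ 1]) (simp_all add: pfun_norm_le)

lemma efun_L2: "efun n \<in> L2"
  unfolding efun_def[abs_def] by (rule L2_cay_powi[OF res_L2])

text \<open>The constant 2 / pi is 4 / (2 pi), the 4 coming from the chord formula; the diagonal y =
  x is a null set.\<close>

lemma R_op_eq:
  assumes f: "f \<in> L2"
  shows "R_op m f x = complex_of_real (2 / pi) *
    (\<Sum>d\<in>{- int m<..<int m}. of_int (int m - \<bar>d\<bar>) * (pfun d x * L2_inner f (pfun d)))"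
proof -
  have int: "integrable lborel (\<lambda>y. 4 * (of_int (int m - \<bar>d\<bar>) * (pfun d x * (f y * cnj (pfun d y)))))" for d
    by (intro integrable_mult_right L2_inner_integrable f pfun_L2)
  have [measurable]: "f \<in> borel_measurable borel" using f by auto
  have qm: "(\<lambda>y. complex_of_real ((norm (Q_map m x - Q_map m y))\<^sup>2 / \<bar>x - y\<bar>\<^sup>2)) \<in> borel_measurable borel"
    unfolding Q_map_distance by measurable
  have "(LINT y|lborel. complex_of_real ((norm (Q_map m x - Q_map m y))\<^sup>2 / \<bar>x - y\<bar>\<^sup>2) * f y)
      = (LINT y|lborel. (\<Sum>d\<in>{- int m<..<int m}. 4 * (of_int (int m - \<bar>d\<bar>) * (pfun d x * (f y * cnj (pfun d y))))))"
  proof (rule integral_cong_AE)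
    show "AE y in lborel. complex_of_real ((norm (Q_map m x - Q_map m y))\<^sup>2 / \<bar>x - y\<bar>\<^sup>2) * f y
      = (\<Sum>d\<in>{- int m<..<int m}. 4 * (of_int (int m - \<bar>d\<bar>) * (pfun d x * (f y * cnj (pfun d y)))))"
      using AE_lborel_singleton[of x]
    proof eventually_elim
      case (elim y)
      show ?case using elim
        by (subst R_kernel) (auto simp: sum_distrib_left sum_distrib_right mult_ac)
    qed
    show "(\<lambda>y. complex_of_real ((norm (Q_map m x - Q_map m y))\<^sup>2 / \<bar>x - y\<bar>\<^sup>2) * f y) \<in> borel_measurable lborel"
      using borel_measurable_times[OF qm L2_measurable[OF f]] by simp
    show "(\<lambda>y. \<Sum>d\<in>{- int m<..<int m}. 4 * (of_int (int m - \<bar>d\<bar>) * (pfun d x * (f y * cnj (pfun d y)))))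
        \<in> borel_measurable lborel"
      by (intro borel_measurable_sum borel_measurable_integrable int)
  qed
  also have "\<dots> = 4 * (\<Sum>d\<in>{- int m<..<int m}. of_int (int m - \<bar>d\<bar>) * (pfun d x * L2_inner f (pfun d)))"
    using int by (subst Bochner_Integration.integral_sum) (simp_all add: L2_inner_def sum_distrib_left)
  finally show ?thesis unfolding R_op_def by simp
qed

lemma R_op_fun_eq:
  assumes f: "f \<in> L2"
  shows "R_op m f = (\<lambda>x. \<Sum>d\<in>{- int m<..<int m}. (complex_of_real (2 / pi) * of_int (int m - \<bar>d\<bar>) * L2_inner f (pfun d)) * pfun d x)"
  by (rule ext) (simp add: R_op_eq[OF f] sum_distrib_left mult_ac)

lemma R_op_L2: "f \<in> L2 \<Longrightarrow> R_op m f \<in> L2"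
  unfolding R_op_fun_eq by (intro L2_sum L2_scale pfun_L2)

lemma R_op_add: "f \<in> L2 \<Longrightarrow> g \<in> L2 \<Longrightarrow> R_op m (\<lambda>x. f x + g x) x = R_op m f x + R_op m g x"
  by (simp add: R_op_eq L2_add L2_inner_add_left pfun_L2 distrib_left sum.distrib)

lemma R_op_scale: "f \<in> L2 \<Longrightarrow> R_op m (\<lambda>x. c * f x) x = c * R_op m f x"
  by (simp add: R_op_eq L2_scale L2_inner_scale_left sum_distrib_left mult_ac)

lemma R_op_cong_AE: "f \<in> L2 \<Longrightarrow> g \<in> L2 \<Longrightarrow> AE x in lborel. f x = g x \<Longrightarrow> R_op m f x = R_op m g x"
  unfolding R_op_eq
  by (intro arg_cong2[where f="(*)"] sum.cong refl L2_inner_cong_AE pfun_L2) auto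

lemma pfun_reflect: "pfun d (- x) = pfun (- d) x"
  by (simp add: pfun_def cay_powi_reflect)

lemma L2_inner_reflect: "L2_inner (\<lambda>x. f (- x)) (\<lambda>x. g (- x)) = L2_inner f g"
  unfolding L2_inner_def using lborel_integral_reflect[of "\<lambda>x. f x * cnj (g x)"] by simp

lemma R_op_reflect:
  assumes f: "f \<in> L2" shows "R_op m (\<lambda>x. f (- x)) x = R_op m f (- x)"
proof -
  have inn: "L2_inner (\<lambda>x. f (- x)) (pfun d) = L2_inner f (pfun (- d))" for d
    using L2_inner_reflect[of f "pfun (- d)"] by (simp add: pfun_reflect)
  have "(\<Sum>d\<in>{- int m<..<int m}. of_int (int m - \<bar>d\<bar>) * (pfun d x * L2_inner f (pfun (- d))))
      = (\<Sum>d\<in>{- int m<..<int m}. of_int (int m - \<bar>d\<bar>) * (pfun (- d) x * L2_inner f (pfun d)))"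
    by (rule sum.reindex_bij_witness[of _ uminus uminus]) auto
  then show ?thesis by (simp add: R_op_eq L2_reflect f inn pfun_reflect)
qed

lemma R_op_symmetric:
  assumes f: "f \<in> L2" and g: "g \<in> L2"
  shows "L2_inner (R_op m f) g = L2_inner f (R_op m g)"
proof -
  have left: "L2_inner (R_op m a) b = (\<Sum>d\<in>{- int m<..<int m}. (complex_of_real (2 / pi) * of_int (int m - \<bar>d\<bar>)) * (L2_inner a (pfun d) * L2_inner (pfun d) b))"
    if "a \<in> L2" "b \<in> L2" for a b
  proof -
    have "L2_inner (R_op m a) b = (\<Sum>d\<in>{- int m<..<int m}.
        L2_inner (\<lambda>x. (complex_of_real (2 / pi) * of_int (int m - \<bar>d\<bar>) * L2_inner a (pfun d)) * pfun d x) b)"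
      unfolding R_op_fun_eq[OF that(1)]
      by (rule L2_inner_sum_left) (rule finite_greaterThanLessThan_int | intro L2_scale pfun_L2 that)+
    then show ?thesis by (simp only: L2_inner_scale_left mult.assoc)
  qed
  have "L2_inner f (R_op m g) = cnj (L2_inner (R_op m g) f)" by (rule L2_inner_commute)
  also have "\<dots> = L2_inner (R_op m f) g"
    unfolding left[OF f g] left[OF g f] cnj_sum
    by (intro sum.cong refl) (simp add: L2_inner_commute[of f] L2_inner_commute[of _ g])
  finally show ?thesis ..
qed

lemma pfun_eq: "pfun d x = efun d x * cnj (res x)"
  using res_mult_cnj[of x] by (simp add: pfun_def efun_def mult.assoc)

lemma efun_shift: "cay x powi k * efun n x = efun (k + n) x"
  by (simp add: efun_def power_int_add)

text \<open>Reflection exchanges the indices n \<ge> 0 with n < 0, which is why the range -m \<le> n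
  < m is symmetric.\<close>

lemma efun_reflect: "efun n (- x) = - efun (- n - 1) x"
proof -
  have "efun n (- x) = cay x powi (- n - 1) * (cay x * cnj (res x))"
    by (simp add: efun_def cay_powi_reflect res_reflect power_int_diff)
  also have "\<dots> = - efun (- n - 1) x" unfolding cay_cnj_res by (simp add: efun_def)
  finally show ?thesis .
qed

lemma pfun_efun: "pfun d x = (efun d x - efun (d - 1) x) / 2"
proof -
  have "efun (d - 1) x = cay x powi d / cay x * (- (cay x * cnj (res x)))"
    unfolding cay_cnj_res by (simp add: efun_def power_int_diff)
  then have "efun (d - 1) x = - (cay x powi d * cnj (res x))" by simp
  then have "efun d x - efun (d - 1) x = cay x powi d * (res x + cnj (res x))"
    by (simp add: efun_def distrib_left)
  also have "\<dots> = 2 * pfun d x" unfolding res_plus_cnj pfun_def by simp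
  finally show ?thesis by simp
qed

lemma pfun_fun: "pfun d = (\<lambda>x. (1 / 2) * (efun d x - efun (d - 1) x))"
  by (rule ext) (simp add: pfun_efun)

lemma Hp_efun: "n \<ge> 0 \<Longrightarrow> Hp (efun n)"
  using Hp_cay_power[OF Hp_res, of "nat n"] by (simp add: efun_def[abs_def] power_int_def)

lemma Hp_efun_reflect: "n < 0 \<Longrightarrow> Hp (\<lambda>x. efun n (- x))"
  using Hp_scale[OF Hp_efun[of "- n - 1"], of "-1"] by (simp add: efun_reflect)

lemma res_norm: "L2_norm res = sqrt pi"
  by (simp add: L2_norm_def norm_res_sq integral_inverse_square)

text \<open>Shifting both indices by k + 1 is unitary and moves k to -1 while n - k - 1 stays
  nonnegative, so the two functions lie in opposite Hardy halves.\<close>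

lemma efun_orthogonal_less: assumes "k < n" shows "L2_inner (efun n) (efun k) = 0"
proof -
  have "L2_inner (efun n) (efun k) = L2_inner (\<lambda>x. cay x powi (k + 1) * efun (n - k - 1) x) (efun k)"
    by (simp add: efun_shift)
  also have "\<dots> = L2_inner (efun (n - k - 1)) (efun (- 1))"
    unfolding L2_inner_cay_powi by (simp add: efun_shift)
  also have "\<dots> = 0" using assms by (intro Hp_inner_orthogonal Hp_efun Hp_efun_reflect) auto
  finally show ?thesis .
qed

lemma efun_orthogonal: "L2_inner (efun n) (efun k) = (if n = k then complex_of_real pi else 0)"
proof -
  have "L2_inner (efun n) (efun n) = complex_of_real pi"
    using L2_inner_self[OF efun_L2[of n]] L2_norm_cay_powi[of n res] res_norm
    by (simp add: efun_def[abs_def])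
  then show ?thesis
    using efun_orthogonal_less[of k n] efun_orthogonal_less[of n k] L2_inner_commute[of "efun n" "efun k"]
    by (cases n k rule: linorder_cases) auto
qed

lemma efun_pfun_inner:
  "L2_inner (efun n) (pfun d) = complex_of_real (pi / 2) * ((if d = n then 1 else 0) - (if d = n + 1 then 1 else 0))"
proof -
  have "L2_inner (efun n) (pfun d) = (1 / 2) * (L2_inner (efun n) (efun d) - L2_inner (efun n) (efun (d - 1)))"
    unfolding pfun_fun L2_inner_scale_right L2_inner_diff_right[OF efun_L2 efun_L2 efun_L2] by simp
  then show ?thesis by (auto simp: efun_orthogonal)
qed

lemma R_op_efun:
  assumes "0 \<le> n" "n < int m"
  shows "R_op m (efun n) x = of_int (int m - n) * pfun n x - of_int (int m - n - 1) * pfun (n + 1) x"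
proof -
  let ?w = "\<lambda>d. of_int (int m - \<bar>d\<bar>) * pfun d x"
  have "R_op m (efun n) x = (\<Sum>d\<in>{- int m<..<int m}. (if d = n then ?w d else 0) - (if d = n + 1 then ?w d else 0))"
    unfolding R_op_eq[OF efun_L2] efun_pfun_inner sum_distrib_left
    by (intro sum.cong refl) auto
  also have "\<dots> = ?w n - (if n + 1 < int m then ?w (n + 1) else 0)"
    using assms by (simp add: sum_subtractf sum.delta)
  also have "\<dots> = of_int (int m - n) * pfun n x - of_int (int m - n - 1) * pfun (n + 1) x"
  \<comment> \<open>For n = m - 1 the index n + 1 is outside the sum, but its coefficient m - n - 1
    is 0, so the formula persists.\<close>
  proof (cases "n + 1 < int m")
    case True then show ?thesis using assms by simp
  next
    case False
    then have "int m - n - 1 = 0" using assms by simp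
    then show ?thesis using False assms by (simp del: of_int_diff)
  qed
  finally show ?thesis .
qed

text \<open>After |\<nabla>| contributes 2 n, the potential -2 m, and R its two neighbouring terms,
  all dependence on m and n cancels. The remaining factor \<open>res\<close> + cnj
  \<open>res\<close> - 2 |\<open>res\<close>|^2 is 0.\<close>

lemma L_minus_efun_nonneg:
  assumes "0 \<le> n" "n < int m"
  shows "efun n \<in> H1" "AE x in lborel. L_minus m (efun n) x = 0"
proof -
  have e: "efun n = (\<lambda>x. cay x ^ nat n * res x)" using assms by (auto simp: efun_def power_int_def)
  note c = abs_nabla_cay_power[OF abs_nabla_res(1) Hp_res, of "nat n"]
  show "efun n \<in> H1" unfolding e using c by simp
  show "AE x in lborel. L_minus m (efun n) x = 0"
    using conjunct2[OF c] abs_nabla_res(2)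
  proof eventually_elim
    case (elim x)
    let ?e = "efun n x" and ?r = "res x" and ?c = "cnj (res x)"
    have vr: "complex_of_real (2 * real j / (1 + x\<^sup>2)) = 2 * of_nat j * (?r * ?c)" for j :: nat
      unfolding res_mult_cnj by simp
    have A: "abs_nabla (efun n) x = ?e * ?r + complex_of_real (2 * real (nat n) / (1 + x\<^sup>2)) * ?e"
      using elim unfolding e by (simp add: power2_eq_square)
    have "efun (n + 1) x = cay x * ?e" using efun_shift[of x 1 n] by (simp add: add.commute)
    then have B: "pfun (n + 1) x = (1 - 2 * ?r) * (?e * ?c)"
      by (simp only: pfun_eq cay_eq mult.assoc)
    have C: "complex_of_int (int m - n) = of_nat m - of_nat (nat n)"
      "complex_of_int (int m - n - 1) = of_nat m - of_nat (nat n) - 1"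
      using assms by simp_all
    have "L_minus m (efun n) x = (?e * ?r + 2 * of_nat (nat n) * (?r * ?c) * ?e) - 2 * of_nat m * (?r * ?c) * ?e
        + ((of_nat m - of_nat (nat n)) * (?e * ?c) - (of_nat m - of_nat (nat n) - 1) * ((1 - 2 * ?r) * (?e * ?c)))"
      by (simp only: L_minus_def L_plus_def R_op_efun[OF assms] A B C vr pfun_eq[of n])
    also have "\<dots> = ?e * (?r + ?c - 2 * (?r * ?c))" by (simp add: algebra_simps)
    also have "?r + ?c - 2 * (?r * ?c) = 0" unfolding res_plus_cnj res_mult_cnj by simp
    finally show ?case by simp
  qed
qed

lemma L_minus_reflect:
  "f \<in> H1 \<Longrightarrow> AE x in lborel. L_minus m (\<lambda>x. f (- x)) x = L_minus m f (- x)"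
  using H1_reflect(2)[of f] by (auto simp: L_minus_def L_plus_def R_op_reflect H1_L2 elim!: eventually_mono)

section \<open>Both operators as perturbations of |\<nabla>|\<close>

definition V_mult :: "nat \<Rightarrow> (real \<Rightarrow> complex) \<Rightarrow> real \<Rightarrow> complex" where
  "V_mult m f x = complex_of_real (2 * real m / (1 + x\<^sup>2)) * f x"

lemma V_bound: "norm (complex_of_real (2 * real m / (1 + x\<^sup>2))) \<le> 2 * real m"
proof -
  have "2 * real m / (1 + x\<^sup>2) \<le> 2 * real m / 1" by (intro divide_left_mono) (auto intro: add_pos_nonneg)
  then show ?thesis unfolding norm_of_real by simp
qed

lemma V_mult_L2: "f \<in> L2 \<Longrightarrow> V_mult m f \<in> L2"
  unfolding V_mult_def[abs_def] by (rule L2_mult_bounded[OF _ _ V_bound]) measurable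

lemma V_mult_symmetric: "L2_inner (V_mult m f) g = L2_inner f (V_mult m g)"
  unfolding L2_inner_def V_mult_def by (simp add: mult_ac)

lemma AE_norm_bound_nonneg:
  fixes f :: "real \<Rightarrow> complex"
  shows "AE x in lborel. norm (f x) \<le> s \<Longrightarrow> 0 \<le> s"
proof -
  assume ae: "AE x in lborel. norm (f x) \<le> s"
  have "AE x::real in lborel. x \<notin> UNIV" if "s < 0"
    by (rule eventually_mono[OF ae]) (use that norm_ge_zero order_trans not_less in blast)
  then show "0 \<le> s"
    using AE_iff_null_sets[of "UNIV :: real set" lborel] by (force simp: null_sets_def)
qed

text \<open>The weight 1 / (1 + x^2) is at most |\<open>res\<close>|, which is in \<open>L2\<close>
  with norm sqrt pi; that is the origin of the constant.\<close>

lemma V_mult_sup_bound: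
  assumes f: "f \<in> L2" and s: "AE x in lborel. norm (f x) \<le> s"
  shows "L2_norm (V_mult m f) \<le> (2 * real m * sqrt pi) * s"
proof -
  have s0: "0 \<le> s" by (rule AE_norm_bound_nonneg[OF s])
  have "L2_norm (V_mult m f) \<le> (2 * real m * s) * L2_norm res"
  proof (rule L2_norm_dominated[OF _ res_L2])
    show "AE x in lborel. norm (V_mult m f x) \<le> 2 * real m * s * norm (res x)"
      using s
    proof eventually_elim
      case (elim x)
      have "complex_of_real (2 * real m / (1 + x\<^sup>2)) = of_nat (2 * m) * complex_of_real (1 / (1 + x\<^sup>2))" by simp
      then have "norm (V_mult m f x) = 2 * real m * (norm (f x) * norm (pfun 0 x))"
        by (simp add: V_mult_def norm_mult pfun_def del: of_real_divide)
      also have "\<dots> \<le> 2 * real m * (s * norm (res x))"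
        by (intro mult_left_mono mult_mono pfun_norm_le elim s0) auto
      finally show ?case by simp
    qed
  qed (use V_mult_L2[OF f] s0 in auto)
  then show ?thesis by (simp add: res_norm mult_ac)
qed

lemma R_op_sup_bound:
  assumes f: "f \<in> L2" and s: "AE x in lborel. norm (f x) \<le> s"
  shows "L2_norm (R_op m f) \<le> (\<Sum>d\<in>{- int m<..<int m}. 2 * of_int (int m - \<bar>d\<bar>) * sqrt pi) * s"
proof -
  have s0: "0 \<le> s" by (rule AE_norm_bound_nonneg[OF s])
  have inn: "norm (L2_inner f (pfun d)) \<le> s * pi" for d
  proof -
    have "norm (L2_inner f (pfun d)) \<le> (LINT x|lborel. norm (f x * cnj (pfun d x)))"
      unfolding L2_inner_def by (rule integral_norm_bound)
    also have "\<dots> \<le> (LINT x|lborel. s * (1 / (1 + x\<^sup>2)))"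
    proof (rule integral_mono_AE)
      show "integrable lborel (\<lambda>x. norm (f x * cnj (pfun d x)))"
        by (intro integrable_norm L2_inner_integrable f pfun_L2)
      show "integrable lborel (\<lambda>x::real. s * (1 / (1 + x\<^sup>2)))"
        by (intro integrable_mult_right integral_inverse_square)
      show "AE x in lborel. norm (f x * cnj (pfun d x)) \<le> s * (1 / (1 + x\<^sup>2))"
        using s by eventually_elim (auto simp: norm_mult pfun_norm intro!: divide_right_mono)
    qed
    also have "\<dots> = s * pi" by (simp only: integral_mult_right_zero integral_inverse_square)
    finally show ?thesis .
  qed
  have pn: "L2_norm (pfun d) \<le> sqrt pi" for d
    using L2_norm_dominated[OF _ res_L2, of "pfun d" 1] by (simp add: pfun_norm_le res_norm)
  have "L2_norm (R_op m f) \<le> (\<Sum>d\<in>{- int m<..<int m}. L2_norm (\<lambda>x. (complex_of_real (2 / pi) * of_int (int m - \<bar>d\<bar>) * L2_inner f (pfun d)) * pfun d x))"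
    unfolding R_op_fun_eq[OF f] by (intro L2_norm_sum L2_scale pfun_L2) auto
  also have "\<dots> \<le> (\<Sum>d\<in>{- int m<..<int m}. 2 * of_int (int m - \<bar>d\<bar>) * sqrt pi * s)"
  proof (rule sum_mono)
    fix d assume d: "d \<in> {- int m<..<int m}"
    then have dn: "norm (complex_of_int (int m - \<bar>d\<bar>)) = of_int (int m - \<bar>d\<bar>)"
      by (subst norm_of_int) auto
    have "L2_norm (\<lambda>x. (complex_of_real (2 / pi) * of_int (int m - \<bar>d\<bar>) * L2_inner f (pfun d)) * pfun d x)
        = (2 / pi) * of_int (int m - \<bar>d\<bar>) * (norm (L2_inner f (pfun d)) * L2_norm (pfun d))"
      unfolding L2_norm_scale norm_mult dn by (simp add: norm_divide algebra_simps)
    also have "\<dots> \<le> (2 / pi) * of_int (int m - \<bar>d\<bar>) * ((s * pi) * sqrt pi)"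
      using d s0 by (intro mult_left_mono mult_mono inn pn) auto
    finally show "L2_norm (\<lambda>x. (complex_of_real (2 / pi) * of_int (int m - \<bar>d\<bar>) * L2_inner f (pfun d)) * pfun d x)
        \<le> 2 * of_int (int m - \<bar>d\<bar>) * sqrt pi * s" by (simp add: mult_ac)
  qed
  finally show ?thesis by (simp add: sum_distrib_right)
qed

interpretation Lp: perturbation "V_mult m" "2 * real m * sqrt pi" for m
  by unfold_locales (auto intro: V_mult_L2 V_mult_symmetric V_mult_sup_bound)

text \<open>The locale subtracts its perturbation, so adding R to \<open>L_plus\<close> means
  subtracting the potential minus R.\<close>

interpretation Lm: perturbation "\<lambda>f x. V_mult m f x - R_op m f x"
  "2 * real m * sqrt pi + (\<Sum>d\<in>{- int m<..<int m}. 2 * of_int (int m - \<bar>d\<bar>) * sqrt pi)" for m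
proof
  fix f g assume f: "f \<in> L2"
  show "(\<lambda>x. V_mult m f x - R_op m f x) \<in> L2" by (intro L2_diff V_mult_L2 R_op_L2 f)
  show "L2_inner (\<lambda>x. V_mult m f x - R_op m f x) g = L2_inner f (\<lambda>x. V_mult m g x - R_op m g x)"
    if "g \<in> L2"
    using that f by (simp add: L2_inner_diff_left L2_inner_diff_right V_mult_L2 R_op_L2 V_mult_symmetric R_op_symmetric)
  show "L2_norm (\<lambda>x. V_mult m f x - R_op m f x)
      \<le> (2 * real m * sqrt pi + (\<Sum>d\<in>{- int m<..<int m}. 2 * of_int (int m - \<bar>d\<bar>) * sqrt pi)) * s"
    if "AE x in lborel. norm (f x) \<le> s" for s
    using L2_norm_triangle_diff[OF V_mult_L2[OF f] R_op_L2[OF f], of m m]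
      V_mult_sup_bound[OF f that, of m] R_op_sup_bound[OF f that, of m]
    by (simp add: distrib_right)
qed

lemma L_plus_eq: "L_plus m = Lp.T m"
  by (intro ext) (simp add: L_plus_def Lp.T_def V_mult_def)

lemma L_minus_eq: "L_minus m = Lm.T m"
  unfolding fun_eq_iff Lm.T_def by (simp add: L_minus_def L_plus_def V_mult_def)

section \<open>Action of \<open>L_minus\<close> on the pieces of \<open>L2\<close>\<close>

lemma L_minus_add:
  "f \<in> H1 \<Longrightarrow> g \<in> H1 \<Longrightarrow> AE x in lborel. L_minus m (\<lambda>x. f x + g x) x = L_minus m f x + L_minus m g x"
  using H1_add(2)[of f g] by (auto simp: L_minus_def L_plus_def R_op_add H1_L2 algebra_simps add_divide_distrib elim!: eventually_mono)

lemma L_minus_scale: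
  "f \<in> H1 \<Longrightarrow> AE x in lborel. L_minus m (\<lambda>x. c * f x) x = c * L_minus m f x"
  using H1_scale(2)[of f c] by (auto simp: L_minus_def L_plus_def R_op_scale H1_L2 algebra_simps elim!: eventually_mono)

lemma L_minus_cong_AE:
  assumes "f \<in> H1" "g \<in> H1" "AE x in lborel. f x = g x"
  shows "AE x in lborel. L_minus m f x = L_minus m g x"
  using H1_cong_AE(2)[OF assms(1) L2_measurable[OF H1_L2[OF assms(2)]] assms(3)] assms(3)
  by eventually_elim (simp add: L_minus_def L_plus_def R_op_cong_AE[OF H1_L2[OF assms(1)] H1_L2[OF assms(2)] assms(3)])

text \<open>Negative indices come from nonnegative ones by reflection, which commutes with
  \<open>L_minus\<close> and sends n to -n - 1 up to sign.\<close>

lemma L_minus_efun: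
  assumes "- int m \<le> n" "n < int m"
  shows "efun n \<in> H1" "AE x in lborel. L_minus m (efun n) x = 0"
proof -
  have "efun n \<in> H1 \<and> (AE x in lborel. L_minus m (efun n) x = 0)"
  proof (cases "0 \<le> n")
    case True then show ?thesis using L_minus_efun_nonneg assms by blast
  next
    case False
    let ?g = "\<lambda>x. (-1) * efun (- n - 1) x"
    have h: "efun (- n - 1) \<in> H1" "AE x in lborel. L_minus m (efun (- n - 1)) x = 0"
      using L_minus_efun_nonneg[of "- n - 1" m] assms False by auto
    have g: "?g \<in> H1" by (rule H1_scale[OF h(1)])
    have g0: "AE x in lborel. L_minus m ?g x = 0"
      using L_minus_scale[OF h(1), of m "-1"] h(2) by eventually_elim simp
    have e: "efun n = (\<lambda>x. ?g (- x))" by (auto simp: efun_reflect)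
    show ?thesis unfolding e
      using H1_reflect(1)[OF g] L_minus_reflect[OF g, of m] AE_lborel_reflect[OF g0]
      by (auto elim: eventually_elim2)
  qed
  then show "efun n \<in> H1" "AE x in lborel. L_minus m (efun n) x = 0" by auto
qed

lemma Hp_cay_power_orthogonal:
  assumes "Hp u" "k < int m" shows "L2_inner (\<lambda>x. cay x ^ m * u x) (efun k) = 0"
proof -
  have "L2_inner (\<lambda>x. cay x ^ m * u x) (efun k) = L2_inner u (efun (k - int m))"
    using L2_inner_cay_powi[of "int m" u "efun k"] by (simp add: efun_shift)
  also have "\<dots> = 0" using assms by (intro Hp_inner_orthogonal Hp_efun_reflect) auto
  finally show ?thesis .
qed

text \<open>The function \<beta>^m u is orthogonal to every e_k with k < m, hence to all functions
  in the kernel of R, so R annihilates it. The potential is absorbed by the m factors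
  \<beta>.\<close>

lemma L_minus_cay_power:
  assumes u: "u \<in> H1" "Hp u"
  shows "(\<lambda>x. cay x ^ m * u x) \<in> H1"
    and "AE x in lborel. L_minus m (\<lambda>x. cay x ^ m * u x) x = cay x ^ m * abs_nabla u x"
proof -
  note c = abs_nabla_cay_power[OF u, of m]
  show H: "(\<lambda>x. cay x ^ m * u x) \<in> H1" using c by simp
  have inn: "L2_inner (\<lambda>x. cay x ^ m * u x) (pfun d) = 0" if "d < int m" for d
  proof -
    show ?thesis
      unfolding pfun_fun L2_inner_scale_right L2_inner_diff_right[OF efun_L2 efun_L2 H1_L2[OF H]]
      using that by (simp add: Hp_cay_power_orthogonal[OF u(2)])
  qed
  have "R_op m (\<lambda>x. cay x ^ m * u x) x = 0" for x
    unfolding R_op_eq[OF H1_L2[OF H]] using inn by simp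
  then show "AE x in lborel. L_minus m (\<lambda>x. cay x ^ m * u x) x = cay x ^ m * abs_nabla u x"
    using conjunct2[OF c] by (auto simp: L_minus_def L_plus_def elim!: eventually_mono)
qed

section \<open>The spectrum of \<open>L_minus\<close>\<close>

text \<open>The second hypothesis says that \<beta>^-k g lies in the other Hardy half. Removing the
  component along \<open>res\<close> allows one division by \<beta>, which lowers k by 1; for k = 0
  the function lies in both halves and is null.\<close>

lemma Hp_span:
  assumes "Hp g" "Hp (\<lambda>x. cay (- x) powi (- int k) * g (- x))"
  shows "\<exists>c. AE x in lborel. g x = (\<Sum>j<k. c j * efun (int j) x)"
  using assms
proof (induction k arbitrary: g)
  case 0
  then have "L2_inner g g = 0" by (intro Hp_inner_orthogonal) auto
  then have "AE x in lborel. g x = 0"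
    using L2_inner_self[OF Hp_L2[OF 0(1)]] L2_norm_eq_0[OF Hp_L2[OF 0(1)]] by simp
  then show ?case by simp
next
  case (Suc k)
  define c0 where "c0 = L2_inner g res / pi"
  define g1 where "g1 x = g x - c0 * res x" for x
  have g: "g \<in> L2" by (rule Hp_L2[OF Suc.prems(1)])
  have Hg1: "Hp g1" unfolding g1_def[abs_def] by (intro Hp_diff Hp_scale Suc.prems Hp_res)
  have rr: "L2_inner res res = complex_of_real pi" using L2_inner_self[OF res_L2] res_norm by simp
  have "L2_inner g1 res = L2_inner g res - c0 * complex_of_real pi"
    unfolding g1_def[abs_def]
    by (simp only: L2_inner_diff_left[OF g L2_scale[OF res_L2] res_L2] L2_inner_scale_left rr)
  then have "L2_inner g1 res = 0" by (simp add: c0_def)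
  then have Hg': "Hp (\<lambda>x. inverse (cay x) * g1 x)" by (rule Hp_inverse_cay[OF Hg1])
  have "cay (- x) powi (- int k) * (inverse (cay (- x)) * g1 (- x))
      = cay (- x) powi (- int (Suc k)) * g (- x) - c0 * efun (- int (Suc k)) (- x)" for x
  proof -
    have "cay (- x) powi (- int k - 1) = cay (- x) powi (- int k) * inverse (cay (- x))"
      by (simp add: power_int_diff divide_inverse)
    moreover have "- int k - 1 = - int (Suc k)" by simp
    ultimately have "cay (- x) powi (- int (Suc k)) = cay (- x) powi (- int k) * inverse (cay (- x))"
      by (simp only:)
    then show ?thesis by (simp add: g1_def efun_def algebra_simps)
  qed
  moreover have "Hp (\<lambda>x. cay (- x) powi (- int (Suc k)) * g (- x) - c0 * efun (- int (Suc k)) (- x))"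
    by (intro Hp_diff Hp_scale Suc.prems Hp_efun_reflect) simp
  ultimately have "Hp (\<lambda>x. cay (- x) powi (- int k) * (inverse (cay (- x)) * g1 (- x)))" by simp
  from Suc.IH[OF Hg' this] obtain c where
    c: "AE x in lborel. inverse (cay x) * g1 x = (\<Sum>j<k. c j * efun (int j) x)" by blast
  have "AE x in lborel. g x = (\<Sum>j<Suc k. (case j of 0 \<Rightarrow> c0 | Suc j \<Rightarrow> c j) * efun (int j) x)"
    using c
  proof eventually_elim
    case (elim x)
    have "cay x * (inverse (cay x) * g1 x) = g1 x" by (simp flip: mult.assoc)
    then have "g x = c0 * efun 0 x + cay x * (inverse (cay x) * g1 x)"
      by (simp only:) (simp add: g1_def efun_def)
    also have "cay x * (inverse (cay x) * g1 x) = (\<Sum>j<k. c j * efun (int (Suc j)) x)"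
      unfolding elim sum_distrib_left
      by (intro sum.cong refl) (use efun_shift[of x 1] in \<open>simp add: mult.left_commute add.commute\<close>)
    finally show ?case by (simp add: sum.lessThan_Suc_shift del: sum.lessThan_Suc)
  qed
  then show ?case by blast
qed

text \<open>The general element of the kernel of \<open>L_minus m\<close>, with the indices -m \<le>
  n < m renumbered from 0.\<close>

definition kspan :: "nat \<Rightarrow> (nat \<Rightarrow> complex) \<Rightarrow> real \<Rightarrow> complex" where
  "kspan m c x = (\<Sum>j<2 * m. c j * efun (int j - int m) x)"

text \<open>These two conditions express orthogonality to both unitary halves. Multiplying f by
  \<beta>^m turns them into the hypotheses of \<open>Hp_span\<close> with 2 m in place of k.\<close>

lemma kspan_characterization:
  assumes "Hp (\<lambda>x. cay x powi (int m) * f x)" "Hp (\<lambda>x. cay (- x) powi (- int m) * f (- x))"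
  shows "\<exists>c. AE x in lborel. f x = kspan m c x"
proof -
  have "cay x powi (- int (2 * m)) * (cay x powi (int m) * f x) = cay x powi (- int m) * f x" for x
  proof -
    have "cay x powi (- int (2 * m)) * cay x powi (int m) = cay x powi (- int m)"
      using power_int_add[of "cay x" "- int (2 * m)" "int m"] by simp
    then show ?thesis by (simp only: mult.assoc[symmetric])
  qed
  then have "Hp (\<lambda>x. cay (- x) powi (- int (2 * m)) * (cay (- x) powi (int m) * f (- x)))"
    using assms(2) by (simp only:)
  from Hp_span[OF assms(1) this] obtain c where
    c: "AE x in lborel. cay x powi (int m) * f x = (\<Sum>j<2 * m. c j * efun (int j) x)" by blast
  have "AE x in lborel. f x = kspan m c x"
    using c
  proof eventually_elim
    case (elim x)
    have "cay x powi (- int m) * cay x powi (int m) = 1"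
      using power_int_add[of "cay x" "- int m" "int m"] by simp
    then have "f x = cay x powi (- int m) * (cay x powi (int m) * f x)"
      by (simp only: mult.assoc[symmetric] mult_1_left)
    also have "\<dots> = kspan m c x"
      unfolding elim kspan_def sum_distrib_left
      by (intro sum.cong refl) (simp add: mult.left_commute efun_shift)
    finally show ?case .
  qed
  then show ?thesis by blast
qed

lemma kspan_partial:
  assumes "n \<le> 2 * m"
  shows "(\<lambda>x. \<Sum>j<n. c j * efun (int j - int m) x) \<in> H1 \<and>
    (AE x in lborel. L_minus m (\<lambda>x. \<Sum>j<n. c j * efun (int j - int m) x) x = 0)"
  using assms
proof (induction n)
  case 0
  have "AE x in lborel. L_minus m (\<lambda>x. 0 * (0::complex)) x = 0 * L_minus m (\<lambda>x. 0) x"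
    by (rule L_minus_scale[OF H1_zero])
  then show ?case by (simp add: H1_zero)
next
  case (Suc n)
  have e: "efun (int n - int m) \<in> H1" "AE x in lborel. L_minus m (efun (int n - int m)) x = 0"
    using Suc.prems L_minus_efun[of m "int n - int m"] by auto
  have IH: "(\<lambda>x. \<Sum>j<n. c j * efun (int j - int m) x) \<in> H1"
    "AE x in lborel. L_minus m (\<lambda>x. \<Sum>j<n. c j * efun (int j - int m) x) x = 0"
    using Suc by auto
  show ?case unfolding sum.lessThan_Suc
    using H1_add(1)[OF IH(1) H1_scale(1)[OF e(1), of "c n"]]
      L_minus_add[OF IH(1) H1_scale(1)[OF e(1), of "c n"], of m] IH(2) e(2) L_minus_scale[OF e(1), of m "c n"]
    by (auto elim!: eventually_elim2[OF eventually_conj[OF eventually_conj[OF _ IH(2)] e(2)]])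
qed

lemma kspan_H1: "kspan m c \<in> H1"
  using kspan_partial[of "2 * m" m c] by (simp add: kspan_def[abs_def])

lemma L_minus_kspan: "AE x in lborel. L_minus m (kspan m c) x = 0"
  using kspan_partial[of "2 * m" m c] by (simp add: kspan_def[abs_def])

text \<open>The range of |\<nabla>| - cnj z on the Hardy space is dense for every z, real or not,
  because \<bar>\<xi>\<bar> - z vanishes only on a null set. If H is the transform of p, the test
  function with transform (\<bar>\<xi>\<bar> - z) H cut off to [0, n] makes the inner product a
  squared norm.\<close>

lemma shifted_range_orthogonal:
  assumes p: "p \<in> L2"
    and orth: "\<And>u. u \<in> H1 \<Longrightarrow> Hp u \<Longrightarrow> L2_inner p (\<lambda>x. abs_nabla u x - cnj z * u x) = 0"
  shows "Hp (\<lambda>x. p (- x))"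
proof -
  obtain H where H: "has_fourier p H" using has_fourier_exists[OF p] .
  have HL: "H \<in> L2" using H by (rule has_fourier_L2)
  have [measurable]: "H \<in> borel_measurable borel" using HL by auto
  have "AE \<xi> in lborel. indicator {0..real n} \<xi> * H \<xi> = 0" for n
  proof -
    let ?U = "\<lambda>\<xi>. (complex_of_real \<bar>\<xi>\<bar> - z) * (indicator {0..real n} \<xi> * H \<xi>)"
    have UL: "?U \<in> L2"
    proof (rule L2_dominated[OF _ HL, of _ "real n + norm z"])
      show "AE \<xi> in lborel. norm (?U \<xi>) \<le> (real n + norm z) * norm (H \<xi>)"
        by (auto simp: indicator_def norm_mult intro!: mult_right_mono AE_I2 order_trans[OF norm_triangle_ineq4])
    qed measurable
    obtain u where u: "has_fourier u ?U" using has_fourier_surj[OF UL] .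
    have uH: "u \<in> H1" by (rule band_limited_H1[OF u, of "real n"]) (auto simp: indicator_def)
    have uHp: "Hp u" unfolding Hp_def using u by (intro exI[of _ ?U]) auto
    have four: "has_fourier (\<lambda>x. abs_nabla u x - cnj z * u x) (\<lambda>\<xi>. complex_of_real \<bar>\<xi>\<bar> * ?U \<xi> - cnj z * ?U \<xi>)"
      by (intro has_fourier_diff abs_nabla_fourier[OF uH u] has_fourier_scale[OF u])
    have "0 = L2_inner H (\<lambda>\<xi>. complex_of_real \<bar>\<xi>\<bar> * ?U \<xi> - cnj z * ?U \<xi>)"
      using has_fourier_inner[OF H four] orth[OF uH uHp] by simp
    also have "\<dots> = L2_inner ?U ?U"
      unfolding L2_inner_def
      by (intro Bochner_Integration.integral_cong) (auto simp: indicator_def algebra_simps)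
    finally have "L2_norm ?U = 0" using L2_inner_self[OF UL] by simp
    then have "AE \<xi> in lborel. ?U \<xi> = 0" using L2_norm_eq_0[OF UL] by simp
    \<comment> \<open>These are the only frequencies at which \<bar>\<xi>\<bar> = z is
      possible.\<close>
    moreover have "AE \<xi> in lborel. \<xi> \<noteq> Re z" "AE \<xi> in lborel. \<xi> \<noteq> - Re z"
      by (rule AE_lborel_singleton)+
    ultimately show ?thesis
    proof eventually_elim
      case (elim \<xi>)
      have "complex_of_real \<bar>\<xi>\<bar> - z \<noteq> 0" using elim by (auto simp: complex_eq_iff abs_if split: if_splits)
      then show ?case using elim by simp
    qed
  qed
  then have "AE \<xi> in lborel. \<forall>n. indicator {0..real n} \<xi> * H \<xi> = 0"
    unfolding AE_all_countable by (rule allI)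
  then have "AE \<xi> in lborel. 0 \<le> \<xi> \<longrightarrow> H \<xi> = 0"
  proof eventually_elim
    case (elim \<xi>)
    obtain n :: nat where "\<xi> \<le> real n" using real_arch_simple by blast
    with elim[rule_format, of n] show ?case by auto
  qed
  from AE_lborel_reflect[OF this] have "AE \<xi> in lborel. \<xi> < 0 \<longrightarrow> H (- \<xi>) = 0"
    by (auto elim!: eventually_mono)
  then show ?thesis by (rule HpI_AE[OF has_fourier_reflect[OF H]])
qed

text \<open>By symmetry an eigenvector is orthogonal to the range of \<open>L_minus\<close> - cnj z
  on \<beta>^m times the Hardy space, where the operator is a conjugate of |\<nabla>|; so \<beta>^-m
  f has no positive frequencies.\<close>

lemma L_minus_eigenvector_half:
  assumes f: "f \<in> H1" and ev: "AE x in lborel. L_minus m f x = z * f x"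
  shows "Hp (\<lambda>x. cay (- x) powi (- int m) * f (- x))"
proof (rule shifted_range_orthogonal[where z=z and p="\<lambda>x. cay x powi (- int m) * f x"])
  have fL: "f \<in> L2" using f by (rule H1_L2)
  show "(\<lambda>x. cay x powi (- int m) * f x) \<in> L2" by (rule L2_cay_powi[OF fL])
  fix u assume u: "u \<in> H1" "Hp u"
  note c = L_minus_cay_power[OF u, of m]
  let ?v = "\<lambda>x. cay x ^ m * u x"
  have LfL: "L_minus m f \<in> L2" unfolding L_minus_eq by (rule Lm.T_L2[OF f])
  have LvL: "L_minus m ?v \<in> L2" unfolding L_minus_eq by (rule Lm.T_L2[OF c(1)])
  have vL: "?v \<in> L2" by (rule H1_L2[OF c(1)])
  have "L2_inner (\<lambda>x. cay x powi (- int m) * f x) (\<lambda>x. abs_nabla u x - cnj z * u x)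
      = L2_inner f (\<lambda>x. cay x ^ m * abs_nabla u x - cnj z * ?v x)"
    unfolding L2_inner_cay_powi by (simp add: algebra_simps)
  also have "\<dots> = L2_inner f (\<lambda>x. L_minus m ?v x - cnj z * ?v x)"
  proof (rule L2_inner_cong_AE[OF fL _ fL])
    show "(\<lambda>x. L_minus m ?v x - cnj z * ?v x) \<in> L2" by (intro L2_diff LvL L2_scale vL)
    have "(\<lambda>x. cay x powi int m * abs_nabla u x) \<in> L2"
      by (intro L2_cay_powi abs_nabla_L2 u)
    then show "(\<lambda>x. cay x ^ m * abs_nabla u x - cnj z * ?v x) \<in> L2"
      by (intro L2_diff L2_scale vL) simp
    show "AE x in lborel. cay x ^ m * abs_nabla u x - cnj z * ?v x = L_minus m ?v x - cnj z * ?v x"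
      using c(2) by eventually_elim simp
  qed simp
  also have "\<dots> = L2_inner f (L_minus m ?v) - z * L2_inner f ?v"
    by (simp add: L2_inner_diff_right LvL L2_scale vL fL L2_inner_scale_right)
  also have "L2_inner f (L_minus m ?v) = L2_inner (L_minus m f) ?v"
    unfolding L_minus_eq by (rule Lm.T_symmetric[OF f c(1), symmetric])
  also have "\<dots> = L2_inner (\<lambda>x. z * f x) ?v"
    by (rule L2_inner_cong_AE[OF LfL vL L2_scale[OF fL] vL ev]) simp
  finally show "L2_inner (\<lambda>x. cay x powi (- int m) * f x) (\<lambda>x. abs_nabla u x - cnj z * u x) = 0"
    by (simp add: L2_inner_scale_left)
qed

text \<open>Whatever z is, reflection supplies the other half and f lands in the kernel. This
  excludes negative and embedded positive eigenvalues at once.\<close>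

lemma L_minus_eigenvector:
  assumes f: "f \<in> H1" and ev: "AE x in lborel. L_minus m f x = z * f x"
  shows "\<exists>c. AE x in lborel. f x = kspan m c x"
proof (rule kspan_characterization)
  show "Hp (\<lambda>x. cay (- x) powi (- int m) * f (- x))" by (rule L_minus_eigenvector_half[OF f ev])
  have "AE x in lborel. L_minus m (\<lambda>x. f (- x)) x = z * f (- x)"
    using L_minus_reflect[OF f, of m] AE_lborel_reflect[OF ev] by eventually_elim simp
  from L_minus_eigenvector_half[OF H1_reflect(1)[OF f] this]
  show "Hp (\<lambda>x. cay x powi (int m) * f x)" by (simp add: cay_powi_reflect)
qed

lemma L_minus_eigenvector_zero:
  assumes f: "f \<in> H1" and ev: "AE x in lborel. L_minus m f x = z * f x" and z: "z \<noteq> 0"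
  shows "AE x in lborel. f x = 0"
proof -
  obtain c where c: "AE x in lborel. f x = kspan m c x" using L_minus_eigenvector[OF f ev] by blast
  show ?thesis
    using ev L_minus_cong_AE[OF f kspan_H1 c, of m] L_minus_kspan[of m c] by eventually_elim (use z in simp)
qed

lemma kspan_independent:
  assumes "AE x in lborel. kspan m c x = 0" "j < 2 * m" shows "c j = 0"
proof -
  have "L2_inner (kspan m c) (efun (int j - int m)) = (\<Sum>i<2 * m. L2_inner (\<lambda>x. c i * efun (int i - int m) x) (efun (int j - int m)))"
    unfolding kspan_def[abs_def] by (rule L2_inner_sum_left) (auto intro: L2_scale efun_L2)
  also have "\<dots> = (\<Sum>i<2 * m. if i = j then c i * pi else 0)"
    by (intro sum.cong refl) (auto simp: L2_inner_scale_left efun_orthogonal)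
  also have "\<dots> = c j * pi" using assms(2) by simp
  finally have "L2_inner (kspan m c) (efun (int j - int m)) = c j * pi" .
  moreover have "L2_inner (kspan m c) (efun (int j - int m)) = L2_inner (\<lambda>x. 0) (efun (int j - int m))"
    using assms(1) by (intro L2_inner_cong_AE efun_L2 H1_L2 kspan_H1 L2_zero) auto
  ultimately show ?thesis by (simp add: L2_inner_def)
qed

lemma L_minus_eigenspace_dim: "has_dim_AE (eigenspace H1 (L_minus m) 0) (2 * m)"
  unfolding has_dim_AE_def
proof (intro exI[of _ "\<lambda>j. efun (int j - int m)"] conjI allI impI ballI)
  fix j assume "j < 2 * m"
  then show "efun (int j - int m) \<in> eigenspace H1 (L_minus m) 0"
    using L_minus_efun[of m "int j - int m"] by (auto simp: eigenspace_def)
next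
  fix c j assume "AE x in lborel. (\<Sum>j<2 * m. c j * efun (int j - int m) x) = 0" "j < 2 * m"
  then show "c j = 0" using kspan_independent[of m c j] by (simp add: kspan_def)
next
  fix f assume "f \<in> eigenspace H1 (L_minus m) 0"
  then show "\<exists>c. AE x in lborel. f x = (\<Sum>j<2 * m. c j * efun (int j - int m) x)"
    using L_minus_eigenvector[of f m 0] by (auto simp: eigenspace_def kspan_def)
qed

lemma L_minus_point_spectrum:
  assumes "m \<ge> 1" shows "point_spectrum H1 (L_minus m) = {0}"
proof
  show "point_spectrum H1 (L_minus m) \<subseteq> {0}"
    using L_minus_eigenvector_zero by (fastforce simp: point_spectrum_def eigenspace_def)
  have "efun 0 \<in> eigenspace H1 (L_minus m) 0"
    using L_minus_efun[of m 0] assms by (auto simp: eigenspace_def)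
  moreover have "\<not> (AE x in lborel. efun 0 x = 0)"
    using L2_norm_eq_0[OF efun_L2[of 0]] res_norm by (simp add: efun_def[abs_def])
  ultimately show "{0} \<subseteq> point_spectrum H1 (L_minus m)" by (auto simp: point_spectrum_def)
qed

text \<open>Let a be the Hardy projection of \<beta>^-m g. Dividing its transform by
  \<bar>\<xi>\<bar> - z solves the equation with right-hand side \<beta>^m a, and the rest of
  \<beta>^-m g lies in the opposite half.\<close>

lemma L_minus_half_solution:
  assumes g: "g \<in> L2" and d: "d > 0" "\<And>\<xi>. d \<le> norm (complex_of_real \<bar>\<xi>\<bar> - z)"
  shows "\<exists>f\<in>H1. \<exists>a. Hp a \<and> (AE x in lborel. L_minus m f x - z * f x = cay x powi (int m) * a x) \<and>
    Hp (\<lambda>x. cay (- x) powi (- int m) * g (- x) - a (- x)) \<and>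
    L2_norm f \<le> L2_norm g / d \<and> L2_norm a \<le> L2_norm g"
proof -
  have hL: "(\<lambda>x. cay x powi (- int m) * g x) \<in> L2" by (rule L2_cay_powi[OF g])
  obtain A where A: "has_fourier (\<lambda>x. cay x powi (- int m) * g x) A" using has_fourier_exists[OF hL] .
  have AL: "A \<in> L2" using A by (rule has_fourier_L2)
  have [measurable]: "A \<in> borel_measurable borel" using AL by auto
  have nA: "L2_norm A = sqrt (2 * pi) * L2_norm g"
    using has_fourier_norm[OF A] by (simp only: L2_norm_cay_powi)
  let ?P = "\<lambda>\<xi>. indicator {0..} \<xi> * A \<xi>"
  have PL: "?P \<in> L2" by (rule L2_indicator[OF AL]) simp
  obtain a where a: "has_fourier a ?P" using has_fourier_surj[OF PL] .
  have Ha: "Hp a" unfolding Hp_def using a by (intro exI[of _ ?P]) auto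
  let ?U = "\<lambda>\<xi>. ?P \<xi> / (complex_of_real \<bar>\<xi>\<bar> - z)"
  have nz: "complex_of_real \<bar>\<xi>\<bar> - z \<noteq> 0" for \<xi> using d(2)[of \<xi>] d(1) by auto
  have bd: "AE \<xi> in lborel. norm (?U \<xi>) \<le> (1 / d) * norm (A \<xi>)"
  proof (rule AE_I2)
    fix \<xi>
    have "norm (?U \<xi>) \<le> norm (A \<xi>) / norm (complex_of_real \<bar>\<xi>\<bar> - z)"
      unfolding norm_divide by (intro divide_right_mono) (auto simp: indicator_def)
    also have "\<dots> \<le> norm (A \<xi>) / d"
      using d nz[of \<xi>] by (intro divide_left_mono) (auto intro!: mult_pos_pos)
    finally show "norm (?U \<xi>) \<le> (1 / d) * norm (A \<xi>)" by simp
  qed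
  have UL: "?U \<in> L2" by (rule L2_dominated[OF _ AL bd]) measurable
  obtain u where u: "has_fourier u ?U" using has_fourier_surj[OF UL] .
  have "(\<lambda>\<xi>. ?P \<xi> + z * ?U \<xi>) = (\<lambda>\<xi>. complex_of_real \<bar>\<xi>\<bar> * ?U \<xi>)"
    using nz by (intro ext) (simp add: field_simps)
  then have "has_fourier (\<lambda>x. a x + z * u x) (\<lambda>\<xi>. complex_of_real \<bar>\<xi>\<bar> * ?U \<xi>)"
    using has_fourier_add[OF a has_fourier_scale[OF u, of z]] by simp
  note un = abs_nabla_eqI[OF u this]
  have uHp: "Hp u" unfolding Hp_def using u by (intro exI[of _ ?U]) auto
  note c = L_minus_cay_power[OF un(1) uHp, of m]
  have "AE x in lborel. L_minus m (\<lambda>x. cay x ^ m * u x) x - z * (cay x ^ m * u x) = cay x powi (int m) * a x"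
    using c(2) un(2) by eventually_elim (simp add: algebra_simps)
  moreover have "Hp (\<lambda>x. cay (- x) powi (- int m) * g (- x) - a (- x))"
    unfolding Hp_def using has_fourier_reflect[OF has_fourier_diff[OF A a]]
    by (intro exI[of _ "\<lambda>\<xi>. A (- \<xi>) - ?P (- \<xi>)"]) auto
  moreover have "L2_norm (\<lambda>x. cay x ^ m * u x) \<le> L2_norm g / d"
  proof -
    have "sqrt (2 * pi) * L2_norm u \<le> (1 / d) * (sqrt (2 * pi) * L2_norm g)"
      using L2_norm_dominated[OF _ AL bd] d(1) unfolding has_fourier_norm[OF u, symmetric] nA[symmetric] by simp
    also have "\<dots> = sqrt (2 * pi) * (L2_norm g / d)" by simp
    finally have "L2_norm u \<le> L2_norm g / d" by (simp only: mult_le_cancel_left_pos real_sqrt_gt_zero pi_gt_zero zero_less_mult_iff zero_less_numeral simp_thms)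
    then show ?thesis using L2_norm_cay_powi[of "int m" u] by simp
  qed
  moreover have "L2_norm a \<le> L2_norm g"
  proof -
    have "L2_norm ?P \<le> 1 * L2_norm A"
      by (rule L2_norm_dominated[OF _ AL]) (auto simp: indicator_def)
    then have "sqrt (2 * pi) * L2_norm a \<le> sqrt (2 * pi) * L2_norm g"
      unfolding has_fourier_norm[OF a, symmetric] nA[symmetric] by simp
    then show ?thesis by (simp only: mult_le_cancel_left_pos real_sqrt_gt_zero pi_gt_zero zero_less_mult_iff zero_less_numeral simp_thms)
  qed
  ultimately show ?thesis using c(1) Ha by blast
qed

lemma nonneg_gap:
  assumes "z \<notin> complex_of_real ` {0..}"
  obtains d where "d > 0" "\<And>\<xi>. d \<le> norm (complex_of_real \<bar>\<xi>\<bar> - z)"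
proof -
  have "complex_of_real ` {0..} = \<real>\<^sub>\<ge>\<^sub>0" by (auto simp: nonneg_Reals_def)
  then have "closed (complex_of_real ` {0..})" by simp
  then have "open (- complex_of_real ` {0..})" by (rule open_Compl)
  with assms obtain d where d: "d > 0" "ball z d \<subseteq> - complex_of_real ` {0..}"
    by (metis ComplI openE)
  have "d \<le> norm (complex_of_real \<bar>\<xi>\<bar> - z)" for \<xi>
  proof (rule ccontr)
    assume "\<not> d \<le> norm (complex_of_real \<bar>\<xi>\<bar> - z)"
    then have "complex_of_real \<bar>\<xi>\<bar> \<in> ball z d" by (simp add: dist_norm norm_minus_commute)
    then show False using d(2) by auto
  qed
  with d(1) show ?thesis by (rule that)
qed

text \<open>The half solution is applied to g and to its reflection. What is left of g lies in the
  kernel of \<open>L_minus\<close>, where the inverse of \<open>L_minus\<close> - z is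
  multiplication by -1/z.\<close>

lemma L_minus_solution:
  assumes z: "z \<notin> complex_of_real ` {0..}"
  obtains C where "C \<ge> 0" "\<And>g. g \<in> L2 \<Longrightarrow> \<exists>f\<in>H1. (AE x in lborel. L_minus m f x - z * f x = g x) \<and> L2_norm f \<le> C * L2_norm g"
proof -
  obtain d where d: "d > 0" "\<And>\<xi>. d \<le> norm (complex_of_real \<bar>\<xi>\<bar> - z)" using nonneg_gap[OF z] by blast
  have z0: "z \<noteq> 0" using z by auto
  \<comment> \<open>Each half costs 1/d; the kernel part has norm at most 3 times that of g and is
    divided by |z|.\<close>
  define C where "C = 2 / d + 3 / norm z"
  have C: "C \<ge> 0" using d by (simp add: C_def)
  moreover have "\<exists>f\<in>H1. (AE x in lborel. L_minus m f x - z * f x = g x) \<and> L2_norm f \<le> C * L2_norm g" if g: "g \<in> L2" for g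
  proof -
    obtain f1 a where f1: "f1 \<in> H1" "Hp a" "AE x in lborel. L_minus m f1 x - z * f1 x = cay x powi (int m) * a x"
      "Hp (\<lambda>x. cay (- x) powi (- int m) * g (- x) - a (- x))" "L2_norm f1 \<le> L2_norm g / d" "L2_norm a \<le> L2_norm g"
      using L_minus_half_solution[OF g d] by blast
    obtain f2 b where f2: "f2 \<in> H1" "Hp b" "AE x in lborel. L_minus m f2 x - z * f2 x = cay x powi (int m) * b x"
      "Hp (\<lambda>x. cay (- x) powi (- int m) * g x - b (- x))" "L2_norm f2 \<le> L2_norm g / d" "L2_norm b \<le> L2_norm g"
      using L_minus_half_solution[OF L2_reflect[OF g] d, of m] unfolding L2_norm_reflect[of g] minus_minus
      by blast
    define g1 where "g1 x = cay x powi (int m) * a x" for x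
    define g2 where "g2 x = cay x powi (- int m) * b (- x)" for x
    define k where "k x = g x - g1 x - g2 x" for x
    have g1L: "g1 \<in> L2" unfolding g1_def[abs_def] by (intro L2_cay_powi Hp_L2 f1)
    have g2L: "g2 \<in> L2" unfolding g2_def[abs_def] by (intro L2_cay_powi L2_reflect Hp_L2 f2)
    have ev2: "AE x in lborel. L_minus m (\<lambda>x. f2 (- x)) x - z * f2 (- x) = g2 x"
      using L_minus_reflect[OF f2(1), of m] AE_lborel_reflect[OF f2(3)]
    proof eventually_elim
      case (elim x)
      show ?case unfolding elim g2_def cay_powi_reflect ..
    qed
    have c1: "cay x powi (int m) * cay x powi (- int m) = 1" for x
      using power_int_add[of "cay x" "int m" "- int m"] by simp
    have "\<exists>c. AE x in lborel. k x = kspan m c x"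
    proof (rule kspan_characterization)
      \<comment> \<open>Subtracting the mirrored part leaves a Hardy function by the half solution,
        and the other part contributes \<beta>^(2 m) a, again a Hardy function.\<close>
      have "cay x powi (int m) * k x = (cay (- x) powi (- int m) * g x - b (- x)) - cay x ^ (2 * m) * a x" for x
      proof -
        have "cay x powi (int m) * k x = cay x powi (int m) * g x - cay x powi (int m) * (cay x powi (int m) * a x)
            - (cay x powi (int m) * cay x powi (- int m)) * b (- x)"
          by (simp only: k_def g1_def g2_def right_diff_distrib mult.assoc)
        then show ?thesis unfolding c1 by (simp add: cay_powi_reflect mult_2 power_add mult.assoc)
      qed
      then show "Hp (\<lambda>x. cay x powi (int m) * k x)"
        using Hp_diff[OF f2(4) Hp_cay_power[OF f1(2), of "2 * m"]] by simp
      have "cay (- x) powi (- int m) * k (- x) = (cay (- x) powi (- int m) * g (- x) - a (- x)) - cay x ^ (2 * m) * b x" for x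
      proof -
        have "cay (- x) powi (- int m) * k (- x) = cay (- x) powi (- int m) * g (- x)
            - (cay (- x) powi (int m) * cay (- x) powi (- int m)) * a (- x)
            - cay (- x) powi (- int m) * (cay (- x) powi (- int m) * b x)"
          by (simp only: k_def g1_def g2_def right_diff_distrib mult_ac minus_minus)
        then show ?thesis unfolding c1 by (simp add: cay_powi_reflect mult_2 power_add mult.assoc)
      qed
      then show "Hp (\<lambda>x. cay (- x) powi (- int m) * k (- x))"
        using Hp_diff[OF f1(4) Hp_cay_power[OF f2(2), of "2 * m"]] by simp
    qed
    then obtain c where c: "AE x in lborel. k x = kspan m c x" by blast
    let ?f3 = "\<lambda>x. (- 1 / z) * kspan m c x"
    have f3H: "?f3 \<in> H1" by (rule H1_scale(1)[OF kspan_H1])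
    have ev3: "AE x in lborel. L_minus m ?f3 x - z * ?f3 x = k x"
      using L_minus_scale[OF kspan_H1, of m "- 1 / z" m c] L_minus_kspan[of m c] c
      by eventually_elim (use z0 in simp)
    have f2H: "(\<lambda>x. f2 (- x)) \<in> H1" by (rule H1_reflect(1)[OF f2(1)])
    have f12H: "(\<lambda>x. f1 x + f2 (- x)) \<in> H1" by (rule H1_add(1)[OF f1(1) f2H])
    let ?f = "\<lambda>x. (f1 x + f2 (- x)) + ?f3 x"
    have fH: "?f \<in> H1" by (rule H1_add(1)[OF f12H f3H])
    have ev: "AE x in lborel. L_minus m ?f x - z * ?f x = g x"
      using L_minus_add[OF f12H f3H, of m] L_minus_add[OF f1(1) f2H, of m] f1(3) ev2 ev3
    proof eventually_elim
      case (elim x)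
      have "L_minus m ?f x - z * ?f x = (L_minus m f1 x - z * f1 x) + (L_minus m (\<lambda>x. f2 (- x)) x - z * f2 (- x))
          + (L_minus m ?f3 x - z * ?f3 x)" unfolding elim(1,2) by (simp only: algebra_simps)
      then show ?case unfolding elim(3-5) by (simp add: k_def g1_def)
    qed
    have nk: "L2_norm k \<le> 3 * L2_norm g"
    proof -
      have "L2_norm k \<le> L2_norm (\<lambda>x. g x - g1 x) + L2_norm g2"
        unfolding k_def[abs_def] by (intro L2_norm_triangle_diff L2_diff g g1L g2L)
      moreover have "L2_norm (\<lambda>x. g x - g1 x) \<le> L2_norm g + L2_norm g1"
        by (intro L2_norm_triangle_diff g g1L)
      moreover have "L2_norm g1 = L2_norm a" "L2_norm g2 = L2_norm b"
        unfolding g1_def[abs_def] g2_def[abs_def] L2_norm_cay_powi L2_norm_reflect[of b] by auto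
      ultimately show ?thesis using f1(6) f2(6) by linarith
    qed
    have kL: "k \<in> L2" unfolding k_def[abs_def] by (intro L2_diff g g1L g2L)
    have nf3: "L2_norm ?f3 \<le> 3 / norm z * L2_norm g"
    proof -
      have "L2_norm (kspan m c) = L2_norm k"
        using c kL H1_L2[OF kspan_H1[of m c]] by (intro L2_norm_cong_AE) auto
      then have "L2_norm ?f3 = L2_norm k / norm z" unfolding L2_norm_scale by (simp add: norm_divide)
      also have "\<dots> \<le> 3 * L2_norm g / norm z" by (intro divide_right_mono nk) simp
      finally show ?thesis by simp
    qed
    have "L2_norm ?f \<le> L2_norm (\<lambda>x. f1 x + f2 (- x)) + L2_norm ?f3"
      by (intro L2_norm_triangle H1_L2 f12H f3H)
    also have "L2_norm (\<lambda>x. f1 x + f2 (- x)) \<le> L2_norm f1 + L2_norm (\<lambda>x. f2 (- x))"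
      by (intro L2_norm_triangle H1_L2 f1 f2H)
    finally have "L2_norm ?f \<le> C * L2_norm g"
      using f1(5) f2(5) nf3 unfolding L2_norm_reflect[of f2] by (simp add: C_def distrib_right)
    with fH ev show ?thesis by blast
  qed
  ultimately show ?thesis by (rule that)
qed

text \<open>The constructed solution carries the bound; injectivity for z \<noteq> 0 identifies it
  with any given f that has the same image.\<close>

lemma L_minus_resolvent:
  assumes z: "z \<notin> complex_of_real ` {0..}"
  shows "z \<in> resolvent_set H1 (L_minus m)"
proof -
  have z0: "z \<noteq> 0" using z by auto
  obtain C where C: "\<And>g. g \<in> L2 \<Longrightarrow> \<exists>f\<in>H1. (AE x in lborel. L_minus m f x - z * f x = g x) \<and> L2_norm f \<le> C * L2_norm g"
    using L_minus_solution[OF z] by metis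
  have "L2_norm f \<le> C * L2_norm (\<lambda>x. L_minus m f x - z * f x)" if f: "f \<in> H1" for f
  proof -
    have gL: "(\<lambda>x. L_minus m f x - z * f x) \<in> L2"
      unfolding L_minus_eq by (intro L2_diff Lm.T_L2 L2_scale H1_L2 f)
    obtain f' where f': "f' \<in> H1" "AE x in lborel. L_minus m f' x - z * f' x = L_minus m f x - z * f x"
      "L2_norm f' \<le> C * L2_norm (\<lambda>x. L_minus m f x - z * f x)"
      using C[OF gL] by blast
    let ?n = "\<lambda>x. (- 1) * f' x"
    have n: "?n \<in> H1" by (rule H1_scale(1)[OF f'(1)])
    have "AE x in lborel. L_minus m (\<lambda>x. f x + ?n x) x = z * (f x + ?n x)"
      using L_minus_add[OF f n, of m] L_minus_scale[OF f'(1), of m "-1"] f'(2)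
    proof eventually_elim
      case (elim x)
      show ?case unfolding elim(1,2) using elim(3) by (simp add: algebra_simps)
    qed
    from L_minus_eigenvector_zero[OF H1_add(1)[OF f n] this z0]
    have "AE x in lborel. f x = f' x" by simp
    then have "L2_norm f = L2_norm f'"
      using H1_L2[OF f] H1_L2[OF f'(1)] by (intro L2_norm_cong_AE) auto
    then show ?thesis using f'(3) by simp
  qed
  then show ?thesis unfolding resolvent_set_def using C by blast
qed

section \<open>The resolvent of \<open>L_plus\<close>\<close>

text \<open>An injective square system has nonzero determinant, hence a right inverse. The matrices
  are hidden so that the caller works with plain sums.\<close>

lemma finite_system_inverse:
  fixes M :: "nat \<Rightarrow> nat \<Rightarrow> complex"
  assumes inj: "\<And>x. (\<And>i. i < n \<Longrightarrow> (\<Sum>k<n. M i k * x k) = 0) \<Longrightarrow> (\<And>k. k < n \<Longrightarrow> x k = 0)"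
  obtains N where "\<And>y i. i < n \<Longrightarrow> (\<Sum>k<n. M i k * (\<Sum>l<n. N k l * y l)) = y i"
proof -
  define A where "A = Matrix.mat n n (\<lambda>(i, k). M i k)"
  have A: "A \<in> carrier_mat n n" by (simp add: A_def)
  have "Determinant.det A \<noteq> 0"
  proof
    assume "Determinant.det A = 0"
    then obtain v where v: "v \<in> carrier_vec n" "v \<noteq> 0\<^sub>v n" "A *\<^sub>v v = 0\<^sub>v n"
      using det_0_iff_vec_prod_zero_field[OF A] by auto
    have "(\<Sum>k<n. M i k * vec_index v k) = 0" if "i < n" for i
    proof -
      have "(\<Sum>k<n. M i k * vec_index v k) = vec_index (A *\<^sub>v v) i"
        using that v(1) by (simp add: A_def scalar_prod_def atLeast0LessThan)
      then show ?thesis using v(3) that by simp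
    qed
    from inj[OF this] have "v = 0\<^sub>v n" using v(1) by (intro eq_vecI) auto
    with v(2) show False by simp
  qed
  from det_non_zero_imp_unit[OF A this, of "()"]
  obtain B where B: "B \<in> carrier_mat n n" "A * B = 1\<^sub>m n"
    by (auto simp: Units_def ring_mat_simps)
  have AB: "(\<Sum>k<n. M i k * index_mat B (k, l)) = (if i = l then 1 else 0)" if "i < n" "l < n" for i l
  proof -
    have "(\<Sum>k<n. M i k * index_mat B (k, l)) = index_mat (A * B) (i, l)"
      using that B(1) by (simp add: A_def scalar_prod_def atLeast0LessThan)
    then show ?thesis using that by (simp add: B(2))
  qed
  have "(\<Sum>k<n. M i k * (\<Sum>l<n. index_mat B (k, l) * y l)) = y i" if "i < n" for y i
  proof -
    have "(\<Sum>k<n. M i k * (\<Sum>l<n. index_mat B (k, l) * y l)) = (\<Sum>k<n. \<Sum>l<n. M i k * index_mat B (k, l) * y l)"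
      by (simp add: sum_distrib_left mult.assoc)
    also have "\<dots> = (\<Sum>l<n. (\<Sum>k<n. M i k * index_mat B (k, l)) * y l)"
      by (subst sum.swap) (simp add: sum_distrib_right)
    also have "\<dots> = (\<Sum>l<n. (if i = l then 1 else 0) * y l)"
      using that by (intro sum.cong refl) (simp add: AB)
    also have "\<dots> = (\<Sum>l<n. if i = l then y l else 0)" by (intro sum.cong) auto
    finally show ?thesis using that by simp
  qed
  then show ?thesis by (rule that)
qed

lemma L_plus_add:
  "f \<in> H1 \<Longrightarrow> g \<in> H1 \<Longrightarrow> AE x in lborel. L_plus m (\<lambda>x. f x + g x) x = L_plus m f x + L_plus m g x"
  using H1_add(2)[of f g] by (auto simp: L_plus_def algebra_simps add_divide_distrib elim!: eventually_mono)

lemma L_plus_scale: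
  "f \<in> H1 \<Longrightarrow> AE x in lborel. L_plus m (\<lambda>x. c * f x) x = c * L_plus m f x"
  using H1_scale(2)[of f c] by (auto simp: L_plus_def algebra_simps elim!: eventually_mono)

lemma L_minus_sum:
  fixes n :: nat
  assumes "\<And>j. j < n \<Longrightarrow> a j \<in> H1" "\<And>j. j < n \<Longrightarrow> AE t in lborel. L_minus m (a j) t - z * a j t = q j t"
  shows "(\<lambda>t. \<Sum>j<n. x j * a j t) \<in> H1 \<and>
    (AE t in lborel. L_minus m (\<lambda>t. \<Sum>j<n. x j * a j t) t - z * (\<Sum>j<n. x j * a j t) = (\<Sum>j<n. x j * q j t))"
  using assms
proof (induction n)
  case 0
  have "AE t in lborel. L_minus m (\<lambda>x. 0 * (0::complex)) t = 0 * L_minus m (\<lambda>x. 0) t"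
    by (rule L_minus_scale[OF H1_zero])
  then show ?case by (simp add: H1_zero)
next
  case (Suc n)
  have IH: "(\<lambda>t. \<Sum>j<n. x j * a j t) \<in> H1"
    "AE t in lborel. L_minus m (\<lambda>t. \<Sum>j<n. x j * a j t) t - z * (\<Sum>j<n. x j * a j t) = (\<Sum>j<n. x j * q j t)"
    using Suc.IH Suc.prems by auto
  have an: "a n \<in> H1" "AE t in lborel. L_minus m (a n) t - z * a n t = q n t" using Suc.prems by auto
  have s: "(\<lambda>t. x n * a n t) \<in> H1" by (rule H1_scale(1)[OF an(1)])
  have "AE t in lborel. L_minus m (\<lambda>t. (\<Sum>j<n. x j * a j t) + x n * a n t) t
      - z * ((\<Sum>j<n. x j * a j t) + x n * a n t) = (\<Sum>j<n. x j * q j t) + x n * q n t"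
    using L_minus_add[OF IH(1) s, of m] L_minus_scale[OF an(1), of m "x n"] IH(2) an(2)
  proof eventually_elim
    case (elim t)
    show ?case unfolding elim(1,2) elim(3)[symmetric] elim(4)[symmetric] by (simp only: algebra_simps)
  qed
  then show ?case unfolding sum.lessThan_Suc using H1_add(1)[OF IH(1) s] by blast
qed

text \<open>\<open>L_plus\<close> is \<open>L_minus\<close> minus R. Solve first with
  \<open>L_minus\<close> and correct by a combination of the solutions a_j for the vectors q_j that
  span the range of R. The coefficients satisfy a finite linear system, and a null vector of that
  system would give an element of the kernel of \<open>L_plus\<close> - z.\<close>

lemma L_plus_resolvent:
  assumes z: "z \<notin> complex_of_real ` {0..}"
    and inj: "\<And>f. f \<in> H1 \<Longrightarrow> AE x in lborel. L_plus m f x = z * f x \<Longrightarrow> AE x in lborel. f x = 0"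
  shows "z \<in> resolvent_set H1 (L_plus m)"
proof -
  obtain C where C: "C \<ge> 0" "\<And>g. g \<in> L2 \<Longrightarrow> \<exists>f\<in>H1. (AE x in lborel. L_minus m f x - z * f x = g x) \<and> L2_norm f \<le> C * L2_norm g"
    using L_minus_solution[OF z] by metis
  \<comment> \<open>There are 2 m - 1 indices with \<bar>d\<bar> < m, and \<open>d\<close> numbers
    them from 0.\<close>
  define n where "n = 2 * m - 1"
  define d where "d j = int j + 1 - int m" for j
  define q where "q j = pfun (d j)" for j
  define \<kappa> where "\<kappa> j = complex_of_real (2 / pi) * of_int (int m - \<bar>d j\<bar>)" for j
  have qL: "q j \<in> L2" for j by (simp add: q_def pfun_L2)
  have R: "R_op m f x = (\<Sum>j<n. \<kappa> j * L2_inner f (q j) * q j x)" if "f \<in> L2" for f x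
  proof -
    have "R_op m f x = (\<Sum>e\<in>{- int m<..<int m}. (complex_of_real (2 / pi) * of_int (int m - \<bar>e\<bar>) * L2_inner f (pfun e)) * pfun e x)"
      unfolding R_op_fun_eq[OF that] ..
    also have "\<dots> = (\<Sum>j<n. \<kappa> j * L2_inner f (q j) * q j x)"
      unfolding \<kappa>_def q_def
      by (rule sum.reindex_bij_witness[of _ d "\<lambda>e. nat (e + int m - 1)"]) (auto simp: d_def n_def)
    finally show ?thesis .
  qed
  have "\<forall>j. \<exists>a. a \<in> H1 \<and> (AE x in lborel. L_minus m a x - z * a x = q j x)"
    using C(2)[OF qL] by blast
  then obtain a where a: "\<And>j. a j \<in> H1" "\<And>j. AE x in lborel. L_minus m (a j) x - z * a j x = q j x"
    by metis
  define comb where "comb x t = (\<Sum>j<n. x j * a j t)" for x t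
  have comb: "comb x \<in> H1" "AE t in lborel. L_minus m (comb x) t - z * comb x t = (\<Sum>j<n. x j * q j t)" for x
    using L_minus_sum[of n a m z q x] a by (simp_all add: comb_def[abs_def])
  have inner_comb: "L2_inner (comb x) (q j) = (\<Sum>k<n. x k * L2_inner (a k) (q j))" for x j
  proof -
    have "L2_inner (comb x) (q j) = (\<Sum>k<n. L2_inner (\<lambda>t. x k * a k t) (q j))"
      unfolding comb_def[abs_def] by (rule L2_inner_sum_left) (auto intro: L2_scale H1_L2 a qL)
    then show ?thesis by (simp add: L2_inner_scale_left)
  qed
  \<comment> \<open>The system M x = y with y j = \<kappa> j \<langle>f0, q j\<rangle> says that R
    applied to f0 + \<open>comb x\<close> is the sum of the x j q j, exactly the term that
    \<open>comb x\<close> contributes.\<close>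
  define M where "M j k = (if j = k then 1 else 0) - \<kappa> j * L2_inner (a k) (q j)" for j k
  have Mx: "(\<Sum>k<n. M j k * x k) = x j - \<kappa> j * L2_inner (comb x) (q j)" if "j < n" for j x
  proof -
    have "(\<Sum>k<n. M j k * x k) = (\<Sum>k<n. (if j = k then x k else 0) - \<kappa> j * (x k * L2_inner (a k) (q j)))"
      by (intro sum.cong refl) (simp add: M_def algebra_simps)
    also have "\<dots> = x j - \<kappa> j * (\<Sum>k<n. x k * L2_inner (a k) (q j))"
      using that by (simp add: sum_subtractf sum_distrib_left)
    finally show ?thesis by (simp add: inner_comb)
  qed
  have split: "L_plus m f x - z * f x = (L_minus m f x - z * f x) - R_op m f x" for f x
    by (simp add: L_minus_def)
  have Minj: "x k = 0" if Mz: "\<And>i. i < n \<Longrightarrow> (\<Sum>k<n. M i k * x k) = 0" and k: "k < n" for x k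
  proof -
    have eq: "x j = \<kappa> j * L2_inner (comb x) (q j)" if "j < n" for j
      using Mx[OF that, of x] Mz[OF that] by simp
    have "AE t in lborel. L_plus m (comb x) t = z * comb x t"
      using comb(2)[of x]
    proof eventually_elim
      case (elim t)
      have "L_plus m (comb x) t - z * comb x t = (\<Sum>j<n. x j * q j t) - (\<Sum>j<n. \<kappa> j * L2_inner (comb x) (q j) * q j t)"
        unfolding split elim R[OF H1_L2[OF comb(1)]] ..
      also have "\<dots> = 0" using eq by simp
      finally show ?case by simp
    qed
    from inj[OF comb(1) this] have "L2_inner (comb x) (q k) = L2_inner (\<lambda>t. 0) (q k)"
      by (intro L2_inner_cong_AE H1_L2 comb qL L2_zero) auto
    then show ?thesis using eq[OF k] by (simp add: L2_inner_def)
  qed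
  obtain N where N: "\<And>y i. i < n \<Longrightarrow> (\<Sum>k<n. M i k * (\<Sum>l<n. N k l * y l)) = y i"
  proof (rule finite_system_inverse[of n M])
    fix x k assume "\<And>i. i < n \<Longrightarrow> (\<Sum>k<n. M i k * x k) = 0" "k < n"
    then show "x k = 0" by (rule Minj[of x k])
  qed blast
  \<comment> \<open>C bounds f0; the sum bounds the correction through Cauchy-Schwarz for the data y
    and the entries of N.\<close>
  define D where "D = C * (1 + (\<Sum>k<n. (\<Sum>l<n. norm (N k l) * (norm (\<kappa> l) * L2_norm (q l))) * L2_norm (a k)))"
  have sol: "\<exists>f\<in>H1. (AE x in lborel. L_plus m f x - z * f x = g x) \<and> L2_norm f \<le> D * L2_norm g" if g: "g \<in> L2" for g
  proof -
    obtain f0 where f0: "f0 \<in> H1" "AE x in lborel. L_minus m f0 x - z * f0 x = g x" "L2_norm f0 \<le> C * L2_norm g"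
      using C(2)[OF g] by blast
    have f0L: "f0 \<in> L2" using f0 by (intro H1_L2)
    define y where "y j = \<kappa> j * L2_inner f0 (q j)" for j
    define x where "x k = (\<Sum>l<n. N k l * y l)" for k
    have xeq: "x j = \<kappa> j * L2_inner f0 (q j) + \<kappa> j * L2_inner (comb x) (q j)" if "j < n" for j
    proof -
      have 1: "(\<Sum>k<n. M j k * x k) = y j" unfolding x_def by (rule N[OF that])
      show ?thesis using Mx[OF that, of x] unfolding 1 unfolding y_def by (simp add: algebra_simps)
    qed
    let ?f = "\<lambda>t. f0 t + comb x t"
    have fH: "?f \<in> H1" by (rule H1_add(1)[OF f0(1) comb(1)])
    have "AE t in lborel. L_plus m ?f t - z * ?f t = g t"
      using L_minus_add[OF f0(1) comb(1), of m x] f0(2) comb(2)[of x]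
    proof eventually_elim
      case (elim t)
      have "R_op m ?f t = (\<Sum>j<n. (\<kappa> j * L2_inner f0 (q j) + \<kappa> j * L2_inner (comb x) (q j)) * q j t)"
        unfolding R[OF H1_L2[OF fH]]
        by (simp add: L2_inner_add_left f0L H1_L2 comb qL distrib_left)
      also have "\<dots> = (\<Sum>j<n. x j * q j t)" using xeq by simp
      finally have Rf: "R_op m ?f t = (\<Sum>j<n. x j * q j t)" .
      have "L_plus m ?f t - z * ?f t = (L_minus m ?f t - z * ?f t) - R_op m ?f t" by (rule split)
      also have "\<dots> = (L_minus m f0 t - z * f0 t) + (L_minus m (comb x) t - z * comb x t) - R_op m ?f t"
        unfolding elim(1) by (simp add: algebra_simps)
      finally have "L_plus m ?f t - z * ?f t = (L_minus m f0 t - z * f0 t) + (L_minus m (comb x) t - z * comb x t) - R_op m ?f t" .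
      then show ?case unfolding Rf elim(2,3) by simp
    qed
    moreover have "L2_norm ?f \<le> D * L2_norm g"
    proof -
      have y: "norm (y l) \<le> (norm (\<kappa> l) * L2_norm (q l)) * L2_norm f0" for l
        using mult_left_mono[OF L2_Cauchy_Schwarz[OF f0L qL, of l] norm_ge_zero[of "\<kappa> l"]]
        by (simp add: y_def norm_mult mult_ac)
      have x: "norm (x k) \<le> (\<Sum>l<n. norm (N k l) * (norm (\<kappa> l) * L2_norm (q l))) * L2_norm f0" for k
      proof -
        have "norm (x k) \<le> (\<Sum>l<n. norm (N k l) * norm (y l))"
          unfolding x_def by (rule order_trans[OF norm_sum]) (simp add: norm_mult)
        also have "\<dots> \<le> (\<Sum>l<n. norm (N k l) * ((norm (\<kappa> l) * L2_norm (q l)) * L2_norm f0))"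
          by (intro sum_mono mult_left_mono y) auto
        finally show ?thesis by (simp add: sum_distrib_right mult.assoc)
      qed
      have "L2_norm (comb x) \<le> (\<Sum>k<n. L2_norm (\<lambda>t. x k * a k t))"
        unfolding comb_def[abs_def] by (intro L2_norm_sum L2_scale H1_L2 a) auto
      also have "\<dots> \<le> (\<Sum>k<n. ((\<Sum>l<n. norm (N k l) * (norm (\<kappa> l) * L2_norm (q l))) * L2_norm f0) * L2_norm (a k))"
        unfolding L2_norm_scale by (intro sum_mono mult_right_mono x) auto
      also have "\<dots> = (\<Sum>k<n. (\<Sum>l<n. norm (N k l) * (norm (\<kappa> l) * L2_norm (q l))) * L2_norm (a k)) * L2_norm f0"
      proof -
        have "(\<Sum>k<n. (S k * L2_norm f0) * L2_norm (a k)) = (\<Sum>k<n. S k * L2_norm (a k)) * L2_norm f0" for S :: "nat \<Rightarrow> real"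
          by (simp add: sum_distrib_left mult_ac)
        then show ?thesis .
      qed
      finally have c: "L2_norm (comb x) \<le> (\<Sum>k<n. (\<Sum>l<n. norm (N k l) * (norm (\<kappa> l) * L2_norm (q l))) * L2_norm (a k)) * L2_norm f0" .
      have "L2_norm ?f \<le> L2_norm f0 + L2_norm (comb x)" by (intro L2_norm_triangle f0L H1_L2 comb)
      also have "\<dots> \<le> (1 + (\<Sum>k<n. (\<Sum>l<n. norm (N k l) * (norm (\<kappa> l) * L2_norm (q l))) * L2_norm (a k))) * L2_norm f0"
        using c by (simp add: distrib_right)
      also have "\<dots> \<le> (1 + (\<Sum>k<n. (\<Sum>l<n. norm (N k l) * (norm (\<kappa> l) * L2_norm (q l))) * L2_norm (a k))) * (C * L2_norm g)"
        by (intro mult_left_mono f0 add_nonneg_nonneg sum_nonneg mult_nonneg_nonneg) auto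
      finally show ?thesis by (simp add: D_def mult_ac)
    qed
    ultimately show ?thesis using fH by blast
  qed
  have "L2_norm f \<le> D * L2_norm (\<lambda>x. L_plus m f x - z * f x)" if f: "f \<in> H1" for f
  proof -
    have gL: "(\<lambda>x. L_plus m f x - z * f x) \<in> L2"
      unfolding L_plus_eq by (intro L2_diff Lp.T_L2 L2_scale H1_L2 f)
    obtain f' where f': "f' \<in> H1" "AE x in lborel. L_plus m f' x - z * f' x = L_plus m f x - z * f x"
      "L2_norm f' \<le> D * L2_norm (\<lambda>x. L_plus m f x - z * f x)"
      using sol[OF gL] by blast
    let ?n = "\<lambda>x. (- 1) * f' x"
    have n': "?n \<in> H1" by (rule H1_scale(1)[OF f'(1)])
    have "AE x in lborel. L_plus m (\<lambda>x. f x + ?n x) x = z * (f x + ?n x)"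
      using L_plus_add[OF f n', of m] L_plus_scale[OF f'(1), of m "-1"] f'(2)
    proof eventually_elim
      case (elim x)
      show ?case unfolding elim(1,2) using elim(3) by (simp add: algebra_simps)
    qed
    from inj[OF H1_add(1)[OF f n'] this]
    have "AE x in lborel. f x = f' x" by simp
    then have "L2_norm f = L2_norm f'"
      using H1_L2[OF f] H1_L2[OF f'(1)] by (intro L2_norm_cong_AE) auto
    then show ?thesis using f'(3) by simp
  qed
  then show ?thesis unfolding resolvent_set_def using sol by blast
qed

section \<open>Laguerre polynomials\<close>

text \<open>\<open>lag m k\<close> is \<open>exp (2 x)\<close> times the \<open>k\<close>-th derivative of \<open>x\<^sup>m exp (- 2 x)\<close>, so that Rolle's theorem
  produces its roots.\<close>

fun lag :: "nat \<Rightarrow> nat \<Rightarrow> real poly" where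
  "lag m 0 = Polynomial.monom 1 m"
| "lag m (Suc k) = pderiv (lag m k) - Polynomial.smult 2 (lag m k)"

lemma degree_lag_le: "degree (lag m k) \<le> m"
proof (induction k)
  case 0 show ?case by (simp add: degree_monom_le)
next
  case (Suc k) then show ?case
    by (auto intro!: degree_diff_le simp: degree_pderiv)
qed

lemma coeff_lag: "Polynomial.coeff (lag m k) m = (-2) ^ k"
proof (induction k)
  case (Suc k)
  have "Polynomial.coeff (lag m k) (Suc m) = 0" using degree_lag_le[of m k] by (intro coeff_eq_0) auto
  then show ?case using Suc by (simp add: coeff_pderiv)
qed simp

lemma lag_nonzero: "lag m k \<noteq> 0"
  using coeff_lag[of m k] by auto

lemma X_power_dvd_lag_step:
  fixes p :: "real poly"
  assumes "[:0, 1:] ^ Suc j dvd p" shows "[:0, 1:] ^ j dvd pderiv p - Polynomial.smult 2 p"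
proof -
  obtain s where s: "p = [:0, 1:] ^ Suc j * s" using assms by (auto elim: dvdE)
  have "pderiv p = [:0, 1:] ^ j * (Polynomial.smult (of_nat (Suc j)) s + [:0, 1:] * pderiv s)"
    unfolding s pderiv_mult pderiv_power_Suc by (simp add: algebra_simps pderiv_pCons)
  then have "[:0, 1:] ^ j dvd pderiv p" by simp
  moreover have "[:0, 1:] ^ j dvd Polynomial.smult 2 p"
  proof -
    have "Polynomial.smult 2 p = [:0, 1:] ^ j * Polynomial.smult 2 ([:0, 1:] * s)"
      unfolding s by (simp only: power_Suc2 mult.assoc mult_smult_right)
    then show ?thesis by (simp only: dvd_triv_left)
  qed
  ultimately show ?thesis by (rule dvd_diff)
qed

lemma X_power_dvd_lag: "k \<le> m \<Longrightarrow> [:0, 1:] ^ (m - k) dvd lag m k"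
proof (induction k)
  case 0 show ?case by (simp add: monom_altdef)
next
  case (Suc k)
  then have "[:0, 1:] ^ Suc (m - Suc k) dvd lag m k" by (simp add: Suc_diff_Suc)
  then show ?case using X_power_dvd_lag_step by simp
qed

lemma poly_lag_0: "k < m \<Longrightarrow> poly (lag m k) 0 = 0"
proof -
  assume "k < m"
  then have "[:0, 1:] dvd lag m k"
    using X_power_dvd_lag[of k m] by (metis dvd_power dvd_trans less_imp_le zero_less_diff)
  then show ?thesis by (auto elim!: dvdE)
qed

lemma exp_poly_tendsto_0:
  fixes p :: "real poly" assumes "c > 0"
  shows "((\<lambda>x. exp (- c * x) * poly p x) \<longlongrightarrow> 0) at_top"
proof -
  have "((\<lambda>x. exp (- c * x) * x ^ i) \<longlongrightarrow> 0) at_top" for i :: nat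
    using assms by real_asymp
  then have "((\<lambda>x. \<Sum>i\<le>degree p. Polynomial.coeff p i * (exp (- c * x) * x ^ i)) \<longlongrightarrow> (\<Sum>i\<le>degree p. Polynomial.coeff p i * 0)) at_top"
    by (intro tendsto_sum tendsto_mult tendsto_const)
  moreover have "(\<lambda>x. \<Sum>i\<le>degree p. Polynomial.coeff p i * (exp (- c * x) * x ^ i)) = (\<lambda>x. exp (- c * x) * poly p x)"
    by (simp add: poly_altdef sum_distrib_left mult_ac)
  ultimately show ?thesis by simp
qed

text \<open>The derivative of exp (- c x) p has the zeros of p' - c p. Rolle gives one between
  consecutive zeros of p, and decay at infinity gives one more beyond the last, so no zero is
  lost.\<close>

lemma Rolle_exp_poly:
  fixes p :: "real poly"
  assumes c: "c > 0" and p: "p \<noteq> 0"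
  shows "card {x. 0 \<le> x \<and> poly p x = 0} \<le> card {x. 0 < x \<and> poly (pderiv p - Polynomial.smult c p) x = 0}"
proof -
  define q where "q = pderiv p - Polynomial.smult c p"
  define h where "h x = exp (- c * x) * poly p x" for x
  define S where "S = {x. 0 \<le> x \<and> poly p x = 0}"
  have finS: "finite S" unfolding S_def using poly_roots_finite[OF p] by (rule rev_finite_subset) auto
  have dh: "(h has_real_derivative exp (- c * x) * poly q x) (at x)" for x
    unfolding h_def q_def by (auto intro!: derivative_eq_intros simp: algebra_simps)
  have h0: "h x = 0 \<longleftrightarrow> poly p x = 0" for x by (simp add: h_def)
  have hcont: "continuous_on A h" for A
    using dh by (meson DERIV_isCont continuous_at_imp_continuous_on)
  have rolle: "\<exists>t. a < t \<and> t < b \<and> poly q t = 0" if "a < b" "h a = h b" for a b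
  proof -
    have "\<exists>t. a < t \<and> t < b \<and> (h has_real_derivative 0) (at t)"
      using that hcont dh by (intro Rolle[of a b h]) (auto simp: real_differentiable_def)
    then obtain t where t: "a < t" "t < b" "(h has_real_derivative 0) (at t)" by blast
    then have "exp (- c * t) * poly q t = 0" using dh DERIV_unique by blast
    then show ?thesis using t by auto
  qed
  have "\<exists>t. s < t \<and> poly q t = 0 \<and> (\<forall>s'\<in>S. s < s' \<longrightarrow> t < s')" if s: "s \<in> S" for s
  proof (cases "\<exists>s'\<in>S. s < s'")
    case True
    define b where "b = Min {s'\<in>S. s < s'}"
    have fin: "finite {s'\<in>S. s < s'}" using finS by simp
    have b: "b \<in> {s'\<in>S. s < s'}" unfolding b_def by (rule Min_in[OF fin]) (use True in auto)
    have le: "b \<le> s'" if "s' \<in> S" "s < s'" for s'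
      unfolding b_def using that by (intro Min_le[OF fin]) auto
    have "h s = h b" using s b h0[of s] h0[of b] by (simp add: S_def)
    then obtain t where "s < t" "t < b" "poly q t = 0" using rolle[of s b] b by auto
    then show ?thesis using le by force
  next
    case False
    have nz: "h x \<noteq> 0" if "x > s" for x
      using False that s by (auto simp: h0 S_def)
    \<comment> \<open>Beyond the last zero s the function keeps its sign. A far point x1 has a
      smaller absolute value than x0, so its value is also taken between s and x0; Rolle applies
      between these two points.\<close>
    define x0 where "x0 = s + 1"
    have hx0: "h x0 \<noteq> 0" using nz by (simp add: x0_def)
    have "((\<lambda>x. \<bar>h x\<bar>) \<longlongrightarrow> 0) at_top"
      using exp_poly_tendsto_0[OF c, of p] unfolding h_def by (rule tendsto_rabs_zero)
    then have "eventually (\<lambda>x. \<bar>h x\<bar> < \<bar>h x0\<bar>) at_top"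
      using hx0 by (intro order_tendstoD) auto
    then obtain x1 where x1: "x1 > x0" "\<bar>h x1\<bar> < \<bar>h x0\<bar>"
      using eventually_gt_at_top[of x0] by (metis (mono_tags, lifting) eventually_conj eventually_at_top_linorder order_refl)
    have same: "h x1 * h x0 > 0"
    proof (rule ccontr)
      assume "\<not> h x1 * h x0 > 0"
      then have "h x0 \<le> 0 \<and> 0 \<le> h x1 \<or> 0 \<le> h x0 \<and> h x1 \<le> 0"
        by (smt (verit) mult_pos_pos mult_neg_neg)
      then have "\<exists>x. x0 \<le> x \<and> x \<le> x1 \<and> h x = 0"
        by (elim disjE) (use IVT'[of h x0 0 x1] IVT2'[of h x1 0 x0] x1 hcont in auto)
      then show False using nz by (force simp: x0_def)
    qed
    have "\<exists>a. s \<le> a \<and> a \<le> x0 \<and> h a = h x1"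
    proof (cases "h x0 > 0")
      case True
      then have "0 < h x1" using same by (simp add: zero_less_mult_iff)
      then show ?thesis using IVT'[of h s "h x1" x0] s True x1 hcont
        by (auto simp: S_def h0[symmetric] x0_def)
    next
      case False
      then have "h x1 < 0" using same by (auto simp: zero_less_mult_iff)
      then show ?thesis using IVT2'[of h x0 "h x1" s] s False x1 hcont
        by (auto simp: S_def h0[symmetric] x0_def)
    qed
    then obtain a where a: "s \<le> a" "a \<le> x0" "h a = h x1" by blast
    have "h x1 \<noteq> 0" using same by auto
    then have "a \<noteq> s" using a s by (auto simp: S_def h0[symmetric])
    then have "s < a" using a by simp
    moreover obtain t where "a < t" "poly q t = 0" using rolle[of a x1] a x1 by auto
    ultimately show ?thesis using False by (intro exI[of _ t]) auto
  qed
  then obtain t where t: "\<And>s. s \<in> S \<Longrightarrow> s < t s" "\<And>s. s \<in> S \<Longrightarrow> poly q (t s) = 0"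
    "\<And>s s'. s \<in> S \<Longrightarrow> s' \<in> S \<Longrightarrow> s < s' \<Longrightarrow> t s < s'" by metis
  have inj: "inj_on t S"
  proof (rule linorder_inj_onI)
    fix s s' assume "s < s'" "s \<in> S" "s' \<in> S"
    then show "t s \<noteq> t s'" using t(1)[of s'] t(3)[of s s'] by force
  qed auto
  have "q \<noteq> 0"
  proof
    assume "q = 0"
    then have "Polynomial.coeff q (degree p) = 0" by simp
    moreover have "Polynomial.coeff (pderiv p) (degree p) = 0" by (simp add: coeff_pderiv coeff_eq_0)
    ultimately show False using c p by (simp add: q_def)
  qed
  then have fin: "finite {x. 0 < x \<and> poly q x = 0}"
    using poly_roots_finite by (rule_tac rev_finite_subset[of "{x. poly q x = 0}"]) auto
  have "t ` S \<subseteq> {x. 0 < x \<and> poly q x = 0}" using t(1,2) by (force simp: S_def)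
  from card_mono[OF fin this] show ?thesis
    unfolding card_image[OF inj] by (simp add: S_def q_def)
qed

text \<open>Each step yields as many positive roots as there were nonnegative ones before, and 0
  remains a root while k < m; the count thus grows by 1.\<close>

lemma card_lag_roots_ge: "k < m \<Longrightarrow> Suc k \<le> card {x. 0 \<le> x \<and> poly (lag m k) x = 0}"
proof (induction k)
  case 0
  then have "{x. 0 \<le> x \<and> poly (lag m 0) x = 0} = {0}" by (auto simp: poly_monom)
  then show ?case by simp
next
  case (Suc k)
  let ?P = "{x. 0 < x \<and> poly (lag m (Suc k)) x = 0}"
  have fin: "finite ?P" using poly_roots_finite[OF lag_nonzero[of m "Suc k"]] by (rule rev_finite_subset) auto
  have "Suc k \<le> card ?P"
    using Suc.IH Suc.prems Rolle_exp_poly[of 2 "lag m k"] lag_nonzero[of m k] by simp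
  then have "Suc (Suc k) \<le> card (insert 0 ?P)" using fin by (simp add: card_insert_if)
  also have "insert 0 ?P = {x. 0 \<le> x \<and> poly (lag m (Suc k)) x = 0}"
    using poly_lag_0[OF Suc.prems] by (auto simp del: lag.simps)
  finally show ?case .
qed

text \<open>Differentiating the first relation gives the next one. The relation between r and p is
  scaled by b so that the start b = 0, r = 0 is covered.\<close>

lemma lag_recurrence_step:
  fixes p r :: "real poly"
  assumes rec: "[:0, 1:] * pderiv p = Polynomial.smult a p - Polynomial.smult (2 * b) r"
    and r: "Polynomial.smult b (pderiv r - Polynomial.smult 2 r) = Polynomial.smult b p"
  shows "[:0, 1:] * pderiv (pderiv p - Polynomial.smult 2 p)
    = Polynomial.smult (a - 1) (pderiv p - Polynomial.smult 2 p) - Polynomial.smult (2 * (b + 1)) p"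
proof -
  have "pderiv ([:0, 1:] * pderiv p) = Polynomial.smult a (pderiv p) - Polynomial.smult (2 * b) (pderiv r)"
    unfolding rec by (simp add: pderiv_diff pderiv_smult)
  then have d: "[:0, 1:] * pderiv (pderiv p) = Polynomial.smult a (pderiv p) - Polynomial.smult (2 * b) (pderiv r) - pderiv p"
    by (simp add: pderiv_mult pderiv_pCons algebra_simps)
  have r': "Polynomial.smult (2 * b) (pderiv r) = Polynomial.smult (4 * b) r + Polynomial.smult (2 * b) p"
  proof -
    have "Polynomial.smult b (pderiv r) = Polynomial.smult (2 * b) r + Polynomial.smult b p"
      using r by (simp add: smult_diff_right algebra_simps)
    then have "Polynomial.smult 2 (Polynomial.smult b (pderiv r)) = Polynomial.smult 2 (Polynomial.smult (2 * b) r + Polynomial.smult b p)" by simp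
    then show ?thesis by (simp add: smult_add_right)
  qed
  have "[:0, 1:] * pderiv (pderiv p - Polynomial.smult 2 p)
      = [:0, 1:] * pderiv (pderiv p) - Polynomial.smult 2 ([:0, 1:] * pderiv p)"
    by (simp only: pderiv_diff pderiv_smult right_diff_distrib mult_smult_right)
  also have "\<dots> = Polynomial.smult a (pderiv p) - (Polynomial.smult (4 * b) r + Polynomial.smult (2 * b) p) - pderiv p
      - Polynomial.smult 2 (Polynomial.smult a p - Polynomial.smult (2 * b) r)"
    unfolding d r' rec ..
  also have "\<dots> = Polynomial.smult (a - 1) (pderiv p - Polynomial.smult 2 p) - Polynomial.smult (2 * (b + 1)) p"
    by (rule poly_eqI) (simp add: algebra_simps)
  finally show ?thesis .
qed

lemma lag_recurrence:
  "[:0, 1:] * pderiv (lag m (Suc k))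
    = Polynomial.smult (real m - real (Suc k)) (lag m (Suc k)) - Polynomial.smult (2 * real (Suc k)) (lag m k)"
proof (induction k)
  case 0
  have "[:0, 1:] * pderiv (lag m 0) = Polynomial.smult (real m) (lag m 0) - Polynomial.smult (2 * 0) 0"
    by (cases m) (simp_all add: pderiv_monom smult_monom, simp add: monom_Suc)
  from lag_recurrence_step[OF this] show ?case by simp
next
  case (Suc k)
  from lag_recurrence_step[OF Suc.IH] show ?case
    by (simp add: diff_diff_eq add.commute del: lag.simps(1))
qed

section \<open>The Coulomb solution and its zeros\<close>

locale laguerre =
  fixes m :: nat assumes m: "m \<ge> 1"
begin

text \<open>A multiple of x times the associated Laguerre polynomial of degree m - 1 and parameter
  1, taken at 2 x. Stopping at the (m - 1)-st derivative keeps the zero at the origin.\<close>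

definition P :: "real poly" where "P = lag m (m - 1)"

definition Q :: "real poly" where "Q = pderiv P - P"

lemma P_nonzero: "P \<noteq> 0" by (simp add: P_def lag_nonzero)

lemma degree_P: "degree P \<le> m" by (simp add: P_def degree_lag_le)

lemma P_0: "poly P 0 = 0" using poly_lag_0[of "m - 1" m] m by (simp add: P_def)

lemma card_poly_roots_le:
  fixes p :: "real poly" assumes "p \<noteq> 0" "S \<subseteq> {x. poly p x = 0}" shows "card S \<le> degree p"
  using card_mono[OF poly_roots_finite[OF assms(1)] assms(2)] card_poly_roots_bound[OF assms(1)] by linarith

definition "Z0 = {x. 0 \<le> x \<and> poly P x = 0}"

definition "Z1 = {x. 0 < x \<and> poly Q x = 0}"

lemma finite_Z0: "finite Z0"
  unfolding Z0_def using poly_roots_finite[OF P_nonzero] by (rule rev_finite_subset) auto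

lemma card_Z0: "card Z0 = m"
proof (rule antisym)
  show "card Z0 \<le> m"
    by (rule order_trans[OF card_poly_roots_le[OF P_nonzero] degree_P]) (auto simp: Z0_def)
  show "m \<le> card Z0" using card_lag_roots_ge[of "m - 1" m] m by (simp add: Z0_def P_def)
qed

text \<open>With a double root the quotient by the linear factor would keep all m roots while its
  degree is only m - 1.\<close>

lemma P_roots_simple:
  assumes "0 \<le> x" "poly P x = 0" shows "poly (pderiv P) x \<noteq> 0"
proof
  assume d: "poly (pderiv P) x = 0"
  obtain s where s: "P = [:- x, 1:] * s" using assms(2) by (auto simp: poly_eq_0_iff_dvd elim: dvdE)
  have "poly s x = 0" using d unfolding s pderiv_mult by (simp add: pderiv_pCons)
  then have "Z0 \<subseteq> {y. poly s y = 0}" unfolding Z0_def s by auto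
  moreover have "s \<noteq> 0" using P_nonzero s by auto
  ultimately have "m \<le> degree s" using card_poly_roots_le[of s Z0] card_Z0 by simp
  moreover have "degree P = Suc (degree s)" unfolding s using \<open>s \<noteq> 0\<close> by (subst degree_mult_eq) auto
  ultimately show False using degree_P by simp
qed

lemma P_Q_no_common_root: "0 \<le> x \<Longrightarrow> poly P x = 0 \<Longrightarrow> poly Q x \<noteq> 0"
  using P_roots_simple[of x] by (simp add: Q_def)

lemma Q_nonzero: "Q \<noteq> 0"
  using P_Q_no_common_root[of 0] P_0 by auto

lemma finite_Z1: "finite Z1"
  unfolding Z1_def using poly_roots_finite[OF Q_nonzero] by (rule rev_finite_subset) auto

text \<open>One more Rolle step, now with the rate 1 of \<open>W\<close>, gives m positive zeros of
  \<open>Q\<close>; the degree forbids more.\<close>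

lemma card_Z1: "card Z1 = m"
proof (rule antisym)
  have "degree Q \<le> m" unfolding Q_def using degree_P by (auto intro!: degree_diff_le simp: degree_pderiv)
  moreover have "Z1 \<subseteq> {x. poly Q x = 0}" by (auto simp: Z1_def)
  ultimately show "card Z1 \<le> m" using card_poly_roots_le[OF Q_nonzero] order_trans by blast
  show "m \<le> card Z1" using Rolle_exp_poly[of 1 P] P_nonzero card_Z0 by (simp add: Z0_def Z1_def Q_def)
qed

text \<open>The set of values - E for the eigenvalues E: zeros of \<open>P\<close> come from odd
  continuation and zeros of \<open>Q\<close> from even continuation.\<close>

definition "Z = {x. 0 \<le> x \<and> (poly P x = 0 \<or> poly Q x = 0)}"

lemma Z_eq: "Z = Z0 \<union> Z1"
  using P_Q_no_common_root[of 0] P_0 by (auto simp: Z_def Z0_def Z1_def less_le)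

lemma finite_Z: "finite Z" unfolding Z_eq using finite_Z0 finite_Z1 by simp

lemma card_Z: "card Z = 2 * m"
proof -
  have "Z0 \<inter> Z1 = {}" using P_Q_no_common_root by (auto simp: Z0_def Z1_def)
  then show ?thesis unfolding Z_eq by (simp add: card_Un_disjoint finite_Z0 finite_Z1 card_Z0 card_Z1)
qed

text \<open>In \<open>lag_recurrence\<close> at k = m - 1 the coefficient m - (k + 1) is 0, which
  leaves x times the derivative of P' - 2 P equal to -2 m P.\<close>

lemma P_ode: "x * poly (pderiv (pderiv P) - Polynomial.smult 2 (pderiv P)) x = - 2 * real m * poly P x"
proof -
  obtain k where k: "m = Suc k" using m by (cases m) auto
  have "[:0, 1:] * pderiv (pderiv P - Polynomial.smult 2 P) = - Polynomial.smult (2 * real m) P"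
  proof -
    have "m - 1 = k" using k by simp
    then have "P = lag m k" unfolding P_def by (simp only:)
    then show ?thesis using lag_recurrence[of m k] by (simp add: k)
  qed
  then have "poly ([:0, 1:] * pderiv (pderiv P - Polynomial.smult 2 P)) x = poly (- Polynomial.smult (2 * real m) P) x" by simp
  then show ?thesis by (simp add: pderiv_diff pderiv_smult)
qed

definition W :: "real \<Rightarrow> real" where "W x = poly P x * exp (- x)"

definition W' :: "real \<Rightarrow> real" where "W' x = poly Q x * exp (- x)"

lemma W_deriv: "(W has_real_derivative W' x) (at x)"
  unfolding W_def[abs_def] W'_def Q_def
  by (auto intro!: derivative_eq_intros simp: algebra_simps)

lemma W'_deriv:
  assumes "x \<noteq> 0" shows "(W' has_real_derivative (1 - 2 * real m / x) * W x) (at x)"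
proof -
  have "(W' has_real_derivative (poly (pderiv Q) x - poly Q x) * exp (- x)) (at x)"
    unfolding W'_def[abs_def] by (auto intro!: derivative_eq_intros simp: algebra_simps)
  moreover have "x * (poly (pderiv Q) x - poly Q x) = (x - 2 * real m) * poly P x"
    using P_ode[of x] unfolding Q_def by (simp add: pderiv_diff algebra_simps)
  then have "poly (pderiv Q) x - poly Q x = (1 - 2 * real m / x) * poly P x"
    using assms by (simp add: field_simps)
  ultimately show ?thesis by (simp add: W_def mult.assoc)
qed

lemma W_W'_nonzero: "0 \<le> x \<Longrightarrow> W x \<noteq> 0 \<or> W' x \<noteq> 0"
  using P_Q_no_common_root[of x] by (auto simp: W_def W'_def)

lemma W_0: "W 0 = 0" by (simp add: W_def P_0)

lemma W'_0: "W' 0 \<noteq> 0" using W_W'_nonzero[of 0] W_0 by simp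

lemma W_tendsto: "(W \<longlongrightarrow> 0) at_top" "(W' \<longlongrightarrow> 0) at_top"
  using exp_poly_tendsto_0[of 1 P] exp_poly_tendsto_0[of 1 Q]
  by (simp_all add: W_def[abs_def] W'_def[abs_def] mult.commute)

lemma Z_iff: "x \<in> Z \<longleftrightarrow> 0 \<le> x \<and> (W x = 0 \<or> W' x = 0)"
  by (simp add: Z_def W_def W'_def)

end

section \<open>The eigenvalue equation on the Fourier side\<close>

text \<open>Splitting the half line at a point left of x reduces both claims to the fundamental
  theorem on a compact interval.\<close>

lemma cumulative_integral:
  fixes f :: "real \<Rightarrow> complex"
  assumes int: "\<And>x. integrable lborel (\<lambda>t. indicator {..x} t * f t)"
  defines "I \<equiv> \<lambda>x. LINT t|lborel. indicator {..x} t * f t"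
  shows "continuous_on UNIV I" and "isCont f x \<Longrightarrow> (I has_vector_derivative f x) (at x)"
proof -
  have part: "f integrable_on {c..d}" "\<And>y. c \<le> y \<Longrightarrow> I y = I c + integral {c..y} f" for c d
  proof -
    have si: "set_integrable lborel {c..y} f" for y
    proof -
      have "integrable lborel (\<lambda>t. indicator {c..y} t *\<^sub>R (indicator {..y} t * f t))"
        by (rule integrable_mult_indicator[OF _ int]) simp
      also have "(\<lambda>t. indicator {c..y} t *\<^sub>R (indicator {..y} t * f t)) = (\<lambda>t. indicator {c..y} t *\<^sub>R f t)"
        by (auto simp: indicator_def)
      finally show ?thesis by (simp add: set_integrable_def)
    qed
    show "f integrable_on {c..d}" using set_borel_integral_eq_integral(1)[OF si] .
    fix y assume y: "c \<le> y"
    have "I y = (LINT t|lborel. indicator {..c} t * f t + indicator {c..y} t *\<^sub>R f t)"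
      unfolding I_def
    proof (rule integral_cong_AE)
      show "AE t in lborel. indicator {..y} t * f t = indicator {..c} t * f t + indicator {c..y} t *\<^sub>R f t"
        using AE_lborel_singleton[of c] by eventually_elim (use y in \<open>auto simp: indicator_def\<close>)
    qed (use int[of y] int[of c] si[of y] in \<open>auto simp: set_integrable_def\<close>)
    also have "\<dots> = I c + (LINT t:{c..y}|lborel. f t)"
      unfolding I_def set_lebesgue_integral_def using int si by (simp add: set_integrable_def)
    finally show "I y = I c + integral {c..y} f" using set_borel_integral_eq_integral(2)[OF si] by simp
  qed
  have at_within: "x \<in> interior {x - 1..x + 1}" for x :: real by simp
  show "continuous_on UNIV I"
  proof (rule continuous_at_imp_continuous_on, rule ballI)
    fix x :: real
    have "continuous_on {x - 1..x + 1} (\<lambda>y. I (x - 1) + integral {x - 1..y} f)"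
      by (intro continuous_on_add continuous_on_const indefinite_integral_continuous_1 part(1))
    then have "continuous_on {x - 1..x + 1} I"
      by (rule continuous_on_eq) (simp add: part(2)[of "x - 1", symmetric])
    then show "isCont I x" by (rule continuous_on_interior[OF _ at_within])
  qed
  assume x: "isCont f x"
  have "((\<lambda>u. integral {x - 1..u} f) has_vector_derivative f x) (at x within ({x - 1..x + 1} - {}))"
    by (rule integral_has_vector_derivative_continuous_at[OF part(1)])
      (use x in \<open>auto intro: continuous_at_imp_continuous_at_within\<close>)
  then have "((\<lambda>u. I (x - 1) + integral {x - 1..u} f) has_vector_derivative 0 + f x) (at x within {x - 1..x + 1})"
    by (intro has_vector_derivative_add has_vector_derivative_const) simp
  then have "((\<lambda>u. I (x - 1) + integral {x - 1..u} f) has_vector_derivative f x) (at x within {x - 1..x + 1})"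
    by simp
  then have "(I has_vector_derivative f x) (at x within {x - 1..x + 1})"
    by (rule has_vector_derivative_transform[rotated 2]) (simp_all add: part(2)[of "x - 1", symmetric])
  then show "(I has_vector_derivative f x) (at x)"
    using at_within_interior[OF at_within] by metis
qed

text \<open>\<open>two_sided G\<close> is the convolution of \<open>G\<close> with \<open>exp (- \<bar>s\<bar>)\<close>, and \<open>two_sided_deriv G\<close> is its derivative.\<close>

definition left_conv :: "(real \<Rightarrow> complex) \<Rightarrow> real \<Rightarrow> complex" where
  "left_conv G \<xi> = conv ek G \<xi>"

definition right_conv :: "(real \<Rightarrow> complex) \<Rightarrow> real \<Rightarrow> complex" where
  "right_conv G \<xi> = left_conv (\<lambda>t. G (- t)) (- \<xi>)"

definition two_sided :: "(real \<Rightarrow> complex) \<Rightarrow> real \<Rightarrow> complex" where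
  "two_sided G \<xi> = left_conv G \<xi> + right_conv G \<xi>"

definition two_sided_deriv :: "(real \<Rightarrow> complex) \<Rightarrow> real \<Rightarrow> complex" where
  "two_sided_deriv G \<xi> = right_conv G \<xi> - left_conv G \<xi>"

text \<open>Since exp (- (\<xi> - t)) factors, the convolution is exp (- \<xi>) times an integral
  with upper limit \<xi>, which can be differentiated although G need not be.\<close>

lemma left_conv_eq_cumulative:
  "left_conv G \<xi> = of_real (exp (- \<xi>)) * (LINT t|lborel. indicator {..\<xi>} t * (of_real (exp t) * G t))"
proof -
  have "left_conv G \<xi> = (LINT t|lborel. of_real (ek (\<xi> - t)) * G t)"
    using lborel_integral_real_affine[of "-1" "\<lambda>t. of_real (ek (\<xi> - t)) * G t" \<xi>] by (simp add: left_conv_def conv_def)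
  also have "\<dots> = (LINT t|lborel. of_real (exp (- \<xi>)) * (indicator {..\<xi>} t * (of_real (exp t) * G t)))"
    by (intro Bochner_Integration.integral_cong)
      (auto simp: ek_def indicator_def exp_diff exp_minus field_simps)
  finally show ?thesis by simp
qed

lemma cumulative_integrable:
  assumes "G \<in> L2" shows "integrable lborel (\<lambda>t. indicator {..\<xi>} t * (of_real (exp t) * G t) :: complex)"
proof -
  have "integrable lborel (\<lambda>t. of_real (exp \<xi>) * (of_real (ek (\<xi> - (\<xi> + (-1) * t))) * G (\<xi> - t)))"
    using ek.conv_integrable[OF assms, of \<xi>] by simp
  then have "integrable lborel (\<lambda>t. of_real (exp \<xi>) * (of_real (ek (\<xi> - t)) * G t))"
    using lborel_integrable_real_affine[of "\<lambda>t. of_real (exp \<xi>) * (of_real (ek t) * G (\<xi> - t))" "-1" \<xi>] by simp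
  also have "(\<lambda>t. of_real (exp \<xi>) * (of_real (ek (\<xi> - t)) * G t)) = (\<lambda>t. indicator {..\<xi>} t * (of_real (exp t) * G t))"
    by (auto simp: ek_def indicator_def exp_diff exp_minus field_simps)
  finally show ?thesis .
qed

lemma left_conv_continuous: assumes "G \<in> L2" shows "continuous_on UNIV (left_conv G)"
  unfolding left_conv_eq_cumulative[abs_def]
  by (intro continuous_intros cumulative_integral(1) cumulative_integrable assms)

lemma left_conv_derivative:
  assumes "G \<in> L2" "isCont G \<xi>"
  shows "(left_conv G has_vector_derivative G \<xi> - left_conv G \<xi>) (at \<xi>)"
proof -
  let ?I = "\<lambda>\<xi>. LINT t|lborel. indicator {..\<xi>} t * (of_real (exp t) * G t)"
  have I: "(?I has_vector_derivative of_real (exp \<xi>) * G \<xi>) (at \<xi>)"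
    by (intro cumulative_integral(2) cumulative_integrable continuous_intros assms)
  have "((\<lambda>\<xi>. of_real (exp (- \<xi>)) * ?I \<xi>) has_vector_derivative
      of_real (exp (- \<xi>)) * (of_real (exp \<xi>) * G \<xi>) + of_real (- exp (- \<xi>)) * ?I \<xi>) (at \<xi>)"
    by (intro has_vector_derivative_mult I has_vector_derivative_of_real)
      (auto intro!: derivative_eq_intros)
  moreover have "complex_of_real (exp (- \<xi>)) * (complex_of_real (exp \<xi>) * G \<xi>) = G \<xi>"
    unfolding mult.assoc[symmetric] of_real_mult[symmetric] by (simp flip: exp_add)
  ultimately show ?thesis unfolding left_conv_eq_cumulative[abs_def] by simp
qed

text \<open>Boundedness up to infinity is what later kills the Wronskian with \<open>W\<close> and
  the homogeneous solutions in \<open>decaying_zero\<close>.\<close>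

lemma left_conv_bounded: assumes "G \<in> L2" shows "norm (left_conv G \<xi>) \<le> L2_norm (\<lambda>s. complex_of_real (ek s)) * L2_norm G"
proof -
  have "L2_norm (\<lambda>s. G (\<xi> - s)) = L2_norm G"
    using lborel_integral_real_affine[of "-1" "\<lambda>s. (norm (G s))\<^sup>2" \<xi>] by (simp add: L2_norm_def)
  moreover have "left_conv G \<xi> = L2_inner (\<lambda>s. complex_of_real (ek s)) (\<lambda>s. cnj (G (\<xi> - s)))"
    by (simp add: left_conv_def conv_def L2_inner_def)
  ultimately show ?thesis
    using L2_Cauchy_Schwarz[OF ek_L2 L2_cnj[OF ek.shift_L2[OF assms, of \<xi>]]] by (simp add: L2_norm_def)
qed

lemma right_conv_continuous: assumes "G \<in> L2" shows "continuous_on UNIV (right_conv G)"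
  unfolding right_conv_def[abs_def]
  by (rule continuous_on_compose2[OF left_conv_continuous[OF L2_reflect[OF assms]]]) (auto intro: continuous_intros)

lemma right_conv_derivative:
  assumes "G \<in> L2" "isCont G \<xi>"
  shows "(right_conv G has_vector_derivative right_conv G \<xi> - G \<xi>) (at \<xi>)"
proof -
  have "isCont (\<lambda>t. G (- t)) (- \<xi>)"
    using assms(2) by (intro continuous_at_compose[of "- \<xi>" uminus G, unfolded o_def]) (auto intro: continuous_intros)
  from left_conv_derivative[OF L2_reflect[OF assms(1)] this]
  have "(left_conv (\<lambda>t. G (- t)) has_vector_derivative G \<xi> - right_conv G \<xi>) (at (- \<xi>))" by (simp add: right_conv_def)
  moreover have "(uminus has_vector_derivative - 1) (at \<xi>)" by (auto intro!: derivative_eq_intros)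
  ultimately have "(left_conv (\<lambda>t. G (- t)) \<circ> uminus has_vector_derivative - 1 *\<^sub>R (G \<xi> - right_conv G \<xi>)) (at \<xi>)"
    by (intro vector_diff_chain_at) auto
  then show ?thesis by (simp add: right_conv_def[abs_def] o_def)
qed

lemma right_conv_bounded: assumes "G \<in> L2" shows "norm (right_conv G \<xi>) \<le> L2_norm (\<lambda>s. complex_of_real (ek s)) * L2_norm G"
  unfolding right_conv_def using left_conv_bounded[OF L2_reflect[OF assms]] by (simp add: L2_norm_reflect)

lemma two_sided_continuous: "G \<in> L2 \<Longrightarrow> continuous_on UNIV (two_sided G)"
  unfolding two_sided_def[abs_def] by (intro continuous_intros left_conv_continuous right_conv_continuous)

lemma two_sided_deriv_continuous: "G \<in> L2 \<Longrightarrow> continuous_on UNIV (two_sided_deriv G)"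
  unfolding two_sided_deriv_def[abs_def] by (intro continuous_intros left_conv_continuous right_conv_continuous)

lemma two_sided_isCont: "G \<in> L2 \<Longrightarrow> isCont (two_sided G) \<xi>"
  using two_sided_continuous by (simp add: continuous_on_eq_continuous_at)

lemma two_sided_deriv_isCont: "G \<in> L2 \<Longrightarrow> isCont (two_sided_deriv G) \<xi>"
  using two_sided_deriv_continuous by (simp add: continuous_on_eq_continuous_at)

lemma two_sided_derivative:
  "G \<in> L2 \<Longrightarrow> isCont G \<xi> \<Longrightarrow> (two_sided G has_vector_derivative two_sided_deriv G \<xi>) (at \<xi>)"
  unfolding two_sided_def[abs_def] two_sided_deriv_def
  using has_vector_derivative_add[OF left_conv_derivative[of G \<xi>] right_conv_derivative[of G \<xi>]] by simp

text \<open>This is u'' = u - 2 G: half of exp (- \<bar>s\<bar>) is the Green function of 1 -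
  d^2/d\<xi>^2.\<close>

lemma two_sided_deriv_derivative:
  "G \<in> L2 \<Longrightarrow> isCont G \<xi> \<Longrightarrow> (two_sided_deriv G has_vector_derivative two_sided G \<xi> - 2 * G \<xi>) (at \<xi>)"
  unfolding two_sided_def two_sided_deriv_def[abs_def]
  using has_vector_derivative_diff[OF right_conv_derivative[of G \<xi>] left_conv_derivative[of G \<xi>]] by (simp add: algebra_simps)

lemma two_sided_two_sided_deriv_bounded:
  assumes "G \<in> L2" obtains M where "\<And>\<xi>. norm (two_sided G \<xi>) \<le> M" "\<And>\<xi>. norm (two_sided_deriv G \<xi>) \<le> M"
proof -
  let ?b = "L2_norm (\<lambda>s. complex_of_real (ek s)) * L2_norm G"
  have "norm (two_sided G \<xi>) \<le> ?b + ?b" "norm (two_sided_deriv G \<xi>) \<le> ?b + ?b" for \<xi>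
    unfolding two_sided_def two_sided_deriv_def
    using left_conv_bounded[OF assms, of \<xi>] right_conv_bounded[OF assms, of \<xi>]
      norm_triangle_ineq[of "left_conv G \<xi>" "right_conv G \<xi>"] norm_triangle_ineq4[of "right_conv G \<xi>" "left_conv G \<xi>"] by linarith+
  then show ?thesis by (rule that)
qed

lemma two_sided_reflect: "two_sided (\<lambda>t. G (- t)) \<xi> = two_sided G (- \<xi>)" and two_sided_deriv_reflect: "two_sided_deriv (\<lambda>t. G (- t)) \<xi> = - two_sided_deriv G (- \<xi>)"
  by (simp_all add: two_sided_def two_sided_deriv_def right_conv_def)

section \<open>Eigenfunctions as solutions of the Coulomb equation\<close>

lemma two_sided_cong_AE:
  assumes "G \<in> L2" "H \<in> L2" "AE x in lborel. G x = H x" shows "two_sided G \<xi> = two_sided H \<xi>"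
proof -
  have *: "left_conv G \<xi> = left_conv H \<xi>" if "G \<in> L2" "H \<in> L2" "AE x in lborel. G x = H x" for G H \<xi>
    unfolding left_conv_eq_cumulative
    using that(3) cumulative_integrable[OF that(1), of \<xi>] cumulative_integrable[OF that(2), of \<xi>]
    by (intro arg_cong2[where f="(*)"] refl integral_cong_AE) auto
  show ?thesis
    unfolding two_sided_def right_conv_def *[OF assms]
      *[OF L2_reflect[OF assms(1)] L2_reflect[OF assms(2)] AE_lborel_reflect[OF assms(3)]] ..
qed

text \<open>The potential is m (\<open>res\<close> + cnj \<open>res\<close>), and the two summands
  convolve the transform with the two one-sided exponentials.\<close>

lemma L_plus_fourier:
  assumes f: "f \<in> H1" and G: "has_fourier f G"
  shows "has_fourier (L_plus m f) (\<lambda>\<xi>. complex_of_real \<bar>\<xi>\<bar> * G \<xi> - of_nat m * two_sided G \<xi>)"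
proof -
  have "has_fourier (\<lambda>x. of_nat m * (res x * f x + cnj (res x) * f x)) (\<lambda>\<xi>. of_nat m * two_sided G \<xi>)"
    unfolding two_sided_def left_conv_def right_conv_def
    by (intro has_fourier_scale has_fourier_add has_fourier_res_mult has_fourier_cnj_res_mult G)
  from has_fourier_diff[OF abs_nabla_fourier[OF f G] this]
  have "has_fourier (\<lambda>x. abs_nabla f x - of_nat m * (res x * f x + cnj (res x) * f x))
      (\<lambda>\<xi>. complex_of_real \<bar>\<xi>\<bar> * G \<xi> - of_nat m * two_sided G \<xi>)" .
  moreover have "of_nat m * (res x * f x + cnj (res x) * f x) = complex_of_real (2 * real m / (1 + x\<^sup>2)) * f x" for x
  proof -
    have "of_nat m * (res x * f x + cnj (res x) * f x) = of_nat m * (res x + cnj (res x)) * f x"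
      by (simp add: algebra_simps)
    then show ?thesis unfolding res_plus_cnj by simp
  qed
  ultimately show ?thesis unfolding L_plus_def[abs_def] by (simp only:)
qed

lemma L_plus_eigen_iff:
  assumes f: "f \<in> H1" and G: "has_fourier f G"
  shows "(AE x in lborel. L_plus m f x = z * f x) \<longleftrightarrow>
    (AE \<xi> in lborel. complex_of_real \<bar>\<xi>\<bar> * G \<xi> - of_nat m * two_sided G \<xi> = z * G \<xi>)"
  using has_fourier_AE_zero_iff[OF has_fourier_diff[OF L_plus_fourier[OF f G, of m] has_fourier_scale[OF G, of z]]]
  by simp

text \<open>The equation is imposed at every point, which makes G continuous off \<bar>\<xi>\<bar> =
  E; at \<bar>\<xi>\<bar> = E division by zero sets G to 0.\<close>

definition profile :: "nat \<Rightarrow> real \<Rightarrow> (real \<Rightarrow> complex) \<Rightarrow> bool" where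
  "profile m E G \<longleftrightarrow> G \<in> L2 \<and> (\<forall>\<xi>. G \<xi> = of_nat m * two_sided G \<xi> / complex_of_real (\<bar>\<xi>\<bar> - E))"

lemma eigenvector_profile:
  assumes f: "f \<in> H1" and ev: "AE x in lborel. L_plus m f x = complex_of_real E * f x"
  obtains G where "has_fourier f G" "profile m E G"
proof -
  obtain H where H: "has_fourier f H" using f by (metis H1E)
  have HL: "H \<in> L2" using H by (rule has_fourier_L2)
  \<comment> \<open>The right-hand side of the eigenvalue equation selects the representative. It
    agrees with H almost everywhere, so \<open>two_sided\<close> does not change and the equation
    becomes pointwise.\<close>
  define G where "G \<xi> = of_nat m * two_sided H \<xi> / complex_of_real (\<bar>\<xi>\<bar> - E)" for \<xi>
  have [measurable]: "two_sided H \<in> borel_measurable borel"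
    using two_sided_continuous[OF HL] by (rule borel_measurable_continuous_onI)
  have Gm: "G \<in> borel_measurable borel" unfolding G_def[abs_def] by measurable
  have ae: "AE \<xi> in lborel. H \<xi> = G \<xi>"
    using L_plus_eigen_iff[OF f H, of m "of_real E", THEN iffD1, OF ev]
      AE_lborel_singleton[of E] AE_lborel_singleton[of "- E"]
  proof eventually_elim
    case (elim \<xi>)
    have nz: "complex_of_real (\<bar>\<xi>\<bar> - E) \<noteq> 0" using elim by (auto simp: abs_if split: if_splits simp del: of_real_diff)
    have "complex_of_real (\<bar>\<xi>\<bar> - E) * H \<xi> = of_nat m * two_sided H \<xi>" using elim(1) by (simp add: algebra_simps)
    then show ?case unfolding G_def using nz by (simp add: field_simps del: of_real_diff)
  qed
  have G: "has_fourier f G"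
    using L2_measurable[OF has_fourier_L2(1)[OF H]] Gm ae by (intro has_fourier_cong_AE[OF H]) auto
  have GL: "G \<in> L2" using G by (rule has_fourier_L2)
  have "G \<xi> = of_nat m * two_sided G \<xi> / complex_of_real (\<bar>\<xi>\<bar> - E)" for \<xi>
    unfolding two_sided_cong_AE[OF HL GL ae, symmetric] by (rule G_def)
  then have "profile m E G" unfolding profile_def using GL by blast
  with G show ?thesis by (rule that)
qed

lemma profile_reflect: "profile m E G \<Longrightarrow> profile m E (\<lambda>t. G (- t))"
  unfolding profile_def two_sided_reflect
proof (intro conjI allI)
  assume G: "G \<in> L2 \<and> (\<forall>\<xi>. G \<xi> = of_nat m * two_sided G \<xi> / complex_of_real (\<bar>\<xi>\<bar> - E))"
  then show "(\<lambda>t. G (- t)) \<in> L2" by (intro L2_reflect) blast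
  show "G (- \<xi>) = of_nat m * two_sided G (- \<xi>) / complex_of_real (\<bar>\<xi>\<bar> - E)" for \<xi>
    using G abs_minus_cancel[of \<xi>] by metis
qed

lemma profile_isCont:
  assumes "profile m E G" "\<bar>\<xi>\<bar> \<noteq> E" shows "isCont G \<xi>"
proof -
  have G: "G = (\<lambda>\<xi>. of_nat m * two_sided G \<xi> / complex_of_real (\<bar>\<xi>\<bar> - E))" and GL: "G \<in> L2"
    using assms(1) by (auto simp: profile_def)
  have "isCont (\<lambda>\<xi>. of_nat m * two_sided G \<xi> / complex_of_real (\<bar>\<xi>\<bar> - E)) \<xi>"
    using assms(2) by (intro continuous_intros two_sided_isCont GL) (auto simp del: of_real_diff)
  then show ?thesis using G by metis
qed

lemma profile_two_sided_deriv_derivative: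
  assumes "profile m E G" "\<bar>\<xi>\<bar> \<noteq> E"
  shows "(two_sided_deriv G has_vector_derivative complex_of_real (1 - 2 * real m / (\<bar>\<xi>\<bar> - E)) * two_sided G \<xi>) (at \<xi>)"
proof -
  have G: "G \<xi> = of_nat m * two_sided G \<xi> / complex_of_real (\<bar>\<xi>\<bar> - E)" and GL: "G \<in> L2"
    using assms(1) unfolding profile_def by blast+
  have "two_sided G \<xi> - 2 * G \<xi> = complex_of_real (1 - 2 * real m / (\<bar>\<xi>\<bar> - E)) * two_sided G \<xi>"
    by (subst G) (simp add: algebra_simps)
  then show ?thesis using two_sided_deriv_derivative[OF GL profile_isCont[OF assms]] by simp
qed

lemma profile_two_sided_derivative:
  assumes "profile m E G" "\<bar>\<xi>\<bar> \<noteq> E"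
  shows "(two_sided G has_vector_derivative two_sided_deriv G \<xi>) (at \<xi>)"
  using assms profile_isCont by (intro two_sided_derivative) (auto simp: profile_def)

context laguerre
begin

text \<open>The Wronskian of u and w is constant and tends to 0, as u and u' are bounded while W and
  W' decay. So (u, u') is parallel to (w, w'), which never vanishes, and the factor of
  proportionality has derivative 0.\<close>

lemma profile_right:
  assumes G: "profile m E G"
  shows "\<exists>c. \<forall>\<xi>>max 0 E. two_sided G \<xi> = c * complex_of_real (W (\<xi> - E)) \<and> two_sided_deriv G \<xi> = c * complex_of_real (W' (\<xi> - E))"
proof -
  define e where "e = max 0 E"
  define q where "q \<xi> = 1 - 2 * real m / (\<xi> - E)" for \<xi>
  define w where "w \<xi> = W (\<xi> - E)" for \<xi>
  define w' where "w' \<xi> = W' (\<xi> - E)" for \<xi>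
  have GL: "G \<in> L2" using G by (simp add: profile_def)
  have dshift: "((\<lambda>\<xi>. \<xi> - E) has_real_derivative 1) (at \<xi>)" for \<xi>
    by (auto intro!: derivative_eq_intros)
  have dw: "(w has_real_derivative w' \<xi>) (at \<xi>)" for \<xi>
    unfolding w_def[abs_def] w'_def using DERIV_chain2[OF W_deriv dshift] by simp
  have dw': "(w' has_real_derivative q \<xi> * w \<xi>) (at \<xi>)" if "\<xi> > e" for \<xi>
    unfolding w_def w'_def[abs_def] q_def using that DERIV_chain2[OF W'_deriv dshift, of \<xi>] by (simp add: e_def)
  have dU: "(two_sided G has_vector_derivative two_sided_deriv G \<xi>) (at \<xi>)" if "\<xi> > e" for \<xi>
    using that by (intro profile_two_sided_derivative[OF G]) (auto simp: e_def)
  have dD: "(two_sided_deriv G has_vector_derivative of_real (q \<xi>) * two_sided G \<xi>) (at \<xi>)" if "\<xi> > e" for \<xi>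
    using profile_two_sided_deriv_derivative[OF G, of \<xi>] that by (auto simp: e_def q_def)
  have const: "\<exists>c. \<forall>\<xi>>e. h \<xi> = c" if "\<And>\<xi>. \<xi> > e \<Longrightarrow> (h has_vector_derivative 0) (at \<xi>)" for h :: "real \<Rightarrow> complex"
  proof -
    have "\<exists>c. \<forall>\<xi>\<in>{e<..}. h \<xi> = c"
    proof (rule has_derivative_zero_constant)
      fix \<xi> assume "\<xi> \<in> {e<..}"
      then have "(h has_derivative (\<lambda>h. 0)) (at \<xi>)" using that[of \<xi>] by (simp add: has_vector_derivative_def)
      then show "(h has_derivative (\<lambda>h. 0)) (at \<xi> within {e<..})" by (rule has_derivative_at_withinI)
    qed simp
    then show ?thesis by auto
  qed
  define Wr where "Wr \<xi> = two_sided G \<xi> * of_real (w' \<xi>) - two_sided_deriv G \<xi> * of_real (w \<xi>)" for \<xi>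
  have "(Wr has_vector_derivative 0) (at \<xi>)" if "\<xi> > e" for \<xi>
  proof -
    have "(Wr has_vector_derivative (two_sided G \<xi> * of_real (q \<xi> * w \<xi>) + two_sided_deriv G \<xi> * of_real (w' \<xi>))
        - (two_sided_deriv G \<xi> * of_real (w' \<xi>) + (of_real (q \<xi>) * two_sided G \<xi>) * of_real (w \<xi>))) (at \<xi>)"
      unfolding Wr_def[abs_def]
      by (intro has_vector_derivative_diff has_vector_derivative_mult has_vector_derivative_of_real dU dD that
          dw dw')
    then show ?thesis by (simp add: mult_ac)
  qed
  from const[OF this] obtain k where k: "\<And>\<xi>. \<xi> > e \<Longrightarrow> Wr \<xi> = k" by blast
  obtain M where M: "\<And>\<xi>. norm (two_sided G \<xi>) \<le> M" "\<And>\<xi>. norm (two_sided_deriv G \<xi>) \<le> M" using two_sided_two_sided_deriv_bounded[OF GL] by blast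
  have shift: "filterlim (\<lambda>\<xi>. \<xi> - E) at_top at_top" by real_asymp
  have "(Wr \<longlongrightarrow> 0) at_top"
  proof (rule Lim_null_comparison)
    have "norm (Wr \<xi>) \<le> M * \<bar>w' \<xi>\<bar> + M * \<bar>w \<xi>\<bar>" for \<xi>
      unfolding Wr_def by (rule order_trans[OF norm_triangle_ineq4])
        (auto simp: norm_mult intro!: add_mono mult_right_mono M)
    then show "\<forall>\<^sub>F \<xi> in at_top. norm (Wr \<xi>) \<le> M * \<bar>w' \<xi>\<bar> + M * \<bar>w \<xi>\<bar>" by simp
    have "((\<lambda>\<xi>. M * \<bar>w' \<xi>\<bar> + M * \<bar>w \<xi>\<bar>) \<longlongrightarrow> M * \<bar>0\<bar> + M * \<bar>0\<bar>) at_top"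
      unfolding w_def w'_def
      by (intro tendsto_intros filterlim_compose[OF W_tendsto(1) shift] filterlim_compose[OF W_tendsto(2) shift])
    then show "((\<lambda>\<xi>. M * \<bar>w' \<xi>\<bar> + M * \<bar>w \<xi>\<bar>) \<longlongrightarrow> 0) at_top" by simp
  qed
  moreover have "(Wr \<longlongrightarrow> k) at_top"
    by (rule tendsto_eventually, rule eventually_mono[OF eventually_gt_at_top[of e]]) (use k in auto)
  ultimately have "k = 0" by (intro tendsto_unique[of at_top]) auto
  with k have par: "two_sided G \<xi> * of_real (w' \<xi>) = two_sided_deriv G \<xi> * of_real (w \<xi>)" if "\<xi> > e" for \<xi>
    using that by (simp add: Wr_def)
  \<comment> \<open>Projecting (u, u') onto (w, w') gives the factor without dividing by w, which
    has zeros.\<close>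
  define n where "n \<xi> = (w \<xi>)\<^sup>2 + (w' \<xi>)\<^sup>2" for \<xi>
  have n: "n \<xi> \<noteq> 0" if "\<xi> > e" for \<xi>
    using W_W'_nonzero[of "\<xi> - E"] that by (auto simp: n_def w_def w'_def e_def sum_power2_eq_zero_iff)
  define S where "S \<xi> = two_sided G \<xi> * of_real (w \<xi>) + two_sided_deriv G \<xi> * of_real (w' \<xi>)" for \<xi>
  define c where "c \<xi> = of_real (1 / n \<xi>) * S \<xi>" for \<xi>
  have Uc: "two_sided G \<xi> = c \<xi> * of_real (w \<xi>)" if "\<xi> > e" for \<xi>
  proof -
    have "S \<xi> * of_real (w \<xi>) = two_sided G \<xi> * of_real (w \<xi>) * of_real (w \<xi>) + (two_sided_deriv G \<xi> * of_real (w \<xi>)) * of_real (w' \<xi>)"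
      by (simp add: S_def algebra_simps)
    also have "\<dots> = two_sided G \<xi> * of_real (n \<xi>)"
      unfolding par[OF that, symmetric] by (simp add: n_def power2_eq_square algebra_simps)
    finally show ?thesis using n[OF that] by (simp add: c_def field_simps)
  qed
  have Dc: "two_sided_deriv G \<xi> = c \<xi> * of_real (w' \<xi>)" if "\<xi> > e" for \<xi>
  proof -
    have "S \<xi> * of_real (w' \<xi>) = (two_sided G \<xi> * of_real (w' \<xi>)) * of_real (w \<xi>) + two_sided_deriv G \<xi> * of_real (w' \<xi>) * of_real (w' \<xi>)"
      by (simp add: S_def algebra_simps)
    also have "\<dots> = two_sided_deriv G \<xi> * of_real (n \<xi>)"
      unfolding par[OF that] by (simp add: n_def power2_eq_square algebra_simps)
    finally show ?thesis using n[OF that] by (simp add: c_def field_simps)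
  qed
  have "(c has_vector_derivative 0) (at \<xi>)" if "\<xi> > e" for \<xi>
  proof -
    define n' where "n' = 2 * w \<xi> * w' \<xi> + 2 * w' \<xi> * (q \<xi> * w \<xi>)"
    have dn: "(n has_real_derivative n') (at \<xi>)"
      unfolding n_def[abs_def] n'_def using dw dw'[OF that] by (auto intro!: derivative_eq_intros)
    have "((\<lambda>\<xi>. 1 / n \<xi>) has_real_derivative - n' / (n \<xi>)\<^sup>2) (at \<xi>)"
      using dn n[OF that] by (auto intro!: derivative_eq_intros simp: power2_eq_square)
    then have d1: "((\<lambda>\<xi>. complex_of_real (1 / n \<xi>)) has_vector_derivative complex_of_real (- n' / (n \<xi>)\<^sup>2)) (at \<xi>)"
      by (rule has_vector_derivative_of_real)
    have d2: "(S has_vector_derivative (two_sided G \<xi> * of_real (w' \<xi>) + two_sided_deriv G \<xi> * of_real (w \<xi>))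
        + (two_sided_deriv G \<xi> * of_real (q \<xi> * w \<xi>) + (of_real (q \<xi>) * two_sided G \<xi>) * of_real (w' \<xi>))) (at \<xi>)"
      unfolding S_def[abs_def]
      by (intro has_vector_derivative_add has_vector_derivative_mult has_vector_derivative_of_real dU dD that
          dw dw')
    have S': "(two_sided G \<xi> * of_real (w' \<xi>) + two_sided_deriv G \<xi> * of_real (w \<xi>))
        + (two_sided_deriv G \<xi> * of_real (q \<xi> * w \<xi>) + (of_real (q \<xi>) * two_sided G \<xi>) * of_real (w' \<xi>)) = c \<xi> * of_real n'"
      unfolding Uc[OF that] Dc[OF that] n'_def by (simp add: algebra_simps)
    have S: "S \<xi> = c \<xi> * of_real (n \<xi>)" using n[OF that] by (simp add: c_def)
    have "(c has_vector_derivative of_real (1 / n \<xi>) * (c \<xi> * of_real n') + of_real (- n' / (n \<xi>)\<^sup>2) * (c \<xi> * of_real (n \<xi>))) (at \<xi>)"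
      using has_vector_derivative_mult[OF d1 d2] unfolding S' S[symmetric] c_def[symmetric, abs_def] .
    moreover have "of_real (1 / n \<xi>) * (c \<xi> * of_real n') + of_real (- n' / (n \<xi>)\<^sup>2) * (c \<xi> * of_real (n \<xi>)) = 0"
      using n[OF that] by (simp add: field_simps power2_eq_square)
    ultimately show ?thesis by simp
  qed
  from const[OF this] obtain c0 where "\<And>\<xi>. \<xi> > e \<Longrightarrow> c \<xi> = c0" by blast
  then show ?thesis
    using Uc Dc unfolding e_def w_def w'_def by (intro exI[of _ c0]) auto
qed

text \<open>The reflected profile is treated by \<open>profile_right\<close>; reflection changes the
  sign of the derivative.\<close>

lemma profile_left:
  assumes G: "profile m E G"
  shows "\<exists>c. \<forall>\<xi>. \<xi> < - max 0 E \<longrightarrow> two_sided G \<xi> = c * complex_of_real (W (- \<xi> - E)) \<and> two_sided_deriv G \<xi> = - c * complex_of_real (W' (- \<xi> - E))"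
proof -
  obtain c where c: "\<And>\<xi>. \<xi> > max 0 E \<Longrightarrow> two_sided (\<lambda>t. G (- t)) \<xi> = c * complex_of_real (W (\<xi> - E))"
    "\<And>\<xi>. \<xi> > max 0 E \<Longrightarrow> two_sided_deriv (\<lambda>t. G (- t)) \<xi> = c * complex_of_real (W' (\<xi> - E))"
    using profile_right[OF profile_reflect[OF G]] by blast
  show ?thesis
  proof (intro exI[of _ c] allI impI conjI)
    fix \<xi> assume "\<xi> < - max 0 E"
    then have "- \<xi> > max 0 E" by linarith
    from c[OF this] have "two_sided G \<xi> = c * complex_of_real (W (- \<xi> - E))" "- two_sided_deriv G \<xi> = c * complex_of_real (W' (- \<xi> - E))"
      unfolding two_sided_reflect two_sided_deriv_reflect by simp_all
    then show "two_sided G \<xi> = c * complex_of_real (W (- \<xi> - E))" "two_sided_deriv G \<xi> = - c * complex_of_real (W' (- \<xi> - E))"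
      by (simp_all flip: \<open>- two_sided_deriv G \<xi> = _\<close>)
  qed
qed

end

lemma eq_at_right_limit:
  fixes f g :: "real \<Rightarrow> complex"
  assumes "isCont f a" "isCont g a" "a < b" "\<And>x. a < x \<Longrightarrow> x < b \<Longrightarrow> f x = g x"
  shows "f a = g a"
proof -
  have "(f \<longlongrightarrow> f a) (at_right a)" "(g \<longlongrightarrow> g a) (at_right a)"
    using assms(1,2) by (auto simp: isCont_def filterlim_at_split)
  moreover have "\<forall>\<^sub>F x in at_right a. f x = g x"
    using assms(3,4) by (auto simp: eventually_at_right)
  ultimately show ?thesis
    by (metis tendsto_cong tendsto_unique trivial_limit_at_right_real)
qed

lemma eq_at_left_limit:
  fixes f g :: "real \<Rightarrow> complex"
  assumes "isCont f a" "isCont g a" "b < a" "\<And>x. b < x \<Longrightarrow> x < a \<Longrightarrow> f x = g x"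
  shows "f a = g a"
proof -
  have "(f \<longlongrightarrow> f a) (at_left a)" "(g \<longlongrightarrow> g a) (at_left a)"
    using assms(1,2) by (auto simp: isCont_def filterlim_at_split)
  moreover have "\<forall>\<^sub>F x in at_left a. f x = g x"
    using assms(3,4) by (auto simp: eventually_at_left)
  ultimately show ?thesis
    by (metis tendsto_cong tendsto_unique trivial_limit_at_left_real)
qed

text \<open>\<open>u\<^sup>2\<close> is convex, because \<open>u'' = q u\<close> with \<open>q \<ge> 0\<close>.\<close>

lemma positive_potential_dirichlet:
  fixes u v q :: "real \<Rightarrow> real"
  assumes cont: "\<And>x. isCont u x"
    and du: "\<And>x. a < x \<Longrightarrow> x < b \<Longrightarrow> (u has_real_derivative v x) (at x)"
    and dv: "\<And>x. a < x \<Longrightarrow> x < b \<Longrightarrow> (v has_real_derivative q x * u x) (at x)"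
    and q: "\<And>x. a < x \<Longrightarrow> x < b \<Longrightarrow> 0 \<le> q x"
    and bd: "u a = 0" "u b = 0" and x: "a < x" "x < b"
  shows "u x = 0"
proof (rule ccontr)
  assume nz: "u x \<noteq> 0"
  have dsq: "((\<lambda>x. (u x)\<^sup>2) has_real_derivative 2 * (u c * v c)) (at c)" if "a < c" "c < b" for c
    using du[OF that] by (auto intro!: derivative_eq_intros)
  have mvt: "\<exists>c. s < c \<and> c < t \<and> (u t)\<^sup>2 - (u s)\<^sup>2 = (t - s) * (2 * (u c * v c))"
    if "a \<le> s" "s < t" "t \<le> b" for s t
  proof -
    have "\<exists>l c. s < c \<and> c < t \<and> ((\<lambda>x. (u x)\<^sup>2) has_real_derivative l) (at c) \<and> (u t)\<^sup>2 - (u s)\<^sup>2 = (t - s) * l"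
    proof (rule MVT[OF that(2)])
      show "continuous_on {s..t} (\<lambda>x. (u x)\<^sup>2)"
        by (intro continuous_intros continuous_at_imp_continuous_on) (use cont in auto)
      show "(\<lambda>x. (u x)\<^sup>2) differentiable (at x)" if "s < x" "x < t" for x
        using dsq[of x] that \<open>a \<le> s\<close> \<open>t \<le> b\<close> by (auto simp: real_differentiable_def)
    qed
    then obtain l c where lc: "s < c" "c < t" "((\<lambda>x. (u x)\<^sup>2) has_real_derivative l) (at c)"
      "(u t)\<^sup>2 - (u s)\<^sup>2 = (t - s) * l" by blast
    have "l = 2 * (u c * v c)" using lc that by (intro DERIV_unique[OF lc(3) dsq]) auto
    with lc show ?thesis by blast
  qed
  obtain c1 where c1: "a < c1" "c1 < x" "(u x)\<^sup>2 - (u a)\<^sup>2 = (x - a) * (2 * (u c1 * v c1))"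
    using mvt[of a x] x by auto
  obtain c2 where c2: "x < c2" "c2 < b" "(u b)\<^sup>2 - (u x)\<^sup>2 = (b - x) * (2 * (u c2 * v c2))"
    using mvt[of x b] x by auto
  have pos: "(u x)\<^sup>2 > 0" using nz by simp
  have "0 < u c1 * v c1"
  proof -
    have "0 < (x - a) * (2 * (u c1 * v c1))" using c1(3) pos bd by simp
    then show ?thesis using x by (simp add: zero_less_mult_iff)
  qed
  moreover have "u c2 * v c2 < 0"
  proof -
    have "(b - x) * (2 * (u c2 * v c2)) = - (u x)\<^sup>2" using c2(3) bd by simp
    then have "(b - x) * (2 * (u c2 * v c2)) < 0" using pos by linarith
    then show ?thesis using x by (simp add: mult_less_0_iff)
  qed
  moreover have "u c1 * v c1 \<le> u c2 * v c2"
  proof (rule DERIV_nonneg_imp_nondecreasing[where f="\<lambda>y. u y * v y"])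
    show "c1 \<le> c2" using c1 c2 by simp
    fix y assume y: "c1 \<le> y" "y \<le> c2"
    then have ab: "a < y" "y < b" using c1 c2 by auto
    have "((\<lambda>y. u y * v y) has_real_derivative v y * v y + q y * u y * u y) (at y)"
      by (rule DERIV_mult[OF du[OF ab] dv[OF ab], simplified mult.commute[of _ "u y"], THEN DERIV_cong])
        (simp add: mult_ac)
    moreover have "0 \<le> v y * v y + q y * u y * u y"
      using q[OF ab] by (simp add: mult.assoc)
    ultimately show "\<exists>d. ((\<lambda>y. u y * v y) has_real_derivative d) (at y) \<and> 0 \<le> d" by blast
  qed
  ultimately show False by simp
qed

section \<open>The eigenvalues of \<open>L_plus\<close>\<close>

lemma bounded_on_half_line:
  fixes f :: "real \<Rightarrow> real"
  assumes cont: "continuous_on UNIV f" and lim: "(f \<longlongrightarrow> 0) at_top"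
  obtains M where "\<And>x. 0 \<le> x \<Longrightarrow> \<bar>f x\<bar> \<le> M"
proof -
  have "eventually (\<lambda>x. \<bar>f x\<bar> < 1) at_top"
    using tendsto_rabs_zero[OF lim] by (intro order_tendstoD) auto
  then obtain N where N: "\<And>x. x \<ge> N \<Longrightarrow> \<bar>f x\<bar> < 1" by (auto simp: eventually_at_top_linorder)
  have "compact (f ` {0..N})"
    using cont by (intro compact_continuous_image) (auto intro: continuous_on_subset)
  then obtain B where B: "\<And>x. x \<in> {0..N} \<Longrightarrow> \<bar>f x\<bar> \<le> B"
    using compact_imp_bounded by (fastforce simp: bounded_iff)
  have "\<bar>f x\<bar> \<le> max 1 B" if "0 \<le> x" for x
    using N[of x] B[of x] that by (cases "x \<le> N") force+
  then show ?thesis by (rule that)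
qed

text \<open>The product exp \<xi> h is constant on each half line, tends to 0 at minus infinity
  because h is bounded, and continuity at 0 carries the value across. The exception at 0 allows for
  the kink of \<bar>\<xi>\<bar>.\<close>

lemma decaying_zero:
  fixes h :: "real \<Rightarrow> complex"
  assumes cont: "\<And>\<xi>. isCont h \<xi>" and bd: "\<And>\<xi>. norm (h \<xi>) \<le> M"
    and der: "\<And>\<xi>. \<xi> \<noteq> 0 \<Longrightarrow> (h has_vector_derivative - h \<xi>) (at \<xi>)"
  shows "h \<xi> = 0"
proof -
  define g where "g \<xi> = complex_of_real (exp \<xi>) * h \<xi>" for \<xi>
  have dg: "(g has_derivative (\<lambda>_. 0)) (at \<xi>)" if "\<xi> \<noteq> 0" for \<xi>
  proof -
    have "(g has_vector_derivative of_real (exp \<xi>) * (- h \<xi>) + of_real (exp \<xi>) * h \<xi>) (at \<xi>)"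
      unfolding g_def[abs_def]
      by (intro has_vector_derivative_mult has_vector_derivative_of_real der that DERIV_exp)
    then show ?thesis by (simp add: has_vector_derivative_def)
  qed
  have gcont: "isCont g \<xi>" for \<xi> unfolding g_def[abs_def] by (intro continuous_intros cont)
  have "\<exists>c. \<forall>\<xi>\<in>{..<0}. g \<xi> = c"
    by (rule has_derivative_zero_constant) (auto intro!: has_derivative_at_withinI dg)
  then obtain c where c: "\<And>\<xi>. \<xi> < 0 \<Longrightarrow> g \<xi> = c" by auto
  have "(g \<longlongrightarrow> 0) at_bot"
  proof (rule Lim_null_comparison)
    show "\<forall>\<^sub>F \<xi> in at_bot. norm (g \<xi>) \<le> exp \<xi> * M"
      using bd by (auto simp: g_def norm_mult)
    have "((\<lambda>\<xi>. exp \<xi> * M) \<longlongrightarrow> 0 * M) at_bot" by (intro tendsto_intros exp_at_bot)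
    then show "((\<lambda>\<xi>. exp \<xi> * M) \<longlongrightarrow> 0) at_bot" by simp
  qed
  moreover have "(g \<longlongrightarrow> c) at_bot"
    by (rule tendsto_eventually, rule eventually_mono[OF eventually_gt_at_bot[of 0]]) (use c in auto)
  ultimately have "c = 0" by (intro tendsto_unique[of at_bot]) auto
  then have neg: "g \<xi> = 0" if "\<xi> < 0" for \<xi> using c that by simp
  have g0: "g 0 = 0"
    using eq_at_left_limit[where f=g and g="\<lambda>_. 0" and a=0 and b="-1"] gcont neg by simp
  have "\<exists>c. \<forall>\<xi>\<in>{0<..}. g \<xi> = c"
    by (rule has_derivative_zero_constant) (auto intro!: has_derivative_at_withinI dg)
  then obtain d where d: "\<And>\<xi>. \<xi> > 0 \<Longrightarrow> g \<xi> = d" by auto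
  have "g 0 = d" using eq_at_right_limit[where f=g and g="\<lambda>_. d" and a=0 and b=1] gcont d by simp
  then have "g \<xi> = 0" using g0 neg d by (metis linorder_neqE_linordered_idom)
  then show ?thesis by (simp add: g_def)
qed

lemma Re_of_real_mult: "Re (complex_of_real r * z) = r * Re z" and Im_of_real_mult: "Im (complex_of_real r * z) = r * Im z"
  by simp_all

context laguerre
begin

lemma isCont_W: "isCont W x" and isCont_W': "isCont W' x"
  unfolding W_def[abs_def] W'_def[abs_def] by (intro continuous_intros)+

lemma profile_positive_right:
  assumes G: "profile m E G" and E: "E > 0" and x: "0 \<le> x" shows "two_sided G x = 0"
proof -
  have GL: "G \<in> L2" using G by (simp add: profile_def)
  note cont = two_sided_isCont[OF GL] two_sided_deriv_isCont[OF GL]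
  obtain c where c: "\<And>\<xi>. \<xi> > E \<Longrightarrow> two_sided G \<xi> = c * of_real (W (\<xi> - E))" "\<And>\<xi>. \<xi> > E \<Longrightarrow> two_sided_deriv G \<xi> = c * of_real (W' (\<xi> - E))"
    using profile_right[OF G] E by (auto simp: max_def)
  obtain d where d: "\<And>\<xi>. \<xi> < - E \<Longrightarrow> two_sided G \<xi> = d * of_real (W (- \<xi> - E))"
    using profile_left[OF G] E by (auto simp: max_def)
  have wc: "isCont (\<lambda>\<xi>. c * complex_of_real (W (\<xi> - E))) E" "isCont (\<lambda>\<xi>. c * complex_of_real (W' (\<xi> - E))) E"
    "isCont (\<lambda>\<xi>. d * complex_of_real (W (- \<xi> - E))) (- E)"
    by (intro continuous_intros isCont_o2[OF _ isCont_W] isCont_o2[OF _ isCont_W'])+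
  \<comment> \<open>The decaying solution vanishes at the singular point because
    \<open>W 0 = 0\<close>, and u is continuous there; the same holds at - E.\<close>
  have UE: "two_sided G E = 0"
    using eq_at_right_limit[OF cont(1) wc(1), of "E + 1"] c W_0 by simp
  have DE: "two_sided_deriv G E = c * of_real (W' 0)"
    using eq_at_right_limit[OF cont(2) wc(2), of "E + 1"] c by simp
  have UmE: "two_sided G (- E) = 0"
    using eq_at_left_limit[OF cont(1) wc(3), of "- E - 1"] d W_0 by simp
  have q: "0 \<le> 1 - 2 * real m / (\<bar>\<xi>\<bar> - E)" if "- E < \<xi>" "\<xi> < E" for \<xi>
  proof -
    have "2 * real m / (\<bar>\<xi>\<bar> - E) \<le> 0" using that by (intro divide_nonneg_neg) auto
    then show ?thesis by linarith
  qed
  have mid: "two_sided G \<xi> = 0" if \<xi>: "- E < \<xi>" "\<xi> < E" for \<xi>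
  proof -
    have dU: "(two_sided G has_vector_derivative two_sided_deriv G \<xi>) (at \<xi>)" if "- E < \<xi>" "\<xi> < E" for \<xi>
      using that by (intro profile_two_sided_derivative[OF G]) auto
    have dD: "(two_sided_deriv G has_vector_derivative of_real (1 - 2 * real m / (\<bar>\<xi>\<bar> - E)) * two_sided G \<xi>) (at \<xi>)" if "- E < \<xi>" "\<xi> < E" for \<xi>
      using that by (intro profile_two_sided_deriv_derivative[OF G]) auto
    have "Re (two_sided G \<xi>) = 0"
    proof (rule positive_potential_dirichlet[where a="- E" and b=E and u="\<lambda>\<xi>. Re (two_sided G \<xi>)" and q="\<lambda>\<xi>. 1 - 2 * real m / (\<bar>\<xi>\<bar> - E)" and v="\<lambda>\<xi>. Re (two_sided_deriv G \<xi>)"])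
      fix x assume x: "- E < x" "x < E"
      show "((\<lambda>x. Re (two_sided G x)) has_real_derivative Re (two_sided_deriv G x)) (at x)"
        using bounded_linear.has_vector_derivative[OF bounded_linear_Re dU[OF x]] by (simp add: has_real_derivative_iff_has_vector_derivative)
      show "((\<lambda>x. Re (two_sided_deriv G x)) has_real_derivative (1 - 2 * real m / (\<bar>x\<bar> - E)) * Re (two_sided G x)) (at x)"
        using bounded_linear.has_vector_derivative[OF bounded_linear_Re dD[OF x]] unfolding has_real_derivative_iff_has_vector_derivative Re_of_real_mult .
    qed (use UE UmE \<xi> q cont in \<open>auto intro!: continuous_intros\<close>)
    moreover have "Im (two_sided G \<xi>) = 0"
    proof (rule positive_potential_dirichlet[where a="- E" and b=E and u="\<lambda>\<xi>. Im (two_sided G \<xi>)" and q="\<lambda>\<xi>. 1 - 2 * real m / (\<bar>\<xi>\<bar> - E)" and v="\<lambda>\<xi>. Im (two_sided_deriv G \<xi>)"])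
      fix x assume x: "- E < x" "x < E"
      show "((\<lambda>x. Im (two_sided G x)) has_real_derivative Im (two_sided_deriv G x)) (at x)"
        using bounded_linear.has_vector_derivative[OF bounded_linear_Im dU[OF x]] by (simp add: has_real_derivative_iff_has_vector_derivative)
      show "((\<lambda>x. Im (two_sided_deriv G x)) has_real_derivative (1 - 2 * real m / (\<bar>x\<bar> - E)) * Im (two_sided G x)) (at x)"
        using bounded_linear.has_vector_derivative[OF bounded_linear_Im dD[OF x]] unfolding has_real_derivative_iff_has_vector_derivative Im_of_real_mult .
    qed (use UE UmE \<xi> q cont in \<open>auto intro!: continuous_intros\<close>)
    ultimately show ?thesis by (simp add: complex_eq_iff)
  qed
  \<comment> \<open>u' is continuous across the singularity at E: it is 0 from the left and c
    \<open>W' 0\<close> from the right, so c = 0.\<close>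
  have "two_sided_deriv G \<xi> = 0" if \<xi>: "- E < \<xi>" "\<xi> < E" for \<xi>
  proof -
    have "(two_sided G has_vector_derivative two_sided_deriv G \<xi>) (at \<xi>)"
      using \<xi> by (intro profile_two_sided_derivative[OF G]) auto
    moreover have "(two_sided G has_vector_derivative 0) (at \<xi>)"
      by (rule has_vector_derivative_transform_within_open[of "\<lambda>_. 0" _ _ "{-E<..<E}"]) (use \<xi> mid in auto)
    ultimately show ?thesis by (rule vector_derivative_unique_at)
  qed
  then have "two_sided_deriv G E = 0" using eq_at_left_limit[where f="two_sided_deriv G" and g="\<lambda>_. 0" and a=E and b="- E"] cont(2) E by simp
  then have "c = 0" using DE W'_0 by simp
  then show ?thesis using c(1)[of x] mid[of x] UE x E by (cases x E rule: linorder_cases) auto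
qed

lemma profile_positive:
  assumes G: "profile m E G" and E: "E > 0" shows "two_sided G \<xi> = 0"
  using profile_positive_right[OF G E, of \<xi>] profile_positive_right[OF profile_reflect[OF G] E, of "- \<xi>"]
  by (cases "0 \<le> \<xi>") (auto simp: two_sided_reflect)

text \<open>Continuity of u at 0 reads (d - c) W(- E) = 0 and that of u' reads (d + c) W'(- E) = 0.
  Both continuities hold for E = 0 as well, since u and u' are convolutions of an \<open>L2\<close>
  function.\<close>

lemma profile_nonpositive:
  assumes G: "profile m E G" and E: "E \<le> 0"
  obtains c d where "\<And>\<xi>. \<xi> > 0 \<Longrightarrow> two_sided G \<xi> = c * complex_of_real (W (\<xi> - E))"
    "\<And>\<xi>. \<xi> < 0 \<Longrightarrow> two_sided G \<xi> = d * complex_of_real (W (- \<xi> - E))"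
    "W (- E) \<noteq> 0 \<Longrightarrow> d = c" "W' (- E) \<noteq> 0 \<Longrightarrow> d = - c"
proof -
  have GL: "G \<in> L2" using G by (simp add: profile_def)
  note cont = two_sided_isCont[OF GL] two_sided_deriv_isCont[OF GL]
  obtain c where c: "\<And>\<xi>. \<xi> > 0 \<Longrightarrow> two_sided G \<xi> = c * of_real (W (\<xi> - E))" "\<And>\<xi>. \<xi> > 0 \<Longrightarrow> two_sided_deriv G \<xi> = c * of_real (W' (\<xi> - E))"
    using profile_right[OF G] E by (auto simp: max_def split: if_splits)
  obtain d where d: "\<And>\<xi>. \<xi> < 0 \<Longrightarrow> two_sided G \<xi> = d * of_real (W (- \<xi> - E))"
    "\<And>\<xi>. \<xi> < 0 \<Longrightarrow> two_sided_deriv G \<xi> = - d * of_real (W' (- \<xi> - E))"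
    using profile_left[OF G] E by (auto simp: max_def split: if_splits)
  have wc: "isCont (\<lambda>\<xi>. c * complex_of_real (W (\<xi> - E))) 0" "isCont (\<lambda>\<xi>. c * complex_of_real (W' (\<xi> - E))) 0"
    "isCont (\<lambda>\<xi>. d * complex_of_real (W (- \<xi> - E))) 0" "isCont (\<lambda>\<xi>. - d * complex_of_real (W' (- \<xi> - E))) 0"
    by (intro continuous_intros isCont_o2[OF _ isCont_W] isCont_o2[OF _ isCont_W'])+
  have U0: "two_sided G 0 = c * of_real (W (- E))" "two_sided G 0 = d * of_real (W (- E))"
    using eq_at_right_limit[OF cont(1) wc(1), of 1] eq_at_left_limit[OF cont(1) wc(3), of "- 1"] c d by simp_all
  have D0: "two_sided_deriv G 0 = c * of_real (W' (- E))" "two_sided_deriv G 0 = - d * of_real (W' (- E))"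
    using eq_at_right_limit[OF cont(2) wc(2), of 1] eq_at_left_limit[OF cont(2) wc(4), of "- 1"] c d by simp_all
  have "(d - c) * of_real (W (- E)) = 0" using U0 by (simp add: left_diff_distrib)
  moreover have "(d + c) * of_real (W' (- E)) = 0" unfolding distrib_right D0(1)[symmetric] unfolding D0(2) by simp
  ultimately have "W (- E) \<noteq> 0 \<Longrightarrow> d = c" "W' (- E) \<noteq> 0 \<Longrightarrow> d = - c"
    by (auto simp: eq_neg_iff_add_eq_0)
  with c(1) d(1) show ?thesis by (rule that)
qed

lemma profile_zero:
  assumes "profile m E G" "\<And>\<xi>. \<xi> \<noteq> 0 \<Longrightarrow> two_sided G \<xi> = 0" shows "AE \<xi> in lborel. G \<xi> = 0"
  using AE_lborel_singleton[of "0::real"]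
proof eventually_elim
  case (elim \<xi>)
  have "G \<xi> = of_nat m * two_sided G \<xi> / complex_of_real (\<bar>\<xi>\<bar> - E)" using assms(1) unfolding profile_def by blast
  then show ?case using assms(2)[OF elim] by simp
qed

lemma L_plus_no_eigenvector:
  assumes f: "f \<in> H1" and ev: "AE x in lborel. L_plus m f x = complex_of_real E * f x" and E: "- E \<notin> Z"
  shows "AE x in lborel. f x = 0"
proof -
  obtain G where G: "has_fourier f G" "profile m E G" using eigenvector_profile[OF f ev] .
  have "two_sided G \<xi> = 0" if "\<xi> \<noteq> 0" for \<xi>
  proof (cases "E > 0")
    case True then show ?thesis using profile_positive[OF G(2)] by simp
  next
    case False
    then have nz: "W (- E) \<noteq> 0" "W' (- E) \<noteq> 0" using E by (auto simp: Z_iff)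
    obtain c d where cd: "\<And>\<xi>. \<xi> > 0 \<Longrightarrow> two_sided G \<xi> = c * complex_of_real (W (\<xi> - E))"
      "\<And>\<xi>. \<xi> < 0 \<Longrightarrow> two_sided G \<xi> = d * complex_of_real (W (- \<xi> - E))"
      "W (- E) \<noteq> 0 \<Longrightarrow> d = c" "W' (- E) \<noteq> 0 \<Longrightarrow> d = - c"
      using profile_nonpositive[OF G(2)] False by (metis not_less)
    have "c = 0" "d = 0" using cd(3)[OF nz(1)] cd(4)[OF nz(2)] by auto
    then show ?thesis using cd(1,2) that by (metis linorder_neqE_linordered_idom mult_zero_left)
  qed
  then show ?thesis using profile_zero[OF G(2)] has_fourier_AE_zero_iff[OF G(1)] by blast
qed

end

section \<open>Construction of the eigenvectors\<close>

lemma two_sided_zero: "two_sided (\<lambda>_. 0) \<xi> = 0"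
  by (simp add: two_sided_def right_conv_def left_conv_def conv_def)

lemma exp_abs_L2: "(\<lambda>\<xi>. complex_of_real (exp (- \<bar>\<xi>\<bar> / 2))) \<in> L2"
proof (rule L2I)
  have "(norm (complex_of_real (exp (- \<bar>\<xi>\<bar> / 2))))\<^sup>2 = exp (- 1 * \<bar>\<xi>\<bar>)" for \<xi> :: real
    by (simp add: power2_eq_square flip: exp_add)
  then show "integrable lborel (\<lambda>\<xi>. (norm (complex_of_real (exp (- \<bar>\<xi>\<bar> / 2))))\<^sup>2)"
    using exp_abs_integrable[of 1] by simp
qed measurable

context laguerre
begin

text \<open>W vanishes at 0, so W r / r is a polynomial times exp (- r). Half of the exponential
  absorbs the polynomial, and the factor 1 + r provides for the weight \<bar>\<xi>\<bar> that
  membership in \<open>H1\<close> requires.\<close>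

lemma W_div_bound:
  obtains M where "\<And>r. 0 \<le> r \<Longrightarrow> \<bar>W r / r\<bar> * (1 + r) \<le> M * exp (- r / 2)"
proof -
  obtain S where S: "P = [:0, 1:] * S"
    using P_0 by (auto simp: poly_eq_0_iff_dvd elim: dvdE)
  define f where "f r = exp (- (1/2) * r) * poly (S * [:1, 1:]) r" for r :: real
  have "continuous_on UNIV f" unfolding f_def[abs_def] by (intro continuous_intros)
  moreover have "(f \<longlongrightarrow> 0) at_top" unfolding f_def[abs_def] by (rule exp_poly_tendsto_0) simp
  ultimately obtain M where M: "\<And>r. 0 \<le> r \<Longrightarrow> \<bar>f r\<bar> \<le> M" by (rule bounded_on_half_line) blast
  have "\<bar>W r / r\<bar> * (1 + r) \<le> M * exp (- r / 2)" if r: "0 \<le> r" for r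
  proof (cases "r = 0")
    case True then show ?thesis using M[of 0] by simp
  next
    case False
    have "W r / r = poly S r * exp (- r)" using False by (simp add: W_def S)
    then have "\<bar>W r / r\<bar> * (1 + r) = \<bar>poly S r * (1 + r)\<bar> * exp (- r)" using r by (simp add: abs_mult)
    also have "\<dots> = \<bar>f r\<bar> * exp (- r / 2)"
    proof -
      have "exp (- r) = exp (- (1/2) * r) * exp (- r / 2)" by (simp flip: exp_add)
      then show ?thesis unfolding f_def poly_mult by (simp add: abs_mult mult_ac add_ac)
    qed
    also have "\<dots> \<le> M * exp (- r / 2)" by (intro mult_right_mono M r) auto
    finally show ?thesis .
  qed
  then show ?thesis by (rule that)
qed

text \<open>The sign \<kappa> chooses the odd continuation when W a = 0 and the even one otherwise.
  With G defined from u by the eigenvalue equation, the work is to show that convolving G returns u,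
  and not u plus a homogeneous solution.\<close>

lemma profile_exists:
  assumes a: "a \<in> Z"
  defines "\<kappa> \<equiv> if W a = 0 then - 1 else 1 :: real"
  defines "u \<equiv> \<lambda>\<xi>. if \<xi> \<le> 0 then \<kappa> * W (- \<xi> + a) else W (\<xi> + a)"
  obtains G where "profile m (- a) G" "two_sided G = (\<lambda>\<xi>. complex_of_real (u \<xi>))"
    "(\<lambda>\<xi>. complex_of_real \<bar>\<xi>\<bar> * G \<xi>) \<in> L2"
proof -
  have a0: "0 \<le> a" and aW: "W a = 0 \<or> W' a = 0" using a by (auto simp: Z_iff)
  define v where "v \<xi> = (if \<xi> \<le> 0 then - \<kappa> * W' (- \<xi> + a) else W' (\<xi> + a))" for \<xi>
  define G where "G \<xi> = complex_of_real (real m * u \<xi> / (\<bar>\<xi>\<bar> + a))" for \<xi>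
  have Wc: "continuous_on A W" "continuous_on A W'" for A
    by (intro continuous_at_imp_continuous_on ballI isCont_W isCont_W')+
  \<comment> \<open>The pieces meet at 0: in the odd case W a = 0 joins u, and in the even case W' a
    = 0 joins v.\<close>
  have ucont: "continuous_on UNIV u"
    unfolding u_def
    by (rule continuous_on_cases_le)
      (auto intro!: continuous_intros continuous_on_compose2[OF Wc(1)[of UNIV]] simp: \<kappa>_def)
  have vcont: "continuous_on UNIV v"
    unfolding v_def[abs_def]
    by (rule continuous_on_cases_le)
      (use aW in \<open>auto intro!: continuous_intros continuous_on_compose2[OF Wc(2)[of UNIV]] simp: \<kappa>_def\<close>)
  have uC: "isCont u \<xi>" and vC: "isCont v \<xi>" for \<xi>
    using ucont vcont by (auto simp: continuous_on_eq_continuous_at)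
  have \<kappa>1: "\<bar>\<kappa>\<bar> = 1" by (simp add: \<kappa>_def)
  have u_abs: "\<bar>u \<xi>\<bar> = \<bar>W (\<bar>\<xi>\<bar> + a)\<bar>" for \<xi>
    using \<kappa>1 by (auto simp: u_def abs_mult)
  have v_abs: "\<bar>v \<xi>\<bar> = \<bar>W' (\<bar>\<xi>\<bar> + a)\<bar>" for \<xi>
    using \<kappa>1 by (auto simp: v_def abs_mult)
  have dW: "((\<lambda>\<xi>. W (\<xi> + a)) has_real_derivative W' (\<xi> + a)) (at \<xi>)"
    "((\<lambda>\<xi>. W (- \<xi> + a)) has_real_derivative - W' (- \<xi> + a)) (at \<xi>)" for \<xi>
  proof -
    have "((\<lambda>\<xi>. \<xi> + a) has_real_derivative 1) (at \<xi>)" "((\<lambda>\<xi>. - \<xi> + a) has_real_derivative - 1) (at \<xi>)"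
      by (auto intro!: derivative_eq_intros)
    from this(1)[THEN DERIV_chain2[OF W_deriv]] this(2)[THEN DERIV_chain2[OF W_deriv]]
    show "((\<lambda>\<xi>. W (\<xi> + a)) has_real_derivative W' (\<xi> + a)) (at \<xi>)"
      "((\<lambda>\<xi>. W (- \<xi> + a)) has_real_derivative - W' (- \<xi> + a)) (at \<xi>)" by simp_all
  qed
  have dW': "\<xi> + a \<noteq> 0 \<Longrightarrow> ((\<lambda>\<xi>. W' (\<xi> + a)) has_real_derivative (1 - 2 * real m / (\<xi> + a)) * W (\<xi> + a)) (at \<xi>)"
    "- \<xi> + a \<noteq> 0 \<Longrightarrow> ((\<lambda>\<xi>. W' (- \<xi> + a)) has_real_derivative - ((1 - 2 * real m / (- \<xi> + a)) * W (- \<xi> + a))) (at \<xi>)" for \<xi>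
  proof -
    have s: "((\<lambda>\<xi>. \<xi> + a) has_real_derivative 1) (at \<xi>)" "((\<lambda>\<xi>. - \<xi> + a) has_real_derivative - 1) (at \<xi>)"
      by (auto intro!: derivative_eq_intros)
    show "((\<lambda>\<xi>. W' (\<xi> + a)) has_real_derivative (1 - 2 * real m / (\<xi> + a)) * W (\<xi> + a)) (at \<xi>)" if "\<xi> + a \<noteq> 0"
      using DERIV_chain2[OF W'_deriv[OF that] s(1)] by simp
    show "((\<lambda>\<xi>. W' (- \<xi> + a)) has_real_derivative - ((1 - 2 * real m / (- \<xi> + a)) * W (- \<xi> + a))) (at \<xi>)" if "- \<xi> + a \<noteq> 0"
      using DERIV_chain2[OF W'_deriv[OF that] s(2)] by simp
  qed
  have du: "(u has_real_derivative v \<xi>) (at \<xi>)" and dv: "(v has_real_derivative (1 - 2 * real m / (\<bar>\<xi>\<bar> + a)) * u \<xi>) (at \<xi>)"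
    if "\<xi> \<noteq> 0" for \<xi>
  proof -
    have "(u has_real_derivative v \<xi>) (at \<xi>) \<and> (v has_real_derivative (1 - 2 * real m / (\<bar>\<xi>\<bar> + a)) * u \<xi>) (at \<xi>)"
    proof (cases "\<xi> > 0")
      case True
      have ev: "\<forall>\<^sub>F x in nhds \<xi>. x \<in> {0<..}" using True by (intro eventually_nhds_in_open) auto
      have eu: "\<forall>\<^sub>F x in nhds \<xi>. u x = W (x + a)" "\<forall>\<^sub>F x in nhds \<xi>. v x = W' (x + a)"
        using ev by (auto elim!: eventually_mono simp: u_def v_def)
      show ?thesis
        using dW(1)[of \<xi>] dW'(1)[of \<xi>] True a0
        unfolding DERIV_cong_ev[OF refl eu(1) refl] DERIV_cong_ev[OF refl eu(2) refl]
        by (simp add: u_def v_def)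
    next
      case False
      then have neg: "\<xi> < 0" using that by simp
      have ev: "\<forall>\<^sub>F x in nhds \<xi>. x \<in> {..<0}" using neg by (intro eventually_nhds_in_open) auto
      have eu: "\<forall>\<^sub>F x in nhds \<xi>. u x = \<kappa> * W (- x + a)" "\<forall>\<^sub>F x in nhds \<xi>. v x = - \<kappa> * W' (- x + a)"
        using ev by (auto elim!: eventually_mono simp: u_def v_def)
      show ?thesis
        using DERIV_cmult[OF dW(2)[of \<xi>], of \<kappa>] DERIV_cmult[OF dW'(2)[of \<xi>], of "- \<kappa>"] neg a0
        unfolding DERIV_cong_ev[OF refl eu(1) refl] DERIV_cong_ev[OF refl eu(2) refl]
        by (simp add: u_def v_def mult_ac)
    qed
    then show "(u has_real_derivative v \<xi>) (at \<xi>)" "(v has_real_derivative (1 - 2 * real m / (\<bar>\<xi>\<bar> + a)) * u \<xi>) (at \<xi>)" by auto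
  qed
  obtain M where M: "\<And>r. 0 \<le> r \<Longrightarrow> \<bar>W r / r\<bar> * (1 + r) \<le> M * exp (- r / 2)" using W_div_bound by blast
  have [measurable]: "u \<in> borel_measurable borel" using ucont by (rule borel_measurable_continuous_onI)
  have Gm [measurable]: "G \<in> borel_measurable borel" unfolding G_def[abs_def] by measurable
  have M0: "0 \<le> M" using M[of 0] by simp
  have G_bound: "norm (G \<xi>) * (1 + \<bar>\<xi>\<bar>) \<le> real m * M * exp (- \<bar>\<xi>\<bar> / 2)" for \<xi>
  proof -
    let ?r = "\<bar>\<xi>\<bar> + a"
    have "norm (G \<xi>) = real m * \<bar>W ?r / ?r\<bar>"
      unfolding G_def norm_of_real using u_abs[of \<xi>] by (simp add: abs_mult)
    then have "norm (G \<xi>) * (1 + \<bar>\<xi>\<bar>) \<le> real m * (\<bar>W ?r / ?r\<bar> * (1 + ?r))"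
      using a0 unfolding mult.assoc[of "real m"] by (simp only: mult.assoc) (intro mult_left_mono; simp)
    also have "\<dots> \<le> real m * (M * exp (- ?r / 2))" using a0 by (intro mult_left_mono M) auto
    also have "\<dots> \<le> real m * (M * exp (- \<bar>\<xi>\<bar> / 2))"
      using a0 M0 by (intro mult_left_mono) auto
    finally show ?thesis by simp
  qed
  have GL: "G \<in> L2"
  proof (rule L2_dominated[OF Gm exp_abs_L2, of "real m * M"], rule AE_I2)
    fix \<xi>
    have "norm (G \<xi>) * 1 \<le> norm (G \<xi>) * (1 + \<bar>\<xi>\<bar>)" by (intro mult_left_mono) auto
    then show "norm (G \<xi>) \<le> real m * M * norm (complex_of_real (exp (- \<bar>\<xi>\<bar> / 2)))"
      using G_bound[of \<xi>] by simp
  qed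
  have wGL: "(\<lambda>\<xi>. complex_of_real \<bar>\<xi>\<bar> * G \<xi>) \<in> L2"
  proof (rule L2_dominated[OF _ exp_abs_L2, of _ "real m * M"])
    show "AE \<xi> in lborel. norm (complex_of_real \<bar>\<xi>\<bar> * G \<xi>) \<le> real m * M * norm (complex_of_real (exp (- \<bar>\<xi>\<bar> / 2)))"
    proof (rule AE_I2)
      fix \<xi>
      have "norm (G \<xi>) * \<bar>\<xi>\<bar> \<le> norm (G \<xi>) * (1 + \<bar>\<xi>\<bar>)" by (intro mult_left_mono) auto
      then show "norm (complex_of_real \<bar>\<xi>\<bar> * G \<xi>) \<le> real m * M * norm (complex_of_real (exp (- \<bar>\<xi>\<bar> / 2)))"
        using G_bound[of \<xi>] by (simp add: norm_mult mult.commute[of "\<bar>\<xi>\<bar>"])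
    qed
  qed measurable
  have Gcont: "isCont G \<xi>" if "\<xi> \<noteq> 0" for \<xi>
    unfolding G_def[abs_def] using that a0 by (intro continuous_intros uC) auto
  have G2: "of_real ((1 - 2 * real m / (\<bar>\<xi>\<bar> + a)) * u \<xi>) = of_real (u \<xi>) - 2 * G \<xi>" for \<xi>
    by (simp add: G_def algebra_simps)
  have du': "((\<lambda>\<xi>. complex_of_real (u \<xi>)) has_vector_derivative of_real (v \<xi>)) (at \<xi>)" if "\<xi> \<noteq> 0" for \<xi>
    by (rule has_vector_derivative_of_real[OF du[OF that]])
  have dv': "((\<lambda>\<xi>. complex_of_real (v \<xi>)) has_vector_derivative of_real (u \<xi>) - 2 * G \<xi>) (at \<xi>)" if "\<xi> \<noteq> 0" for \<xi>
    using has_vector_derivative_of_real[where ?'a=complex, OF dv[OF that]] unfolding G2 .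
  obtain M1 where M1: "\<And>r. 0 \<le> r \<Longrightarrow> \<bar>W r\<bar> \<le> M1" using bounded_on_half_line[OF Wc(1) W_tendsto(1)] by blast
  obtain M2 where M2: "\<And>r. 0 \<le> r \<Longrightarrow> \<bar>W' r\<bar> \<le> M2" using bounded_on_half_line[OF Wc(2) W_tendsto(2)] by blast
  have ub: "norm (complex_of_real (u \<xi>)) \<le> M1" and vb: "norm (complex_of_real (v \<xi>)) \<le> M2" for \<xi>
    using M1[of "\<bar>\<xi>\<bar> + a"] M2[of "\<bar>\<xi>\<bar> + a"] a0 u_abs[of \<xi>] v_abs[of \<xi>] by simp_all
  let ?b = "L2_norm (\<lambda>s. complex_of_real (ek s)) * L2_norm G"
  have AAc: "isCont (left_conv G) \<xi>" and BBc: "isCont (right_conv G) \<xi>" for \<xi>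
    using left_conv_continuous[OF GL] right_conv_continuous[OF GL] by (auto simp: continuous_on_eq_continuous_at)
  \<comment> \<open>If the convolution is u, its left part is (u - u') / 2. The difference from that
    function satisfies h' = - h off 0 and is bounded, hence it vanishes.\<close>
  have A: "left_conv G \<xi> - (1/2) * (of_real (u \<xi>) - of_real (v \<xi>)) = 0" for \<xi>
  proof (rule decaying_zero[where h="\<lambda>\<xi>. left_conv G \<xi> - (1/2) * (of_real (u \<xi>) - of_real (v \<xi>))" and M="?b + (1/2) * (M1 + M2)"])
    show "isCont (\<lambda>\<xi>. left_conv G \<xi> - (1/2) * (of_real (u \<xi>) - of_real (v \<xi>))) x" for x
      by (intro continuous_intros AAc uC vC)
    show "norm (left_conv G x - (1/2) * (of_real (u x) - of_real (v x))) \<le> ?b + (1/2) * (M1 + M2)" for x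
    proof -
      have "norm (of_real (u x) - complex_of_real (v x)) \<le> M1 + M2"
        by (rule order_trans[OF norm_triangle_ineq4 add_mono[OF ub vb]])
      then have "norm ((1/2) * (of_real (u x) - complex_of_real (v x))) \<le> (1/2) * (M1 + M2)"
        unfolding norm_mult by simp
      then show ?thesis by (rule order_trans[OF norm_triangle_ineq4 add_mono[OF left_conv_bounded[OF GL]]])
    qed
    fix x :: real assume x: "x \<noteq> 0"
    have "((\<lambda>\<xi>. left_conv G \<xi> - (1/2) * (of_real (u \<xi>) - of_real (v \<xi>))) has_vector_derivative
        (G x - left_conv G x) - (1/2) * (of_real (v x) - (of_real (u x) - 2 * G x))) (at x)"
      by (intro has_vector_derivative_diff left_conv_derivative[OF GL Gcont[OF x]] has_vector_derivative_mult_right du' dv' x)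
    also have "(G x - left_conv G x) - (1/2) * (of_real (v x) - (of_real (u x) - 2 * G x))
        = - (left_conv G x - (1/2) * (of_real (u x) - of_real (v x)))" by (simp add: field_simps)
    finally show "((\<lambda>\<xi>. left_conv G \<xi> - (1/2) * (of_real (u \<xi>) - of_real (v \<xi>))) has_vector_derivative
        - (left_conv G x - (1/2) * (of_real (u x) - of_real (v x)))) (at x)" .
  qed
  let ?g = "\<lambda>\<xi>. right_conv G \<xi> - (1/2) * (of_real (u \<xi>) + of_real (v \<xi>))"
  have gC: "isCont ?g x" for x by (intro continuous_intros BBc uC vC)
  have B: "?g (- \<xi>) = 0" for \<xi>
  proof (rule decaying_zero[where h="\<lambda>\<xi>. ?g (- \<xi>)" and M="?b + (1/2) * (M1 + M2)"])
    show "isCont (\<lambda>\<xi>. ?g (- \<xi>)) x" for x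
      by (rule isCont_o2[of _ uminus, OF _ gC]) (intro continuous_intros)
    show "norm (?g (- x)) \<le> ?b + (1/2) * (M1 + M2)" for x
    proof -
      have "norm (of_real (u (- x)) + complex_of_real (v (- x))) \<le> M1 + M2"
        by (rule order_trans[OF norm_triangle_ineq add_mono[OF ub vb]])
      then have "norm ((1/2) * (of_real (u (- x)) + complex_of_real (v (- x)))) \<le> (1/2) * (M1 + M2)"
        unfolding norm_mult by simp
      then show ?thesis by (rule order_trans[OF norm_triangle_ineq4 add_mono[OF right_conv_bounded[OF GL]]])
    qed
    fix x :: real assume "x \<noteq> 0"
    then have x: "- x \<noteq> 0" by simp
    have "(?g has_vector_derivative
        (right_conv G (- x) - G (- x)) - (1/2) * (of_real (v (- x)) + (of_real (u (- x)) - 2 * G (- x)))) (at (- x))"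
      by (intro has_vector_derivative_diff has_vector_derivative_add right_conv_derivative[OF GL Gcont[OF x]] has_vector_derivative_mult_right du' dv' x)
    also have "(right_conv G (- x) - G (- x)) - (1/2) * (of_real (v (- x)) + (of_real (u (- x)) - 2 * G (- x))) = ?g (- x)"
      by (simp add: field_simps)
    finally have g: "(?g has_vector_derivative ?g (- x)) (at (- x))" .
    have um: "(uminus has_vector_derivative - 1) (at x)" by (auto intro!: derivative_eq_intros)
    from vector_diff_chain_at[OF um g]
    show "((\<lambda>\<xi>. ?g (- \<xi>)) has_vector_derivative - ?g (- x)) (at x)" by (simp add: o_def)
  qed
  have UUu: "two_sided G = (\<lambda>\<xi>. complex_of_real (u \<xi>))"
  proof
    fix \<xi>
    have "left_conv G \<xi> = (1/2) * (of_real (u \<xi>) - of_real (v \<xi>))" using A[of \<xi>] by simp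
    moreover have "right_conv G \<xi> = (1/2) * (of_real (u \<xi>) + of_real (v \<xi>))" using B[of "- \<xi>"] by simp
    ultimately have "left_conv G \<xi> + right_conv G \<xi> = (1/2) * (2 * complex_of_real (u \<xi>))"
      by (simp only: distrib_left right_diff_distrib) simp
    then show "two_sided G \<xi> = complex_of_real (u \<xi>)" by (simp add: two_sided_def)
  qed
  have "profile m (- a) G"
    unfolding profile_def UUu using GL by (simp add: G_def)
  from that[OF this UUu wGL] show ?thesis .
qed

lemma L_plus_eigenspace_dim:
  assumes a: "a \<in> Z"
  shows "has_dim_AE (eigenspace H1 (L_plus m) (complex_of_real (- a))) 1"
    and "\<exists>\<phi>\<in>eigenspace H1 (L_plus m) (complex_of_real (- a)). \<not> (AE x in lborel. \<phi> x = 0)"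
proof -
  have a0: "0 \<le> a" and aW: "W a = 0 \<or> W' a = 0" using a by (auto simp: Z_iff)
  define \<kappa> where "\<kappa> = (if W a = 0 then - 1 else 1 :: real)"
  define u where "u = (\<lambda>\<xi>. if \<xi> \<le> 0 then \<kappa> * W (- \<xi> + a) else W (\<xi> + a))"
  obtain G where G: "profile m (- a) G" "two_sided G = (\<lambda>\<xi>. complex_of_real (u \<xi>))"
    "(\<lambda>\<xi>. complex_of_real \<bar>\<xi>\<bar> * G \<xi>) \<in> L2"
    using profile_exists[OF a] unfolding u_def \<kappa>_def by blast
  have GL: "G \<in> L2" using G(1) by (simp add: profile_def)
  have Geq: "G \<xi> = of_nat m * two_sided G \<xi> / complex_of_real (\<bar>\<xi>\<bar> - - a)" for \<xi>
    using G(1) unfolding profile_def by blast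
  obtain \<phi> where \<phi>: "has_fourier \<phi> G" using has_fourier_surj[OF GL] .
  have \<phi>H: "\<phi> \<in> H1" by (rule H1I[OF \<phi> G(3)])
  have "AE \<xi> in lborel. complex_of_real \<bar>\<xi>\<bar> * G \<xi> - of_nat m * two_sided G \<xi> = complex_of_real (- a) * G \<xi>"
    using AE_lborel_singleton[of "0::real"]
  proof eventually_elim
    case (elim \<xi>)
    then have nz: "complex_of_real (\<bar>\<xi>\<bar> - - a) \<noteq> 0" using a0 by (simp only: of_real_eq_0_iff)
    have "complex_of_real (\<bar>\<xi>\<bar> - - a) * G \<xi> = of_nat m * two_sided G \<xi>"
      by (subst Geq, simp only: times_divide_eq_right, rule nonzero_mult_div_cancel_left[OF nz])
    then show ?case by (simp add: algebra_simps)
  qed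
  then have \<phi>ev: "AE x in lborel. L_plus m \<phi> x = complex_of_real (- a) * \<phi> x"
    using L_plus_eigen_iff[OF \<phi>H \<phi>] by blast
  have \<phi>E: "\<phi> \<in> eigenspace H1 (L_plus m) (complex_of_real (- a))"
    using \<phi>H \<phi>ev by (simp add: eigenspace_def)
  have \<phi>nz: "\<not> (AE x in lborel. \<phi> x = 0)"
  proof
    assume "AE x in lborel. \<phi> x = 0"
    then have "AE \<xi> in lborel. G \<xi> = 0" using has_fourier_AE_zero_iff[OF \<phi>] by simp
    then have "two_sided G \<xi> = 0" for \<xi> using two_sided_cong_AE[OF GL L2_zero, of \<xi>] two_sided_zero by simp
    then have u0: "u \<xi> = 0" for \<xi> using G(2) by (metis of_real_eq_0_iff)
    have "{a<..} \<subseteq> Z0"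
    proof
      fix r assume "r \<in> {a<..}"
      then show "r \<in> Z0" using u0[of "r - a"] a0 by (simp add: u_def Z0_def W_def)
    qed
    then show False using finite_Z0 infinite_Ioi finite_subset by blast
  qed
  then show "\<exists>\<phi>\<in>eigenspace H1 (L_plus m) (complex_of_real (- a)). \<not> (AE x in lborel. \<phi> x = 0)"
    using \<phi>E by blast
  show "has_dim_AE (eigenspace H1 (L_plus m) (complex_of_real (- a))) 1"
    unfolding has_dim_AE_def
  proof (intro exI[of _ "\<lambda>_. \<phi>"] conjI allI impI ballI)
    show "\<phi> \<in> eigenspace H1 (L_plus m) (complex_of_real (- a))" by (rule \<phi>E)
    fix c :: "nat \<Rightarrow> complex" and j :: nat
    assume "AE x in lborel. (\<Sum>j<1. c j * \<phi> x) = 0" "j < 1"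
    then show "c j = 0" using \<phi>nz by (cases "c 0 = 0") auto
  next
    fix f assume f: "f \<in> eigenspace H1 (L_plus m) (complex_of_real (- a))"
    then obtain F where F: "has_fourier f F" "profile m (- a) F"
      using eigenvector_profile[of f m "- a"] by (auto simp: eigenspace_def)
    obtain c d where cd: "\<And>\<xi>. \<xi> > 0 \<Longrightarrow> two_sided F \<xi> = c * complex_of_real (W (\<xi> - - a))"
      "\<And>\<xi>. \<xi> < 0 \<Longrightarrow> two_sided F \<xi> = d * complex_of_real (W (- \<xi> - - a))"
      "W (- (- a)) \<noteq> 0 \<Longrightarrow> d = c" "W' (- (- a)) \<noteq> 0 \<Longrightarrow> d = - c"
      using profile_nonpositive[OF F(2)] a0 by (metis neg_le_0_iff_le)
    \<comment> \<open>W a and W' a do not vanish together, so exactly one matching condition binds,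
      the one recorded by \<kappa>.\<close>
    have "d = c * of_real \<kappa>"
      using cd(3,4) W_W'_nonzero[OF a0] by (auto simp: \<kappa>_def)
    then have UF: "two_sided F \<xi> = c * two_sided G \<xi>" if "\<xi> \<noteq> 0" for \<xi>
      using cd(1,2)[of \<xi>] that by (cases "\<xi> > 0") (auto simp: G(2) u_def)
    have "AE \<xi> in lborel. F \<xi> - c * G \<xi> = 0"
      using AE_lborel_singleton[of "0::real"]
    proof eventually_elim
      case (elim \<xi>)
      have "F \<xi> = of_nat m * two_sided F \<xi> / complex_of_real (\<bar>\<xi>\<bar> - - a)" using F(2) unfolding profile_def by blast
      then show ?case unfolding UF[OF elim] by (subst Geq) simp
    qed
    then have "AE x in lborel. f x - c * \<phi> x = 0"
      using has_fourier_AE_zero_iff[OF has_fourier_diff[OF F(1) has_fourier_scale[OF \<phi>, of c]]] by simp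
    then show "\<exists>c. AE x in lborel. f x = (\<Sum>j<(1::nat). c j * \<phi> x)"
      by (intro exI[of _ "\<lambda>_. c"]) simp
  qed
qed

section \<open>Spectra and the final count\<close>

lemma L_plus_point_spectrum: "point_spectrum H1 (L_plus m) = uminus ` Z"
proof
  show "point_spectrum H1 (L_plus m) \<subseteq> uminus ` Z"
  proof
    fix E assume "E \<in> point_spectrum H1 (L_plus m)"
    then obtain \<phi> where "\<phi> \<in> H1" "AE x in lborel. L_plus m \<phi> x = complex_of_real E * \<phi> x"
      "\<not> (AE x in lborel. \<phi> x = 0)" by (auto simp: point_spectrum_def eigenspace_def)
    then have "- E \<in> Z" using L_plus_no_eigenvector by blast
    then show "E \<in> uminus ` Z" by force
  qed
  show "uminus ` Z \<subseteq> point_spectrum H1 (L_plus m)"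
    using L_plus_eigenspace_dim(2) by (auto simp: point_spectrum_def simp del: of_real_minus)
qed

lemma L_plus_essential_spectrum: "essential_spectrum H1 (L_plus m) = complex_of_real ` {0..}"
  unfolding L_plus_eq
\<comment> \<open>The eigenvalue 0 lies at the edge of the half line and is not isolated, so only
  the nonzero elements of \<open>Z\<close> are discrete.\<close>
proof (rule Lp.essential_spectrum_T[of "uminus ` (Z - {0})"])
  show "finite (uminus ` (Z - {0}))" using finite_Z by simp
  show "E < 0" if "E \<in> uminus ` (Z - {0})" for E using that by (auto simp: Z_def)
  show "\<exists>k\<ge>1. has_dim_AE (eigenspace H1 (Lp.T m) (complex_of_real E)) k" if "E \<in> uminus ` (Z - {0})" for E
    using that L_plus_eigenspace_dim(1) unfolding L_plus_eq by (auto simp del: of_real_minus)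
  fix z assume z: "z \<notin> complex_of_real ` {0..}" "z \<notin> complex_of_real ` uminus ` (Z - {0})"
  show "z \<in> resolvent_set H1 (Lp.T m)"
    unfolding L_plus_eq[symmetric]
  proof (rule L_plus_resolvent[OF z(1)], rule ccontr)
    fix f assume f: "f \<in> H1" "AE x in lborel. L_plus m f x = z * f x" "\<not> (AE x in lborel. f x = 0)"
    then have "z \<in> \<real>" unfolding L_plus_eq by (rule Lp.eigenvalue_real)
    then obtain E where E: "z = complex_of_real E" by (auto elim: Reals_cases)
    have "- E \<in> Z" using L_plus_no_eigenvector[OF f(1)] f(2,3) E by blast
    moreover have "- E \<noteq> 0" using z(1) E by auto
    ultimately have "E \<in> uminus ` (Z - {0})" by (intro image_eqI[of _ _ "- E"]) auto
    then show False using z(2) E by blast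
  qed
qed

end

lemma L_minus_essential_spectrum: "essential_spectrum H1 (L_minus m) = complex_of_real ` {0..}"
  unfolding L_minus_eq
  by (rule Lm.essential_spectrum_T[of "{}"]) (use L_minus_resolvent[of _ m] in \<open>auto simp: L_minus_eq\<close>)

lemma finite_set_strict_enumeration:
  fixes S :: "real set"
  assumes "finite S" "card S = n"
  obtains e where "S = e ` {..<n}" "strict_mono_on {..<n} e"
proof -
  let ?xs = "sorted_list_of_set S"
  have len: "length ?xs = n" using assms by simp
  have "S = (\<lambda>k. ?xs ! k) ` {..<n}"
    using set_sorted_list_of_set[OF assms(1)] len by (auto simp: set_conv_nth)
  moreover have "strict_mono_on {..<n} (\<lambda>k. ?xs ! k)"
    using sorted_wrt_nth_less[OF strict_sorted_list_of_set[of S]] len by (auto intro!: strict_mono_onI)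
  ultimately show ?thesis by (rule that)
qed

theorem theorem4:
  fixes m :: nat
  assumes "m \<ge> 1"
  shows "(self_adjoint H1 (L_plus m) \<and> self_adjoint H1 (L_minus m)) \<and>
         (\<exists>E :: nat \<Rightarrow> real.
            point_spectrum H1 (L_plus m) = E ` {..<2 * m} \<and>
            (\<forall>k<2 * m. has_dim_AE (eigenspace H1 (L_plus m) (complex_of_real (E k))) 1) \<and>
            strict_mono_on {..<2 * m} E \<and>
            E (2 * m - 1) = 0) \<and>
         (point_spectrum H1 (L_minus m) = {0} \<and>
          has_dim_AE (eigenspace H1 (L_minus m) 0) (2 * m)) \<and>
         (essential_spectrum H1 (L_plus m) = complex_of_real ` {0..} \<and>
          essential_spectrum H1 (L_minus m) = complex_of_real ` {0..} \<and>
          point_spectrum H1 (L_plus m) \<inter> {0<..} = {} \<and>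
          point_spectrum H1 (L_minus m) \<inter> {0<..} = {})"
proof (intro conjI)
  interpret laguerre m by unfold_locales (rule assms)
  show "self_adjoint H1 (L_plus m)" unfolding L_plus_eq by (rule Lp.self_adjoint_T)
  show "self_adjoint H1 (L_minus m)" unfolding L_minus_eq by (rule Lm.self_adjoint_T)
  show "point_spectrum H1 (L_minus m) = {0}" by (rule L_minus_point_spectrum[OF assms])
  then show "point_spectrum H1 (L_minus m) \<inter> {0<..} = {}" by simp
  show "has_dim_AE (eigenspace H1 (L_minus m) 0) (2 * m)" by (rule L_minus_eigenspace_dim)
  show "essential_spectrum H1 (L_plus m) = complex_of_real ` {0..}" by (rule L_plus_essential_spectrum)
  show "essential_spectrum H1 (L_minus m) = complex_of_real ` {0..}" by (rule L_minus_essential_spectrum)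
  show "point_spectrum H1 (L_plus m) \<inter> {0<..} = {}"
    unfolding L_plus_point_spectrum by (auto simp: Z_def)
  have "finite (uminus ` Z)" "card (uminus ` Z) = 2 * m"
    using finite_Z card_Z by (simp_all add: card_image inj_on_def)
  then obtain E where E: "uminus ` Z = E ` {..<2 * m}" "strict_mono_on {..<2 * m} E"
    by (rule finite_set_strict_enumeration)
  have le: "E k \<le> 0" if "k < 2 * m" for k
  proof -
    have "E k \<in> uminus ` Z" using that unfolding E(1) by auto
    then show ?thesis by (auto simp: Z_def)
  qed
  have "0 \<in> Z" by (simp add: Z_def P_0)
  then have "0 \<in> E ` {..<2 * m}" unfolding E(1)[symmetric] by force
  then obtain k where k: "k < 2 * m" "E k = 0" by auto
  \<comment> \<open>0 occurs among the values and none is positive, so strict monotonicity puts it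
    last.\<close>
  have "E (2 * m - 1) = 0"
  proof (cases "k = 2 * m - 1")
    case False
    then have "E k < E (2 * m - 1)" using k by (intro strict_mono_onD[OF E(2)]) auto
    then show ?thesis using le[of "2 * m - 1"] k by simp
  qed (use k in simp)
  moreover have "has_dim_AE (eigenspace H1 (L_plus m) (complex_of_real (E k))) 1" if "k < 2 * m" for k
  proof -
    have "E k \<in> uminus ` Z" using that unfolding E(1) by auto
    then show ?thesis using L_plus_eigenspace_dim(1) by (auto simp del: of_real_minus)
  qed
  ultimately show "\<exists>E :: nat \<Rightarrow> real.
            point_spectrum H1 (L_plus m) = E ` {..<2 * m} \<and>
            (\<forall>k<2 * m. has_dim_AE (eigenspace H1 (L_plus m) (complex_of_real (E k))) 1) \<and>
            strict_mono_on {..<2 * m} E \<and>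
            E (2 * m - 1) = 0"
    using E L_plus_point_spectrum by (intro exI[of _ E]) simp
qed

end
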